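(* The categories $\mathit{Gpd}_C$ (localic étale groupoids and covering functors) and $\mathit{IQLoc}=\mathit{IQFrm}^{\mathrm{op}}$ (the opposite of the category $\mathit{IQFrm}$ of inverse quantal frames and homomorphisms of unital involutive quantales that also preserve finite meets) are equivalent.
   Context: Locales. $\mathit{Loc}=\mathit{Frm}^{\mathrm{op}}$; a map of locales $f:X\to Y$ is a frame homomorphism $f^*:Y\to X$ (its inverse image). $f$ is open if $f^*$ has a left adjoint $f_!$ satisfying $f_!(f^*(y)\wedge x)=y\wedge f_!(x)$; it is a local homeomorphism if it is open and there is $\Gamma\subset X$ with $\bigvee\Gamma=1$ such that for each $s\in\Gamma$, $f_!$ restricts to an isomorphism ${\downarrow}(s)\cong{\downarrow}(f_!(s))$. Groupoids. A localic groupoid $G$ is an internal groupoid in $\mathit{Loc}$ with objects $G_0$, arrows $G_1$, domain and range $d,r:G_1\to G_0$, units $u$, inversion $i$, multiplication $m:G_2\to G_1$, where $G_2$ is the pullback with $r\circ\pi_1=d\circ\pi_2$. $G$ is étale if $d$ is a local homeomorphism; then all structure maps are local homeomorphisms. $\mathit{Gpd}$ is the category of localic étale groupoids and internal functors $f=(f_0,f_1)$ in $\mathit{Loc}$. Quantale of an étale groupoid. $\mathcal O(G)$ is the frame $G_1$ with product $ab=m_!(\pi_1^*(a)\wedge\pi_2^*(b))$, involution $a^*=i_!(a)$ and unit $e=u_!(1)$; it is a unital involutive quantale (a unital involutive semigroup in the category of sup-lattices), and in fact an inverse quantal frame. An inverse quantal frame is a unital involutive quantale $Q$ that is also a frame and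 satisfies: (1) $a1\wedge e=aa^*\wedge e$ for all $a\in Q$; (2) $(a1\wedge e)a=a$ for all $a\in Q$; (3) $\bigvee Q_{\mathcal I}=1$, where $Q_{\mathcal I}=\{s\in Q: ss^*\vee s^*s\le e\}$. $\mathit{Gpd}_C$ is the subcategory of $\mathit{Gpd}$ with all objects and whose morphisms are the covering functors: the functors $f:G\to H$ such that $f_1^*:\mathcal O(H)\to\mathcal O(G)$ is a homomorphism of unital involutive quantales. *)

theory Defs
  imports "HOL-Algebra.Complete_Lattice" "HOL-Library.FuncSet"
begin

section \<open>Categories and equivalences of categories\<close>

text \<open>
  Arrows are taken relative to hom-sets: the same value of type \<open>'m\<close> may be an arrow between
  several pairs of objects, so composition and the arrow part of a functor also receive
  the objects involved. \<open>Comp C a b c g f\<close> is the composite of \<open>f : a \<rightarrow> b\<close> and \<open>g : b \<rightarrow> c\<close>.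
\<close>

record ('o, 'm) category =
  Obj :: "'o set"
  Hom :: "'o \<Rightarrow> 'o \<Rightarrow> 'm set"
  Ident :: "'o \<Rightarrow> 'm"
  Comp :: "'o \<Rightarrow> 'o \<Rightarrow> 'o \<Rightarrow> 'm \<Rightarrow> 'm \<Rightarrow> 'm"

definition is_category :: "('o, 'm) category \<Rightarrow> bool" where
  "is_category C \<longleftrightarrow>
     (\<forall>a\<in>Obj C. Ident C a \<in> Hom C a a) \<and>
     (\<forall>a\<in>Obj C. \<forall>b\<in>Obj C. \<forall>c\<in>Obj C. \<forall>f\<in>Hom C a b. \<forall>g\<in>Hom C b c.
        Comp C a b c g f \<in> Hom C a c) \<and>
     (\<forall>a\<in>Obj C. \<forall>b\<in>Obj C. \<forall>f\<in>Hom C a b.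
        Comp C a a b f (Ident C a) = f \<and> Comp C a b b (Ident C b) f = f) \<and>
     (\<forall>a\<in>Obj C. \<forall>b\<in>Obj C. \<forall>c\<in>Obj C. \<forall>d\<in>Obj C.
        \<forall>f\<in>Hom C a b. \<forall>g\<in>Hom C b c. \<forall>h\<in>Hom C c d.
          Comp C a c d h (Comp C a b c g f) = Comp C a b d (Comp C b c d h g) f)"

definition op_category :: "('o, 'm) category \<Rightarrow> ('o, 'm) category" where
  "op_category C =
     \<lparr>Obj = Obj C,
      Hom = (\<lambda>a b. Hom C b a),
      Ident = Ident C,
      Comp = (\<lambda>a b c g f. Comp C c b a f g)\<rparr>"

record ('o, 'm, 'p, 'n) cat_functor =
  fobj :: "'o \<Rightarrow> 'p"
  farr :: "'o \<Rightarrow> 'o \<Rightarrow> 'm \<Rightarrow> 'n"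

definition is_functor ::
  "('o, 'm) category \<Rightarrow> ('p, 'n) category \<Rightarrow> ('o, 'm, 'p, 'n) cat_functor \<Rightarrow> bool" where
  "is_functor C D F \<longleftrightarrow>
     is_category C \<and> is_category D \<and>
     (\<forall>a\<in>Obj C. fobj F a \<in> Obj D) \<and>
     (\<forall>a\<in>Obj C. \<forall>b\<in>Obj C. \<forall>f\<in>Hom C a b. farr F a b f \<in> Hom D (fobj F a) (fobj F b)) \<and>
     (\<forall>a\<in>Obj C. farr F a a (Ident C a) = Ident D (fobj F a)) \<and>
     (\<forall>a\<in>Obj C. \<forall>b\<in>Obj C. \<forall>c\<in>Obj C. \<forall>f\<in>Hom C a b. \<forall>g\<in>Hom C b c.
        farr F a c (Comp C a b c g f) =
        Comp D (fobj F a) (fobj F b) (fobj F c) (farr F b c g) (farr F a b f))"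

definition id_functor :: "('o, 'm, 'o, 'm) cat_functor" where
  "id_functor = \<lparr>fobj = (\<lambda>a. a), farr = (\<lambda>a b f. f)\<rparr>"

definition comp_functor ::
  "('p, 'n, 'q, 'k) cat_functor \<Rightarrow> ('o, 'm, 'p, 'n) cat_functor \<Rightarrow> ('o, 'm, 'q, 'k) cat_functor" where
  "comp_functor G F =
     \<lparr>fobj = (\<lambda>a. fobj G (fobj F a)),
      farr = (\<lambda>a b f. farr G (fobj F a) (fobj F b) (farr F a b f))\<rparr>"

definition is_iso :: "('o, 'm) category \<Rightarrow> 'o \<Rightarrow> 'o \<Rightarrow> 'm \<Rightarrow> bool" where
  "is_iso C a b f \<longleftrightarrow>
     f \<in> Hom C a b \<and>
     (\<exists>g\<in>Hom C b a. Comp C a b a g f = Ident C a \<and> Comp C b a b f g = Ident C b)"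

definition naturally_isomorphic ::
  "('o, 'm) category \<Rightarrow> ('p, 'n) category \<Rightarrow>
   ('o, 'm, 'p, 'n) cat_functor \<Rightarrow> ('o, 'm, 'p, 'n) cat_functor \<Rightarrow> bool" where
  "naturally_isomorphic C D F G \<longleftrightarrow>
     (\<exists>\<tau>.
        (\<forall>a\<in>Obj C. is_iso D (fobj F a) (fobj G a) (\<tau> a)) \<and>
        (\<forall>a\<in>Obj C. \<forall>b\<in>Obj C. \<forall>f\<in>Hom C a b.
           Comp D (fobj F a) (fobj F b) (fobj G b) (\<tau> b) (farr F a b f) =
           Comp D (fobj F a) (fobj G a) (fobj G b) (farr G a b f) (\<tau> a)))"

definition equivalent_categories :: "('o, 'm) category \<Rightarrow> ('p, 'n) category \<Rightarrow> bool" where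
  "equivalent_categories C D \<longleftrightarrow>
     (\<exists>F G. is_functor C D F \<and> is_functor D C G \<and>
            naturally_isomorphic C C id_functor (comp_functor G F) \<and>
            naturally_isomorphic D D (comp_functor F G) id_functor)"


section \<open>Frames and locales\<close>

locale frame = complete_lattice L for L (structure) +
  assumes meet_sup_distrib:
    "\<lbrakk>x \<in> carrier L; A \<subseteq> carrier L\<rbrakk> \<Longrightarrow> x \<sqinter> \<Squnion>A = \<Squnion>((\<lambda>a. x \<sqinter> a) ` A)"

text \<open>
  Homomorphisms are extensional, so that homomorphisms agreeing on the carrier are equal.
\<close>

definition frame_hom ::
  "('a, 'c) gorder_scheme \<Rightarrow> ('b, 'd) gorder_scheme \<Rightarrow> ('a \<Rightarrow> 'b) set" where
  "frame_hom L M =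
     {f \<in> carrier L \<rightarrow>\<^sub>E carrier M. sup_pres L M f \<and> meet_pres L M f \<and> f \<top>\<^bsub>L\<^esub> = \<top>\<^bsub>M\<^esub>}"

text \<open>
  A map of locales \<open>f : X \<rightarrow> Y\<close> is represented by its inverse image homomorphism
  \<open>f\<^sup>* : Y \<rightarrow> X\<close>. Accordingly \<open>loc_comp Z g f\<close> is \<open>g \<circ> f\<close> for \<open>f : X \<rightarrow> Y\<close> and \<open>g : Y \<rightarrow> Z\<close>,
  with inverse image \<open>z \<mapsto> f\<^sup>* (g\<^sup>* z)\<close>.
\<close>

definition loc_map ::
  "('a, 'c) gorder_scheme \<Rightarrow> ('b, 'd) gorder_scheme \<Rightarrow> ('b \<Rightarrow> 'a) set" where
  "loc_map X Y = frame_hom Y X"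

definition loc_id :: "('a, 'c) gorder_scheme \<Rightarrow> 'a \<Rightarrow> 'a" where
  "loc_id X = (\<lambda>x\<in>carrier X. x)"

definition loc_comp ::
  "('z, 'c) gorder_scheme \<Rightarrow> ('z \<Rightarrow> 'y) \<Rightarrow> ('y \<Rightarrow> 'x) \<Rightarrow> 'z \<Rightarrow> 'x" where
  "loc_comp Z g f = compose (carrier Z) f g"

definition left_adjoint ::
  "('a, 'c) gorder_scheme \<Rightarrow> ('b, 'd) gorder_scheme \<Rightarrow> ('b \<Rightarrow> 'a) \<Rightarrow> ('a \<Rightarrow> 'b) \<Rightarrow> bool" where
  "left_adjoint X Y f h \<longleftrightarrow>
     h \<in> carrier X \<rightarrow>\<^sub>E carrier Y \<and>
     (\<forall>x\<in>carrier X. \<forall>y\<in>carrier Y. h x \<sqsubseteq>\<^bsub>Y\<^esub> y \<longleftrightarrow> x \<sqsubseteq>\<^bsub>X\<^esub> f y)"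

text \<open>The map written \<open>f\<^sub>!\<close>; it is meaningful only if the left adjoint exists.\<close>

definition direct_image ::
  "('a, 'c) gorder_scheme \<Rightarrow> ('b, 'd) gorder_scheme \<Rightarrow> ('b \<Rightarrow> 'a) \<Rightarrow> 'a \<Rightarrow> 'b" where
  "direct_image X Y f = (THE h. left_adjoint X Y f h)"

definition open_loc_map ::
  "('a, 'c) gorder_scheme \<Rightarrow> ('b, 'd) gorder_scheme \<Rightarrow> ('b \<Rightarrow> 'a) \<Rightarrow> bool" where
  "open_loc_map X Y f \<longleftrightarrow>
     f \<in> loc_map X Y \<and>
     (\<exists>h. left_adjoint X Y f h) \<and>
     (\<forall>x\<in>carrier X. \<forall>y\<in>carrier Y.
        direct_image X Y f (f y \<sqinter>\<^bsub>X\<^esub> x) = y \<sqinter>\<^bsub>Y\<^esub> direct_image X Y f x)"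

definition down :: "('a, 'c) gorder_scheme \<Rightarrow> 'a \<Rightarrow> 'a set" where
  "down X s = {x \<in> carrier X. x \<sqsubseteq>\<^bsub>X\<^esub> s}"

definition local_homeomorphism ::
  "('a, 'c) gorder_scheme \<Rightarrow> ('b, 'd) gorder_scheme \<Rightarrow> ('b \<Rightarrow> 'a) \<Rightarrow> bool" where
  "local_homeomorphism X Y f \<longleftrightarrow>
     open_loc_map X Y f \<and>
     (\<exists>\<Gamma>\<subseteq>carrier X. \<Squnion>\<^bsub>X\<^esub>\<Gamma> = \<top>\<^bsub>X\<^esub> \<and>
        (\<forall>s\<in>\<Gamma>.
           bij_betw (direct_image X Y f) (down X s) (down Y (direct_image X Y f s)) \<and>
           (\<forall>x\<in>down X s. \<forall>x'\<in>down X s.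
              x \<sqsubseteq>\<^bsub>X\<^esub> x' \<longleftrightarrow> direct_image X Y f x \<sqsubseteq>\<^bsub>Y\<^esub> direct_image X Y f x')))"


section \<open>Pullbacks of locales\<close>

text \<open>
  The pullback of \<open>f : X \<rightarrow> Z\<close> and \<open>g : Y \<rightarrow> Z\<close> in locales is the pushout \<open>X \<otimes>\<^sub>Z Y\<close> of frames. It is
  realized concretely as the frame of those down-closed subsets of \<open>X \<times> Y\<close> that are closed
  under arbitrary joins in each variable (for the empty join: that contain all pairs with
  a coordinate \<open>\<bottom>\<close>) and balanced over \<open>Z\<close>; \<open>pb_tensor x y\<close> is the pure tensor \<open>x \<otimes> y\<close>.
  Its universal property, with respect to frames over an arbitrary type, is
  \<open>pullback_universal\<close> below.
\<close>

definition pb_ideal ::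
  "('x, 'c) gorder_scheme \<Rightarrow> ('y, 'd) gorder_scheme \<Rightarrow> ('z, 'e) gorder_scheme \<Rightarrow>
   ('z \<Rightarrow> 'x) \<Rightarrow> ('z \<Rightarrow> 'y) \<Rightarrow> ('x \<times> 'y) set \<Rightarrow> bool" where
  "pb_ideal X Y Z f g U \<longleftrightarrow>
     U \<subseteq> carrier X \<times> carrier Y \<and>
     (\<forall>x\<in>carrier X. \<forall>y\<in>carrier Y. \<forall>(a, b)\<in>U. x \<sqsubseteq>\<^bsub>X\<^esub> a \<and> y \<sqsubseteq>\<^bsub>Y\<^esub> b \<longrightarrow> (x, y) \<in> U) \<and>
     (\<forall>A\<subseteq>carrier X. \<forall>y\<in>carrier Y. A \<times> {y} \<subseteq> U \<longrightarrow> (\<Squnion>\<^bsub>X\<^esub>A, y) \<in> U) \<and>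
     (\<forall>x\<in>carrier X. \<forall>B\<subseteq>carrier Y. {x} \<times> B \<subseteq> U \<longrightarrow> (x, \<Squnion>\<^bsub>Y\<^esub>B) \<in> U) \<and>
     (\<forall>x\<in>carrier X. \<forall>y\<in>carrier Y. \<forall>z\<in>carrier Z.
        (x \<sqinter>\<^bsub>X\<^esub> f z, y) \<in> U \<longleftrightarrow> (x, g z \<sqinter>\<^bsub>Y\<^esub> y) \<in> U)"

definition pullback ::
  "('x, 'c) gorder_scheme \<Rightarrow> ('y, 'd) gorder_scheme \<Rightarrow> ('z, 'e) gorder_scheme \<Rightarrow>
   ('z \<Rightarrow> 'x) \<Rightarrow> ('z \<Rightarrow> 'y) \<Rightarrow> ('x \<times> 'y) set gorder" where
  "pullback X Y Z f g = \<lparr>carrier = {U. pb_ideal X Y Z f g U}, eq = (=), le = (\<subseteq>)\<rparr>"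

definition pb_tensor ::
  "('x, 'c) gorder_scheme \<Rightarrow> ('y, 'd) gorder_scheme \<Rightarrow> ('z, 'e) gorder_scheme \<Rightarrow>
   ('z \<Rightarrow> 'x) \<Rightarrow> ('z \<Rightarrow> 'y) \<Rightarrow> 'x \<Rightarrow> 'y \<Rightarrow> ('x \<times> 'y) set" where
  "pb_tensor X Y Z f g x y = \<Inter>{U. pb_ideal X Y Z f g U \<and> (x, y) \<in> U}"

definition pb_fst ::
  "('x, 'c) gorder_scheme \<Rightarrow> ('y, 'd) gorder_scheme \<Rightarrow> ('z, 'e) gorder_scheme \<Rightarrow>
   ('z \<Rightarrow> 'x) \<Rightarrow> ('z \<Rightarrow> 'y) \<Rightarrow> 'x \<Rightarrow> ('x \<times> 'y) set" where
  "pb_fst X Y Z f g = (\<lambda>x\<in>carrier X. pb_tensor X Y Z f g x \<top>\<^bsub>Y\<^esub>)"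

definition pb_snd ::
  "('x, 'c) gorder_scheme \<Rightarrow> ('y, 'd) gorder_scheme \<Rightarrow> ('z, 'e) gorder_scheme \<Rightarrow>
   ('z \<Rightarrow> 'x) \<Rightarrow> ('z \<Rightarrow> 'y) \<Rightarrow> 'y \<Rightarrow> ('x \<times> 'y) set" where
  "pb_snd X Y Z f g = (\<lambda>y\<in>carrier Y. pb_tensor X Y Z f g \<top>\<^bsub>X\<^esub> y)"

text \<open>
  The map \<open>\<langle>p, q\<rangle>\<close> from \<open>W\<close> to the pullback determined by \<open>p : W \<rightarrow> X\<close> and \<open>q : W \<rightarrow> Y\<close>.
\<close>

definition pb_pair ::
  "('x, 'c) gorder_scheme \<Rightarrow> ('y, 'd) gorder_scheme \<Rightarrow> ('z, 'e) gorder_scheme \<Rightarrow>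
   ('z \<Rightarrow> 'x) \<Rightarrow> ('z \<Rightarrow> 'y) \<Rightarrow> ('w, 'h) gorder_scheme \<Rightarrow>
   ('x \<Rightarrow> 'w) \<Rightarrow> ('y \<Rightarrow> 'w) \<Rightarrow> ('x \<times> 'y) set \<Rightarrow> 'w" where
  "pb_pair X Y Z f g W p q =
     (\<lambda>U\<in>carrier (pullback X Y Z f g). \<Squnion>\<^bsub>W\<^esub>((\<lambda>(x, y). p x \<sqinter>\<^bsub>W\<^esub> q y) ` U))"

lemma (in complete_lattice) le_bounds:
  shows top_in: "\<top> \<in> carrier L" and le_top: "x \<in> carrier L \<Longrightarrow> x \<sqsubseteq> \<top>"
proof -
  have "\<exists>t. greatest L t (carrier L)"
    using sup_exists [of "carrier L"] sup_closed [of "carrier L"] sup_upper [of "carrier L"]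
    unfolding greatest_def by blast
  then have "greatest L \<top> (carrier L)"
    unfolding top_def by (rule someI_ex)
  then show "\<top> \<in> carrier L" "x \<in> carrier L \<Longrightarrow> x \<sqsubseteq> \<top>"
    by (auto simp: greatest_def)
qed

lemma (in complete_lattice) meet_mono:
  assumes "a \<sqsubseteq> c" "b \<sqsubseteq> d" "a \<in> carrier L" "b \<in> carrier L" "c \<in> carrier L" "d \<in> carrier L"
  shows "a \<sqinter> b \<sqsubseteq> c \<sqinter> d"
  using assms by (meson le_trans meet_closed meet_le meet_left meet_right)

lemma (in complete_lattice) le_iff_meet_eq:
  assumes "x \<in> carrier L" "y \<in> carrier L" shows "x \<sqsubseteq> y \<longleftrightarrow> x \<sqinter> y = x"
  using assms by (metis le_antisym le_refl meet_closed meet_le meet_left meet_right)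

lemma (in complete_lattice) meet_top:
  assumes "x \<in> carrier L" shows "x \<sqinter> \<top> = x" "\<top> \<sqinter> x = x"
  using assms le_iff_meet_eq [of x \<top>] top_in le_top by (auto simp: meet_comm)

lemma (in complete_lattice) sup_eqI:
  assumes "A \<subseteq> carrier L" "s \<in> carrier L"
    and "\<And>w. w \<in> carrier L \<Longrightarrow> s \<sqsubseteq> w \<longleftrightarrow> (\<forall>a\<in>A. a \<sqsubseteq> w)"
  shows "\<Squnion>A = s"
proof (rule le_antisym)
  show "\<Squnion>A \<sqsubseteq> s" using assms(1,2) assms(3) [OF assms(2)] by (intro sup_least) auto
  show "s \<sqsubseteq> \<Squnion>A" using assms sup_upper by auto
qed (use assms in auto)

lemma left_adjoint_unique:
  assumes X: "complete_lattice X" and Y: "complete_lattice Y"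
    and h: "left_adjoint X Y f h" and k: "left_adjoint X Y f k"
  shows "h = k"
proof -
  interpret Y: complete_lattice Y by (rule Y)
  show ?thesis
  proof (rule extensionalityI [of _ "carrier X"])
    fix x assume x: "x \<in> carrier X"
    then have "h x \<in> carrier Y" "k x \<in> carrier Y"
      using h k by (auto simp: left_adjoint_def)
    with x h k show "h x = k x"
      by (metis Y.le_antisym Y.le_refl left_adjoint_def)
  qed (use h k in \<open>auto simp: left_adjoint_def PiE_def\<close>)
qed

lemma direct_image_eq:
  assumes "complete_lattice X" "complete_lattice Y" "left_adjoint X Y f h"
  shows "direct_image X Y f = h"
  unfolding direct_image_def using assms left_adjoint_unique by blast

lemma frame_homD:
  assumes "f \<in> frame_hom L M"
  shows "x \<in> carrier L \<Longrightarrow> f x \<in> carrier M"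
    and "\<lbrakk>x \<in> carrier L; y \<in> carrier L\<rbrakk> \<Longrightarrow> f (x \<sqinter>\<^bsub>L\<^esub> y) = f x \<sqinter>\<^bsub>M\<^esub> f y"
    and "A \<subseteq> carrier L \<Longrightarrow> f (\<Squnion>\<^bsub>L\<^esub>A) = \<Squnion>\<^bsub>M\<^esub>(f ` A)"
    and "f \<top>\<^bsub>L\<^esub> = \<top>\<^bsub>M\<^esub>"
    and "f \<in> extensional (carrier L)"
  using assms unfolding frame_hom_def sup_pres_def meet_pres_def by (auto simp: PiE_def)

lemma frame_homI:
  assumes "complete_lattice L" "complete_lattice M"
    and "f \<in> carrier L \<rightarrow>\<^sub>E carrier M"
    and "\<And>x y. \<lbrakk>x \<in> carrier L; y \<in> carrier L\<rbrakk> \<Longrightarrow> f (x \<sqinter>\<^bsub>L\<^esub> y) = f x \<sqinter>\<^bsub>M\<^esub> f y"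
    and "\<And>A. A \<subseteq> carrier L \<Longrightarrow> f (\<Squnion>\<^bsub>L\<^esub>A) = \<Squnion>\<^bsub>M\<^esub>(f ` A)"
    and "f \<top>\<^bsub>L\<^esub> = \<top>\<^bsub>M\<^esub>"
  shows "f \<in> frame_hom L M"
  using assms unfolding frame_hom_def sup_pres_def meet_pres_def
  by (auto simp: complete_lattice_lattice)

locale loc_cospan =
  X: frame X + Y: frame Y + Z: frame Z
  for X :: "('x, 'c) gorder_scheme" and Y :: "('y, 'd) gorder_scheme"
    and Z :: "('z, 'e) gorder_scheme" +
  fixes f :: "'z \<Rightarrow> 'x" and g :: "'z \<Rightarrow> 'y"
  assumes f_map: "f \<in> loc_map X Z" and g_map: "g \<in> loc_map Y Z"
begin

abbreviation "ideal \<equiv> pb_ideal X Y Z f g"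
abbreviation "P \<equiv> pullback X Y Z f g"
abbreviation "tensor \<equiv> pb_tensor X Y Z f g"
abbreviation "proj1 \<equiv> pb_fst X Y Z f g"
abbreviation "proj2 \<equiv> pb_snd X Y Z f g"

lemma f_closed [simp]: "z \<in> carrier Z \<Longrightarrow> f z \<in> carrier X"
  using f_map by (auto simp: loc_map_def dest: frame_homD)

lemma g_closed [simp]: "z \<in> carrier Z \<Longrightarrow> g z \<in> carrier Y"
  using g_map by (auto simp: loc_map_def dest: frame_homD)

lemma idealI:
  assumes "U \<subseteq> carrier X \<times> carrier Y"
    and "\<And>x y a b. \<lbrakk>x \<in> carrier X; y \<in> carrier Y; (a, b) \<in> U; x \<sqsubseteq>\<^bsub>X\<^esub> a; y \<sqsubseteq>\<^bsub>Y\<^esub> b\<rbrakk> \<Longrightarrow> (x, y) \<in> U"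
    and "\<And>A y. \<lbrakk>A \<subseteq> carrier X; y \<in> carrier Y; \<And>a. a \<in> A \<Longrightarrow> (a, y) \<in> U\<rbrakk> \<Longrightarrow> (\<Squnion>\<^bsub>X\<^esub>A, y) \<in> U"
    and "\<And>x B. \<lbrakk>x \<in> carrier X; B \<subseteq> carrier Y; \<And>b. b \<in> B \<Longrightarrow> (x, b) \<in> U\<rbrakk> \<Longrightarrow> (x, \<Squnion>\<^bsub>Y\<^esub>B) \<in> U"
    and "\<And>x y z. \<lbrakk>x \<in> carrier X; y \<in> carrier Y; z \<in> carrier Z\<rbrakk> \<Longrightarrow>
           (x \<sqinter>\<^bsub>X\<^esub> f z, y) \<in> U \<longleftrightarrow> (x, g z \<sqinter>\<^bsub>Y\<^esub> y) \<in> U"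
  shows "ideal U"
  unfolding pb_ideal_def
proof (intro conjI)
  show "U \<subseteq> carrier X \<times> carrier Y" by (rule assms(1))
  show "\<forall>x\<in>carrier X. \<forall>y\<in>carrier Y. \<forall>(a, b)\<in>U. x \<sqsubseteq>\<^bsub>X\<^esub> a \<and> y \<sqsubseteq>\<^bsub>Y\<^esub> b \<longrightarrow> (x, y) \<in> U"
    using assms(2) by blast
  show "\<forall>A\<subseteq>carrier X. \<forall>y\<in>carrier Y. A \<times> {y} \<subseteq> U \<longrightarrow> (\<Squnion>\<^bsub>X\<^esub>A, y) \<in> U"
    by (intro allI impI ballI assms(3)) auto
  show "\<forall>x\<in>carrier X. \<forall>B\<subseteq>carrier Y. {x} \<times> B \<subseteq> U \<longrightarrow> (x, \<Squnion>\<^bsub>Y\<^esub>B) \<in> U"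
    by (intro allI impI ballI assms(4)) auto
  show "\<forall>x\<in>carrier X. \<forall>y\<in>carrier Y. \<forall>z\<in>carrier Z.
          (x \<sqinter>\<^bsub>X\<^esub> f z, y) \<in> U \<longleftrightarrow> (x, g z \<sqinter>\<^bsub>Y\<^esub> y) \<in> U"
    using assms(5) by blast
qed

lemma idealD:
  assumes "ideal U"
  shows "U \<subseteq> carrier X \<times> carrier Y"
    and "\<lbrakk>x \<in> carrier X; y \<in> carrier Y; (a, b) \<in> U; x \<sqsubseteq>\<^bsub>X\<^esub> a; y \<sqsubseteq>\<^bsub>Y\<^esub> b\<rbrakk> \<Longrightarrow> (x, y) \<in> U"
    and "\<lbrakk>A \<subseteq> carrier X; y \<in> carrier Y; \<And>a. a \<in> A \<Longrightarrow> (a, y) \<in> U\<rbrakk> \<Longrightarrow> (\<Squnion>\<^bsub>X\<^esub>A, y) \<in> U"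
    and "\<lbrakk>x \<in> carrier X; B \<subseteq> carrier Y; \<And>b. b \<in> B \<Longrightarrow> (x, b) \<in> U\<rbrakk> \<Longrightarrow> (x, \<Squnion>\<^bsub>Y\<^esub>B) \<in> U"
    and "\<lbrakk>x \<in> carrier X; y \<in> carrier Y; z \<in> carrier Z\<rbrakk> \<Longrightarrow>
           (x \<sqinter>\<^bsub>X\<^esub> f z, y) \<in> U \<longleftrightarrow> (x, g z \<sqinter>\<^bsub>Y\<^esub> y) \<in> U"
proof -
  show "U \<subseteq> carrier X \<times> carrier Y"
    using assms unfolding pb_ideal_def by (elim conjE)
  have "\<forall>x\<in>carrier X. \<forall>y\<in>carrier Y. \<forall>(a, b)\<in>U. x \<sqsubseteq>\<^bsub>X\<^esub> a \<and> y \<sqsubseteq>\<^bsub>Y\<^esub> b \<longrightarrow> (x, y) \<in> U"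
    using assms unfolding pb_ideal_def by (elim conjE)
  then show "\<lbrakk>x \<in> carrier X; y \<in> carrier Y; (a, b) \<in> U; x \<sqsubseteq>\<^bsub>X\<^esub> a; y \<sqsubseteq>\<^bsub>Y\<^esub> b\<rbrakk> \<Longrightarrow> (x, y) \<in> U"
    by blast
  have "\<forall>A\<subseteq>carrier X. \<forall>y\<in>carrier Y. A \<times> {y} \<subseteq> U \<longrightarrow> (\<Squnion>\<^bsub>X\<^esub>A, y) \<in> U"
    using assms unfolding pb_ideal_def by (elim conjE)
  then show "(\<Squnion>\<^bsub>X\<^esub>A, y) \<in> U"
    if "A \<subseteq> carrier X" "y \<in> carrier Y" "\<And>a. a \<in> A \<Longrightarrow> (a, y) \<in> U"
    using that by (simp add: subset_eq)
  have "\<forall>x\<in>carrier X. \<forall>B\<subseteq>carrier Y. {x} \<times> B \<subseteq> U \<longrightarrow> (x, \<Squnion>\<^bsub>Y\<^esub>B) \<in> U"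
    using assms unfolding pb_ideal_def by (elim conjE)
  then show "(x, \<Squnion>\<^bsub>Y\<^esub>B) \<in> U"
    if "x \<in> carrier X" "B \<subseteq> carrier Y" "\<And>b. b \<in> B \<Longrightarrow> (x, b) \<in> U"
    using that by (simp add: subset_eq)
  have "\<forall>x\<in>carrier X. \<forall>y\<in>carrier Y. \<forall>z\<in>carrier Z.
          (x \<sqinter>\<^bsub>X\<^esub> f z, y) \<in> U \<longleftrightarrow> (x, g z \<sqinter>\<^bsub>Y\<^esub> y) \<in> U"
    using assms unfolding pb_ideal_def by (elim conjE)
  then show "\<lbrakk>x \<in> carrier X; y \<in> carrier Y; z \<in> carrier Z\<rbrakk> \<Longrightarrow>
          (x \<sqinter>\<^bsub>X\<^esub> f z, y) \<in> U \<longleftrightarrow> (x, g z \<sqinter>\<^bsub>Y\<^esub> y) \<in> U"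
    by blast
qed

lemma ideal_mem:
  assumes "ideal U" "(x, y) \<in> U" shows "x \<in> carrier X" "y \<in> carrier Y"
  using assms idealD(1) by auto

lemma ideal_all: "ideal (carrier X \<times> carrier Y)"
  by (rule idealI) auto

lemma ideal_Inter:
  assumes ne: "S \<noteq> {}" and S: "\<And>U. U \<in> S \<Longrightarrow> ideal U"
  shows "ideal (\<Inter>S)"
proof (rule idealI)
  show "\<Inter>S \<subseteq> carrier X \<times> carrier Y" using ne S idealD(1) by blast
next
  fix x y a b
  assume "x \<in> carrier X" "y \<in> carrier Y" "(a, b) \<in> \<Inter>S" "x \<sqsubseteq>\<^bsub>X\<^esub> a" "y \<sqsubseteq>\<^bsub>Y\<^esub> b"
  then show "(x, y) \<in> \<Inter>S" using S idealD(2) by (meson InterE InterI)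
next
  fix A y assume "A \<subseteq> carrier X" "y \<in> carrier Y" "\<And>a. a \<in> A \<Longrightarrow> (a, y) \<in> \<Inter>S"
  then show "(\<Squnion>\<^bsub>X\<^esub>A, y) \<in> \<Inter>S" using S by (auto intro!: idealD(3))
next
  fix x B assume "x \<in> carrier X" "B \<subseteq> carrier Y" "\<And>b. b \<in> B \<Longrightarrow> (x, b) \<in> \<Inter>S"
  then show "(x, \<Squnion>\<^bsub>Y\<^esub>B) \<in> \<Inter>S" using S by (auto intro!: idealD(4))
next
  fix x y z assume "x \<in> carrier X" "y \<in> carrier Y" "z \<in> carrier Z"
  then show "(x \<sqinter>\<^bsub>X\<^esub> f z, y) \<in> \<Inter>S \<longleftrightarrow> (x, g z \<sqinter>\<^bsub>Y\<^esub> y) \<in> \<Inter>S"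
    using S idealD(5) by blast
qed

lemma ideal_Int: "\<lbrakk>ideal U; ideal V\<rbrakk> \<Longrightarrow> ideal (U \<inter> V)"
  using ideal_Inter [of "{U, V}"] by auto

lemma ideal_residual:
  assumes T: "ideal T" and a: "a \<in> carrier X" and b: "b \<in> carrier Y"
  shows "ideal {(x, y). x \<in> carrier X \<and> y \<in> carrier Y \<and> (x \<sqinter>\<^bsub>X\<^esub> a, y \<sqinter>\<^bsub>Y\<^esub> b) \<in> T}"
proof (rule idealI, goal_cases)
  case 1 show ?case by auto
next
  case (2 x y c d)
  then have cd: "c \<in> carrier X" "d \<in> carrier Y" "(c \<sqinter>\<^bsub>X\<^esub> a, d \<sqinter>\<^bsub>Y\<^esub> b) \<in> T" by auto
  have "(x \<sqinter>\<^bsub>X\<^esub> a, y \<sqinter>\<^bsub>Y\<^esub> b) \<in> T"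
    by (rule idealD(2) [OF T _ _ cd(3)])
      (use 2 cd a b in \<open>auto intro!: X.meet_mono Y.meet_mono\<close>)
  with 2 show ?case by auto
next
  case (3 A y)
  have "(\<Squnion>\<^bsub>X\<^esub>((\<lambda>x. a \<sqinter>\<^bsub>X\<^esub> x) ` A), y \<sqinter>\<^bsub>Y\<^esub> b) \<in> T"
    by (rule idealD(3) [OF T]) (use 3 a b in \<open>auto simp: meet_comm [of X a] subset_eq\<close>)
  then show ?case
    using 3 a by (simp add: X.meet_sup_distrib meet_comm [of X _ a])
next
  case (4 x B)
  have "(x \<sqinter>\<^bsub>X\<^esub> a, \<Squnion>\<^bsub>Y\<^esub>((\<lambda>y. b \<sqinter>\<^bsub>Y\<^esub> y) ` B)) \<in> T"
    by (rule idealD(4) [OF T]) (use 4 a b in \<open>auto simp: meet_comm [of Y b] subset_eq\<close>)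
  then show ?case
    using 4 b by (simp add: Y.meet_sup_distrib meet_comm [of Y _ b])
next
  case (5 x y z)
  have 1: "(x \<sqinter>\<^bsub>X\<^esub> f z) \<sqinter>\<^bsub>X\<^esub> a = (x \<sqinter>\<^bsub>X\<^esub> a) \<sqinter>\<^bsub>X\<^esub> f z"
    using 5 a by (metis X.meet_assoc f_closed meet_comm)
  have 2: "(g z \<sqinter>\<^bsub>Y\<^esub> y) \<sqinter>\<^bsub>Y\<^esub> b = g z \<sqinter>\<^bsub>Y\<^esub> (y \<sqinter>\<^bsub>Y\<^esub> b)"
    using 5 b by (simp add: Y.meet_assoc)
  show ?case
    using 5 a b idealD(5) [OF T, of "x \<sqinter>\<^bsub>X\<^esub> a" "y \<sqinter>\<^bsub>Y\<^esub> b" z] by (simp add: 1 2)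
qed

lemma P_simps [simp]:
  "carrier P = {U. ideal U}" "eq P = (=)" "le P = (\<subseteq>)"
  by (simp_all add: pullback_def)

lemma P_complete: "complete_lattice P"
proof -
  interpret P: partial_order P
    by unfold_locales (auto simp: pullback_def)
  show ?thesis
  proof (rule P.complete_lattice_criterion1)
    show "\<exists>t. greatest P t (carrier P)"
      using ideal_all idealD(1) by (intro exI [of _ "carrier X \<times> carrier Y"]) (auto simp: greatest_def)
    fix S assume S: "S \<subseteq> carrier P" "S \<noteq> {}"
    show "\<exists>i. greatest P i (Lower P S)"
      using S ideal_Inter [of S]
      by (intro exI [of _ "\<Inter>S"]) (auto simp: greatest_def Lower_def)
  qed
qed

sublocale P: complete_lattice P
  by (rule P_complete)

lemma P_top: "\<top>\<^bsub>P\<^esub> = carrier X \<times> carrier Y"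
  using P.top_in P.le_top [of "carrier X \<times> carrier Y"] ideal_all idealD(1) [of "\<top>\<^bsub>P\<^esub>"] by auto

lemma P_meet:
  assumes "ideal U" "ideal V" shows "U \<sqinter>\<^bsub>P\<^esub> V = U \<inter> V"
proof
  show "U \<sqinter>\<^bsub>P\<^esub> V \<subseteq> U \<inter> V"
    using P.meet_left [of U V] P.meet_right [of U V] assms by simp
  show "U \<inter> V \<subseteq> U \<sqinter>\<^bsub>P\<^esub> V"
    using P.meet_le [of "U \<inter> V" U V] assms ideal_Int by simp
qed

lemma P_sup_le:
  assumes S: "\<And>U. U \<in> S \<Longrightarrow> ideal U" and T: "ideal T"
  shows "\<Squnion>\<^bsub>P\<^esub>S \<subseteq> T \<longleftrightarrow> (\<forall>U\<in>S. U \<subseteq> T)"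
proof
  have c: "S \<subseteq> carrier P" using S by auto
  show "\<forall>U\<in>S. U \<subseteq> T" if "\<Squnion>\<^bsub>P\<^esub>S \<subseteq> T"
  proof
    fix U assume "U \<in> S"
    then have "U \<subseteq> \<Squnion>\<^bsub>P\<^esub>S" using P.sup_upper [OF c] by simp
    with that show "U \<subseteq> T" by (rule order_trans [rotated])
  qed
  show "\<Squnion>\<^bsub>P\<^esub>S \<subseteq> T" if "\<forall>U\<in>S. U \<subseteq> T"
    using P.sup_least [OF c, of T] T that by simp
qed

lemma P_frame: "frame P"
proof
  fix U S assume "U \<in> carrier P" and "S \<subseteq> carrier P"
  then have U: "ideal U" and S: "\<And>V. V \<in> S \<Longrightarrow> ideal V" by auto
  have I: "ideal (\<Squnion>\<^bsub>P\<^esub>S)" using P.sup_closed [of S] S by auto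
  have im: "(\<lambda>V. U \<sqinter>\<^bsub>P\<^esub> V) ` S = (\<lambda>V. U \<inter> V) ` S"
    using U S P_meet by (intro image_cong) auto
  show "U \<sqinter>\<^bsub>P\<^esub> \<Squnion>\<^bsub>P\<^esub>S = \<Squnion>\<^bsub>P\<^esub>((\<lambda>V. U \<sqinter>\<^bsub>P\<^esub> V) ` S)"
    unfolding im P_meet [OF U I]
  proof (rule P.sup_eqI [symmetric])
    show "(\<lambda>V. U \<inter> V) ` S \<subseteq> carrier P" "U \<inter> \<Squnion>\<^bsub>P\<^esub>S \<in> carrier P"
      using U S I ideal_Int by auto
    fix T assume "T \<in> carrier P"
    then have T: "ideal T" by simp
    have a: "U \<inter> \<Squnion>\<^bsub>P\<^esub>S \<subseteq> T" if *: "\<And>V. V \<in> S \<Longrightarrow> U \<inter> V \<subseteq> T"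
    proof clarify
      fix x y assume xy: "(x, y) \<in> U" "(x, y) \<in> \<Squnion>\<^bsub>P\<^esub>S"
      then have c: "x \<in> carrier X" "y \<in> carrier Y" using ideal_mem U by auto
      let ?R = "{(a, b). a \<in> carrier X \<and> b \<in> carrier Y \<and> (a \<sqinter>\<^bsub>X\<^esub> x, b \<sqinter>\<^bsub>Y\<^esub> y) \<in> T}"
      have "V \<subseteq> ?R" if V: "V \<in> S" for V
      proof clarify
        fix a b assume ab: "(a, b) \<in> V"
        then have d: "a \<in> carrier X" "b \<in> carrier Y" using ideal_mem S [OF V] by auto
        have "(a \<sqinter>\<^bsub>X\<^esub> x, b \<sqinter>\<^bsub>Y\<^esub> y) \<in> U" "(a \<sqinter>\<^bsub>X\<^esub> x, b \<sqinter>\<^bsub>Y\<^esub> y) \<in> V"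
          using c d ab xy idealD(2) [OF U] idealD(2) [OF S [OF V]]
          by (meson X.meet_closed X.meet_left X.meet_right
                Y.meet_closed Y.meet_left Y.meet_right)+
        with d * [OF V] show "a \<in> carrier X \<and> b \<in> carrier Y \<and> (a \<sqinter>\<^bsub>X\<^esub> x, b \<sqinter>\<^bsub>Y\<^esub> y) \<in> T"
          by auto
      qed
      then have "\<Squnion>\<^bsub>P\<^esub>S \<subseteq> ?R"
        using P_sup_le [OF S] ideal_residual [OF T c] by blast
      with xy have "(x \<sqinter>\<^bsub>X\<^esub> x, y \<sqinter>\<^bsub>Y\<^esub> y) \<in> T" by auto
      then show "(x, y) \<in> T"
        by (rule idealD(2) [OF T c]) (use c in \<open>auto intro!: X.meet_le Y.meet_le\<close>)
    qed
    have b: "U \<inter> V \<subseteq> T" if "U \<inter> \<Squnion>\<^bsub>P\<^esub>S \<subseteq> T" "V \<in> S" for V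
      using that P_sup_le [OF S I] by blast
    have "U \<inter> \<Squnion>\<^bsub>P\<^esub>S \<subseteq> T \<longleftrightarrow> (\<forall>V\<in>S. U \<inter> V \<subseteq> T)"
    proof
      show "\<forall>V\<in>S. U \<inter> V \<subseteq> T" if "U \<inter> \<Squnion>\<^bsub>P\<^esub>S \<subseteq> T"
        using b [OF that] by (rule ballI)
      show "U \<inter> \<Squnion>\<^bsub>P\<^esub>S \<subseteq> T" if "\<forall>V\<in>S. U \<inter> V \<subseteq> T"
        using that by (intro a) (rule bspec)
    qed
    then show "U \<inter> \<Squnion>\<^bsub>P\<^esub>S \<sqsubseteq>\<^bsub>P\<^esub> T \<longleftrightarrow> (\<forall>V\<in>(\<lambda>V. U \<inter> V) ` S. V \<sqsubseteq>\<^bsub>P\<^esub> T)"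
      by simp
  qed
qed

lemma tensor_ideal:
  assumes "x \<in> carrier X" "y \<in> carrier Y" shows "ideal (tensor x y)"
  unfolding pb_tensor_def
  by (rule ideal_Inter) (use ideal_all assms in auto)

lemma tensor_le:
  assumes "x \<in> carrier X" "y \<in> carrier Y" "ideal U"
  shows "tensor x y \<subseteq> U \<longleftrightarrow> (x, y) \<in> U"
proof
  show "(x, y) \<in> U" if "tensor x y \<subseteq> U" using that by (auto simp: pb_tensor_def)
  show "tensor x y \<subseteq> U" if "(x, y) \<in> U" using that assms by (auto simp: pb_tensor_def)
qed

lemma tensor_self: "\<lbrakk>x \<in> carrier X; y \<in> carrier Y\<rbrakk> \<Longrightarrow> (x, y) \<in> tensor x y"
  using tensor_le tensor_ideal by blast

lemma tensor_meet:
  assumes "x \<in> carrier X" "y \<in> carrier Y" "x' \<in> carrier X" "y' \<in> carrier Y"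
  shows "tensor x y \<inter> tensor x' y' = tensor (x \<sqinter>\<^bsub>X\<^esub> x') (y \<sqinter>\<^bsub>Y\<^esub> y')"
proof
  have "(x \<sqinter>\<^bsub>X\<^esub> x', y \<sqinter>\<^bsub>Y\<^esub> y') \<in> tensor x y" "(x \<sqinter>\<^bsub>X\<^esub> x', y \<sqinter>\<^bsub>Y\<^esub> y') \<in> tensor x' y'"
    using assms tensor_ideal tensor_self
    by (meson idealD(2) X.meet_closed X.meet_left X.meet_right
          Y.meet_closed Y.meet_left Y.meet_right)+
  then show "tensor (x \<sqinter>\<^bsub>X\<^esub> x') (y \<sqinter>\<^bsub>Y\<^esub> y') \<subseteq> tensor x y \<inter> tensor x' y'"
    using assms tensor_le tensor_ideal by simp
  let ?T = "tensor (x \<sqinter>\<^bsub>X\<^esub> x') (y \<sqinter>\<^bsub>Y\<^esub> y')"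
  have T: "ideal ?T" using assms tensor_ideal by simp
  show "tensor x y \<inter> tensor x' y' \<subseteq> ?T"
  proof clarify
    fix a b assume ab: "(a, b) \<in> tensor x y" "(a, b) \<in> tensor x' y'"
    then have c: "a \<in> carrier X" "b \<in> carrier Y"
      using assms tensor_ideal ideal_mem by blast+
    have "(x, y) \<in> {(p, q). p \<in> carrier X \<and> q \<in> carrier Y \<and> (p \<sqinter>\<^bsub>X\<^esub> x', q \<sqinter>\<^bsub>Y\<^esub> y') \<in> ?T}"
      using assms tensor_self by auto
    then have "tensor x y \<subseteq>
        {(p, q). p \<in> carrier X \<and> q \<in> carrier Y \<and> (p \<sqinter>\<^bsub>X\<^esub> x', q \<sqinter>\<^bsub>Y\<^esub> y') \<in> ?T}"
      using tensor_le ideal_residual [OF T] assms by blast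
    with ab have "(a \<sqinter>\<^bsub>X\<^esub> x', b \<sqinter>\<^bsub>Y\<^esub> y') \<in> ?T" by auto
    then have "(x', y') \<in> {(p, q). p \<in> carrier X \<and> q \<in> carrier Y \<and> (p \<sqinter>\<^bsub>X\<^esub> a, q \<sqinter>\<^bsub>Y\<^esub> b) \<in> ?T}"
      using assms by (simp add: meet_comm)
    then have "tensor x' y' \<subseteq>
        {(p, q). p \<in> carrier X \<and> q \<in> carrier Y \<and> (p \<sqinter>\<^bsub>X\<^esub> a, q \<sqinter>\<^bsub>Y\<^esub> b) \<in> ?T}"
      using tensor_le ideal_residual [OF T c] assms by blast
    with ab have "(a \<sqinter>\<^bsub>X\<^esub> a, b \<sqinter>\<^bsub>Y\<^esub> b) \<in> ?T" by auto
    then show "(a, b) \<in> ?T"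
      by (rule idealD(2) [OF T c]) (use c in \<open>auto intro!: X.meet_le Y.meet_le\<close>)
  qed
qed

lemma tensor_top: "tensor \<top>\<^bsub>X\<^esub> \<top>\<^bsub>Y\<^esub> = carrier X \<times> carrier Y"
proof
  have t: "ideal (tensor \<top>\<^bsub>X\<^esub> \<top>\<^bsub>Y\<^esub>)" using tensor_ideal X.top_in Y.top_in by auto
  show "tensor \<top>\<^bsub>X\<^esub> \<top>\<^bsub>Y\<^esub> \<subseteq> carrier X \<times> carrier Y"
    using idealD(1) [OF t] .
  show "carrier X \<times> carrier Y \<subseteq> tensor \<top>\<^bsub>X\<^esub> \<top>\<^bsub>Y\<^esub>"
    using idealD(2) [OF t _ _ tensor_self] X.top_in Y.top_in X.le_top Y.le_top by auto
qed

lemma proj1_map: "proj1 \<in> loc_map P X"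
  unfolding loc_map_def
proof (rule frame_homI)
  show "complete_lattice X" "complete_lattice P" by unfold_locales
  show "proj1 \<in> carrier X \<rightarrow>\<^sub>E carrier P"
    using tensor_ideal Y.top_in by (auto simp: pb_fst_def)
  show "proj1 \<top>\<^bsub>X\<^esub> = \<top>\<^bsub>P\<^esub>"
    using X.top_in by (simp add: pb_fst_def P_top tensor_top)
  show "proj1 (x \<sqinter>\<^bsub>X\<^esub> y) = proj1 x \<sqinter>\<^bsub>P\<^esub> proj1 y" if "x \<in> carrier X" "y \<in> carrier X" for x y
    using that Y.top_in by (simp add: pb_fst_def P_meet tensor_ideal tensor_meet Y.meet_top)
  fix A assume A: "A \<subseteq> carrier X"
  have im: "proj1 ` A = (\<lambda>a. tensor a \<top>\<^bsub>Y\<^esub>) ` A"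
    using A by (intro image_cong) (auto simp: pb_fst_def)
  have "\<Squnion>\<^bsub>P\<^esub>((\<lambda>a. tensor a \<top>\<^bsub>Y\<^esub>) ` A) = tensor (\<Squnion>\<^bsub>X\<^esub>A) \<top>\<^bsub>Y\<^esub>"
  proof (rule P.sup_eqI)
    show "(\<lambda>a. tensor a \<top>\<^bsub>Y\<^esub>) ` A \<subseteq> carrier P" "tensor (\<Squnion>\<^bsub>X\<^esub>A) \<top>\<^bsub>Y\<^esub> \<in> carrier P"
      using A Y.top_in tensor_ideal by auto
    fix W assume "W \<in> carrier P"
    then have W: "ideal W" by simp
    have "(\<Squnion>\<^bsub>X\<^esub>A, \<top>\<^bsub>Y\<^esub>) \<in> W \<longleftrightarrow> (\<forall>a\<in>A. (a, \<top>\<^bsub>Y\<^esub>) \<in> W)"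
      using idealD(2,3) [OF W] A Y.top_in X.sup_upper [OF A] by (meson Y.le_refl in_mono)
    then show "tensor (\<Squnion>\<^bsub>X\<^esub>A) \<top>\<^bsub>Y\<^esub> \<sqsubseteq>\<^bsub>P\<^esub> W \<longleftrightarrow> (\<forall>a\<in>(\<lambda>a. tensor a \<top>\<^bsub>Y\<^esub>) ` A. a \<sqsubseteq>\<^bsub>P\<^esub> W)"
      using A Y.top_in W by (simp add: tensor_le subset_eq [of A])
  qed
  then show "proj1 (\<Squnion>\<^bsub>X\<^esub>A) = \<Squnion>\<^bsub>P\<^esub>(proj1 ` A)"
    using A by (simp add: im) (simp add: pb_fst_def)
qed

lemma proj2_map: "proj2 \<in> loc_map P Y"
  unfolding loc_map_def
proof (rule frame_homI)
  show "complete_lattice Y" "complete_lattice P" by unfold_locales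
  show "proj2 \<in> carrier Y \<rightarrow>\<^sub>E carrier P"
    using tensor_ideal X.top_in by (auto simp: pb_snd_def)
  show "proj2 \<top>\<^bsub>Y\<^esub> = \<top>\<^bsub>P\<^esub>"
    using Y.top_in by (simp add: pb_snd_def P_top tensor_top)
  show "proj2 (x \<sqinter>\<^bsub>Y\<^esub> y) = proj2 x \<sqinter>\<^bsub>P\<^esub> proj2 y" if "x \<in> carrier Y" "y \<in> carrier Y" for x y
    using that X.top_in by (simp add: pb_snd_def P_meet tensor_ideal tensor_meet X.meet_top)
  fix B assume B: "B \<subseteq> carrier Y"
  have im: "proj2 ` B = (\<lambda>b. tensor \<top>\<^bsub>X\<^esub> b) ` B"
    using B by (intro image_cong) (auto simp: pb_snd_def)
  have "\<Squnion>\<^bsub>P\<^esub>((\<lambda>b. tensor \<top>\<^bsub>X\<^esub> b) ` B) = tensor \<top>\<^bsub>X\<^esub> (\<Squnion>\<^bsub>Y\<^esub>B)"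
  proof (rule P.sup_eqI)
    show "(\<lambda>b. tensor \<top>\<^bsub>X\<^esub> b) ` B \<subseteq> carrier P" "tensor \<top>\<^bsub>X\<^esub> (\<Squnion>\<^bsub>Y\<^esub>B) \<in> carrier P"
      using B X.top_in tensor_ideal by auto
    fix W assume "W \<in> carrier P"
    then have W: "ideal W" by simp
    have "(\<top>\<^bsub>X\<^esub>, \<Squnion>\<^bsub>Y\<^esub>B) \<in> W \<longleftrightarrow> (\<forall>b\<in>B. (\<top>\<^bsub>X\<^esub>, b) \<in> W)"
      using idealD(2,4) [OF W] B X.top_in Y.sup_upper [OF B] by (meson X.le_refl in_mono)
    then show "tensor \<top>\<^bsub>X\<^esub> (\<Squnion>\<^bsub>Y\<^esub>B) \<sqsubseteq>\<^bsub>P\<^esub> W \<longleftrightarrow> (\<forall>b\<in>(\<lambda>b. tensor \<top>\<^bsub>X\<^esub> b) ` B. b \<sqsubseteq>\<^bsub>P\<^esub> W)"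
      using B X.top_in W by (simp add: tensor_le subset_eq [of B])
  qed
  then show "proj2 (\<Squnion>\<^bsub>Y\<^esub>B) = \<Squnion>\<^bsub>P\<^esub>(proj2 ` B)"
    using B by (simp add: im) (simp add: pb_snd_def)
qed

lemma proj_commute: "loc_comp Z f proj1 = loc_comp Z g proj2"
proof (rule extensionalityI [of _ "carrier Z"])
  fix z assume z: "z \<in> carrier Z"
  have "(f z, \<top>\<^bsub>Y\<^esub>) \<in> T \<longleftrightarrow> (\<top>\<^bsub>X\<^esub>, g z) \<in> T" if "ideal T" for T
    using idealD(5) [OF that, of "\<top>\<^bsub>X\<^esub>" "\<top>\<^bsub>Y\<^esub>" z] z X.top_in Y.top_in
    by (simp add: X.meet_top Y.meet_top)
  then have "tensor (f z) \<top>\<^bsub>Y\<^esub> = tensor \<top>\<^bsub>X\<^esub> (g z)"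
    unfolding pb_tensor_def by (intro arg_cong [where f = Inter]) blast
  then show "loc_comp Z f proj1 z = loc_comp Z g proj2 z"
    using z by (simp add: loc_comp_def compose_def pb_fst_def pb_snd_def)
qed (auto simp: loc_comp_def)

lemma tensor_eq_meet:
  assumes "x \<in> carrier X" "y \<in> carrier Y"
  shows "tensor x y = proj1 x \<sqinter>\<^bsub>P\<^esub> proj2 y"
  using assms X.top_in Y.top_in
  by (simp add: pb_fst_def pb_snd_def P_meet tensor_ideal tensor_meet X.meet_top Y.meet_top)

lemma ideal_eq_sup:
  assumes "ideal U" shows "\<Squnion>\<^bsub>P\<^esub>((\<lambda>(x, y). tensor x y) ` U) = U"
proof (rule P.sup_eqI)
  show "(\<lambda>(x, y). tensor x y) ` U \<subseteq> carrier P" "U \<in> carrier P"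
    using assms ideal_mem [OF assms] tensor_ideal by auto
  fix W assume "W \<in> carrier P"
  then have W: "ideal W" by simp
  have "(\<forall>(x, y)\<in>U. tensor x y \<subseteq> W) \<longleftrightarrow> (\<forall>(x, y)\<in>U. (x, y) \<in> W)"
    using ideal_mem [OF assms] tensor_le [OF _ _ W] by (intro ball_cong) clarsimp+
  then show "U \<sqsubseteq>\<^bsub>P\<^esub> W \<longleftrightarrow> (\<forall>V\<in>(\<lambda>(x, y). tensor x y) ` U. V \<sqsubseteq>\<^bsub>P\<^esub> W)"
    by (simp add: subset_eq [of U] case_prod_unfold)
qed

end

theorem pullback_frame:
  assumes "frame X" "frame Y" "frame Z" "f \<in> loc_map X Z" "g \<in> loc_map Y Z"
  shows "frame (pullback X Y Z f g)"
    and "pb_fst X Y Z f g \<in> loc_map (pullback X Y Z f g) X"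
    and "pb_snd X Y Z f g \<in> loc_map (pullback X Y Z f g) Y"
    and "loc_comp Z f (pb_fst X Y Z f g) = loc_comp Z g (pb_snd X Y Z f g)"
proof -
  interpret loc_cospan X Y Z f g
    using assms by (simp add: loc_cospan_def loc_cospan_axioms_def)
  show "frame P" by (rule P_frame)
  show "proj1 \<in> loc_map P X" by (rule proj1_map)
  show "proj2 \<in> loc_map P Y" by (rule proj2_map)
  show "loc_comp Z f proj1 = loc_comp Z g proj2" by (rule proj_commute)
qed

theorem pullback_universal:
  assumes "frame X" "frame Y" "frame Z" "f \<in> loc_map X Z" "g \<in> loc_map Y Z"
    and W: "frame W" and p: "p \<in> loc_map W X" and q: "q \<in> loc_map W Y"
    and pq: "loc_comp Z f p = loc_comp Z g q"
  shows "pb_pair X Y Z f g W p q \<in> loc_map W (pullback X Y Z f g)"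
    and "loc_comp X (pb_fst X Y Z f g) (pb_pair X Y Z f g W p q) = p"
    and "loc_comp Y (pb_snd X Y Z f g) (pb_pair X Y Z f g W p q) = q"
    and "\<And>h. \<lbrakk>h \<in> loc_map W (pullback X Y Z f g);
              loc_comp X (pb_fst X Y Z f g) h = p; loc_comp Y (pb_snd X Y Z f g) h = q\<rbrakk>
           \<Longrightarrow> h = pb_pair X Y Z f g W p q"
proof -
  interpret loc_cospan X Y Z f g
    using assms by (simp add: loc_cospan_def loc_cospan_axioms_def)
  interpret W: frame W by (rule W)
  note p = p [unfolded loc_map_def] and q = q [unfolded loc_map_def]
  note pD = frame_homD [OF p] and qD = frame_homD [OF q]
  let ?h = "pb_pair X Y Z f g W p q"
  let ?K = "\<lambda>w. {(x, y). x \<in> carrier X \<and> y \<in> carrier Y \<and> p x \<sqinter>\<^bsub>W\<^esub> q y \<sqsubseteq>\<^bsub>W\<^esub> w}"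
  have pqz: "p (f z) = q (g z)" if "z \<in> carrier Z" for z
    using fun_cong [OF pq, of z] that by (simp add: loc_comp_def compose_def)
  have W_sup_le: "\<Squnion>\<^bsub>W\<^esub>A \<sqsubseteq>\<^bsub>W\<^esub> w \<longleftrightarrow> (\<forall>a\<in>A. a \<sqsubseteq>\<^bsub>W\<^esub> w)"
    if "A \<subseteq> carrier W" "w \<in> carrier W" for A w
    using W.sup_upper [OF that(1)] W.sup_least [OF that] W.le_trans that
    by (meson W.sup_closed in_mono)
  have p_mono: "p x \<sqsubseteq>\<^bsub>W\<^esub> p x'" if "x \<in> carrier X" "x' \<in> carrier X" "x \<sqsubseteq>\<^bsub>X\<^esub> x'" for x x'
    using that pD(1,2) X.le_iff_meet_eq W.le_iff_meet_eq by metis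
  have q_mono: "q y \<sqsubseteq>\<^bsub>W\<^esub> q y'" if "y \<in> carrier Y" "y' \<in> carrier Y" "y \<sqsubseteq>\<^bsub>Y\<^esub> y'" for y y'
    using that qD(1,2) Y.le_iff_meet_eq W.le_iff_meet_eq by metis
  have K: "ideal (?K w)" if w: "w \<in> carrier W" for w
  proof (rule idealI, goal_cases)
    case 1 show ?case by auto
  next
    case (2 x y a b)
    then have "p x \<sqinter>\<^bsub>W\<^esub> q y \<sqsubseteq>\<^bsub>W\<^esub> p a \<sqinter>\<^bsub>W\<^esub> q b"
      by (intro W.meet_mono) (auto intro: p_mono q_mono pD(1) qD(1))
    with 2 w show ?case
      using pD(1) qD(1) W.le_trans [of "p x \<sqinter>\<^bsub>W\<^esub> q y" "p a \<sqinter>\<^bsub>W\<^esub> q b" w] by auto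
  next
    case (3 A y)
    have "p (\<Squnion>\<^bsub>X\<^esub>A) \<sqinter>\<^bsub>W\<^esub> q y = \<Squnion>\<^bsub>W\<^esub>((\<lambda>v. q y \<sqinter>\<^bsub>W\<^esub> v) ` p ` A)"
      using 3 pD qD(1) W.meet_sup_distrib [of "q y" "p ` A"]
      by (simp add: meet_comm [of W _ "q y"] image_subset_iff subset_eq)
    also have "\<dots> \<sqsubseteq>\<^bsub>W\<^esub> w"
      using 3 w pD(1) qD(1) by (intro W.sup_least) (auto simp: meet_comm [of W "q y"])
    finally show ?case using 3 by simp
  next
    case (4 x B)
    have "p x \<sqinter>\<^bsub>W\<^esub> q (\<Squnion>\<^bsub>Y\<^esub>B) = \<Squnion>\<^bsub>W\<^esub>((\<lambda>v. p x \<sqinter>\<^bsub>W\<^esub> v) ` q ` B)"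
      using 4 qD pD(1) W.meet_sup_distrib [of "p x" "q ` B"]
      by (simp add: image_subset_iff subset_eq)
    also have "\<dots> \<sqsubseteq>\<^bsub>W\<^esub> w"
      using 4 w pD(1) qD(1) by (intro W.sup_least) auto
    finally show ?case using 4 by simp
  next
    case (5 x y z)
    then have "p (x \<sqinter>\<^bsub>X\<^esub> f z) \<sqinter>\<^bsub>W\<^esub> q y = p x \<sqinter>\<^bsub>W\<^esub> q (g z \<sqinter>\<^bsub>Y\<^esub> y)"
      using pD(1,2) qD(1,2) pqz by (simp add: W.meet_assoc)
    with 5 show ?case by simp
  qed
  have gen: "(\<lambda>(x, y). p x \<sqinter>\<^bsub>W\<^esub> q y) ` U \<subseteq> carrier W" if "ideal U" for U
    using ideal_mem [OF that] pD(1) qD(1) by auto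
  have h_eq: "?h U = \<Squnion>\<^bsub>W\<^esub>((\<lambda>(x, y). p x \<sqinter>\<^bsub>W\<^esub> q y) ` U)" if "ideal U" for U
    using that by (simp add: pb_pair_def)
  have h_closed: "?h U \<in> carrier W" if "ideal U" for U
    using h_eq [OF that] gen [OF that] by simp
  have h_le: "?h U \<sqsubseteq>\<^bsub>W\<^esub> w \<longleftrightarrow> U \<subseteq> ?K w" if "ideal U" "w \<in> carrier W" for U w
    unfolding h_eq [OF that(1)] W_sup_le [OF gen [OF that(1)] that(2)]
    using ideal_mem [OF that(1)] by auto
  have h_tensor: "?h (tensor x y) = p x \<sqinter>\<^bsub>W\<^esub> q y" if xy: "x \<in> carrier X" "y \<in> carrier Y" for x y
  proof -
    have *: "?h (tensor x y) \<sqsubseteq>\<^bsub>W\<^esub> w \<longleftrightarrow> p x \<sqinter>\<^bsub>W\<^esub> q y \<sqsubseteq>\<^bsub>W\<^esub> w" if "w \<in> carrier W" for w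
      using h_le [OF tensor_ideal [OF xy] that] tensor_le [OF xy K [OF that]] xy by simp
    have c: "?h (tensor x y) \<in> carrier W" "p x \<sqinter>\<^bsub>W\<^esub> q y \<in> carrier W"
      using h_closed tensor_ideal xy pD(1) qD(1) by auto
    show ?thesis
      using * [OF c(1)] * [OF c(2)] c by (intro W.le_antisym) auto
  qed
  have h_top: "?h \<top>\<^bsub>P\<^esub> = \<top>\<^bsub>W\<^esub>"
    using h_tensor [OF X.top_in Y.top_in] pD(4) qD(4) W.meet_top W.top_in
    by (simp add: P_top tensor_top)
  have h_sup: "?h (\<Squnion>\<^bsub>P\<^esub>S) = \<Squnion>\<^bsub>W\<^esub>(?h ` S)" if "S \<subseteq> carrier P" for S
  proof (rule W.sup_eqI [symmetric])
    have S: "\<And>U. U \<in> S \<Longrightarrow> ideal U" using that by auto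
    have I: "ideal (\<Squnion>\<^bsub>P\<^esub>S)" using P.sup_closed [OF that] by simp
    show "?h ` S \<subseteq> carrier W" "?h (\<Squnion>\<^bsub>P\<^esub>S) \<in> carrier W"
      using h_closed S I by auto
    fix w assume w: "w \<in> carrier W"
    show "?h (\<Squnion>\<^bsub>P\<^esub>S) \<sqsubseteq>\<^bsub>W\<^esub> w \<longleftrightarrow> (\<forall>a\<in>?h ` S. a \<sqsubseteq>\<^bsub>W\<^esub> w)"
      using h_le [OF I w] h_le [OF S w] P_sup_le [OF S K [OF w]] by simp
  qed
  have h_mono: "?h U \<sqsubseteq>\<^bsub>W\<^esub> ?h V" if "ideal U" "ideal V" "U \<subseteq> V" for U V
    using h_le [OF that(1) h_closed [OF that(2)]] h_le [OF that(2) h_closed [OF that(2)]]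
      W.le_refl [OF h_closed [OF that(2)]] that(3) by (meson order_trans)
  have h_ge: "p x \<sqinter>\<^bsub>W\<^esub> q y \<sqsubseteq>\<^bsub>W\<^esub> ?h U" if "ideal U" "(x, y) \<in> U" for x y U
    using h_le [OF that(1) h_closed [OF that(1)]] W.le_refl [OF h_closed [OF that(1)]] that(2)
    by auto
  have h_meet: "?h (U \<sqinter>\<^bsub>P\<^esub> V) = ?h U \<sqinter>\<^bsub>W\<^esub> ?h V" if "U \<in> carrier P" "V \<in> carrier P" for U V
  proof (rule W.le_antisym)
    have U: "ideal U" and V: "ideal V" using that by auto
    have UV: "ideal (U \<inter> V)" using ideal_Int U V .
    show c: "?h (U \<sqinter>\<^bsub>P\<^esub> V) \<in> carrier W" "?h U \<sqinter>\<^bsub>W\<^esub> ?h V \<in> carrier W"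
      using U V UV h_closed by (auto simp: P_meet)
    show "?h (U \<sqinter>\<^bsub>P\<^esub> V) \<sqsubseteq>\<^bsub>W\<^esub> ?h U \<sqinter>\<^bsub>W\<^esub> ?h V"
      using U V UV h_closed h_mono by (auto simp: P_meet intro!: W.meet_le)
    have *: "(p x \<sqinter>\<^bsub>W\<^esub> q y) \<sqinter>\<^bsub>W\<^esub> (p x' \<sqinter>\<^bsub>W\<^esub> q y') \<sqsubseteq>\<^bsub>W\<^esub> ?h (U \<inter> V)"
      if "(x, y) \<in> U" "(x', y') \<in> V" for x y x' y'
    proof -
      have m: "x \<in> carrier X" "y \<in> carrier Y" "x' \<in> carrier X" "y' \<in> carrier Y"
        using that U V ideal_mem by auto
      have "(x \<sqinter>\<^bsub>X\<^esub> x', y \<sqinter>\<^bsub>Y\<^esub> y') \<in> U" "(x \<sqinter>\<^bsub>X\<^esub> x', y \<sqinter>\<^bsub>Y\<^esub> y') \<in> V"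
        using m that idealD(2) [OF U] idealD(2) [OF V]
        by (meson X.meet_closed X.meet_left X.meet_right
              Y.meet_closed Y.meet_left Y.meet_right)+
      then have "p (x \<sqinter>\<^bsub>X\<^esub> x') \<sqinter>\<^bsub>W\<^esub> q (y \<sqinter>\<^bsub>Y\<^esub> y') \<sqsubseteq>\<^bsub>W\<^esub> ?h (U \<inter> V)"
        using h_ge [OF UV] by auto
      moreover have "p (x \<sqinter>\<^bsub>X\<^esub> x') \<sqinter>\<^bsub>W\<^esub> q (y \<sqinter>\<^bsub>Y\<^esub> y') =
          (p x \<sqinter>\<^bsub>W\<^esub> q y) \<sqinter>\<^bsub>W\<^esub> (p x' \<sqinter>\<^bsub>W\<^esub> q y')"
      proof -
        have n: "p x \<in> carrier W" "q y \<in> carrier W" "p x' \<in> carrier W" "q y' \<in> carrier W"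
          using m pD(1) qD(1) by auto
        have "(p x \<sqinter>\<^bsub>W\<^esub> p x') \<sqinter>\<^bsub>W\<^esub> (q y \<sqinter>\<^bsub>W\<^esub> q y') = p x \<sqinter>\<^bsub>W\<^esub> ((p x' \<sqinter>\<^bsub>W\<^esub> q y) \<sqinter>\<^bsub>W\<^esub> q y')"
          using n by (simp add: W.meet_assoc)
        also have "\<dots> = p x \<sqinter>\<^bsub>W\<^esub> ((q y \<sqinter>\<^bsub>W\<^esub> p x') \<sqinter>\<^bsub>W\<^esub> q y')"
          by (simp add: meet_comm)
        also have "\<dots> = (p x \<sqinter>\<^bsub>W\<^esub> q y) \<sqinter>\<^bsub>W\<^esub> (p x' \<sqinter>\<^bsub>W\<^esub> q y')"
          using n by (simp add: W.meet_assoc)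
        finally show ?thesis using m pD(2) qD(2) by simp
      qed
      ultimately show ?thesis by simp
    qed
    have d: "?h (U \<inter> V) \<in> carrier W" using h_closed UV .
    have le1: "v \<sqinter>\<^bsub>W\<^esub> ?h V \<sqsubseteq>\<^bsub>W\<^esub> ?h (U \<inter> V)"
      if v: "v \<in> (\<lambda>(x, y). p x \<sqinter>\<^bsub>W\<^esub> q y) ` U" for v
      unfolding h_eq [OF V]
      using v gen [OF U] gen [OF V] d * ideal_mem [OF U] ideal_mem [OF V] pD(1) qD(1)
      by (subst W.meet_sup_distrib) (auto intro!: W.sup_least)
    have le2: "(p x \<sqinter>\<^bsub>W\<^esub> q y) \<sqinter>\<^bsub>W\<^esub> ?h V \<sqsubseteq>\<^bsub>W\<^esub> ?h (U \<inter> V)" if "(x, y) \<in> U" for x y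
      using le1 [OF imageI [OF that]] by simp
    have "?h V \<sqinter>\<^bsub>W\<^esub> ?h U \<sqsubseteq>\<^bsub>W\<^esub> ?h (U \<inter> V)"
      unfolding h_eq [OF U]
      using gen [OF U] h_closed [OF V] d
    proof (subst W.meet_sup_distrib, goal_cases)
      case 3
      show ?case
        by (rule W.sup_least) (use 3 le2 in \<open>auto simp: meet_comm [of W "?h V"]\<close>)
    qed auto
    then show "?h U \<sqinter>\<^bsub>W\<^esub> ?h V \<sqsubseteq>\<^bsub>W\<^esub> ?h (U \<sqinter>\<^bsub>P\<^esub> V)"
      using U V by (simp add: P_meet meet_comm)
  qed
  show "?h \<in> loc_map W P"
    unfolding loc_map_def
  proof (rule frame_homI)
    show "complete_lattice P" "complete_lattice W" by unfold_locales
    show "?h \<in> carrier P \<rightarrow>\<^sub>E carrier W"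
      using h_closed by (auto simp: pb_pair_def)
  qed (use h_meet h_sup h_top in auto)
  show "loc_comp X proj1 ?h = p"
    by (rule extensionalityI [of _ "carrier X"])
      (use pD qD(4) Y.top_in W.meet_top in
        \<open>auto simp: loc_comp_def compose_def pb_fst_def h_tensor\<close>)
  show "loc_comp Y proj2 ?h = q"
    by (rule extensionalityI [of _ "carrier Y"])
      (use qD pD(4) X.top_in W.meet_top in
        \<open>auto simp: loc_comp_def compose_def pb_snd_def h_tensor\<close>)
  fix h assume "h \<in> loc_map W P" and hp: "loc_comp X proj1 h = p" and hq: "loc_comp Y proj2 h = q"
  then have h: "h \<in> frame_hom P W" by (simp add: loc_map_def)
  note hD = frame_homD [OF h]
  have hp: "h (proj1 x) = p x" if "x \<in> carrier X" for x
    using fun_cong [OF hp, of x] that by (simp add: loc_comp_def compose_def)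
  have hq: "h (proj2 y) = q y" if "y \<in> carrier Y" for y
    using fun_cong [OF hq, of y] that by (simp add: loc_comp_def compose_def)
  have pr: "proj1 x \<in> carrier P" if "x \<in> carrier X" for x
    using that tensor_ideal Y.top_in by (simp add: pb_fst_def)
  have pr': "proj2 y \<in> carrier P" if "y \<in> carrier Y" for y
    using that tensor_ideal X.top_in by (simp add: pb_snd_def)
  show "h = ?h"
  proof (rule extensionalityI [of _ "carrier P"])
    show "h \<in> extensional (carrier P)" by (rule hD(5))
    show "?h \<in> extensional (carrier P)" by (simp add: pb_pair_def)
    fix U assume "U \<in> carrier P"
    then have U: "ideal U" by simp
    have "h U = h (\<Squnion>\<^bsub>P\<^esub>((\<lambda>(x, y). tensor x y) ` U))"
      by (simp add: ideal_eq_sup [OF U])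
    also have "\<dots> = \<Squnion>\<^bsub>W\<^esub>(h ` (\<lambda>(x, y). tensor x y) ` U)"
      by (rule hD(3)) (use ideal_mem [OF U] tensor_ideal in auto)
    also have "h ` (\<lambda>(x, y). tensor x y) ` U = (\<lambda>(x, y). p x \<sqinter>\<^bsub>W\<^esub> q y) ` U"
      unfolding image_image
      by (intro image_cong)
        (use ideal_mem [OF U] pr pr' hp hq hD(2) in \<open>auto simp: tensor_eq_meet simp del: P_simps\<close>)
    finally show "h U = ?h U" by (simp add: h_eq [OF U])
  qed
qed


section \<open>Localic groupoids and functors\<close>

text \<open>
  The fields \<open>gdom\<close>, \<open>gran\<close>, \<open>gunit\<close>, \<open>ginv\<close>, \<open>gmul\<close> are the structure maps \<open>d\<close>, \<open>r\<close>, \<open>u\<close>, \<open>i\<close>, \<open>m\<close>, represented by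
  their inverse images; the domain of \<open>m\<close> is the concrete pullback \<open>G2\<close>, with \<open>r \<circ> \<pi>\<^sub>1 = d \<circ> \<pi>\<^sub>2\<close>.
  Size: the type \<open>'a\<close> plays the role of the universe; the categories below consist of all
  objects with carriers in \<open>'a\<close>. Taking \<open>G0\<close> and \<open>G1\<close> over the same type is no restriction,
  because \<open>d \<circ> u = 1\<close> makes \<open>d\<^sup>*\<close> an embedding of \<open>G0\<close> into \<open>G1\<close>.
\<close>

record 'a loc_groupoid =
  G0 :: "'a gorder"
  G1 :: "'a gorder"
  gdom :: "'a \<Rightarrow> 'a"
  gran :: "'a \<Rightarrow> 'a"
  gunit :: "'a \<Rightarrow> 'a"
  ginv :: "'a \<Rightarrow> 'a"
  gmul :: "'a \<Rightarrow> ('a \<times> 'a) set"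

definition G2 :: "'a loc_groupoid \<Rightarrow> ('a \<times> 'a) set gorder" where
  "G2 G = pullback (G1 G) (G1 G) (G0 G) (gran G) (gdom G)"

definition gpi1 :: "'a loc_groupoid \<Rightarrow> 'a \<Rightarrow> ('a \<times> 'a) set" where
  "gpi1 G = pb_fst (G1 G) (G1 G) (G0 G) (gran G) (gdom G)"

definition gpi2 :: "'a loc_groupoid \<Rightarrow> 'a \<Rightarrow> ('a \<times> 'a) set" where
  "gpi2 G = pb_snd (G1 G) (G1 G) (G0 G) (gran G) (gdom G)"

definition gpair ::
  "'a loc_groupoid \<Rightarrow> ('w, 'h) gorder_scheme \<Rightarrow> ('a \<Rightarrow> 'w) \<Rightarrow> ('a \<Rightarrow> 'w) \<Rightarrow> ('a \<times> 'a) set \<Rightarrow> 'w" where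
  "gpair G W p q = pb_pair (G1 G) (G1 G) (G0 G) (gran G) (gdom G) W p q"

text \<open>
  Composable triples are formed as \<open>G\<^sub>2 \<times> G\<^sub>1\<close> over \<open>G\<^sub>0\<close> along \<open>r \<circ> \<pi>\<^sub>2\<close> and \<open>d\<close>, with projections
  \<open>gtri12\<close> to \<open>G\<^sub>2\<close> and \<open>gtri1\<close>, \<open>gtri2\<close>, \<open>gtri3\<close> to \<open>G\<^sub>1\<close>.
\<close>

definition G3 :: "'a loc_groupoid \<Rightarrow> (('a \<times> 'a) set \<times> 'a) set gorder" where
  "G3 G = pullback (G2 G) (G1 G) (G0 G) (loc_comp (G0 G) (gran G) (gpi2 G)) (gdom G)"

definition gtri12 :: "'a loc_groupoid \<Rightarrow> ('a \<times> 'a) set \<Rightarrow> (('a \<times> 'a) set \<times> 'a) set" where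
  "gtri12 G = pb_fst (G2 G) (G1 G) (G0 G) (loc_comp (G0 G) (gran G) (gpi2 G)) (gdom G)"

definition gtri1 :: "'a loc_groupoid \<Rightarrow> 'a \<Rightarrow> (('a \<times> 'a) set \<times> 'a) set" where
  "gtri1 G = loc_comp (G1 G) (gpi1 G) (gtri12 G)"

definition gtri2 :: "'a loc_groupoid \<Rightarrow> 'a \<Rightarrow> (('a \<times> 'a) set \<times> 'a) set" where
  "gtri2 G = loc_comp (G1 G) (gpi2 G) (gtri12 G)"

definition gtri3 :: "'a loc_groupoid \<Rightarrow> 'a \<Rightarrow> (('a \<times> 'a) set \<times> 'a) set" where
  "gtri3 G = pb_snd (G2 G) (G1 G) (G0 G) (loc_comp (G0 G) (gran G) (gpi2 G)) (gdom G)"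

locale localic_groupoid =
  fixes G :: "'a loc_groupoid"
  assumes frame_G0: "frame (G0 G)"
    and frame_G1: "frame (G1 G)"
    and gdom_map: "gdom G \<in> loc_map (G1 G) (G0 G)"
    and gran_map: "gran G \<in> loc_map (G1 G) (G0 G)"
    and gunit_map: "gunit G \<in> loc_map (G0 G) (G1 G)"
    and ginv_map: "ginv G \<in> loc_map (G1 G) (G1 G)"
    and gmul_map: "gmul G \<in> loc_map (G2 G) (G1 G)"
    and dom_unit: "loc_comp (G0 G) (gdom G) (gunit G) = loc_id (G0 G)"
    and ran_unit: "loc_comp (G0 G) (gran G) (gunit G) = loc_id (G0 G)"
    and dom_mul: "loc_comp (G0 G) (gdom G) (gmul G) = loc_comp (G0 G) (gdom G) (gpi1 G)"
    and ran_mul: "loc_comp (G0 G) (gran G) (gmul G) = loc_comp (G0 G) (gran G) (gpi2 G)"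
    and mul_assoc:
      "loc_comp (G1 G) (gmul G)
         (gpair G (G3 G) (loc_comp (G1 G) (gmul G) (gtri12 G)) (gtri3 G)) =
       loc_comp (G1 G) (gmul G)
         (gpair G (G3 G) (gtri1 G)
            (loc_comp (G1 G) (gmul G) (gpair G (G3 G) (gtri2 G) (gtri3 G))))"
    and unit_mul:
      "loc_comp (G1 G) (gmul G)
         (gpair G (G1 G) (loc_comp (G1 G) (gunit G) (gdom G)) (loc_id (G1 G))) = loc_id (G1 G)"
    and mul_unit:
      "loc_comp (G1 G) (gmul G)
         (gpair G (G1 G) (loc_id (G1 G)) (loc_comp (G1 G) (gunit G) (gran G))) = loc_id (G1 G)"
    and dom_inv: "loc_comp (G0 G) (gdom G) (ginv G) = gran G"
    and ran_inv: "loc_comp (G0 G) (gran G) (ginv G) = gdom G"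
    and mul_inv:
      "loc_comp (G1 G) (gmul G) (gpair G (G1 G) (loc_id (G1 G)) (ginv G)) =
       loc_comp (G1 G) (gunit G) (gdom G)"
    and inv_mul:
      "loc_comp (G1 G) (gmul G) (gpair G (G1 G) (ginv G) (loc_id (G1 G))) =
       loc_comp (G1 G) (gunit G) (gran G)"

locale etale_groupoid = localic_groupoid G for G :: "'a loc_groupoid" +
  assumes gdom_local_homeo: "local_homeomorphism (G1 G) (G0 G) (gdom G)"

text \<open>An internal functor \<open>f = (f\<^sub>0, f\<^sub>1)\<close>; it automatically commutes with inversion.\<close>

definition groupoid_functor ::
  "'a loc_groupoid \<Rightarrow> 'a loc_groupoid \<Rightarrow> (('a \<Rightarrow> 'a) \<times> ('a \<Rightarrow> 'a)) set" where
  "groupoid_functor G H =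
     {(f0, f1).
        f0 \<in> loc_map (G0 G) (G0 H) \<and>
        f1 \<in> loc_map (G1 G) (G1 H) \<and>
        loc_comp (G0 H) (gdom H) f1 = loc_comp (G0 H) f0 (gdom G) \<and>
        loc_comp (G0 H) (gran H) f1 = loc_comp (G0 H) f0 (gran G) \<and>
        loc_comp (G1 H) f1 (gunit G) = loc_comp (G1 H) (gunit H) f0 \<and>
        loc_comp (G1 H) f1 (gmul G) =
          loc_comp (G1 H) (gmul H)
            (gpair H (G2 G) (loc_comp (G1 H) f1 (gpi1 G)) (loc_comp (G1 H) f1 (gpi2 G)))}"

definition Gpd :: "('a loc_groupoid, ('a \<Rightarrow> 'a) \<times> ('a \<Rightarrow> 'a)) category" where
  "Gpd =
     \<lparr>Obj = {G. etale_groupoid G},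
      Hom = groupoid_functor,
      Ident = (\<lambda>G. (loc_id (G0 G), loc_id (G1 G))),
      Comp = (\<lambda>G H K (g0, g1) (f0, f1). (loc_comp (G0 K) g0 f0, loc_comp (G1 K) g1 f1))\<rparr>"


section \<open>Unital involutive quantales and inverse quantal frames\<close>

record 'a inv_quantale = "'a gorder" +
  qmul :: "'a \<Rightarrow> 'a \<Rightarrow> 'a" (infixl \<open>\<cdot>\<index>\<close> 75)
  qunit :: "'a" (\<open>\<epsilon>\<index>\<close>)
  qinv :: "'a \<Rightarrow> 'a" (\<open>\<iota>\<index> _\<close> [90] 90)

locale unital_involutive_quantale = complete_lattice Q
  for Q :: "('a, 'b) inv_quantale_scheme" (structure) +
  assumes mul_closed: "\<lbrakk>a \<in> carrier Q; b \<in> carrier Q\<rbrakk> \<Longrightarrow> a \<cdot> b \<in> carrier Q"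
    and unit_closed: "\<epsilon> \<in> carrier Q"
    and inv_closed: "a \<in> carrier Q \<Longrightarrow> \<iota> a \<in> carrier Q"
    and mul_assoc:
      "\<lbrakk>a \<in> carrier Q; b \<in> carrier Q; c \<in> carrier Q\<rbrakk> \<Longrightarrow> (a \<cdot> b) \<cdot> c = a \<cdot> (b \<cdot> c)"
    and unit_mul: "a \<in> carrier Q \<Longrightarrow> \<epsilon> \<cdot> a = a"
    and mul_unit: "a \<in> carrier Q \<Longrightarrow> a \<cdot> \<epsilon> = a"
    and sup_mul:
      "\<lbrakk>A \<subseteq> carrier Q; b \<in> carrier Q\<rbrakk> \<Longrightarrow> \<Squnion>A \<cdot> b = \<Squnion>((\<lambda>a. a \<cdot> b) ` A)"
    and mul_sup:
      "\<lbrakk>a \<in> carrier Q; B \<subseteq> carrier Q\<rbrakk> \<Longrightarrow> a \<cdot> \<Squnion>B = \<Squnion>((\<lambda>b. a \<cdot> b) ` B)"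
    and inv_inv: "a \<in> carrier Q \<Longrightarrow> \<iota> (\<iota> a) = a"
    and inv_mul: "\<lbrakk>a \<in> carrier Q; b \<in> carrier Q\<rbrakk> \<Longrightarrow> \<iota> (a \<cdot> b) = \<iota> b \<cdot> \<iota> a"
    and inv_sup: "A \<subseteq> carrier Q \<Longrightarrow> \<iota> (\<Squnion>A) = \<Squnion>((\<lambda>a. \<iota> a) ` A)"

definition partial_units :: "('a, 'b) inv_quantale_scheme \<Rightarrow> 'a set" where
  "partial_units Q =
     {s \<in> carrier Q. (s \<cdot>\<^bsub>Q\<^esub> \<iota>\<^bsub>Q\<^esub> s) \<squnion>\<^bsub>Q\<^esub> (\<iota>\<^bsub>Q\<^esub> s \<cdot>\<^bsub>Q\<^esub> s) \<sqsubseteq>\<^bsub>Q\<^esub> \<epsilon>\<^bsub>Q\<^esub>}"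

locale inverse_quantal_frame = unital_involutive_quantale Q + frame Q
  for Q :: "('a, 'b) inv_quantale_scheme" (structure) +
  assumes support_eq: "a \<in> carrier Q \<Longrightarrow> (a \<cdot> \<top>) \<sqinter> \<epsilon> = (a \<cdot> \<iota> a) \<sqinter> \<epsilon>"
    and support_mul: "a \<in> carrier Q \<Longrightarrow> ((a \<cdot> \<top>) \<sqinter> \<epsilon>) \<cdot> a = a"
    and sup_partial_units: "\<Squnion>(partial_units Q) = \<top>"

definition quantale_hom ::
  "('a, 'c) inv_quantale_scheme \<Rightarrow> ('b, 'd) inv_quantale_scheme \<Rightarrow> ('a \<Rightarrow> 'b) set" where
  "quantale_hom Q R =
     {h \<in> carrier Q \<rightarrow>\<^sub>E carrier R.
        sup_pres Q R h \<and>
        (\<forall>a\<in>carrier Q. \<forall>b\<in>carrier Q. h (a \<cdot>\<^bsub>Q\<^esub> b) = h a \<cdot>\<^bsub>R\<^esub> h b) \<and>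
        (\<forall>a\<in>carrier Q. h (\<iota>\<^bsub>Q\<^esub> a) = \<iota>\<^bsub>R\<^esub> (h a)) \<and>
        h \<epsilon>\<^bsub>Q\<^esub> = \<epsilon>\<^bsub>R\<^esub>}"

definition IQFrm :: "('a inv_quantale, 'a \<Rightarrow> 'a) category" where
  "IQFrm =
     \<lparr>Obj = {Q. inverse_quantal_frame Q},
      Hom = (\<lambda>Q R. {h \<in> quantale_hom Q R. meet_pres Q R h \<and> h \<top>\<^bsub>Q\<^esub> = \<top>\<^bsub>R\<^esub>}),
      Ident = (\<lambda>Q. \<lambda>a\<in>carrier Q. a),
      Comp = (\<lambda>Q R S k h. compose (carrier Q) k h)\<rparr>"

definition IQLoc :: "('a inv_quantale, 'a \<Rightarrow> 'a) category" where
  "IQLoc = op_category IQFrm"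


section \<open>The quantale of an etale groupoid and covering functors\<close>

definition groupoid_quantale :: "'a loc_groupoid \<Rightarrow> 'a inv_quantale" where
  "groupoid_quantale G =
     \<lparr>carrier = carrier (G1 G), eq = eq (G1 G), le = le (G1 G),
      qmul = (\<lambda>a b. direct_image (G2 G) (G1 G) (gmul G) (gpi1 G a \<sqinter>\<^bsub>G2 G\<^esub> gpi2 G b)),
      qunit = direct_image (G0 G) (G1 G) (gunit G) \<top>\<^bsub>G0 G\<^esub>,
      qinv = direct_image (G1 G) (G1 G) (ginv G)\<rparr>"

definition covering_functor ::
  "'a loc_groupoid \<Rightarrow> 'a loc_groupoid \<Rightarrow> (('a \<Rightarrow> 'a) \<times> ('a \<Rightarrow> 'a)) set" where
  "covering_functor G H =
     {(f0, f1) \<in> groupoid_functor G H.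
        f1 \<in> quantale_hom (groupoid_quantale H) (groupoid_quantale G)}"

definition Gpd_C :: "('a loc_groupoid, ('a \<Rightarrow> 'a) \<times> ('a \<Rightarrow> 'a)) category" where
  "Gpd_C = Gpd\<lparr>Hom := covering_functor\<rparr>"

end

theory Submission
  imports Defs
begin


text \<open>
  An etale groupoid \<open>G\<close> and its quantale \<open>\<O>(G)\<close> share the frame \<open>G\<^sub>1\<close>, and the two multiplications
  determine each other through \<open>a b \<le> w \<longleftrightarrow> a \<otimes> b \<le> m\<^sup>* w\<close>. In this form associativity of the
  groupoid and of the quantale become equivalent: in \<open>G\<^sub>3\<close> the two sides of the law send \<open>w\<close> to the
  join of the \<open>a \<otimes> b \<otimes> c\<close> with \<open>(a b) c \<le> w\<close>, respectively \<open>a (b c) \<le> w\<close>.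

  Conversely, an inverse quantal frame \<open>Q\<close> gives a groupoid with \<open>G\<^sub>1 = Q\<close>, \<open>G\<^sub>0 = \<down>e\<close>, \<open>d\<^sup>* b = b 1\<close>,
  \<open>r\<^sup>* b = 1 b\<close>, \<open>u\<^sup>* a = a \<and> e\<close>, \<open>i\<^sup>*\<close> the involution and \<open>m\<^sup>* w = {(x, y). x y \<le> w}\<close>. That \<open>m\<^sup>*\<close> preserves
  joins is checked on partial units \<open>t\<close>, for which \<open>t \<otimes> q = t \<otimes> t\<^sup>* t q\<close>; the same argument shows
  that quantale homomorphisms give functors. Both constructions preserve the frame of arrows, and
  a functor is determined by its arrow part because \<open>d \<circ> u = 1\<close>, so all the required
  isomorphisms are identities on arrows.
\<close>

section \<open>Maps of locales and pullbacks\<close>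

text \<open>Joins in the concrete pullbacks are generated, not given by unions. An inequality out of
  an element of \<open>G2\<close> or \<open>G3\<close> is therefore tested on pure tensors against
  an arbitrary ideal, and much of the work is to recognise an explicit set of pairs as an ideal.
  From groupoids to quantales the obstacle is that only d is assumed to be a local homeomorphism,
  while the product and e are made from m_! and u_!. These are definite descriptions, so left
  adjoints of m^* and u^* have to be constructed first. From quantales to groupoids the laws concern
  generated joins, whereas axioms (1) and (2) concern supports. The bridge is b 1 \<and> a = b a for
  b \<le> e: it turns meets with d^* b into products and makes the support left adjoint to d^*. The
  round trips give isomorphisms rather than equalities: G_0 is replaced by the down-set of e, and
  the operations of a quantale record are arbitrary outside its carrier.\<close>

lemma (in complete_lattice) sup_le_iff:
  assumes "A \<subseteq> carrier L" "w \<in> carrier L"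
  shows "\<Squnion>A \<sqsubseteq> w \<longleftrightarrow> (\<forall>a\<in>A. a \<sqsubseteq> w)"
  using assms sup_upper [OF assms(1)] sup_least [OF assms(1), of w] le_trans
  by (meson in_mono sup_closed)

lemma (in complete_lattice) le_meet_iff:
  assumes "x \<in> carrier L" "y \<in> carrier L" "z \<in> carrier L"
  shows "z \<sqsubseteq> x \<sqinter> y \<longleftrightarrow> z \<sqsubseteq> x \<and> z \<sqsubseteq> y"
  using assms by (meson le_trans meet_closed meet_le meet_left meet_right)

lemma (in complete_lattice) meet_leI1:
  "\<lbrakk>x \<sqsubseteq> w; x \<in> carrier L; y \<in> carrier L; w \<in> carrier L\<rbrakk> \<Longrightarrow> x \<sqinter> y \<sqsubseteq> w"
  by (meson le_trans meet_closed meet_left)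

lemma (in complete_lattice) meet_leI2:
  "\<lbrakk>y \<sqsubseteq> w; x \<in> carrier L; y \<in> carrier L; w \<in> carrier L\<rbrakk> \<Longrightarrow> x \<sqinter> y \<sqsubseteq> w"
  by (meson le_trans meet_closed meet_right)

lemma (in complete_lattice) eq_by_upper:
  assumes "x \<in> carrier L" "y \<in> carrier L"
    and "\<And>w. w \<in> carrier L \<Longrightarrow> x \<sqsubseteq> w \<longleftrightarrow> y \<sqsubseteq> w"
  shows "x = y"
  using assms by (meson le_antisym le_refl)

lemma (in complete_lattice) meet_idem: "x \<in> carrier L \<Longrightarrow> x \<sqinter> x = x"
  using le_iff_meet_eq by blast

lemma (in frame) sup_meet_distrib:
  "\<lbrakk>x \<in> carrier L; A \<subseteq> carrier L\<rbrakk> \<Longrightarrow> \<Squnion>A \<sqinter> x = \<Squnion>((\<lambda>a. a \<sqinter> x) ` A)"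
  using meet_sup_distrib [of x A] by (simp add: meet_comm [of L _ x])

lemma (in frame) cover_meet:
  assumes "x \<in> carrier L" "A \<subseteq> carrier L" "\<Squnion>A = \<top>"
  shows "x = \<Squnion>((\<lambda>a. x \<sqinter> a) ` A)"
  using assms meet_sup_distrib [of x A] by (simp add: meet_top)

lemma frame_hom_complete:
  assumes "f \<in> frame_hom L M" shows "complete_lattice L" "complete_lattice M"
  using assms by (auto simp: frame_hom_def sup_pres_def)

lemma frame_hom_mono:
  assumes f: "f \<in> frame_hom L M" and "x \<in> carrier L" "y \<in> carrier L" "x \<sqsubseteq>\<^bsub>L\<^esub> y"
  shows "f x \<sqsubseteq>\<^bsub>M\<^esub> f y"
  using assms frame_homD(1,2) [OF f]
  by (metis complete_lattice.le_iff_meet_eq frame_hom_complete)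

lemmas loc_mapD = frame_homD [where L = Y and M = X and f = f for X Y f, folded loc_map_def]
lemmas loc_map_mono = frame_hom_mono [where L = Y and M = X and f = f for X Y f, folded loc_map_def]
lemmas loc_mapI = frame_homI [where L = Y and M = X and f = f for X Y f, folded loc_map_def]

lemma loc_map_ext:
  assumes "f \<in> loc_map X Y" "g \<in> loc_map X Y" "\<And>y. y \<in> carrier Y \<Longrightarrow> f y = g y"
  shows "f = g"
  using assms loc_mapD(5) by (metis extensionalityI)

lemma loc_comp_apply [simp]: "z \<in> carrier Z \<Longrightarrow> loc_comp Z g f z = f (g z)"
  by (simp add: loc_comp_def compose_def)

lemma loc_id_apply [simp]: "x \<in> carrier X \<Longrightarrow> loc_id X x = x"
  by (simp add: loc_id_def)

lemma loc_id_map: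
  assumes "complete_lattice X" shows "loc_id X \<in> loc_map X X"
proof -
  interpret X: complete_lattice X by (rule assms)
  show ?thesis
  proof (rule loc_mapI)
    fix A assume A: "A \<subseteq> carrier X"
    then have "loc_id X ` A = A" by (auto simp: subset_eq image_iff)
    with A show "loc_id X (\<Squnion>\<^bsub>X\<^esub>A) = \<Squnion>\<^bsub>X\<^esub>(loc_id X ` A)" by simp
  qed (use assms X.top_in in \<open>auto simp: loc_id_def\<close>)
qed

lemma loc_comp_map:
  assumes f: "f \<in> loc_map X Y" and g: "g \<in> loc_map Y Z"
  shows "loc_comp Z g f \<in> loc_map X Z"
proof (rule loc_mapI)
  note fD = loc_mapD [OF f] and gD = loc_mapD [OF g]
  show Z: "complete_lattice Z" and "complete_lattice X"
    using frame_hom_complete f g by (auto simp: loc_map_def)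
  interpret Z: complete_lattice Z by (rule Z)
  show "loc_comp Z g f \<in> carrier Z \<rightarrow>\<^sub>E carrier X"
    using fD(1) gD(1) by (auto simp: loc_comp_def compose_def)
  show "loc_comp Z g f (x \<sqinter>\<^bsub>Z\<^esub> y) = loc_comp Z g f x \<sqinter>\<^bsub>X\<^esub> loc_comp Z g f y"
    if "x \<in> carrier Z" "y \<in> carrier Z" for x y
    using that fD(1,2) gD(1,2) by simp
  show "loc_comp Z g f \<top>\<^bsub>Z\<^esub> = \<top>\<^bsub>X\<^esub>"
    using fD(4) gD(4) Z.top_in by simp
  fix A assume A: "A \<subseteq> carrier Z"
  then have "g ` A \<subseteq> carrier Y" using gD(1) by auto
  with A have "f (g (\<Squnion>\<^bsub>Z\<^esub>A)) = \<Squnion>\<^bsub>X\<^esub>((\<lambda>z. f (g z)) ` A)"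
    using fD(3) gD(3) by (simp add: image_image)
  also have "(\<lambda>z. f (g z)) ` A = loc_comp Z g f ` A"
    using A by (intro image_cong) auto
  finally show "loc_comp Z g f (\<Squnion>\<^bsub>Z\<^esub>A) = \<Squnion>\<^bsub>X\<^esub>(loc_comp Z g f ` A)"
    using A by simp
qed

lemma loc_comp_extensional [simp]: "loc_comp Z g f \<in> extensional (carrier Z)"
  by (simp add: loc_comp_def)

lemma loc_comp_eqI:
  assumes "\<And>z. z \<in> carrier Z \<Longrightarrow> f (g z) = f' (g' z)"
  shows "loc_comp Z g f = loc_comp Z g' f'"
  by (rule extensionalityI [of _ "carrier Z"]) (use assms in auto)

lemma loc_comp_eqD:
  assumes "loc_comp Z g f = loc_comp Z g' f'" "z \<in> carrier Z"
  shows "f (g z) = f' (g' z)"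
  using fun_cong [OF assms(1), of z] assms(2) by simp

lemma loc_comp_assoc:
  assumes "h \<in> loc_map Y Z"
  shows "loc_comp Z h (loc_comp Y g f) = loc_comp Z (loc_comp Z h g) f"
  using loc_mapD(1) [OF assms] by (intro loc_comp_eqI) simp

lemma loc_comp_id:
  assumes f: "f \<in> loc_map X Y"
  shows "loc_comp Y f (loc_id X) = f" "loc_comp Y (loc_id Y) f = f"
  using loc_mapD(1,5) [OF f] by (auto intro: extensionalityI [of _ "carrier Y"])

section \<open>Left adjoints of inverse images\<close>

lemma left_adjointD:
  assumes "left_adjoint X Y f h"
  shows "x \<in> carrier X \<Longrightarrow> h x \<in> carrier Y"
    and "\<lbrakk>x \<in> carrier X; y \<in> carrier Y\<rbrakk> \<Longrightarrow> h x \<sqsubseteq>\<^bsub>Y\<^esub> y \<longleftrightarrow> x \<sqsubseteq>\<^bsub>X\<^esub> f y"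
  using assms by (auto simp: left_adjoint_def)

lemma left_adjoint_unit:
  assumes h: "left_adjoint X Y f h" and f: "f \<in> loc_map X Y"
  shows "x \<in> carrier X \<Longrightarrow> x \<sqsubseteq>\<^bsub>X\<^esub> f (h x)"
    and "y \<in> carrier Y \<Longrightarrow> h (f y) \<sqsubseteq>\<^bsub>Y\<^esub> y"
    and "\<lbrakk>x \<in> carrier X; x' \<in> carrier X; x \<sqsubseteq>\<^bsub>X\<^esub> x'\<rbrakk> \<Longrightarrow> h x \<sqsubseteq>\<^bsub>Y\<^esub> h x'"
    and "A \<subseteq> carrier X \<Longrightarrow> h (\<Squnion>\<^bsub>X\<^esub>A) = \<Squnion>\<^bsub>Y\<^esub>(h ` A)"
proof -
  interpret X: complete_lattice X using f frame_hom_complete by (auto simp: loc_map_def)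
  interpret Y: complete_lattice Y using f frame_hom_complete by (auto simp: loc_map_def)
  note hD = left_adjointD [OF h] and fD = loc_mapD [OF f]
  show unit: "x \<sqsubseteq>\<^bsub>X\<^esub> f (h x)" if "x \<in> carrier X" for x
    using that hD(1) hD(2) [of x "h x"] by simp
  show "h (f y) \<sqsubseteq>\<^bsub>Y\<^esub> y" if "y \<in> carrier Y"
    using that hD(2) [of "f y" y] fD(1) by simp
  show "h x \<sqsubseteq>\<^bsub>Y\<^esub> h x'" if "x \<in> carrier X" "x' \<in> carrier X" "x \<sqsubseteq>\<^bsub>X\<^esub> x'"
    using that hD unit X.le_trans [of x x' "f (h x')"] fD(1) by auto
  show "h (\<Squnion>\<^bsub>X\<^esub>A) = \<Squnion>\<^bsub>Y\<^esub>(h ` A)" if A: "A \<subseteq> carrier X"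
  proof (rule Y.sup_eqI [symmetric])
    show "h ` A \<subseteq> carrier Y" "h (\<Squnion>\<^bsub>X\<^esub>A) \<in> carrier Y" using A hD(1) by auto
    show "h (\<Squnion>\<^bsub>X\<^esub>A) \<sqsubseteq>\<^bsub>Y\<^esub> w \<longleftrightarrow> (\<forall>a\<in>h ` A. a \<sqsubseteq>\<^bsub>Y\<^esub> w)" if "w \<in> carrier Y" for w
      using A that hD(2) fD(1) by (auto simp: X.sup_le_iff subset_eq)
  qed
qed

lemma left_adjoint_direct_image:
  assumes "f \<in> loc_map X Y" "\<exists>h. left_adjoint X Y f h"
  shows "left_adjoint X Y f (direct_image X Y f)"
proof -
  have "complete_lattice X" "complete_lattice Y"
    using assms(1) frame_hom_complete by (auto simp: loc_map_def)
  with assms(2) show ?thesis by (metis direct_image_eq)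
qed

lemma left_adjointI:
  assumes "\<And>x. x \<in> carrier X \<Longrightarrow> h x \<in> carrier Y"
    and "\<And>x y. \<lbrakk>x \<in> carrier X; y \<in> carrier Y\<rbrakk> \<Longrightarrow> h x \<sqsubseteq>\<^bsub>Y\<^esub> y \<longleftrightarrow> x \<sqsubseteq>\<^bsub>X\<^esub> f y"
  shows "left_adjoint X Y f (\<lambda>x\<in>carrier X. h x)"
  using assms by (auto simp: left_adjoint_def)

text \<open>The candidate is cut off outside the carrier because \<open>left_adjoint\<close> demands
  an extensional map; this is what makes the definite description unique.\<close>

lemma direct_image_apply:
  assumes "f \<in> loc_map X Y"
    and "\<And>x. x \<in> carrier X \<Longrightarrow> h x \<in> carrier Y"
    and "\<And>x y. \<lbrakk>x \<in> carrier X; y \<in> carrier Y\<rbrakk> \<Longrightarrow> h x \<sqsubseteq>\<^bsub>Y\<^esub> y \<longleftrightarrow> x \<sqsubseteq>\<^bsub>X\<^esub> f y"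
    and "x \<in> carrier X"
  shows "direct_image X Y f x = h x"
proof -
  have "complete_lattice X" "complete_lattice Y"
    using assms(1) frame_hom_complete by (auto simp: loc_map_def)
  then have "direct_image X Y f = (\<lambda>x\<in>carrier X. h x)"
    using left_adjointI [of X h Y f] assms(2,3) direct_image_eq by blast
  then show ?thesis using assms(4) by simp
qed

section \<open>Pure tensors, pairings, and the pullback of an open map\<close>

context loc_cospan
begin

lemma mem_tensor_mono:
  assumes "ideal U" "(a, b) \<in> U" "x \<in> carrier X" "y \<in> carrier Y" "x \<sqsubseteq>\<^bsub>X\<^esub> a" "y \<sqsubseteq>\<^bsub>Y\<^esub> b"
  shows "(x, y) \<in> U"
  using assms idealD(2) by blast

lemma proj1_apply: "x \<in> carrier X \<Longrightarrow> proj1 x = tensor x \<top>\<^bsub>Y\<^esub>"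
  by (simp add: pb_fst_def)

lemma proj2_apply: "y \<in> carrier Y \<Longrightarrow> proj2 y = tensor \<top>\<^bsub>X\<^esub> y"
  by (simp add: pb_snd_def)

text \<open>Although (x, y) is an arbitrary element of a generated ideal, \<open>?R\<close> is an
  ideal by \<open>ideal_residual\<close>, so only its membership of the generator (a, b) has to be
  checked. Evaluating the inclusion at (x, y) itself removes the meets by idempotence.\<close>

lemma mem_tensor_meet:
  assumes T: "ideal T" and c: "x \<in> carrier X" "y \<in> carrier Y" "a \<in> carrier X" "b \<in> carrier Y"
    and xy: "(x, y) \<in> tensor a b" and ab: "(x \<sqinter>\<^bsub>X\<^esub> a, y \<sqinter>\<^bsub>Y\<^esub> b) \<in> T"
  shows "(x, y) \<in> T"
proof -
  let ?R = "{(p, q). p \<in> carrier X \<and> q \<in> carrier Y \<and> (p \<sqinter>\<^bsub>X\<^esub> x, q \<sqinter>\<^bsub>Y\<^esub> y) \<in> T}"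
  have "(a, b) \<in> ?R" using ab c by (simp add: meet_comm)
  then have "tensor a b \<subseteq> ?R" using tensor_le ideal_residual [OF T] c by blast
  with xy have "(x \<sqinter>\<^bsub>X\<^esub> x, y \<sqinter>\<^bsub>Y\<^esub> y) \<in> T" by auto
  then show ?thesis using c by (simp add: X.meet_idem Y.meet_idem)
qed

lemma pair_apply:
  "ideal U \<Longrightarrow> pb_pair X Y Z f g W p q U = \<Squnion>\<^bsub>W\<^esub>((\<lambda>(x, y). p x \<sqinter>\<^bsub>W\<^esub> q y) ` U)"
  by (simp add: pb_pair_def)

context
  fixes W :: "('w, 'h) gorder_scheme" and p q
  assumes W: "frame W" and p: "p \<in> loc_map W X" and q: "q \<in> loc_map W Y"
    and pq: "\<And>z. z \<in> carrier Z \<Longrightarrow> p (f z) = q (g z)"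
begin

lemma pair_commute: "loc_comp Z f p = loc_comp Z g q"
  using pq by (rule loc_comp_eqI)

lemmas pair_universal = pullback_universal
  [OF X.frame_axioms Y.frame_axioms Z.frame_axioms f_map g_map W p q pair_commute]

lemma pair_map: "pb_pair X Y Z f g W p q \<in> loc_map W P"
  by (rule pair_universal(1))

lemma pair_proj:
  shows "x \<in> carrier X \<Longrightarrow> pb_pair X Y Z f g W p q (proj1 x) = p x"
    and "y \<in> carrier Y \<Longrightarrow> pb_pair X Y Z f g W p q (proj2 y) = q y"
  using pair_universal(2,3) by (metis loc_comp_apply)+

lemma pair_unique:
  assumes h: "h \<in> loc_map W P" and "\<And>x. x \<in> carrier X \<Longrightarrow> h (proj1 x) = p x"
    and "\<And>y. y \<in> carrier Y \<Longrightarrow> h (proj2 y) = q y"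
  shows "h = pb_pair X Y Z f g W p q"
proof (rule pair_universal(4) [OF h])
  show "loc_comp X proj1 h = p"
    by (rule extensionalityI [of _ "carrier X"]) (use assms(2) loc_mapD(5) [OF p] in auto)
  show "loc_comp Y proj2 h = q"
    by (rule extensionalityI [of _ "carrier Y"]) (use assms(3) loc_mapD(5) [OF q] in auto)
qed

lemma pair_comp:
  assumes V: "frame V" and k: "k \<in> loc_map V W"
  shows "loc_comp P (pb_pair X Y Z f g W p q) k =
    pb_pair X Y Z f g V (loc_comp X p k) (loc_comp Y q k)"
proof -
  note U = pullback_universal
    [OF X.frame_axioms Y.frame_axioms Z.frame_axioms f_map g_map V
      loc_comp_map [OF k p] loc_comp_map [OF k q]]
  show ?thesis
  proof (rule U(4))
    show "loc_comp Z f (loc_comp X p k) = loc_comp Z g (loc_comp Y q k)"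
      using pq by (intro loc_comp_eqI) simp
    show "loc_comp P (pb_pair X Y Z f g W p q) k \<in> loc_map V P"
      by (rule loc_comp_map [OF k pair_map])
    show "loc_comp X proj1 (loc_comp P (pb_pair X Y Z f g W p q) k) = loc_comp X p k"
      using pair_proj loc_mapD(1) [OF proj1_map] by (intro loc_comp_eqI) simp
    show "loc_comp Y proj2 (loc_comp P (pb_pair X Y Z f g W p q) k) = loc_comp Y q k"
      using pair_proj loc_mapD(1) [OF proj2_map] by (intro loc_comp_eqI) simp
  qed
qed

end

lemma proj_balance: "z \<in> carrier Z \<Longrightarrow> proj1 (f z) = proj2 (g z)"
  using proj_commute by (rule loc_comp_eqD)

lemma pair_self: "ideal U \<Longrightarrow> pb_pair X Y Z f g P proj1 proj2 U = U"
proof -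
  have "loc_id P = pb_pair X Y Z f g P proj1 proj2"
    using loc_mapD(1) [OF proj1_map] loc_mapD(1) [OF proj2_map]
    by (intro pair_unique P_frame proj1_map proj2_map loc_id_map P_complete proj_balance) auto
  then show "ideal U \<Longrightarrow> ?thesis" by (metis P_simps(1) loc_id_apply mem_Collect_eq)
qed

text \<open>This makes the generated ideal 1 \<otimes> w explicit when f is open. If g^*(f_! x)
  \<and> y \<le> w, balancing moves g^*(f_! x) to the left factor as f^*(f_! x), which is absorbed
  because x lies below it. Conversely \<open>?J\<close> is an ideal containing (1, w); the Frobenius
  law is exactly what makes \<open>?J\<close> balanced.\<close>

lemma mem_proj2_iff:
  assumes h: "left_adjoint X Z f h"
    and frob: "\<And>x z. \<lbrakk>x \<in> carrier X; z \<in> carrier Z\<rbrakk> \<Longrightarrow> h (x \<sqinter>\<^bsub>X\<^esub> f z) = h x \<sqinter>\<^bsub>Z\<^esub> z"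
    and c: "x \<in> carrier X" "y \<in> carrier Y" "w \<in> carrier Y"
  shows "(x, y) \<in> proj2 w \<longleftrightarrow> g (h x) \<sqinter>\<^bsub>Y\<^esub> y \<sqsubseteq>\<^bsub>Y\<^esub> w"
proof
  note hD = left_adjointD [OF h] left_adjoint_unit [OF h f_map]
  note gD = loc_mapD [OF g_map] loc_map_mono [OF g_map]
  have I: "ideal (tensor \<top>\<^bsub>X\<^esub> w)" using c X.top_in tensor_ideal by simp
  show "(x, y) \<in> proj2 w" if "g (h x) \<sqinter>\<^bsub>Y\<^esub> y \<sqsubseteq>\<^bsub>Y\<^esub> w"
  proof -
    have "(x, g (h x) \<sqinter>\<^bsub>Y\<^esub> y) \<in> tensor \<top>\<^bsub>X\<^esub> w"
      using idealD(2) [OF I _ _ tensor_self [OF X.top_in c(3)]] that c hD X.le_top by simp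
    then have "(x \<sqinter>\<^bsub>X\<^esub> f (h x), y) \<in> tensor \<top>\<^bsub>X\<^esub> w"
      using idealD(5) [OF I] c hD(1) by simp
    moreover have "x \<sqinter>\<^bsub>X\<^esub> f (h x) = x"
      using c hD(1,3) X.le_iff_meet_eq by simp
    ultimately show ?thesis using c by (simp add: proj2_apply)
  qed
  show "g (h x) \<sqinter>\<^bsub>Y\<^esub> y \<sqsubseteq>\<^bsub>Y\<^esub> w" if xy: "(x, y) \<in> proj2 w"
  proof -
    let ?J = "{(x, y). x \<in> carrier X \<and> y \<in> carrier Y \<and> g (h x) \<sqinter>\<^bsub>Y\<^esub> y \<sqsubseteq>\<^bsub>Y\<^esub> w}"
    have "ideal ?J"
    proof (rule idealI, goal_cases)
      case 1 show ?case by auto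
    next
      case (2 x y a b)
      then have "g (h x) \<sqinter>\<^bsub>Y\<^esub> y \<sqsubseteq>\<^bsub>Y\<^esub> g (h a) \<sqinter>\<^bsub>Y\<^esub> b"
        using hD gD by (intro Y.meet_mono) auto
      with 2 show ?case
        using hD(1) c Y.le_trans [of "g (h x) \<sqinter>\<^bsub>Y\<^esub> y" "g (h a) \<sqinter>\<^bsub>Y\<^esub> b" w] by simp
    next
      case (3 A y)
      then have A: "h ` A \<subseteq> carrier Z" "g ` h ` A \<subseteq> carrier Y" using hD(1) by auto
      show ?case
        using 3 A c hD(1,6) gD(3) by (auto simp: Y.sup_meet_distrib intro!: Y.sup_least)
    next
      case (4 x B)
      then show ?case
        using c hD(1) by (auto simp: Y.meet_sup_distrib subset_eq intro!: Y.sup_least)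
    next
      case (5 x y z)
      then show ?case using hD(1) gD(2) frob by (simp add: Y.meet_assoc)
    qed
    moreover have "(\<top>\<^bsub>X\<^esub>, w) \<in> ?J"
      using c hD(1) X.top_in by (simp add: Y.meet_right)
    ultimately have "tensor \<top>\<^bsub>X\<^esub> w \<subseteq> ?J" using tensor_le X.top_in c by blast
    with xy c show ?thesis by (auto simp: proj2_apply)
  qed
qed

text \<open>Open maps are stable under pullback: \<open>k\<close> is the direct image along the
  second projection, satisfies Frobenius, and its value on \<open>proj1 x\<close> is the
  Beck-Chevalley identity. All of it follows by testing \<open>k U\<close> against upper bounds with
  \<open>mem_proj2_iff\<close>.\<close>

lemma left_adjoint_proj2:
  assumes h: "left_adjoint X Z f h"
    and frob: "\<And>x z. \<lbrakk>x \<in> carrier X; z \<in> carrier Z\<rbrakk> \<Longrightarrow> h (x \<sqinter>\<^bsub>X\<^esub> f z) = h x \<sqinter>\<^bsub>Z\<^esub> z"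
  defines "k \<equiv> \<lambda>U. \<Squnion>\<^bsub>Y\<^esub>((\<lambda>(x, y). g (h x) \<sqinter>\<^bsub>Y\<^esub> y) ` U)"
  shows "ideal U \<Longrightarrow> k U \<in> carrier Y"
    and "\<lbrakk>ideal U; y \<in> carrier Y\<rbrakk> \<Longrightarrow> k U \<sqsubseteq>\<^bsub>Y\<^esub> y \<longleftrightarrow> U \<subseteq> proj2 y"
    and "\<lbrakk>ideal U; y \<in> carrier Y\<rbrakk> \<Longrightarrow> k (U \<inter> proj2 y) = k U \<sqinter>\<^bsub>Y\<^esub> y"
    and "\<lbrakk>x \<in> carrier X\<rbrakk> \<Longrightarrow> k (proj1 x) = g (h x)"
proof -
  note hD = left_adjointD [OF h] left_adjoint_unit [OF h f_map]
  have sub: "(\<lambda>(x, y). g (h x) \<sqinter>\<^bsub>Y\<^esub> y) ` U \<subseteq> carrier Y" if "ideal U" for U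
    using ideal_mem [OF that] hD(1) by auto
  show k_closed: "k U \<in> carrier Y" if "ideal U" for U
    unfolding k_def using sub [OF that] by simp
  show k_le: "k U \<sqsubseteq>\<^bsub>Y\<^esub> y \<longleftrightarrow> U \<subseteq> proj2 y" if U: "ideal U" and y: "y \<in> carrier Y" for U y
  proof -
    have "g (h a) \<sqinter>\<^bsub>Y\<^esub> b \<sqsubseteq>\<^bsub>Y\<^esub> y \<longleftrightarrow> (a, b) \<in> proj2 y" if "(a, b) \<in> U" for a b
      using ideal_mem [OF U that] y mem_proj2_iff [OF h frob] by simp
    then show ?thesis unfolding k_def Y.sup_le_iff [OF sub [OF U] y] by auto
  qed
  show "k (U \<inter> proj2 y) = k U \<sqinter>\<^bsub>Y\<^esub> y" if U: "ideal U" and y: "y \<in> carrier Y"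
  proof (rule Y.le_antisym)
    have pI: "ideal (proj2 y)" using loc_mapD(1) [OF proj2_map y] by simp
    have I: "ideal (U \<inter> proj2 y)" using ideal_Int [OF U pI] .
    show c: "k (U \<inter> proj2 y) \<in> carrier Y" "k U \<sqinter>\<^bsub>Y\<^esub> y \<in> carrier Y"
      using k_closed I U y by auto
    have "k (U \<inter> proj2 y) \<sqsubseteq>\<^bsub>Y\<^esub> k U"
      using k_le [OF I k_closed [OF U]] k_le [OF U k_closed [OF U]] k_closed [OF U] by auto
    moreover have "k (U \<inter> proj2 y) \<sqsubseteq>\<^bsub>Y\<^esub> y" using k_le [OF I y] by auto
    ultimately show "k (U \<inter> proj2 y) \<sqsubseteq>\<^bsub>Y\<^esub> k U \<sqinter>\<^bsub>Y\<^esub> y"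
      using k_closed U I y by (simp add: Y.le_meet_iff)
    have "g (h a) \<sqinter>\<^bsub>Y\<^esub> b \<sqinter>\<^bsub>Y\<^esub> y \<sqsubseteq>\<^bsub>Y\<^esub> k (U \<inter> proj2 y)" if ab: "(a, b) \<in> U" for a b
    proof -
      have ab': "a \<in> carrier X" "b \<in> carrier Y" using ideal_mem [OF U ab] by auto
      have "(a, b \<sqinter>\<^bsub>Y\<^esub> y) \<in> U"
        using mem_tensor_mono [OF U ab] ab' y by (simp add: Y.meet_left)
      moreover have "(a, b \<sqinter>\<^bsub>Y\<^esub> y) \<in> proj2 y"
        using mem_tensor_mono [OF pI, of "\<top>\<^bsub>X\<^esub>" y] tensor_self [OF X.top_in y]
          ab' y X.le_top by (simp add: proj2_apply Y.meet_right)
      ultimately have "g (h a) \<sqinter>\<^bsub>Y\<^esub> (b \<sqinter>\<^bsub>Y\<^esub> y) \<in> (\<lambda>(x, y). g (h x) \<sqinter>\<^bsub>Y\<^esub> y) ` (U \<inter> proj2 y)"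
        by force
      then have "g (h a) \<sqinter>\<^bsub>Y\<^esub> (b \<sqinter>\<^bsub>Y\<^esub> y) \<sqsubseteq>\<^bsub>Y\<^esub> k (U \<inter> proj2 y)"
        unfolding k_def using Y.sup_upper [OF sub [OF I]] by blast
      then show ?thesis using ab' y hD(1) by (simp add: Y.meet_assoc)
    qed
    then show "k U \<sqinter>\<^bsub>Y\<^esub> y \<sqsubseteq>\<^bsub>Y\<^esub> k (U \<inter> proj2 y)"
      using sub [OF U] y c(1) ideal_mem [OF U] hD(1)
      by (subst k_def) (auto simp: Y.sup_meet_distrib intro!: Y.sup_least)
  qed
  show "k (proj1 x) = g (h x)" if x: "x \<in> carrier X"
  proof (rule Y.eq_by_upper)
    have I: "ideal (proj1 x)" using loc_mapD(1) [OF proj1_map x] by simp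
    show "k (proj1 x) \<in> carrier Y" "g (h x) \<in> carrier Y" using k_closed [OF I] hD(1) x by auto
    fix w assume w: "w \<in> carrier Y"
    have "ideal (proj2 w)" using loc_mapD(1) [OF proj2_map w] by simp
    then show "k (proj1 x) \<sqsubseteq>\<^bsub>Y\<^esub> w \<longleftrightarrow> g (h x) \<sqsubseteq>\<^bsub>Y\<^esub> w"
      using k_le [OF I w] x w hD(1) mem_proj2_iff [OF h frob x Y.top_in w] Y.top_in
      by (simp add: proj1_apply tensor_le Y.meet_top)
  qed
qed

end

section \<open>The groupoid of maps into a localic groupoid\<close>

text \<open>Domain and range alone determine \<open>G2\<close> and \<open>G3\<close>. Isolating them
  lets the groupoid of a quantale use these pullbacks before its multiplication is known to be a map
  of locales.\<close>

locale loc_graph =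
  fixes G :: "'a loc_groupoid"
  assumes frame_G0: "frame (G0 G)"
    and frame_G1: "frame (G1 G)"
    and gdom_map: "gdom G \<in> loc_map (G1 G) (G0 G)"
    and gran_map: "gran G \<in> loc_map (G1 G) (G0 G)"
begin

abbreviation "X \<equiv> G1 G"
abbreviation "Y \<equiv> G0 G"
abbreviation "d \<equiv> gdom G"
abbreviation "r \<equiv> gran G"

sublocale X: frame "G1 G" by (rule frame_G1)
sublocale Y: frame "G0 G" by (rule frame_G0)

sublocale pb2: loc_cospan "G1 G" "G1 G" "G0 G" "gran G" "gdom G"
  by unfold_locales (rule gran_map gdom_map)+

lemma G2_folds:
  "G2 G = pb2.P" "gpi1 G = pb2.proj1" "gpi2 G = pb2.proj2"
  "gpair G W p q = pb_pair (G1 G) (G1 G) (G0 G) (gran G) (gdom G) W p q"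
  by (simp_all add: G2_def gpi1_def gpi2_def gpair_def)

sublocale G2: frame "G2 G"
  unfolding G2_folds by (rule pb2.P_frame)

lemma gpi1_map: "gpi1 G \<in> loc_map (G2 G) (G1 G)"
  unfolding G2_folds by (rule pb2.proj1_map)

lemma gpi2_map: "gpi2 G \<in> loc_map (G2 G) (G1 G)"
  unfolding G2_folds by (rule pb2.proj2_map)

sublocale pb3: loc_cospan "G2 G" "G1 G" "G0 G" "loc_comp (G0 G) (gran G) (gpi2 G)" "gdom G"
  by unfold_locales (rule gdom_map loc_comp_map [OF gpi2_map gran_map])+

lemma G3_folds: "G3 G = pb3.P" "gtri12 G = pb3.proj1" "gtri3 G = pb3.proj2"
  by (simp_all add: G3_def gtri12_def gtri3_def)

sublocale G3: frame "G3 G"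
  unfolding G3_folds by (rule pb3.P_frame)

lemma gtri12_map: "gtri12 G \<in> loc_map (G3 G) (G2 G)"
  unfolding G3_folds by (rule pb3.proj1_map)

lemma gtri3_map: "gtri3 G \<in> loc_map (G3 G) (G1 G)"
  unfolding G3_folds by (rule pb3.proj2_map)

lemma gtri1_map: "gtri1 G \<in> loc_map (G3 G) (G1 G)"
  unfolding gtri1_def by (rule loc_comp_map [OF gtri12_map gpi1_map])

lemma gtri2_map: "gtri2 G \<in> loc_map (G3 G) (G1 G)"
  unfolding gtri2_def by (rule loc_comp_map [OF gtri12_map gpi2_map])

text \<open>The equation r \<circ> p = d \<circ> q for generalized arrows p and q, read on inverse
  images.\<close>

definition composable :: "('a \<Rightarrow> 'w) \<Rightarrow> ('a \<Rightarrow> 'w) \<Rightarrow> bool" where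
  "composable p q \<longleftrightarrow> (\<forall>z\<in>carrier (G0 G). p (gran G z) = q (gdom G z))"

lemma composableD: "\<lbrakk>composable p q; z \<in> carrier (G0 G)\<rbrakk> \<Longrightarrow> p (gran G z) = q (gdom G z)"
  by (simp add: composable_def)

lemma composable_pi: "composable (gpi1 G) (gpi2 G)"
  unfolding composable_def G2_folds using pb2.proj_balance by blast

lemma composable_tri12: "composable (gtri1 G) (gtri2 G)"
  unfolding composable_def gtri1_def gtri2_def using composable_pi by (simp add: composable_def)

lemma composable_tri23: "composable (gtri2 G) (gtri3 G)"
  unfolding composable_def gtri2_def using pb3.proj_balance by (simp add: G3_folds)

lemmas gpair_map = pb2.pair_map [folded G2_folds]
lemmas gpair_pi = pb2.pair_proj [folded G2_folds]
lemmas gpair_unique = pb2.pair_unique [folded G2_folds]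
lemmas gpair_comp = pb2.pair_comp [folded G2_folds]

end

text \<open>
  For every locale \<open>W\<close> the maps \<open>W \<rightarrow> G\<^sub>1\<close> form a groupoid in the usual sense, with product
  \<open>gprod W\<close>; identities between structure maps are verified in it as for ordinary groupoids.
\<close>

context localic_groupoid
begin

sublocale loc_graph
  by (rule loc_graph.intro) (rule frame_G0 frame_G1 gdom_map gran_map)+

abbreviation "u \<equiv> gunit G"
abbreviation "i \<equiv> ginv G"
abbreviation "m \<equiv> gmul G"

definition gprod :: "('w, 'h) gorder_scheme \<Rightarrow> ('a \<Rightarrow> 'w) \<Rightarrow> ('a \<Rightarrow> 'w) \<Rightarrow> 'a \<Rightarrow> 'w" where
  "gprod W p q = loc_comp X m (gpair G W p q)"

definition lunit :: "('a \<Rightarrow> 'w) \<Rightarrow> 'a \<Rightarrow> 'w" where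
  "lunit p = loc_comp X (loc_comp X u d) p"

definition runit :: "('a \<Rightarrow> 'w) \<Rightarrow> 'a \<Rightarrow> 'w" where
  "runit p = loc_comp X (loc_comp X u r) p"

definition inverse :: "('a \<Rightarrow> 'w) \<Rightarrow> 'a \<Rightarrow> 'w" where
  "inverse p = loc_comp X i p"

lemma structure_apply:
  assumes "z \<in> carrier Y"
  shows "u (d z) = z" "u (r z) = z" "m (d z) = gpi1 G (d z)" "m (r z) = gpi2 G (r z)"
    "i (d z) = r z" "i (r z) = d z"
proof -
  show "u (d z) = z" "u (r z) = z" "m (d z) = gpi1 G (d z)" "m (r z) = gpi2 G (r z)"
    using dom_unit ran_unit dom_mul ran_mul assms by (metis loc_comp_apply loc_id_apply)+
  show "i (d z) = r z" "i (r z) = d z"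
    using dom_inv ran_inv assms by (metis loc_comp_apply)+
qed

lemma u_closed: "x \<in> carrier X \<Longrightarrow> u x \<in> carrier Y"
  using loc_mapD(1) [OF gunit_map] .

lemma ud_map: "loc_comp X u d \<in> loc_map X X" and ur_map: "loc_comp X u r \<in> loc_map X X"
  by (rule loc_comp_map [OF _ gunit_map], rule gdom_map gran_map)+

lemma inverse_apply: "x \<in> carrier X \<Longrightarrow> inverse p x = p (i x)"
  by (simp add: inverse_def)

lemma inverse_dom: "z \<in> carrier Y \<Longrightarrow> inverse p (d z) = p (r z)"
  and inverse_ran: "z \<in> carrier Y \<Longrightarrow> inverse p (r z) = p (d z)"
  by (simp_all add: inverse_apply structure_apply)

lemma lunit_cong:
  "(\<And>z. z \<in> carrier Y \<Longrightarrow> p (d z) = q (d z)) \<Longrightarrow> lunit p = lunit q"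
  unfolding lunit_def by (rule loc_comp_eqI) (simp add: u_closed)

lemma runit_eq_lunit: "composable p q \<Longrightarrow> runit p = lunit q"
  unfolding lunit_def runit_def by (rule loc_comp_eqI) (simp add: u_closed composable_def)

context
  fixes W :: "('w, 'h) gorder_scheme"
  assumes W: "frame W"
begin


context
  fixes p q
  assumes p: "p \<in> loc_map W X" and q: "q \<in> loc_map W X" and pq: "composable p q"
begin

lemma gprod_map: "gprod W p q \<in> loc_map W X"
  unfolding gprod_def by (rule loc_comp_map [OF gpair_map gmul_map]) (fact W p q composableD [OF pq])+

lemma gprod_dom: "z \<in> carrier Y \<Longrightarrow> gprod W p q (d z) = p (d z)"
  unfolding gprod_def using gpair_pi(1) [OF W p q composableD [OF pq]]
  by (simp add: structure_apply)

lemma gprod_ran: "z \<in> carrier Y \<Longrightarrow> gprod W p q (r z) = q (r z)"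
  unfolding gprod_def using gpair_pi(2) [OF W p q composableD [OF pq]]
  by (simp add: structure_apply)

lemma gprod_comp:
  assumes V: "frame V" and k: "k \<in> loc_map V W"
  shows "loc_comp X (gprod W p q) k = gprod V (loc_comp X p k) (loc_comp X q k)"
  unfolding gprod_def
  using gpair_comp [OF W p q composableD [OF pq] V k] loc_comp_assoc [OF gmul_map] by metis

end

end

text \<open>The axiom is associativity of the universal composable triple. A triple p, q, s over W
  is a map \<open>?t\<close> from W to G_3, and precomposing both sides of the axiom with it gives
  the general case.\<close>

lemma gprod_assoc:
  assumes W: "frame W" and p: "p \<in> loc_map W X" and q: "q \<in> loc_map W X" and s: "s \<in> loc_map W X"
    and pq: "composable p q" and qs: "composable q s"
  shows "gprod W (gprod W p q) s = gprod W p (gprod W q s)"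
proof -
  let ?pq = "gpair G W p q"
  let ?t = "pb_pair (G2 G) X Y (loc_comp Y r (gpi2 G)) d W ?pq s"
  note pi = gpair_pi [OF W p q composableD [OF pq]]
  have pq_map: "?pq \<in> loc_map W (G2 G)"
    by (rule gpair_map) (fact W p q composableD [OF pq])+
  have c: "?pq (loc_comp Y r (gpi2 G) z) = s (d z)" if "z \<in> carrier Y" for z
    using that pi composableD [OF qs that] by simp
  have t: "?t \<in> loc_map W (G3 G)"
    unfolding G3_folds by (rule pb3.pair_map) (fact W pq_map s c)+
  note tpi = pb3.pair_proj [OF W pq_map s c, folded G3_folds]
  have t1: "loc_comp X (gtri1 G) ?t = p"
    by (rule extensionalityI [of _ "carrier X"])
      (use tpi pi loc_mapD(1) [OF gpi1_map] loc_mapD(5) [OF p] in \<open>auto simp: gtri1_def\<close>)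
  have t2: "loc_comp X (gtri2 G) ?t = q"
    by (rule extensionalityI [of _ "carrier X"])
      (use tpi pi loc_mapD(1) [OF gpi2_map] loc_mapD(5) [OF q] in \<open>auto simp: gtri2_def\<close>)
  have t3: "loc_comp X (gtri3 G) ?t = s"
    by (rule extensionalityI [of _ "carrier X"])
      (use tpi loc_mapD(5) [OF s] in auto)
  have t12: "loc_comp X (loc_comp X m (gtri12 G)) ?t = gprod W p q"
    unfolding gprod_def using tpi loc_mapD(1) [OF gmul_map] by (intro loc_comp_eqI) simp
  have c1: "composable (loc_comp X m (gtri12 G)) (gtri3 G)"
    using composable_tri23 by (simp add: composable_def structure_apply gtri2_def)
  have m23: "gprod (G3 G) (gtri2 G) (gtri3 G) \<in> loc_map (G3 G) X"
    by (rule gprod_map [OF G3.frame_axioms gtri2_map gtri3_map composable_tri23])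
  have c2: "composable (gtri1 G) (gprod (G3 G) (gtri2 G) (gtri3 G))"
    using composable_tri12
    by (simp add: composable_def gprod_dom [OF G3.frame_axioms gtri2_map gtri3_map composable_tri23])
  have "gprod W (gprod W p q) s =
      loc_comp X (gprod (G3 G) (loc_comp X m (gtri12 G)) (gtri3 G)) ?t"
    by (subst gprod_comp [OF G3.frame_axioms loc_comp_map [OF gtri12_map gmul_map] gtri3_map c1 W t])
      (simp add: t12 t3)
  also have "gprod (G3 G) (loc_comp X m (gtri12 G)) (gtri3 G) =
      gprod (G3 G) (gtri1 G) (gprod (G3 G) (gtri2 G) (gtri3 G))"
    using mul_assoc by (simp add: gprod_def)
  also have "loc_comp X \<dots> ?t = gprod W p (gprod W q s)"
    by (subst gprod_comp [OF G3.frame_axioms gtri1_map m23 c2 W t],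
        subst gprod_comp [OF G3.frame_axioms gtri2_map gtri3_map composable_tri23 W t])
      (simp add: t1 t2 t3)
  finally show ?thesis .
qed

lemma id_map: "loc_id X \<in> loc_map X X"
  by (rule loc_id_map) unfold_locales

context
  fixes W :: "('w, 'h) gorder_scheme"
  assumes W: "frame W"
begin

lemma inverse_map: "p \<in> loc_map W X \<Longrightarrow> inverse p \<in> loc_map W X"
  unfolding inverse_def by (rule loc_comp_map [OF _ ginv_map])

lemma gprod_lunit:
  assumes p: "p \<in> loc_map W X" shows "gprod W (lunit p) p = p"
proof -
  have c: "composable (loc_comp X u d) (loc_id X)"
    using loc_mapD(1) [OF gdom_map] loc_mapD(1) [OF gran_map]
    by (simp add: composable_def structure_apply)
  have "gprod W (lunit p) (loc_comp X (loc_id X) p) =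
      loc_comp X (gprod X (loc_comp X u d) (loc_id X)) p"
    unfolding lunit_def by (rule gprod_comp [OF X.frame_axioms ud_map id_map c W p, symmetric])
  also have "gprod X (loc_comp X u d) (loc_id X) = loc_id X"
    using unit_mul by (simp add: gprod_def)
  finally show ?thesis using loc_comp_id [OF p] by simp
qed

lemma gprod_runit:
  assumes p: "p \<in> loc_map W X" shows "gprod W p (runit p) = p"
proof -
  have c: "composable (loc_id X) (loc_comp X u r)"
    using loc_mapD(1) [OF gdom_map] loc_mapD(1) [OF gran_map]
    by (simp add: composable_def structure_apply)
  have "gprod W (loc_comp X (loc_id X) p) (runit p) =
      loc_comp X (gprod X (loc_id X) (loc_comp X u r)) p"
    unfolding runit_def by (rule gprod_comp [OF X.frame_axioms id_map ur_map c W p, symmetric])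
  also have "gprod X (loc_id X) (loc_comp X u r) = loc_id X"
    using mul_unit by (simp add: gprod_def)
  finally show ?thesis using loc_comp_id [OF p] by simp
qed

lemma gprod_inverse_right:
  assumes p: "p \<in> loc_map W X" shows "gprod W p (inverse p) = lunit p"
proof -
  have c: "composable (loc_id X) i"
    using loc_mapD(1) [OF gdom_map] loc_mapD(1) [OF gran_map]
    by (simp add: composable_def structure_apply)
  have "gprod W (loc_comp X (loc_id X) p) (inverse p) = loc_comp X (gprod X (loc_id X) i) p"
    unfolding inverse_def by (rule gprod_comp [OF X.frame_axioms id_map ginv_map c W p, symmetric])
  also have "\<dots> = lunit p"
    using mul_inv by (simp add: gprod_def lunit_def)
  finally show ?thesis using loc_comp_id [OF p] by simp
qed

lemma gprod_inverse_left:
  assumes p: "p \<in> loc_map W X" shows "gprod W (inverse p) p = runit p"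
proof -
  have c: "composable i (loc_id X)"
    using loc_mapD(1) [OF gdom_map] loc_mapD(1) [OF gran_map]
    by (simp add: composable_def structure_apply)
  have "gprod W (inverse p) (loc_comp X (loc_id X) p) = loc_comp X (gprod X i (loc_id X)) p"
    unfolding inverse_def by (rule gprod_comp [OF X.frame_axioms ginv_map id_map c W p, symmetric])
  also have "\<dots> = runit p"
    using inv_mul by (simp add: gprod_def runit_def)
  finally show ?thesis using loc_comp_id [OF p] by simp
qed

lemma composable_inverse: "composable p (inverse p)" "composable (inverse p) p"
  by (simp_all add: composable_def inverse_dom inverse_ran)

lemma inverse_unique:
  assumes p: "p \<in> loc_map W X" and q: "q \<in> loc_map W X" and pq: "composable p q"
    and eq: "gprod W p q = lunit p"
  shows "q = inverse p"
proof -
  note p' = inverse_map [OF p]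
  have "q = gprod W (runit p) q"
    using gprod_lunit [OF q] runit_eq_lunit [OF pq] by simp
  also have "\<dots> = gprod W (inverse p) (gprod W p q)"
    using gprod_assoc [OF W p' p q _ pq] composable_inverse gprod_inverse_left [OF p] by metis
  also have "\<dots> = gprod W (inverse p) (runit (inverse p))"
    using eq runit_eq_lunit [OF composable_inverse(2) [of p]] by simp
  also have "\<dots> = inverse p" by (rule gprod_runit [OF p'])
  finally show ?thesis .
qed

lemma inverse_inverse:
  assumes p: "p \<in> loc_map W X" shows "inverse (inverse p) = p"
proof (rule inverse_unique [symmetric])
  show "gprod W (inverse p) p = lunit (inverse p)"
    using gprod_inverse_left [OF p] runit_eq_lunit [OF composable_inverse(1)] by simp
qed (fact inverse_map [OF p] p composable_inverse)+

text \<open>That inversion reverses products is not among the axioms. It follows from uniqueness of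
  right inverses, as for ordinary groupoids, and later makes the involution of the quantale an
  antihomomorphism.\<close>

lemma inverse_gprod:
  assumes p: "p \<in> loc_map W X" and q: "q \<in> loc_map W X" and pq: "composable p q"
  shows "inverse (gprod W p q) = gprod W (inverse q) (inverse p)"
proof (rule inverse_unique [symmetric])
  note p' = inverse_map [OF p] and q' = inverse_map [OF q]
  have c: "composable (inverse q) (inverse p)"
    using pq by (simp add: composable_def inverse_dom inverse_ran)
  note pq_map = gprod_map [OF W p q pq] and qp_map = gprod_map [OF W q' p' c]
  note ends = gprod_dom [OF W p q pq] gprod_ran [OF W p q pq]
    gprod_dom [OF W q' p' c] gprod_ran [OF W q' p' c]
  have c': "composable q (gprod W (inverse q) (inverse p))"
    by (simp add: composable_def ends inverse_dom)
  show "composable (gprod W p q) (gprod W (inverse q) (inverse p))"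
    by (simp add: composable_def ends inverse_dom)
  have "gprod W q (gprod W (inverse q) (inverse p)) = gprod W (lunit q) (inverse p)"
    using gprod_assoc [OF W q q' p' composable_inverse(1) c] gprod_inverse_right [OF q] by simp
  also have "lunit q = lunit (inverse p)"
    using pq by (intro lunit_cong) (simp add: inverse_dom composable_def)
  finally have "gprod W q (gprod W (inverse q) (inverse p)) = inverse p"
    using gprod_lunit [OF p'] by simp
  then have "gprod W (gprod W p q) (gprod W (inverse q) (inverse p)) = lunit p"
    using gprod_assoc [OF W p q qp_map pq c'] gprod_inverse_right [OF p] by simp
  then show "gprod W (gprod W p q) (gprod W (inverse q) (inverse p)) = lunit (gprod W p q)"
    using lunit_cong [of "gprod W p q" p] ends by simp
  show "gprod W p q \<in> loc_map W X" "gprod W (inverse q) (inverse p) \<in> loc_map W X"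
    by (fact pq_map, fact qp_map)
qed

end

text \<open>The two projections form the universal composable pair and their pairing is the
  identity, so identities between generalized arrows specialise to identities about m.\<close>

lemma gprod_pi: "gprod (G2 G) (gpi1 G) (gpi2 G) = m"
proof -
  have "gpair G (G2 G) (gpi1 G) (gpi2 G) = loc_id (G2 G)"
    using loc_mapD(1) [OF gpi1_map] loc_mapD(1) [OF gpi2_map] composableD [OF composable_pi]
    by (intro gpair_unique [symmetric] G2.frame_axioms gpi1_map gpi2_map loc_id_map) 
       (auto intro: G2.complete_lattice_axioms)
  then show ?thesis by (simp add: gprod_def loc_comp_id [OF gmul_map])
qed

end

section \<open>Associativity\<close>

lemma open_loc_mapD:
  assumes "open_loc_map X Y f"
  shows "f \<in> loc_map X Y" and "left_adjoint X Y f (direct_image X Y f)"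
    and "\<lbrakk>x \<in> carrier X; y \<in> carrier Y\<rbrakk> \<Longrightarrow>
      direct_image X Y f (x \<sqinter>\<^bsub>X\<^esub> f y) = direct_image X Y f x \<sqinter>\<^bsub>Y\<^esub> y"
  using assms left_adjoint_direct_image [of f X Y]
  by (auto simp: open_loc_map_def meet_comm [of X x] meet_comm [of Y _ y])

text \<open>What both directions of the equivalence can supply without knowing associativity: a
  product corresponding to m^* by adjunction on pure tensors, and the Frobenius law for elements
  pulled back along d and r.\<close>

locale loc_mult_graph = loc_graph G for G :: "'a loc_groupoid" +
  fixes mul :: "'a \<Rightarrow> 'a \<Rightarrow> 'a"
  assumes gmul_in: "gmul G \<in> loc_map (G2 G) (G1 G)"
    and mul_closed: "\<lbrakk>x \<in> carrier X; y \<in> carrier X\<rbrakk> \<Longrightarrow> mul x y \<in> carrier X"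
    and mul_le_iff:
      "\<lbrakk>x \<in> carrier X; y \<in> carrier X; w \<in> carrier X\<rbrakk> \<Longrightarrow> mul x y \<sqsubseteq>\<^bsub>X\<^esub> w \<longleftrightarrow> (x, y) \<in> gmul G w"
    and mul_dom:
      "\<lbrakk>x \<in> carrier X; y \<in> carrier X; z \<in> carrier Y\<rbrakk> \<Longrightarrow> mul (x \<sqinter>\<^bsub>X\<^esub> d z) y = mul x y \<sqinter>\<^bsub>X\<^esub> d z"
    and mul_ran:
      "\<lbrakk>x \<in> carrier X; y \<in> carrier X; z \<in> carrier Y\<rbrakk> \<Longrightarrow> mul x (y \<sqinter>\<^bsub>X\<^esub> r z) = mul x y \<sqinter>\<^bsub>X\<^esub> r z"
begin

lemma gmul_ideal: "w \<in> carrier X \<Longrightarrow> pb2.ideal (gmul G w)"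
  using loc_mapD(1) [OF gmul_in] by (simp add: G2_folds)

lemma mul_balance:
  assumes "x \<in> carrier X" "y \<in> carrier X" "z \<in> carrier Y"
  shows "mul (x \<sqinter>\<^bsub>X\<^esub> r z) y = mul x (d z \<sqinter>\<^bsub>X\<^esub> y)"
  using assms mul_closed pb2.idealD(5) [OF gmul_ideal]
  by (intro X.eq_by_upper) (simp_all add: mul_le_iff)

lemma mul_sup_left:
  assumes "A \<subseteq> carrier X" "y \<in> carrier X"
  shows "mul (\<Squnion>\<^bsub>X\<^esub>A) y = \<Squnion>\<^bsub>X\<^esub>((\<lambda>a. mul a y) ` A)"
proof (rule X.sup_eqI [symmetric])
  show "(\<lambda>a. mul a y) ` A \<subseteq> carrier X" "mul (\<Squnion>\<^bsub>X\<^esub>A) y \<in> carrier X"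
    using assms mul_closed by auto
  fix w assume w: "w \<in> carrier X"
  have "(\<Squnion>\<^bsub>X\<^esub>A, y) \<in> gmul G w \<longleftrightarrow> (\<forall>a\<in>A. (a, y) \<in> gmul G w)"
    using pb2.idealD(2,3) [OF gmul_ideal [OF w]] assms X.sup_upper [OF assms(1)]
    by (meson X.le_refl in_mono)
  then show "mul (\<Squnion>\<^bsub>X\<^esub>A) y \<sqsubseteq>\<^bsub>X\<^esub> w \<longleftrightarrow> (\<forall>a\<in>(\<lambda>a. mul a y) ` A. a \<sqsubseteq>\<^bsub>X\<^esub> w)"
    using assms w by (simp add: mul_le_iff subset_eq)
qed

lemma mul_sup_right:
  assumes "B \<subseteq> carrier X" "x \<in> carrier X"
  shows "mul x (\<Squnion>\<^bsub>X\<^esub>B) = \<Squnion>\<^bsub>X\<^esub>((\<lambda>b. mul x b) ` B)"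
proof (rule X.sup_eqI [symmetric])
  show "(\<lambda>b. mul x b) ` B \<subseteq> carrier X" "mul x (\<Squnion>\<^bsub>X\<^esub>B) \<in> carrier X"
    using assms mul_closed by auto
  fix w assume w: "w \<in> carrier X"
  have "(x, \<Squnion>\<^bsub>X\<^esub>B) \<in> gmul G w \<longleftrightarrow> (\<forall>b\<in>B. (x, b) \<in> gmul G w)"
    using pb2.idealD(2,4) [OF gmul_ideal [OF w]] assms X.sup_upper [OF assms(1)]
    by (meson X.le_refl in_mono)
  then show "mul x (\<Squnion>\<^bsub>X\<^esub>B) \<sqsubseteq>\<^bsub>X\<^esub> w \<longleftrightarrow> (\<forall>b\<in>(\<lambda>b. mul x b) ` B. b \<sqsubseteq>\<^bsub>X\<^esub> w)"
    using assms w by (simp add: mul_le_iff subset_eq)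
qed

lemma mul_mono:
  assumes "x \<sqsubseteq>\<^bsub>X\<^esub> x'" "y \<sqsubseteq>\<^bsub>X\<^esub> y'"
    and "x \<in> carrier X" "y \<in> carrier X" "x' \<in> carrier X" "y' \<in> carrier X"
  shows "mul x y \<sqsubseteq>\<^bsub>X\<^esub> mul x' y'"
proof -
  have *: "(x', y') \<in> gmul G (mul x' y')"
    using assms mul_closed by (simp flip: mul_le_iff)
  have "(x, y) \<in> gmul G (mul x' y')"
    by (rule pb2.mem_tensor_mono [OF gmul_ideal *]) (use assms mul_closed in auto)
  then show ?thesis using assms mul_closed by (simp add: mul_le_iff)
qed

text \<open>Ideals are closed under exactly what a balanced bilinear map f respects. The lemma
  serves both bracketings, with f x y = (x y) c and f x y = x (y c) for a fixed c.\<close>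

lemma mul_ideal:
  assumes f: "\<And>x y. \<lbrakk>x \<in> carrier X; y \<in> carrier X\<rbrakk> \<Longrightarrow> f x y \<in> carrier X"
    and mono: "\<And>x y x' y'. \<lbrakk>x \<in> carrier X; y \<in> carrier X; x' \<in> carrier X; y' \<in> carrier X;
       x \<sqsubseteq>\<^bsub>X\<^esub> x'; y \<sqsubseteq>\<^bsub>X\<^esub> y'\<rbrakk> \<Longrightarrow> f x y \<sqsubseteq>\<^bsub>X\<^esub> f x' y'"
    and left: "\<And>A y. \<lbrakk>A \<subseteq> carrier X; y \<in> carrier X\<rbrakk> \<Longrightarrow> f (\<Squnion>\<^bsub>X\<^esub>A) y = \<Squnion>\<^bsub>X\<^esub>((\<lambda>a. f a y) ` A)"
    and right: "\<And>B x. \<lbrakk>B \<subseteq> carrier X; x \<in> carrier X\<rbrakk> \<Longrightarrow> f x (\<Squnion>\<^bsub>X\<^esub>B) = \<Squnion>\<^bsub>X\<^esub>((\<lambda>b. f x b) ` B)"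
    and bal: "\<And>x y z. \<lbrakk>x \<in> carrier X; y \<in> carrier X; z \<in> carrier Y\<rbrakk> \<Longrightarrow>
        f (x \<sqinter>\<^bsub>X\<^esub> r z) y = f x (d z \<sqinter>\<^bsub>X\<^esub> y)"
    and w: "w \<in> carrier X"
  shows "pb2.ideal {(x, y). x \<in> carrier X \<and> y \<in> carrier X \<and> f x y \<sqsubseteq>\<^bsub>X\<^esub> w}"
proof (rule pb2.idealI, goal_cases)
  case 1 show ?case by auto
next
  case (2 x y a b)
  then show ?case using X.le_trans [OF mono [of x y a b], of w] f w by auto
next
  case (3 A y)
  then show ?case using f w by (auto simp: left subset_eq intro!: X.sup_least)
next
  case (4 x B)
  then show ?case using f w by (auto simp: right subset_eq intro!: X.sup_least)
next
  case (5 x y z)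
  then show ?case using bal by simp
qed

text \<open>
  The two bracketings of a triple product both give families \<open>R\<close> as required here, with
  \<open>R c = {(a, b). (a b) c \<le> w}\<close> and \<open>R c = {(a, b). a (b c) \<le> w}\<close>.
\<close>

lemma triple_ideal:
  assumes R: "\<And>c. c \<in> carrier X \<Longrightarrow> pb2.ideal (R c)"
    and anti: "\<And>c c'. \<lbrakk>c \<in> carrier X; c' \<in> carrier X; c \<sqsubseteq>\<^bsub>X\<^esub> c'\<rbrakk> \<Longrightarrow> R c' \<subseteq> R c"
    and sup: "\<And>C. C \<subseteq> carrier X \<Longrightarrow> (\<Inter>c\<in>C. R c) \<inter> (carrier X \<times> carrier X) \<subseteq> R (\<Squnion>\<^bsub>X\<^esub>C)"
    and bal: "\<And>a b c z. \<lbrakk>a \<in> carrier X; b \<in> carrier X; c \<in> carrier X; z \<in> carrier Y\<rbrakk> \<Longrightarrow>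
        (a, b \<sqinter>\<^bsub>X\<^esub> r z) \<in> R c \<longleftrightarrow> (a, b) \<in> R (d z \<sqinter>\<^bsub>X\<^esub> c)"
  shows "pb3.ideal {(U, c). U \<in> carrier (G2 G) \<and> c \<in> carrier X \<and> U \<subseteq> R c}"
proof (rule pb3.idealI, goal_cases)
  case 1 show ?case by auto
next
  case (2 U c V c')
  then show ?case using anti [of c c'] by (auto simp: G2_folds)
next
  case (3 S c)
  then have "\<Squnion>\<^bsub>G2 G\<^esub>S \<in> carrier (G2 G)" by (intro G2.sup_closed) auto
  moreover have "\<Squnion>\<^bsub>G2 G\<^esub>S \<subseteq> R c"
    using 3 R by (subst G2_folds, subst pb2.P_sup_le) (auto simp: G2_folds)
  ultimately show ?case using 3 by simp
next
  case (4 U C)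
  then have "U \<subseteq> carrier X \<times> carrier X"
    using pb2.idealD(1) by (simp add: G2_folds)
  moreover have "U \<subseteq> (\<Inter>c\<in>C. R c)" using 4 by auto
  ultimately have "U \<subseteq> R (\<Squnion>\<^bsub>X\<^esub>C)" using sup [OF 4(2)] by (meson Int_greatest subset_trans)
  then show ?case using 4 by simp
next
  case (5 U c z)
  \<comment> \<open>G_3 is formed over r \<circ> \<pi>2, so z acts on \<open>U\<close> through its
    second factor: meeting \<open>U\<close> with \<open>?q\<close> amounts to restricting b to r^* z
    in the pairs (a, b) of \<open>U\<close>.\<close>
  let ?q = "gpi2 G (r z)"
  have q: "pb2.ideal ?q" "?q = pb2.tensor \<top>\<^bsub>X\<^esub> (r z)" and U: "pb2.ideal U"
    using 5 loc_mapD(1) [OF gpi2_map] pb2.proj2_apply by (auto simp: G2_folds)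
  have "U \<inter> ?q \<subseteq> R c \<longleftrightarrow> U \<subseteq> R (d z \<sqinter>\<^bsub>X\<^esub> c)"
  proof
    assume *: "U \<inter> ?q \<subseteq> R c"
    show "U \<subseteq> R (d z \<sqinter>\<^bsub>X\<^esub> c)"
    proof clarify
      fix a b assume ab: "(a, b) \<in> U"
      then have m: "a \<in> carrier X" "b \<in> carrier X" using pb2.ideal_mem [OF U] by auto
      have "(a, b \<sqinter>\<^bsub>X\<^esub> r z) \<in> U"
        by (rule pb2.mem_tensor_mono [OF U ab]) (use m 5 in \<open>auto simp: X.meet_left\<close>)
      moreover have "(a, b \<sqinter>\<^bsub>X\<^esub> r z) \<in> ?q"
        by (rule pb2.mem_tensor_mono [OF q(1), of "\<top>\<^bsub>X\<^esub>" "r z"])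
          (use m 5 X.le_top X.top_in pb2.tensor_self in \<open>auto simp: q(2) X.meet_right\<close>)
      ultimately show "(a, b) \<in> R (d z \<sqinter>\<^bsub>X\<^esub> c)"
        using * bal [of a b c z] m 5 by auto
    qed
  next
    assume *: "U \<subseteq> R (d z \<sqinter>\<^bsub>X\<^esub> c)"
    show "U \<inter> ?q \<subseteq> R c"
    proof clarify
      fix a b assume ab: "(a, b) \<in> U" "(a, b) \<in> ?q"
      then have m: "a \<in> carrier X" "b \<in> carrier X" using pb2.ideal_mem [OF U] by auto
      have "(a, b \<sqinter>\<^bsub>X\<^esub> r z) \<in> R c" using * ab bal [of a b c z] m 5 by auto
      then show "(a, b) \<in> R c"
        using pb2.mem_tensor_meet [OF R [OF 5(2)] m X.top_in _ ab(2) [unfolded q(2)], of] m 5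
        by (simp add: X.meet_top)
    qed
  qed
  moreover have "U \<sqinter>\<^bsub>G2 G\<^esub> ?q = U \<inter> ?q"
    using U q(1) by (simp add: G2_folds pb2.P_meet)
  moreover have "?q \<in> carrier (G2 G)" using q(1) by (simp add: G2_folds)
  moreover have "U \<inter> ?q \<in> carrier (G2 G)" using pb2.ideal_Int [OF U q(1)] by (simp add: G2_folds)
  ultimately show ?case using 5 by simp
qed

text \<open>These are the two sides of the groupoid law \<open>mul_assoc\<close>, named here so that
  they can be computed before the law is available.\<close>

definition mult3_left :: "'a \<Rightarrow> (('a \<times> 'a) set \<times> 'a) set" where
  "mult3_left = loc_comp (G1 G) (gmul G)
     (gpair G (G3 G) (loc_comp (G1 G) (gmul G) (gtri12 G)) (gtri3 G))"

definition mult3_right :: "'a \<Rightarrow> (('a \<times> 'a) set \<times> 'a) set" where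
  "mult3_right = loc_comp (G1 G) (gmul G)
     (gpair G (G3 G) (gtri1 G)
        (loc_comp (G1 G) (gmul G) (gpair G (G3 G) (gtri2 G) (gtri3 G))))"


lemma gpair_tri23_map:
  "loc_comp (G1 G) (gmul G) (gpair G (G3 G) (gtri2 G) (gtri3 G)) \<in> loc_map (G3 G) X"
  by (rule loc_comp_map [OF gpair_map gmul_in])
    (fact G3.frame_axioms gtri2_map gtri3_map composableD [OF composable_tri23])+

text \<open>Every element of G_2 is the join of the pure tensors in it, and ideals of G_3 are closed
  under joins in the first variable. Membership in G_3 thereby reduces to triples of elements of
  G_1.\<close>

lemma mem_pb3I:
  assumes T: "pb3.ideal T" and U: "U \<in> carrier (G2 G)" and c: "c \<in> carrier X"
    and mem: "\<And>a b. (a, b) \<in> U \<Longrightarrow> (pb2.tensor a b, c) \<in> T"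
  shows "(U, c) \<in> T"
proof -
  have U': "pb2.ideal U" using U by (simp add: G2_folds)
  have "(\<Squnion>\<^bsub>G2 G\<^esub>((\<lambda>(a, b). pb2.tensor a b) ` U), c) \<in> T"
    by (rule pb3.idealD(3) [OF T _ c])
      (use mem pb2.ideal_mem [OF U'] pb2.tensor_ideal in \<open>auto simp: G2_folds\<close>)
  then show ?thesis using pb2.ideal_eq_sup [OF U'] by (simp add: G2_folds)
qed

lemma tensor3_left:
  assumes "U \<in> carrier (G2 G)" "c \<in> carrier X"
  shows "gtri12 G U \<sqinter>\<^bsub>G3 G\<^esub> gtri3 G c = pb3.tensor U c"
  using pb3.tensor_eq_meet [OF assms] by (simp add: G3_folds)

lemma tensor3_right:
  assumes "a \<in> carrier X" "b \<in> carrier X" "c \<in> carrier X"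
  shows "gtri1 G a \<sqinter>\<^bsub>G3 G\<^esub> (gtri2 G b \<sqinter>\<^bsub>G3 G\<^esub> gtri3 G c) = pb3.tensor (pb2.tensor a b) c"
proof -
  have "gtri1 G a \<sqinter>\<^bsub>G3 G\<^esub> gtri2 G b = gtri12 G (gpi1 G a \<sqinter>\<^bsub>G2 G\<^esub> gpi2 G b)"
    using assms loc_mapD(1) [OF gpi1_map] loc_mapD(1) [OF gpi2_map]
    by (simp add: gtri1_def gtri2_def loc_mapD(2) [OF gtri12_map])
  also have "gpi1 G a \<sqinter>\<^bsub>G2 G\<^esub> gpi2 G b = pb2.tensor a b"
    using pb2.tensor_eq_meet [OF assms(1,2)] by (simp add: G2_folds)
  finally show ?thesis
    using assms tensor3_left [of "pb2.tensor a b" c] pb2.tensor_ideal [OF assms(1,2)]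
      loc_mapD(1) [OF gtri1_map] loc_mapD(1) [OF gtri2_map] loc_mapD(1) [OF gtri3_map]
    by (simp add: G2_folds flip: G3.meet_assoc)
qed

lemma ideal_left:
  assumes w: "w \<in> carrier X" and c: "c \<in> carrier X"
  shows "pb2.ideal {(a, b). a \<in> carrier X \<and> b \<in> carrier X \<and> mul (mul a b) c \<sqsubseteq>\<^bsub>X\<^esub> w}"
proof (rule mul_ideal [OF _ _ _ _ _ w], goal_cases)
  case (3 A y)
  then show ?case
    using c mul_closed by (auto simp: mul_sup_left image_subset_iff subset_eq image_image)
next
  case (4 B x)
  then show ?case
    using c mul_closed
    by (auto simp: mul_sup_left mul_sup_right image_subset_iff subset_eq image_image)
qed (use c mul_closed mul_mono mul_balance in auto)

lemma ideal_right:
  assumes w: "w \<in> carrier X" and c: "c \<in> carrier X"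
  shows "pb2.ideal {(a, b). a \<in> carrier X \<and> b \<in> carrier X \<and> mul a (mul b c) \<sqsubseteq>\<^bsub>X\<^esub> w}"
proof (rule mul_ideal [OF _ _ _ _ _ w], goal_cases)
  case (3 A y)
  then show ?case using c mul_closed by (simp add: mul_sup_left)
next
  case (4 B x)
  then show ?case
    using c mul_closed
    by (auto simp: mul_sup_left mul_sup_right image_subset_iff subset_eq image_image)
next
  \<comment> \<open>Balancing turns (x \<and> r^* z)(y c) into x (d^* z \<and> y c);
    \<open>mul_dom\<close> then moves d^* z inside the product onto y.\<close>
  case (5 x y z)
  then show ?case
    using c mul_closed by (simp add: mul_balance mul_dom meet_comm [of X "d z"])
qed (use c mul_closed mul_mono in auto)

text \<open>The left side is generated by the m^* x \<otimes> y with x y \<le> w. Such a tensor lies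
  in \<open>?J\<close> since a b \<le> x gives (a b) y \<le> w. Conversely, a \<otimes> b \<otimes>
  c with (a b) c \<le> w lies below the generator with x = a b and y = c.\<close>

lemma mult3_left_eq:
  assumes w: "w \<in> carrier X"
  shows "mult3_left w = {(U, c). U \<in> carrier (G2 G) \<and> c \<in> carrier X \<and>
    U \<subseteq> {(a, b). a \<in> carrier X \<and> b \<in> carrier X \<and> mul (mul a b) c \<sqsubseteq>\<^bsub>X\<^esub> w}}"
    (is "_ = ?J")
proof
  let ?R = "\<lambda>c. {(a, b). a \<in> carrier X \<and> b \<in> carrier X \<and> mul (mul a b) c \<sqsubseteq>\<^bsub>X\<^esub> w}"
  have J: "pb3.ideal ?J"
  proof (rule triple_ideal, goal_cases)
    case (1 c)
    then show ?case by (rule ideal_left [OF w])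
  next
    case (2 c c')
    show ?case
    proof (rule subrelI)
      fix a b assume "(a, b) \<in> ?R c'"
      then have ab: "a \<in> carrier X" "b \<in> carrier X" "mul (mul a b) c' \<sqsubseteq>\<^bsub>X\<^esub> w" by auto
      have "mul (mul a b) c \<sqsubseteq>\<^bsub>X\<^esub> mul (mul a b) c'"
        using ab 2 mul_closed by (intro mul_mono) auto
      with ab 2 w show "(a, b) \<in> ?R c"
        using mul_closed X.le_trans [of _ "mul (mul a b) c'" w] by auto
    qed
  next
    case (3 C)
    then show ?case
      using mul_closed w by (auto simp: mul_sup_right subset_eq intro!: X.sup_least)
  next
    case (4 a b c z)
    then show ?case using mul_closed by (simp add: mul_ran mul_balance)
  qed
  have sup: "mult3_left w = \<Squnion>\<^bsub>G3 G\<^esub>((\<lambda>(x, y). pb3.tensor (gmul G x) y) ` gmul G w)"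
  proof -
    have "(\<lambda>(x, y). loc_comp X (gmul G) (gtri12 G) x \<sqinter>\<^bsub>G3 G\<^esub> gtri3 G y) ` gmul G w =
        (\<lambda>(x, y). pb3.tensor (gmul G x) y) ` gmul G w"
      using pb2.ideal_mem [OF gmul_ideal [OF w]] loc_mapD(1) [OF gmul_in] tensor3_left
      by (intro image_cong) auto
    then show ?thesis
      using w by (simp add: mult3_left_def G2_folds(4) pb2.pair_apply [OF gmul_ideal [OF w]])
  qed
  have sub: "(\<lambda>(x, y). pb3.tensor (gmul G x) y) ` gmul G w \<subseteq> carrier (G3 G)"
    using pb2.ideal_mem [OF gmul_ideal [OF w]] loc_mapD(1) [OF gmul_in] pb3.tensor_ideal
    by (auto simp: G3_folds)
  have I: "pb3.ideal (mult3_left w)"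
    using G3.sup_closed [OF sub] by (simp add: sup G3_folds)
  have "pb3.tensor (gmul G x) y \<sqsubseteq>\<^bsub>G3 G\<^esub> ?J" if xy: "(x, y) \<in> gmul G w" for x y
  proof -
    have m: "x \<in> carrier X" "y \<in> carrier X" "gmul G x \<in> carrier (G2 G)"
      using pb2.ideal_mem [OF gmul_ideal [OF w] xy] loc_mapD(1) [OF gmul_in] by auto
    have xy': "mul x y \<sqsubseteq>\<^bsub>X\<^esub> w" using mul_le_iff m w xy by simp
    have "mul (mul a b) y \<sqsubseteq>\<^bsub>X\<^esub> w" if ab: "(a, b) \<in> gmul G x" for a b
    proof -
      have n: "a \<in> carrier X" "b \<in> carrier X"
        using pb2.ideal_mem [OF gmul_ideal [OF m(1)] ab] by auto
      have "mul a b \<sqsubseteq>\<^bsub>X\<^esub> x" using n m ab by (simp add: mul_le_iff)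
      then have "mul (mul a b) y \<sqsubseteq>\<^bsub>X\<^esub> mul x y" using m n mul_closed by (intro mul_mono) auto
      then show ?thesis using xy' m n w mul_closed X.le_trans [of _ "mul x y" w] by simp
    qed
    then have "(gmul G x, y) \<in> ?J" using m pb2.ideal_mem [OF gmul_ideal [OF m(1)]] by auto
    then have "pb3.tensor (gmul G x) y \<subseteq> ?J" using pb3.tensor_le [OF m(3,2) J] by simp
    then show ?thesis by (simp only: G3_folds pb3.P_simps)
  qed
  then have le_J: "\<And>V. V \<in> (\<lambda>(x, y). pb3.tensor (gmul G x) y) ` gmul G w \<Longrightarrow> V \<sqsubseteq>\<^bsub>G3 G\<^esub> ?J"
    by auto
  have "mult3_left w \<sqsubseteq>\<^bsub>G3 G\<^esub> ?J"
    unfolding sup by (rule G3.sup_least [OF sub _ le_J]) (use J in \<open>simp_all add: G3_folds\<close>)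
  then show "mult3_left w \<subseteq> ?J" by (simp only: G3_folds pb3.P_simps)
  show "?J \<subseteq> mult3_left w"
  proof clarify
    fix U c assume U: "U \<in> carrier (G2 G)" "c \<in> carrier X" "U \<subseteq> ?R c"
    show "(U, c) \<in> mult3_left w"
    proof (rule mem_pb3I [OF I U(1,2)])
      fix a b assume "(a, b) \<in> U"
      then have m: "a \<in> carrier X" "b \<in> carrier X" "mul (mul a b) c \<sqsubseteq>\<^bsub>X\<^esub> w" using U(3) by auto
      have ab: "mul a b \<in> carrier X" using m mul_closed by simp
      have "(mul a b, c) \<in> gmul G w" using m ab U(2) w by (simp flip: mul_le_iff)
      then have "pb3.tensor (gmul G (mul a b)) c \<sqsubseteq>\<^bsub>G3 G\<^esub> mult3_left w"
        unfolding sup using G3.sup_upper [OF sub] by force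
      then have *: "(gmul G (mul a b), c) \<in> mult3_left w"
        using pb3.tensor_le [OF loc_mapD(1) [OF gmul_in ab] U(2) I] by (simp add: G3_folds)
      have "(a, b) \<in> gmul G (mul a b)" using m ab by (simp flip: mul_le_iff)
      then have "pb2.tensor a b \<subseteq> gmul G (mul a b)"
        using pb2.tensor_le [OF m(1,2) gmul_ideal [OF ab]] by simp
      then show "(pb2.tensor a b, c) \<in> mult3_left w"
        using pb3.mem_tensor_mono [OF I *] U(2) pb2.tensor_ideal [OF m(1,2)] by (simp add: G2_folds)
    qed
  qed
qed

lemma mult3_right_eq:
  assumes w: "w \<in> carrier X"
  shows "mult3_right w = {(U, c). U \<in> carrier (G2 G) \<and> c \<in> carrier X \<and>
    U \<subseteq> {(a, b). a \<in> carrier X \<and> b \<in> carrier X \<and> mul a (mul b c) \<sqsubseteq>\<^bsub>X\<^esub> w}}"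
    (is "_ = ?J")
proof
  let ?R = "\<lambda>c. {(a, b). a \<in> carrier X \<and> b \<in> carrier X \<and> mul a (mul b c) \<sqsubseteq>\<^bsub>X\<^esub> w}"
  let ?M = "loc_comp (G1 G) (gmul G) (gpair G (G3 G) (gtri2 G) (gtri3 G))"
  have J: "pb3.ideal ?J"
  proof (rule triple_ideal, goal_cases)
    case (1 c)
    then show ?case by (rule ideal_right [OF w])
  next
    case (2 c c')
    show ?case
    proof (rule subrelI)
      fix a b assume "(a, b) \<in> ?R c'"
      then have ab: "a \<in> carrier X" "b \<in> carrier X" "mul a (mul b c') \<sqsubseteq>\<^bsub>X\<^esub> w" by auto
      have "mul a (mul b c) \<sqsubseteq>\<^bsub>X\<^esub> mul a (mul b c')"
        using ab 2 mul_closed by (intro mul_mono) auto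
      with ab 2 w show "(a, b) \<in> ?R c"
        using mul_closed X.le_trans [of _ "mul a (mul b c')" w] by auto
    qed
  next
    case (3 C)
    then show ?case
      using mul_closed w
      by (auto simp: mul_sup_right subset_eq image_image image_subset_iff intro!: X.sup_least)
  next
    case (4 a b c z)
    then show ?case using mul_closed by (simp add: mul_balance)
  qed
  have M: "?M y \<in> carrier (G3 G)" if "y \<in> carrier X" for y
    using loc_mapD(1) [OF gpair_tri23_map that] .
  have M_eq: "?M y = \<Squnion>\<^bsub>G3 G\<^esub>((\<lambda>(p, q). gtri2 G p \<sqinter>\<^bsub>G3 G\<^esub> gtri3 G q) ` gmul G y)"
    if "y \<in> carrier X" for y
    using that by (simp add: G2_folds(4) pb2.pair_apply [OF gmul_ideal [OF that]])
  have M_sub: "(\<lambda>(p, q). gtri2 G p \<sqinter>\<^bsub>G3 G\<^esub> gtri3 G q) ` gmul G y \<subseteq> carrier (G3 G)"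
    if "y \<in> carrier X" for y
    using pb2.ideal_mem [OF gmul_ideal [OF that]] loc_mapD(1) [OF gtri2_map]
      loc_mapD(1) [OF gtri3_map] by auto
  have sup: "mult3_right w = \<Squnion>\<^bsub>G3 G\<^esub>((\<lambda>(x, y). gtri1 G x \<sqinter>\<^bsub>G3 G\<^esub> ?M y) ` gmul G w)"
    unfolding mult3_right_def
    using w by (simp add: G2_folds(4) pb2.pair_apply [OF gmul_ideal [OF w]])
  have sub: "(\<lambda>(x, y). gtri1 G x \<sqinter>\<^bsub>G3 G\<^esub> ?M y) ` gmul G w \<subseteq> carrier (G3 G)"
    using pb2.ideal_mem [OF gmul_ideal [OF w]] loc_mapD(1) [OF gtri1_map] M by auto
  have I: "pb3.ideal (mult3_right w)"
    using G3.sup_closed [OF sub] by (simp add: sup G3_folds)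
  have "gtri1 G x \<sqinter>\<^bsub>G3 G\<^esub> ?M y \<sqsubseteq>\<^bsub>G3 G\<^esub> ?J" if xy: "(x, y) \<in> gmul G w" for x y
  proof -
    have m: "x \<in> carrier X" "y \<in> carrier X"
      using pb2.ideal_mem [OF gmul_ideal [OF w] xy] by auto
    have xy': "mul x y \<sqsubseteq>\<^bsub>X\<^esub> w" using mul_le_iff m w xy by simp
    have le: "gtri1 G x \<sqinter>\<^bsub>G3 G\<^esub> (gtri2 G p \<sqinter>\<^bsub>G3 G\<^esub> gtri3 G q) \<sqsubseteq>\<^bsub>G3 G\<^esub> ?J"
      if pq: "(p, q) \<in> gmul G y" for p q
    proof -
      have n: "p \<in> carrier X" "q \<in> carrier X"
        using pb2.ideal_mem [OF gmul_ideal [OF m(2)] pq] by auto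
      have "mul p q \<sqsubseteq>\<^bsub>X\<^esub> y" using n m pq by (simp add: mul_le_iff)
      then have "mul x (mul p q) \<sqsubseteq>\<^bsub>X\<^esub> mul x y" using m n mul_closed by (intro mul_mono) auto
      then have "mul x (mul p q) \<sqsubseteq>\<^bsub>X\<^esub> w"
        using xy' m n w mul_closed X.le_trans [of _ "mul x y" w] by simp
      then have "(x, p) \<in> ?R q" using m n by simp
      moreover have "pb2.ideal (?R q)" by (rule ideal_right [OF w n(2)])
      ultimately have "pb2.tensor x p \<subseteq> ?R q" using pb2.tensor_le m n by blast
      then have "(pb2.tensor x p, q) \<in> ?J"
        using m n pb2.tensor_ideal by (simp add: G2_folds)
      then have "pb3.tensor (pb2.tensor x p) q \<subseteq> ?J"
        using pb3.tensor_le [OF _ n(2) J] pb2.tensor_ideal [OF m(1) n(1)] by (simp add: G2_folds)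
      then show ?thesis using tensor3_right m n by (simp add: G3_folds)
    qed
    let ?S = "(\<lambda>(p, q). gtri2 G p \<sqinter>\<^bsub>G3 G\<^esub> gtri3 G q) ` gmul G y"
    have x3: "gtri1 G x \<in> carrier (G3 G)" using loc_mapD(1) [OF gtri1_map m(1)] .
    \<comment> \<open>Here the inner product is itself a join of meets, so the outer meet has to be
      distributed over it before the generators become triples; for the left bracketing each
      generator was already a tensor.\<close>
    have "gtri1 G x \<sqinter>\<^bsub>G3 G\<^esub> ?M y = \<Squnion>\<^bsub>G3 G\<^esub>((\<lambda>v. gtri1 G x \<sqinter>\<^bsub>G3 G\<^esub> v) ` ?S)"
      unfolding M_eq [OF m(2)] by (rule G3.meet_sup_distrib [OF x3 M_sub [OF m(2)]])
    also have "\<dots> \<sqsubseteq>\<^bsub>G3 G\<^esub> ?J"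
    proof (rule G3.sup_least)
      show "(\<lambda>v. gtri1 G x \<sqinter>\<^bsub>G3 G\<^esub> v) ` ?S \<subseteq> carrier (G3 G)"
        using M_sub [OF m(2)] x3 by (auto simp: subset_eq)
      show "?J \<in> carrier (G3 G)" using J by (simp add: G3_folds)
    qed (use le in auto)
    finally show ?thesis .
  qed
  then have le_J: "\<And>V. V \<in> (\<lambda>(x, y). gtri1 G x \<sqinter>\<^bsub>G3 G\<^esub> ?M y) ` gmul G w \<Longrightarrow> V \<sqsubseteq>\<^bsub>G3 G\<^esub> ?J"
    by auto
  have "mult3_right w \<sqsubseteq>\<^bsub>G3 G\<^esub> ?J"
    unfolding sup by (rule G3.sup_least [OF sub _ le_J]) (use J in \<open>simp_all add: G3_folds\<close>)
  then show "mult3_right w \<subseteq> ?J" by (simp only: G3_folds pb3.P_simps)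
  show "?J \<subseteq> mult3_right w"
  proof clarify
    fix U c assume U: "U \<in> carrier (G2 G)" "c \<in> carrier X" "U \<subseteq> ?R c"
    show "(U, c) \<in> mult3_right w"
    proof (rule mem_pb3I [OF I U(1,2)])
      fix a b assume "(a, b) \<in> U"
      then have m: "a \<in> carrier X" "b \<in> carrier X" "mul a (mul b c) \<sqsubseteq>\<^bsub>X\<^esub> w" using U(3) by auto
      have bc: "mul b c \<in> carrier X" using m U(2) mul_closed by simp
      have t: "pb2.tensor a b \<in> carrier (G2 G)"
        using pb2.tensor_ideal [OF m(1,2)] by (simp add: G2_folds)
      note cl = loc_mapD(1) [OF gtri1_map m(1)] loc_mapD(1) [OF gtri2_map m(2)]
        loc_mapD(1) [OF gtri3_map U(2)] M [OF bc]
      have "(b, c) \<in> gmul G (mul b c)" using m U(2) bc by (simp flip: mul_le_iff)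
      then have "gtri2 G b \<sqinter>\<^bsub>G3 G\<^esub> gtri3 G c \<sqsubseteq>\<^bsub>G3 G\<^esub> ?M (mul b c)"
        unfolding M_eq [OF bc] using G3.sup_upper [OF M_sub [OF bc]] by force
      then have "gtri1 G a \<sqinter>\<^bsub>G3 G\<^esub> (gtri2 G b \<sqinter>\<^bsub>G3 G\<^esub> gtri3 G c) \<sqsubseteq>\<^bsub>G3 G\<^esub>
          gtri1 G a \<sqinter>\<^bsub>G3 G\<^esub> ?M (mul b c)"
        using cl by (intro G3.meet_mono) auto
      also have "\<dots> \<sqsubseteq>\<^bsub>G3 G\<^esub> mult3_right w"
      proof -
        have "(a, mul b c) \<in> gmul G w" using m bc w by (simp flip: mul_le_iff)
        then show ?thesis unfolding sup using G3.sup_upper [OF sub] by force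
      qed
      finally have "gtri1 G a \<sqinter>\<^bsub>G3 G\<^esub> (gtri2 G b \<sqinter>\<^bsub>G3 G\<^esub> gtri3 G c) \<sqsubseteq>\<^bsub>G3 G\<^esub> mult3_right w"
        using cl G3.sup_closed [OF sub] by (simp add: sup)
      then have "pb3.tensor (pb2.tensor a b) c \<sqsubseteq>\<^bsub>G3 G\<^esub> mult3_right w"
        using tensor3_right m U(2) by simp
      then show "(pb2.tensor a b, c) \<in> mult3_right w"
        using pb3.tensor_le [OF t U(2) I] by (simp add: G3_folds)
    qed
  qed
qed

text \<open>Testing the two explicit ideals at (a \<otimes> b, c) shows that (a b) c and a (b c)
  have the same upper bounds; the converse substitutes one bracketing for the other.\<close>

lemma mult3_left_eq_right_iff:
  "mult3_left = mult3_right \<longleftrightarrow>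
    (\<forall>a\<in>carrier X. \<forall>b\<in>carrier X. \<forall>c\<in>carrier X. mul (mul a b) c = mul a (mul b c))"
proof
  assume *: "mult3_left = mult3_right"
  show "\<forall>a\<in>carrier X. \<forall>b\<in>carrier X. \<forall>c\<in>carrier X. mul (mul a b) c = mul a (mul b c)"
  proof (intro ballI X.eq_by_upper)
    fix a b c w
    assume c: "a \<in> carrier X" "b \<in> carrier X" "c \<in> carrier X" and w: "w \<in> carrier X"
    have t: "pb2.tensor a b \<in> carrier (G2 G)"
      using pb2.tensor_ideal [OF c(1,2)] by (simp add: G2_folds)
    have "mul (mul a b) c \<sqsubseteq>\<^bsub>X\<^esub> w \<longleftrightarrow> (pb2.tensor a b, c) \<in> mult3_left w"
      using c t pb2.tensor_le [OF c(1,2) ideal_left [OF w c(3)]] by (simp add: mult3_left_eq [OF w])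
    also have "\<dots> \<longleftrightarrow> mul a (mul b c) \<sqsubseteq>\<^bsub>X\<^esub> w"
      using c t pb2.tensor_le [OF c(1,2) ideal_right [OF w c(3)]]
      by (simp add: * mult3_right_eq [OF w])
    finally show "mul (mul a b) c \<sqsubseteq>\<^bsub>X\<^esub> w \<longleftrightarrow> mul a (mul b c) \<sqsubseteq>\<^bsub>X\<^esub> w" .
  qed (use mul_closed in auto)
next
  assume *: "\<forall>a\<in>carrier X. \<forall>b\<in>carrier X. \<forall>c\<in>carrier X. mul (mul a b) c = mul a (mul b c)"
  show "mult3_left = mult3_right"
  proof (rule extensionalityI [of _ "carrier X"])
    fix w assume "w \<in> carrier X"
    then show "mult3_left w = mult3_right w"
      by (simp add: mult3_left_eq mult3_right_eq) (use * in \<open>auto simp: subset_eq\<close>)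
  qed (simp_all add: mult3_left_def mult3_right_def)
qed

end

section \<open>The quantale of an etale groupoid\<close>

context loc_mult_graph
begin

text \<open>The inverse image of m composed with a pairing of p and q sends w to the join of the p x
  \<and> q y with x y \<le> w. This converts each unit or inverse law into a least upper bound
  statement about the product.\<close>

lemma gpair_le_iff:
  assumes W: "frame W" and p: "p \<in> loc_map W X" and q: "q \<in> loc_map W X"
    and w: "w \<in> carrier X" and v: "v \<in> carrier W"
  shows "gpair G W p q (gmul G w) \<sqsubseteq>\<^bsub>W\<^esub> v \<longleftrightarrow>
    (\<forall>x\<in>carrier X. \<forall>y\<in>carrier X. mul x y \<sqsubseteq>\<^bsub>X\<^esub> w \<longrightarrow> p x \<sqinter>\<^bsub>W\<^esub> q y \<sqsubseteq>\<^bsub>W\<^esub> v)"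
proof -
  interpret W: frame W by (rule W)
  note pD = loc_mapD(1) [OF p] and qD = loc_mapD(1) [OF q] and I = gmul_ideal [OF w]
  have sub: "(\<lambda>(x, y). p x \<sqinter>\<^bsub>W\<^esub> q y) ` gmul G w \<subseteq> carrier W"
    using pb2.ideal_mem [OF I] pD qD by auto
  show ?thesis
    unfolding G2_folds(4) pb2.pair_apply [OF I] W.sup_le_iff [OF sub v]
    using pb2.ideal_mem [OF I] mul_le_iff [OF _ _ w] by (auto 0 3)
qed

lemma gpair_upper:
  assumes W: "frame W" and p: "p \<in> loc_map W X" and q: "q \<in> loc_map W X"
    and "gpair G W p q (gmul G w) \<in> carrier W"
    and c: "x \<in> carrier X" "y \<in> carrier X" "w \<in> carrier X" "mul x y \<sqsubseteq>\<^bsub>X\<^esub> w"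
  shows "p x \<sqinter>\<^bsub>W\<^esub> q y \<sqsubseteq>\<^bsub>W\<^esub> gpair G W p q (gmul G w)"
proof -
  interpret W: frame W by (rule W)
  show ?thesis
    using gpair_le_iff [OF W p q c(3) assms(4)] assms(4) c W.le_refl by blast
qed

end

section \<open>Openness of the unit and of the multiplication\<close>

context etale_groupoid
begin

abbreviation "dd \<equiv> direct_image X Y d"

lemma d_open: "open_loc_map X Y d"
  using gdom_local_homeo by (simp add: local_homeomorphism_def)

lemma dd_adjoint: "left_adjoint X Y d dd"
  by (rule open_loc_mapD [OF d_open])

lemma dd_frob: "\<lbrakk>x \<in> carrier X; z \<in> carrier Y\<rbrakk> \<Longrightarrow> dd (x \<sqinter>\<^bsub>X\<^esub> d z) = dd x \<sqinter>\<^bsub>Y\<^esub> z"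
  by (rule open_loc_mapD [OF d_open])

lemmas dd_closed = left_adjointD(1) [OF dd_adjoint]
lemmas dd_le_iff = left_adjointD(2) [OF dd_adjoint]
lemmas dd_unit = left_adjoint_unit(1) [OF dd_adjoint gdom_map]
lemmas dd_mono = left_adjoint_unit(3) [OF dd_adjoint gdom_map]

lemmas d_closed = loc_mapD(1) [OF gdom_map]
lemmas r_closed = loc_mapD(1) [OF gran_map]
lemmas i_closed = loc_mapD(1) [OF ginv_map]
lemmas d_mono = loc_map_mono [OF gdom_map]
lemmas u_mono = loc_map_mono [OF gunit_map]
lemmas i_mono = loc_map_mono [OF ginv_map]

text \<open>The elements on which d is injective, in equational form: a part of s is recovered by
  restricting s to the domain of that part. This form is inherited downwards and can be transported
  by the frame homomorphisms u^* and i^*.\<close>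

definition dom_injective :: "'a \<Rightarrow> bool" where
  "dom_injective s \<longleftrightarrow> s \<in> carrier X \<and> (\<forall>x\<in>carrier X. x \<sqsubseteq>\<^bsub>X\<^esub> s \<longrightarrow> x = s \<sqinter>\<^bsub>X\<^esub> d (dd x))"

lemma dom_injectiveD:
  assumes "dom_injective s"
  shows "s \<in> carrier X" "\<lbrakk>x \<in> carrier X; x \<sqsubseteq>\<^bsub>X\<^esub> s\<rbrakk> \<Longrightarrow> s \<sqinter>\<^bsub>X\<^esub> d (dd x) = x"
  using assms by (auto simp: dom_injective_def)

lemma dom_injective_le:
  assumes s: "dom_injective s" and t: "t \<in> carrier X" "t \<sqsubseteq>\<^bsub>X\<^esub> s" shows "dom_injective t"
  unfolding dom_injective_def
proof (intro conjI ballI impI)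
  fix x assume x: "x \<in> carrier X" "x \<sqsubseteq>\<^bsub>X\<^esub> t"
  have "t \<sqinter>\<^bsub>X\<^esub> d (dd x) = (t \<sqinter>\<^bsub>X\<^esub> s) \<sqinter>\<^bsub>X\<^esub> d (dd x)"
    using t dom_injectiveD(1) [OF s] by (simp add: X.le_iff_meet_eq)
  also have "\<dots> = t \<sqinter>\<^bsub>X\<^esub> x"
    using t x dom_injectiveD [OF s] X.le_trans [of x t s] dd_closed d_closed by (simp add: X.meet_assoc)
  also have "\<dots> = x" using x t by (metis X.le_iff_meet_eq meet_comm)
  finally show "x = t \<sqinter>\<^bsub>X\<^esub> d (dd x)" by simp
qed (rule t(1))

lemma dom_injective_cover:
  obtains \<Gamma> where "\<Gamma> \<subseteq> carrier X" "\<Squnion>\<^bsub>X\<^esub>\<Gamma> = \<top>\<^bsub>X\<^esub>" "\<And>s. s \<in> \<Gamma> \<Longrightarrow> dom_injective s"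
proof -
  obtain \<Gamma> where \<Gamma>: "\<Gamma> \<subseteq> carrier X" "\<Squnion>\<^bsub>X\<^esub>\<Gamma> = \<top>\<^bsub>X\<^esub>"
      "\<And>s. s \<in> \<Gamma> \<Longrightarrow> bij_betw dd (down X s) (down Y (dd s))"
    using gdom_local_homeo unfolding local_homeomorphism_def by auto
  have "dom_injective s" if s: "s \<in> \<Gamma>" for s
    unfolding dom_injective_def
  proof (intro conjI ballI impI)
    show sX: "s \<in> carrier X" using s \<Gamma> by auto
    fix x assume x: "x \<in> carrier X" "x \<sqsubseteq>\<^bsub>X\<^esub> s"
    \<comment> \<open>By Frobenius \<open>?y\<close> has the same image as x under d_!. Both lie
      below s, where d_! is injective.\<close>
    let ?y = "s \<sqinter>\<^bsub>X\<^esub> d (dd x)"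
    have "dd ?y = dd s \<sqinter>\<^bsub>Y\<^esub> dd x" using sX x dd_closed by (simp add: dd_frob)
    also have "\<dots> = dd x"
      using sX x dd_closed dd_mono by (metis Y.le_iff_meet_eq meet_comm)
    finally have "dd ?y = dd x" .
    moreover have "?y \<in> down X s" "x \<in> down X s"
      using sX x dd_closed d_closed by (auto simp: down_def X.meet_left)
    ultimately show "x = ?y"
      using \<Gamma>(3) [OF s] by (auto simp: bij_betw_def inj_on_def)
  qed
  with \<Gamma> show ?thesis using that by blast
qed

text \<open>
  In terms of arrows, \<open>g \<in> s\<close> with \<open>d g \<in> u\<inverse> s \<inter> y\<close> has the same domain as the unit at \<open>d g\<close>, which
  also lies in \<open>s\<close>; if \<open>d\<close> is injective on \<open>s\<close>, then \<open>g\<close> is that unit. So \<open>u\<^sub>! y\<close> is the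
  join of the \<open>s \<and> d\<^sup>*(u\<^sup>* s \<and> y)\<close> over a cover by such \<open>s\<close>.
\<close>

lemma u_left_adjoint:
  obtains h where "left_adjoint Y X u h"
    "\<And>y a. \<lbrakk>y \<in> carrier Y; a \<in> carrier X\<rbrakk> \<Longrightarrow> h (y \<sqinter>\<^bsub>Y\<^esub> u a) = h y \<sqinter>\<^bsub>X\<^esub> a"
proof -
  obtain \<Gamma> where \<Gamma>: "\<Gamma> \<subseteq> carrier X" "\<Squnion>\<^bsub>X\<^esub>\<Gamma> = \<top>\<^bsub>X\<^esub>" "\<And>s. s \<in> \<Gamma> \<Longrightarrow> dom_injective s"
    using dom_injective_cover by blast
  define h where "h y = \<Squnion>\<^bsub>X\<^esub>((\<lambda>s. s \<sqinter>\<^bsub>X\<^esub> d (u s \<sqinter>\<^bsub>Y\<^esub> y)) ` \<Gamma>)" for y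
  have sub: "(\<lambda>s. s \<sqinter>\<^bsub>X\<^esub> d (u s \<sqinter>\<^bsub>Y\<^esub> y)) ` \<Gamma> \<subseteq> carrier X" if "y \<in> carrier Y" for y
    using that \<Gamma>(1) u_closed d_closed by (auto simp: subset_eq)
  have h_closed: "h y \<in> carrier X" if "y \<in> carrier Y" for y
    unfolding h_def using sub [OF that] by simp
  have uh: "u (h y) = y" if y: "y \<in> carrier Y" for y
  proof -
    have "u (h y) = \<Squnion>\<^bsub>Y\<^esub>(u ` (\<lambda>s. s \<sqinter>\<^bsub>X\<^esub> d (u s \<sqinter>\<^bsub>Y\<^esub> y)) ` \<Gamma>)"
      unfolding h_def using loc_mapD(3) [OF gunit_map sub [OF y]] .
    also have "u ` (\<lambda>s. s \<sqinter>\<^bsub>X\<^esub> d (u s \<sqinter>\<^bsub>Y\<^esub> y)) ` \<Gamma> = (\<lambda>s. s \<sqinter>\<^bsub>Y\<^esub> y) ` u ` \<Gamma>"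
      unfolding image_image
    proof (rule image_cong)
      fix s assume "s \<in> \<Gamma>"
      then have s: "s \<in> carrier X" "u s \<in> carrier Y" using \<Gamma>(1) u_closed by auto
      have "u (s \<sqinter>\<^bsub>X\<^esub> d (u s \<sqinter>\<^bsub>Y\<^esub> y)) = u s \<sqinter>\<^bsub>Y\<^esub> (u s \<sqinter>\<^bsub>Y\<^esub> y)"
        using s y d_closed by (simp add: loc_mapD(2) [OF gunit_map] structure_apply)
      then show "u (s \<sqinter>\<^bsub>X\<^esub> d (u s \<sqinter>\<^bsub>Y\<^esub> y)) = u s \<sqinter>\<^bsub>Y\<^esub> y"
        using s y by (simp add: Y.meet_idem flip: Y.meet_assoc)
    qed simp
    also have "\<Squnion>\<^bsub>Y\<^esub>\<dots> = \<Squnion>\<^bsub>Y\<^esub>(u ` \<Gamma>) \<sqinter>\<^bsub>Y\<^esub> y"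
      using \<Gamma>(1) u_closed y by (intro Y.sup_meet_distrib [symmetric]) auto
    also have "\<dots> = y"
      using loc_mapD(3) [OF gunit_map \<Gamma>(1)] \<Gamma>(2) loc_mapD(4) [OF gunit_map] y Y.meet_top by simp
    finally show ?thesis .
  qed
  have le: "s \<sqinter>\<^bsub>X\<^esub> d (u s \<sqinter>\<^bsub>Y\<^esub> u a) \<sqsubseteq>\<^bsub>X\<^esub> a" if s: "s \<in> \<Gamma>" and a: "a \<in> carrier X" for s a
  proof -
    let ?t = "s \<sqinter>\<^bsub>X\<^esub> a"
    have c: "s \<in> carrier X" "?t \<in> carrier X" using s a \<Gamma>(1) by auto
    \<comment> \<open>Applying u^* to the adjunction unit bounds u^* t by d_! t, because u^* d^* =
      1. Restricting s to d^*(d_! t) gives t back, and t lies below a.\<close>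
    have "?t \<sqsubseteq>\<^bsub>X\<^esub> d (dd ?t)" using dd_unit c by simp
    then have "u ?t \<sqsubseteq>\<^bsub>Y\<^esub> dd ?t"
      using u_mono [of ?t "d (dd ?t)"] c dd_closed d_closed by (simp add: structure_apply)
    then have "s \<sqinter>\<^bsub>X\<^esub> d (u ?t) \<sqsubseteq>\<^bsub>X\<^esub> s \<sqinter>\<^bsub>X\<^esub> d (dd ?t)"
      using c u_closed dd_closed d_closed by (intro X.meet_mono d_mono) auto
    also have "\<dots> = ?t"
      using dom_injectiveD(2) [OF \<Gamma>(3) [OF s]] c X.meet_left a by simp
    finally have "s \<sqinter>\<^bsub>X\<^esub> d (u ?t) \<sqsubseteq>\<^bsub>X\<^esub> a"
      using c a u_closed d_closed by (simp add: X.le_meet_iff)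
    then show ?thesis using c a by (simp add: loc_mapD(2) [OF gunit_map])
  qed
  have adj: "h y \<sqsubseteq>\<^bsub>X\<^esub> a \<longleftrightarrow> y \<sqsubseteq>\<^bsub>Y\<^esub> u a" if y: "y \<in> carrier Y" and a: "a \<in> carrier X" for y a
  proof
    show "y \<sqsubseteq>\<^bsub>Y\<^esub> u a" if "h y \<sqsubseteq>\<^bsub>X\<^esub> a"
      using u_mono [OF h_closed [OF y] a that] uh [OF y] by simp
    assume ya: "y \<sqsubseteq>\<^bsub>Y\<^esub> u a"
    have "s \<sqinter>\<^bsub>X\<^esub> d (u s \<sqinter>\<^bsub>Y\<^esub> y) \<sqsubseteq>\<^bsub>X\<^esub> a" if s: "s \<in> \<Gamma>" for s
    proof -
      have c: "s \<in> carrier X" using s \<Gamma>(1) by auto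
      have "s \<sqinter>\<^bsub>X\<^esub> d (u s \<sqinter>\<^bsub>Y\<^esub> y) \<sqsubseteq>\<^bsub>X\<^esub> s \<sqinter>\<^bsub>X\<^esub> d (u s \<sqinter>\<^bsub>Y\<^esub> u a)"
        using c y a ya u_closed d_closed by (intro X.meet_mono d_mono Y.meet_mono) auto
      then show ?thesis
        using le [OF s a] X.le_trans c y a u_closed d_closed
        by (meson X.meet_closed Y.meet_closed)
    qed
    then show "h y \<sqsubseteq>\<^bsub>X\<^esub> a" unfolding h_def using X.sup_le_iff [OF sub [OF y] a] by auto
  qed
  have frob: "h (y \<sqinter>\<^bsub>Y\<^esub> u a) = h y \<sqinter>\<^bsub>X\<^esub> a" if y: "y \<in> carrier Y" and a: "a \<in> carrier X" for y a
  proof (rule X.le_antisym)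
    have ya: "y \<sqinter>\<^bsub>Y\<^esub> u a \<in> carrier Y" using y a u_closed by simp
    show c: "h (y \<sqinter>\<^bsub>Y\<^esub> u a) \<in> carrier X" "h y \<sqinter>\<^bsub>X\<^esub> a \<in> carrier X"
      using h_closed ya y a by auto
    show "h (y \<sqinter>\<^bsub>Y\<^esub> u a) \<sqsubseteq>\<^bsub>X\<^esub> h y \<sqinter>\<^bsub>X\<^esub> a"
      using ya y a h_closed by (simp add: adj loc_mapD(2) [OF gunit_map] uh)
    have "s \<sqinter>\<^bsub>X\<^esub> d (u s \<sqinter>\<^bsub>Y\<^esub> y) \<sqinter>\<^bsub>X\<^esub> a \<sqsubseteq>\<^bsub>X\<^esub> h (y \<sqinter>\<^bsub>Y\<^esub> u a)" if s: "s \<in> \<Gamma>" for s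
    proof -
      let ?t = "s \<sqinter>\<^bsub>X\<^esub> a"
      have k: "s \<in> carrier X" "?t \<in> carrier X" "u s \<in> carrier Y" "u a \<in> carrier Y"
        "dd ?t \<in> carrier Y" "u ?t \<in> carrier Y"
        using s \<Gamma>(1) a u_closed dd_closed by auto
      have t: "s \<sqinter>\<^bsub>X\<^esub> d (dd ?t) = ?t"
        using dom_injectiveD(2) [OF \<Gamma>(3) [OF s]] k X.meet_left a by simp
      \<comment> \<open>Applying u^* to the previous equation gives u^* t = u^* s \<and> d_! t.
        Hence t \<and> d^*(u^* s) lies below d^*(u^* t), and so below d^*(u^* a): an arrow of s and
        a whose domain unit lies in s has that unit in a.\<close>
      have "u ?t = u s \<sqinter>\<^bsub>Y\<^esub> dd ?t"
        using arg_cong [OF t, of u] k d_closed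
        by (simp add: loc_mapD(2) [OF gunit_map] structure_apply del: X.meet_closed)
      then have "d (u ?t) = d (u s) \<sqinter>\<^bsub>X\<^esub> d (dd ?t)"
        using k by (simp add: loc_mapD(2) [OF gdom_map])
      moreover have "d (u ?t) \<sqsubseteq>\<^bsub>X\<^esub> d (u a)"
        using k a by (intro d_mono u_mono X.meet_right) auto
      moreover have "?t \<sqinter>\<^bsub>X\<^esub> d (u s) \<sqsubseteq>\<^bsub>X\<^esub> d (u s) \<sqinter>\<^bsub>X\<^esub> d (dd ?t)"
        unfolding meet_comm [of X ?t] using k d_closed dd_unit by (intro X.meet_mono) auto
      ultimately have *: "?t \<sqinter>\<^bsub>X\<^esub> d (u s) \<sqsubseteq>\<^bsub>X\<^esub> d (u a)"
        using X.le_trans [of "?t \<sqinter>\<^bsub>X\<^esub> d (u s)" "d (u ?t)" "d (u a)"] k d_closed by simp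
      let ?v = "s \<sqinter>\<^bsub>X\<^esub> d (u s \<sqinter>\<^bsub>Y\<^esub> y) \<sqinter>\<^bsub>X\<^esub> a"
      have dm: "d (u s \<sqinter>\<^bsub>Y\<^esub> y') = d (u s) \<sqinter>\<^bsub>X\<^esub> d y'" if "y' \<in> carrier Y" for y'
        using that k by (simp add: loc_mapD(2) [OF gdom_map])
      have v: "?v \<in> carrier X" using k y a d_closed by simp
      have v1: "?v \<sqsubseteq>\<^bsub>X\<^esub> s" "?v \<sqsubseteq>\<^bsub>X\<^esub> d (u s)" "?v \<sqsubseteq>\<^bsub>X\<^esub> d y" "?v \<sqsubseteq>\<^bsub>X\<^esub> a"
        using k y a d_closed by (simp_all add: dm X.meet_leI1 X.meet_leI2)
      then have v2: "?v \<sqsubseteq>\<^bsub>X\<^esub> d (u a)"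
        using X.le_trans [OF _ *, of ?v] v k a d_closed by (simp add: X.le_meet_iff)
      have "?v \<sqsubseteq>\<^bsub>X\<^esub> s \<sqinter>\<^bsub>X\<^esub> d (u s \<sqinter>\<^bsub>Y\<^esub> (y \<sqinter>\<^bsub>Y\<^esub> u a))"
        using v v1 v2 k y d_closed
        by (simp add: dm X.le_meet_iff loc_mapD(2) [OF gdom_map])
      also have "\<dots> \<sqsubseteq>\<^bsub>X\<^esub> h (y \<sqinter>\<^bsub>Y\<^esub> u a)"
        unfolding h_def using s X.sup_upper [OF sub [OF ya]] by auto
      finally show ?thesis using k y a c u_closed d_closed by simp
    qed
    then show "h y \<sqinter>\<^bsub>X\<^esub> a \<sqsubseteq>\<^bsub>X\<^esub> h (y \<sqinter>\<^bsub>Y\<^esub> u a)"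
      using sub [OF y] a c(1)
      by (subst h_def, subst X.sup_meet_distrib) (auto intro!: X.sup_least)
  qed
  have "left_adjoint Y X u (\<lambda>y\<in>carrier Y. h y)"
    using h_closed adj by (rule left_adjointI)
  moreover have "(\<lambda>y\<in>carrier Y. h y) (y \<sqinter>\<^bsub>Y\<^esub> u a) = (\<lambda>y\<in>carrier Y. h y) y \<sqinter>\<^bsub>X\<^esub> a"
    if "y \<in> carrier Y" "a \<in> carrier X" for y a
    using that frob u_closed by simp
  ultimately show ?thesis using that by blast
qed


text \<open>
  The map \<open>(g, h) \<mapsto> (g, g h)\<close> with inverse \<open>(g, k) \<mapsto> (g, g\<inverse> k)\<close> (inverse images \<open>\<phi>\<close> and \<open>\<psi>\<close>) turns \<open>m\<close> into
  the second projection of the pullback of \<open>d\<close> along itself, which is open because \<open>d\<close> is.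
\<close>

lemma m_left_adjoint:
  obtains h where "left_adjoint (G2 G) X m h"
    "\<And>U y. \<lbrakk>U \<in> carrier (G2 G); y \<in> carrier X\<rbrakk> \<Longrightarrow> h (U \<sqinter>\<^bsub>G2 G\<^esub> m y) = h U \<sqinter>\<^bsub>X\<^esub> y"
    "\<And>x. x \<in> carrier X \<Longrightarrow> h (gpi1 G x) = d (dd x)"
proof -
  interpret D: loc_cospan "G1 G" "G1 G" "G0 G" "gdom G" "gdom G"
    by (rule loc_cospan.intro)
      (use frame_G0 frame_G1 gdom_map in \<open>auto intro: loc_cospan_axioms.intro\<close>)
  let ?D = "pullback X X Y d d" and ?p1 = "pb_fst X X Y d d" and ?p2 = "pb_snd X X Y d d"
  have FD: "frame ?D" by (rule D.P_frame)
  interpret FD: frame ?D by (rule FD)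
  note p1 = D.proj1_map and p2 = D.proj2_map
  note ip1 = inverse_map [OF FD p1]
  have dd12: "?p1 (d z) = ?p2 (d z)" if "z \<in> carrier Y" for z
    by (rule D.proj_balance [OF that])
  have c1: "composable (inverse ?p1) ?p2"
    using dd12 by (simp add: composable_def inverse_ran)
  let ?q = "gprod ?D (inverse ?p1) ?p2"
  note q = gprod_map [OF FD ip1 p2 c1]
  have c2: "composable ?p1 ?q"
    by (simp add: composable_def gprod_dom [OF FD ip1 p2 c1] inverse_dom)
  define \<psi> where "\<psi> = gpair G ?D ?p1 ?q"
  define \<phi> where "\<phi> = pb_pair X X Y d d (G2 G) (gpi1 G) m"
  have \<psi>_map: "\<psi> \<in> loc_map ?D (G2 G)"
    unfolding \<psi>_def by (rule gpair_map [OF FD p1 q composableD [OF c2]])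
  note \<psi>_pi = gpair_pi [OF FD p1 q composableD [OF c2], folded \<psi>_def]
  have \<phi>c: "gpi1 G (d z) = m (d z)" if "z \<in> carrier Y" for z
    using that by (simp add: structure_apply)
  have \<phi>_map: "\<phi> \<in> loc_map (G2 G) ?D"
    unfolding \<phi>_def by (rule D.pair_map [OF G2.frame_axioms gpi1_map gmul_map \<phi>c])
  note \<phi>_proj = D.pair_proj [OF G2.frame_axioms gpi1_map gmul_map \<phi>c, folded \<phi>_def]
  have \<psi>m: "\<psi> (m x) = ?p2 x" if "x \<in> carrier X" for x
  proof -
    have "gprod ?D ?p1 ?q = gprod ?D (gprod ?D ?p1 (inverse ?p1)) ?p2"
      by (rule gprod_assoc [OF FD p1 ip1 p2 composable_inverse(1) [OF FD] c1, symmetric])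
    also have "\<dots> = gprod ?D (lunit ?p1) ?p2"
      by (simp add: gprod_inverse_right [OF FD p1])
    also have "lunit ?p1 = lunit ?p2"
      using dd12 by (rule lunit_cong)
    also have "gprod ?D (lunit ?p2) ?p2 = ?p2" by (rule gprod_lunit [OF FD p2])
    finally have "loc_comp X m \<psi> = ?p2" by (simp add: gprod_def \<psi>_def)
    then show ?thesis using that by (metis loc_comp_apply)
  qed
  have \<phi>\<psi>: "\<phi> (\<psi> U) = U" if U: "U \<in> carrier (G2 G)" for U
  proof -
    note F2 = G2.frame_axioms
    have e1: "loc_comp X ?p1 \<phi> = gpi1 G" and e2: "loc_comp X ?p2 \<phi> = m"
      using \<phi>_proj loc_mapD(5) [OF gpi1_map] loc_mapD(5) [OF gmul_map]
      by (auto intro: extensionalityI [of _ "carrier X"])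
    have e3: "loc_comp X (inverse ?p1) \<phi> = inverse (gpi1 G)"
      unfolding inverse_def loc_comp_assoc [OF ginv_map, symmetric] e1 by simp
    have "loc_comp X ?q \<phi> = gprod (G2 G) (inverse (gpi1 G)) m"
      by (simp add: gprod_comp [OF FD ip1 p2 c1 F2 \<phi>_map] e2 e3)
    also have "\<dots> = gprod (G2 G) (inverse (gpi1 G)) (gprod (G2 G) (gpi1 G) (gpi2 G))"
      by (simp add: gprod_pi)
    also have "\<dots> = gprod (G2 G) (gprod (G2 G) (inverse (gpi1 G)) (gpi1 G)) (gpi2 G)"
      by (rule gprod_assoc [OF F2 inverse_map [OF F2 gpi1_map] gpi1_map gpi2_map
            composable_inverse(2) [OF F2] composable_pi, symmetric])
    also have "\<dots> = gprod (G2 G) (lunit (gpi2 G)) (gpi2 G)"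
      by (simp add: gprod_inverse_left [OF F2 gpi1_map] runit_eq_lunit [OF composable_pi])
    also have "\<dots> = gpi2 G" by (rule gprod_lunit [OF F2 gpi2_map])
    finally have "loc_comp (G2 G) \<psi> \<phi> = gpair G (G2 G) (gpi1 G) (gpi2 G)"
      using gpair_comp [OF FD p1 q composableD [OF c2] F2 \<phi>_map] by (simp add: \<psi>_def e1)
    then have "\<phi> (\<psi> U) = gpair G (G2 G) (gpi1 G) (gpi2 G) U"
      using U by (metis loc_comp_apply)
    also have "\<dots> = U" using pb2.pair_self U by (simp add: G2_folds)
    finally show ?thesis .
  qed
  \<comment> \<open>\<open>k\<close> is the direct image along the second projection of
    \<open>?D\<close>. Since \<psi> takes m^* y to the second projection of y, \<phi> takes it back,
    and \<phi> \<psi> = 1, the composite of \<psi> and \<open>k\<close> is left adjoint to m^*.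
    Frobenius and the value on \<pi>1^* x transfer along \<psi>.\<close>
  define k where "k U = \<Squnion>\<^bsub>X\<^esub>((\<lambda>(x, y). d (dd x) \<sqinter>\<^bsub>X\<^esub> y) ` U)" for U
  note kD = D.left_adjoint_proj2 [OF dd_adjoint dd_frob, folded k_def]
  have \<psi>I: "D.ideal (\<psi> U)" if "U \<in> carrier (G2 G)" for U
    using loc_mapD(1) [OF \<psi>_map that] by simp
  let ?h = "\<lambda>U\<in>carrier (G2 G). k (\<psi> U)"
  show ?thesis
  proof
    show "left_adjoint (G2 G) X m ?h"
    proof (rule left_adjointI)
      show "k (\<psi> U) \<in> carrier X" if "U \<in> carrier (G2 G)" for U
        using kD(1) \<psi>I [OF that] by blast
      fix U y assume U: "U \<in> carrier (G2 G)" and y: "y \<in> carrier X"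
      have "k (\<psi> U) \<sqsubseteq>\<^bsub>X\<^esub> y \<longleftrightarrow> \<psi> U \<sqsubseteq>\<^bsub>?D\<^esub> ?p2 y"
        using kD(2) \<psi>I [OF U] y by simp
      also have "\<dots> \<longleftrightarrow> U \<sqsubseteq>\<^bsub>G2 G\<^esub> m y"
      proof
        assume "\<psi> U \<sqsubseteq>\<^bsub>?D\<^esub> ?p2 y"
        then have "\<phi> (\<psi> U) \<sqsubseteq>\<^bsub>G2 G\<^esub> \<phi> (?p2 y)"
          by (rule loc_map_mono [OF \<phi>_map loc_mapD(1) [OF \<psi>_map U] loc_mapD(1) [OF p2 y]])
        then show "U \<sqsubseteq>\<^bsub>G2 G\<^esub> m y" using \<phi>\<psi> [OF U] \<phi>_proj(2) [OF _ y] by simp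
      next
        assume "U \<sqsubseteq>\<^bsub>G2 G\<^esub> m y"
        then have "\<psi> U \<sqsubseteq>\<^bsub>?D\<^esub> \<psi> (m y)"
          by (rule loc_map_mono [OF \<psi>_map U loc_mapD(1) [OF gmul_map y]])
        then show "\<psi> U \<sqsubseteq>\<^bsub>?D\<^esub> ?p2 y" using \<psi>m [OF y] by simp
      qed
      finally show "k (\<psi> U) \<sqsubseteq>\<^bsub>X\<^esub> y \<longleftrightarrow> U \<sqsubseteq>\<^bsub>G2 G\<^esub> m y" .
    qed
    show "?h (U \<sqinter>\<^bsub>G2 G\<^esub> m y) = ?h U \<sqinter>\<^bsub>X\<^esub> y"
      if U: "U \<in> carrier (G2 G)" and y: "y \<in> carrier X" for U y
    proof -
      have "\<psi> (U \<sqinter>\<^bsub>G2 G\<^esub> m y) = \<psi> U \<inter> ?p2 y"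
        using U y loc_mapD(1) [OF gmul_map y] loc_mapD(2) [OF \<psi>_map] \<psi>m
          D.P_meet [OF \<psi>I [OF U], of "?p2 y"] loc_mapD(1) [OF p2 y] by simp
      then show ?thesis
        using U y loc_mapD(1) [OF gmul_map y] kD(3) [OF _ _ \<psi>I [OF U] y] by simp
    qed
    show "?h (gpi1 G x) = d (dd x)" if x: "x \<in> carrier X" for x
      using kD(4) [OF _ _ x] \<psi>_pi(1) [OF _ x] loc_mapD(1) [OF gpi1_map x] by simp
  qed
qed

definition qm :: "'a \<Rightarrow> 'a \<Rightarrow> 'a" where
  "qm a b = direct_image (G2 G) X m (gpi1 G a \<sqinter>\<^bsub>G2 G\<^esub> gpi2 G b)"

lemma tensor_G2:
  assumes "a \<in> carrier X" "b \<in> carrier X"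
  shows "gpi1 G a \<sqinter>\<^bsub>G2 G\<^esub> gpi2 G b = pb2.tensor a b" "pb2.tensor a b \<in> carrier (G2 G)"
  using assms pb2.tensor_eq_meet pb2.tensor_ideal by (simp_all add: G2_folds)

lemma m_direct_image:
  shows "left_adjoint (G2 G) X m (direct_image (G2 G) X m)"
    and "\<lbrakk>U \<in> carrier (G2 G); y \<in> carrier X\<rbrakk> \<Longrightarrow>
      direct_image (G2 G) X m (U \<sqinter>\<^bsub>G2 G\<^esub> m y) = direct_image (G2 G) X m U \<sqinter>\<^bsub>X\<^esub> y"
    and "x \<in> carrier X \<Longrightarrow> direct_image (G2 G) X m (gpi1 G x) = d (dd x)"
proof -
  obtain h where h: "left_adjoint (G2 G) X m h"
    "\<And>U y. \<lbrakk>U \<in> carrier (G2 G); y \<in> carrier X\<rbrakk> \<Longrightarrow> h (U \<sqinter>\<^bsub>G2 G\<^esub> m y) = h U \<sqinter>\<^bsub>X\<^esub> y"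
    "\<And>x. x \<in> carrier X \<Longrightarrow> h (gpi1 G x) = d (dd x)"
    using m_left_adjoint by blast
  have "direct_image (G2 G) X m = h"
    by (rule direct_image_eq [OF _ _ h(1)]) unfold_locales
  with h show "left_adjoint (G2 G) X m (direct_image (G2 G) X m)"
    "\<lbrakk>U \<in> carrier (G2 G); y \<in> carrier X\<rbrakk> \<Longrightarrow>
      direct_image (G2 G) X m (U \<sqinter>\<^bsub>G2 G\<^esub> m y) = direct_image (G2 G) X m U \<sqinter>\<^bsub>X\<^esub> y"
    "x \<in> carrier X \<Longrightarrow> direct_image (G2 G) X m (gpi1 G x) = d (dd x)"
    by auto
qed

sublocale Q: loc_mult_graph G qm
proof
  show "m \<in> loc_map (G2 G) X" by (rule gmul_map)
  note mD = left_adjointD [OF m_direct_image(1)]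
  show "qm x y \<in> carrier X" if "x \<in> carrier X" "y \<in> carrier X" for x y
    unfolding qm_def using mD(1) tensor_G2 [OF that] by simp
  show "qm x y \<sqsubseteq>\<^bsub>X\<^esub> w \<longleftrightarrow> (x, y) \<in> m w"
    if "x \<in> carrier X" "y \<in> carrier X" "w \<in> carrier X" for x y w
    unfolding qm_def using mD(2) tensor_G2 [OF that(1,2)] that loc_mapD(1) [OF gmul_map, of w]
      pb2.tensor_le [OF that(1,2), of "m w"] by (simp add: G2_folds)
  show "qm (x \<sqinter>\<^bsub>X\<^esub> d z) y = qm x y \<sqinter>\<^bsub>X\<^esub> d z"
    if c: "x \<in> carrier X" "y \<in> carrier X" "z \<in> carrier Y" for x y z
  proof -
    note cl = loc_mapD(1) [OF gpi1_map] loc_mapD(1) [OF gpi2_map]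
    have "gpi1 G (x \<sqinter>\<^bsub>X\<^esub> d z) \<sqinter>\<^bsub>G2 G\<^esub> gpi2 G y = gpi1 G x \<sqinter>\<^bsub>G2 G\<^esub> gpi2 G y \<sqinter>\<^bsub>G2 G\<^esub> m (d z)"
      using c cl d_closed
      by (simp add: loc_mapD(2) [OF gpi1_map] structure_apply G2.meet_assoc
          meet_comm [of "G2 G" "gpi1 G (d z)"])
    then show ?thesis
      unfolding qm_def using m_direct_image(2) [of "gpi1 G x \<sqinter>\<^bsub>G2 G\<^esub> gpi2 G y" "d z"] c cl d_closed
      by simp
  qed
  show "qm x (y \<sqinter>\<^bsub>X\<^esub> r z) = qm x y \<sqinter>\<^bsub>X\<^esub> r z"
    if c: "x \<in> carrier X" "y \<in> carrier X" "z \<in> carrier Y" for x y z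
  proof -
    note cl = loc_mapD(1) [OF gpi1_map] loc_mapD(1) [OF gpi2_map]
    have "gpi1 G x \<sqinter>\<^bsub>G2 G\<^esub> gpi2 G (y \<sqinter>\<^bsub>X\<^esub> r z) = gpi1 G x \<sqinter>\<^bsub>G2 G\<^esub> gpi2 G y \<sqinter>\<^bsub>G2 G\<^esub> m (r z)"
      using c cl r_closed
      by (simp add: loc_mapD(2) [OF gpi2_map] structure_apply G2.meet_assoc)
    then show ?thesis
      unfolding qm_def using m_direct_image(2) [of "gpi1 G x \<sqinter>\<^bsub>G2 G\<^esub> gpi2 G y" "r z"] c cl r_closed
      by simp
  qed
qed

text \<open>The arrows of x 1 are those whose domain is the domain of an arrow of x; algebraically
  this is the Beck-Chevalley identity for m and d.\<close>

lemma qm_top: "x \<in> carrier X \<Longrightarrow> qm x \<top>\<^bsub>X\<^esub> = d (dd x)"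
  unfolding qm_def using m_direct_image(3) loc_mapD(1) [OF gpi1_map]
  by (simp add: loc_mapD(4) [OF gpi2_map] G2.meet_top)

lemma qm_assoc:
  "\<lbrakk>a \<in> carrier X; b \<in> carrier X; c \<in> carrier X\<rbrakk> \<Longrightarrow> qm (qm a b) c = qm a (qm b c)"
  using Q.mult3_left_eq_right_iff mul_assoc by (simp add: Q.mult3_left_def Q.mult3_right_def)

end

text \<open>The lattice operations are defined through \<open>least\<close>, \<open>greatest\<close>
  and bounds, which read only the carrier and the order. The locale of arrows, the quantale and the
  rebuilt groupoid can thus share them although they are different records.\<close>

lemma gorder_cong:
  assumes "carrier L = carrier M" "le L = le M"
  shows "\<Squnion>\<^bsub>L\<^esub>A = \<Squnion>\<^bsub>M\<^esub>A" "x \<sqinter>\<^bsub>L\<^esub> y = x \<sqinter>\<^bsub>M\<^esub> y" "x \<squnion>\<^bsub>L\<^esub> y = x \<squnion>\<^bsub>M\<^esub> y"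
    "\<top>\<^bsub>L\<^esub> = \<top>\<^bsub>M\<^esub>"
proof -
  have "least L = least M" "greatest L = greatest M" "Upper L = Upper M" "Lower L = Lower M"
    using assms by (auto simp: fun_eq_iff least_def greatest_def Upper_def Lower_def)
  then show "\<Squnion>\<^bsub>L\<^esub>A = \<Squnion>\<^bsub>M\<^esub>A" "x \<sqinter>\<^bsub>L\<^esub> y = x \<sqinter>\<^bsub>M\<^esub> y" "x \<squnion>\<^bsub>L\<^esub> y = x \<squnion>\<^bsub>M\<^esub> y"
    "\<top>\<^bsub>L\<^esub> = \<top>\<^bsub>M\<^esub>"
    using assms by (simp_all add: sup_def inf_def meet_def join_def top_def)
qed

lemma frame_cong:
  assumes L: "frame L" and eqs: "carrier L = carrier M" "eq L = eq M" "le L = le M"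
  shows "frame M"
proof -
  interpret L: frame L by (rule L)
  note [simp] = eqs(1,3) [symmetric]
  have eqM: "eq M = (=)" using eqs(2) L.eq_is_equal by simp
  have bounds: "least M = least L" "greatest M = greatest L" "Upper M = Upper L" "Lower M = Lower L"
    by (auto simp: fun_eq_iff least_def greatest_def Upper_def Lower_def)
  note lat = gorder_cong [OF eqs(1,3), symmetric]
  interpret M: partial_order M
    by unfold_locales (auto simp: eqM intro: L.le_trans L.le_antisym)
  show ?thesis
  proof
    show "\<exists>s. least M s (Upper M A)" if "A \<subseteq> carrier M" for A
      using that L.sup_exists by (simp add: bounds)
    show "\<exists>s. greatest M s (Lower M A)" if "A \<subseteq> carrier M" for A
      using that L.inf_exists by (simp add: bounds)
    show "x \<sqinter>\<^bsub>M\<^esub> \<Squnion>\<^bsub>M\<^esub>A = \<Squnion>\<^bsub>M\<^esub>((\<lambda>a. x \<sqinter>\<^bsub>M\<^esub> a) ` A)"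
      if "x \<in> carrier M" "A \<subseteq> carrier M" for x A
      using that L.meet_sup_distrib by (simp add: lat)
  qed
qed

section \<open>Involution, unit, supports and partial units of the quantale\<close>

context etale_groupoid
begin

lemma i_i: "x \<in> carrier X \<Longrightarrow> i (i x) = x"
proof -
  assume x: "x \<in> carrier X"
  have "inverse (inverse (loc_id X)) x = loc_id X x"
    using inverse_inverse [OF X.frame_axioms id_map] by simp
  then show ?thesis using x i_closed by (simp add: inverse_apply)
qed

lemma i_le_iff:
  assumes "x \<in> carrier X" "y \<in> carrier X"
  shows "i x \<sqsubseteq>\<^bsub>X\<^esub> y \<longleftrightarrow> x \<sqsubseteq>\<^bsub>X\<^esub> i y"
  using assms i_mono [of "i x" y] i_mono [of x "i y"] i_closed i_i by auto

lemma i_direct_image: "x \<in> carrier X \<Longrightarrow> direct_image X X i x = i x"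
  by (rule direct_image_apply [OF ginv_map]) (use i_closed i_le_iff in auto)

text \<open>The law (g h)^-1 = h^-1 g^-1, taken from \<open>inverse_gprod\<close> for the universal
  pair and read on inverse images. \<open>?S\<close> is an ideal because i exchanges d and r, so its
  balancing condition is that of \<open>m w\<close> with the factors swapped.\<close>

lemma m_i:
  assumes w: "w \<in> carrier X"
  shows "m (i w) = {(a, b). a \<in> carrier X \<and> b \<in> carrier X \<and> (i b, i a) \<in> m w}" (is "_ = ?S")
proof
  have I: "pb2.ideal (m w)" "pb2.ideal (m (i w))" using Q.gmul_ideal w i_closed by auto
  note iD = loc_mapD [OF ginv_map]
  have S: "pb2.ideal ?S"
  proof (rule pb2.idealI, goal_cases)
    case 1 show ?case by auto
  next
    case (2 x y a b)
    then have ba: "a \<in> carrier X" "b \<in> carrier X" "(i b, i a) \<in> m w" by auto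
    have "(i y, i x) \<in> m w"
      by (rule pb2.mem_tensor_mono [OF I(1) ba(3)]) (use 2 ba i_closed i_mono in auto)
    with 2 show ?case by simp
  next
    case (3 A y)
    then have "(i y, \<Squnion>\<^bsub>X\<^esub>(i ` A)) \<in> m w"
      using i_closed by (intro pb2.idealD(4) [OF I(1)]) auto
    with 3 show ?case by (simp add: iD(3))
  next
    case (4 x B)
    then have "(\<Squnion>\<^bsub>X\<^esub>(i ` B), i x) \<in> m w"
      using i_closed by (intro pb2.idealD(3) [OF I(1)]) auto
    with 4 show ?case by (simp add: iD(3))
  next
    case (5 x y z)
    then have "(i y \<sqinter>\<^bsub>X\<^esub> r z, i x) \<in> m w \<longleftrightarrow> (i y, d z \<sqinter>\<^bsub>X\<^esub> i x) \<in> m w"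
      using i_closed pb2.idealD(5) [OF I(1)] by simp
    with 5 show ?case
      by (simp add: iD(2) structure_apply meet_comm [of X "r z"] meet_comm [of X "i x"])
  qed
  note F2 = G2.frame_axioms
  note ip1 = inverse_map [OF F2 gpi1_map] and ip2 = inverse_map [OF F2 gpi2_map]
  have "m (i w) = inverse m w" using w by (simp add: inverse_apply)
  also have "inverse m = gprod (G2 G) (inverse (gpi2 G)) (inverse (gpi1 G))"
    using inverse_gprod [OF F2 gpi1_map gpi2_map composable_pi] gprod_pi by simp
  finally have eq: "m (i w) = gpair G (G2 G) (inverse (gpi2 G)) (inverse (gpi1 G)) (m w)"
    using w by (simp add: gprod_def)
  have gen: "inverse (gpi2 G) x \<sqinter>\<^bsub>G2 G\<^esub> inverse (gpi1 G) y = pb2.tensor (i y) (i x)"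
    if "x \<in> carrier X" "y \<in> carrier X" for x y
    using that tensor_G2 i_closed by (simp add: inverse_apply meet_comm [of "G2 G" "gpi2 G _"])
  have "m (i w) \<sqsubseteq>\<^bsub>G2 G\<^esub> ?S"
    unfolding eq
  proof (subst Q.gpair_le_iff [OF F2 ip2 ip1 w], goal_cases)
    case 1 show ?case using S by (simp add: G2_folds)
  next
    case 2
    show ?case
    proof (intro ballI impI)
      fix x y assume xy: "x \<in> carrier X" "y \<in> carrier X" "qm x y \<sqsubseteq>\<^bsub>X\<^esub> w"
      then have "(i y, i x) \<in> ?S" using i_closed w by (simp add: i_i Q.mul_le_iff)
      then show "inverse (gpi2 G) x \<sqinter>\<^bsub>G2 G\<^esub> inverse (gpi1 G) y \<sqsubseteq>\<^bsub>G2 G\<^esub> ?S"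
        using xy i_closed pb2.tensor_le [OF _ _ S] by (simp add: gen) (simp add: G2_folds)
    qed
  qed
  then show "m (i w) \<subseteq> ?S" by (simp add: G2_folds)
  show "?S \<subseteq> m (i w)"
  proof clarify
    fix a b assume ab: "a \<in> carrier X" "b \<in> carrier X" "(i b, i a) \<in> m w"
    have "inverse (gpi2 G) (i b) \<sqinter>\<^bsub>G2 G\<^esub> inverse (gpi1 G) (i a) \<sqsubseteq>\<^bsub>G2 G\<^esub> m (i w)"
      unfolding eq
      using ab w i_closed Q.mul_le_iff loc_mapD(1) [OF gmul_map, of "i w", unfolded eq]
      by (intro Q.gpair_upper [OF F2 ip2 ip1]) auto
    then have "pb2.tensor a b \<subseteq> m (i w)"
      using ab i_closed by (simp add: gen i_i) (simp add: G2_folds)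
    then show "(a, b) \<in> m (i w)" using pb2.tensor_le [OF ab(1,2) I(2)] by simp
  qed
qed

lemma i_qm:
  assumes "a \<in> carrier X" "b \<in> carrier X"
  shows "i (qm a b) = qm (i b) (i a)"
  using assms i_closed Q.mul_closed
  by (intro X.eq_by_upper) (simp_all add: i_le_iff Q.mul_le_iff m_i)

abbreviation "uu \<equiv> direct_image Y X u"

lemma uu_adjoint: "left_adjoint Y X u uu"
  and uu_frob: "\<lbrakk>y \<in> carrier Y; a \<in> carrier X\<rbrakk> \<Longrightarrow> uu (y \<sqinter>\<^bsub>Y\<^esub> u a) = uu y \<sqinter>\<^bsub>X\<^esub> a"
proof -
  obtain h where h: "left_adjoint Y X u h"
    "\<And>y a. \<lbrakk>y \<in> carrier Y; a \<in> carrier X\<rbrakk> \<Longrightarrow> h (y \<sqinter>\<^bsub>Y\<^esub> u a) = h y \<sqinter>\<^bsub>X\<^esub> a"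
    using u_left_adjoint by blast
  have "uu = h" by (rule direct_image_eq [OF _ _ h(1)]) unfold_locales
  with h show "left_adjoint Y X u uu"
    "\<lbrakk>y \<in> carrier Y; a \<in> carrier X\<rbrakk> \<Longrightarrow> uu (y \<sqinter>\<^bsub>Y\<^esub> u a) = uu y \<sqinter>\<^bsub>X\<^esub> a" by auto
qed

lemmas uu_closed = left_adjointD(1) [OF uu_adjoint]
lemmas uu_le_iff = left_adjointD(2) [OF uu_adjoint]

abbreviation "e \<equiv> uu \<top>\<^bsub>Y\<^esub>"

lemma e_closed: "e \<in> carrier X"
  using uu_closed Y.top_in .

lemma uu_u: "a \<in> carrier X \<Longrightarrow> uu (u a) = a \<sqinter>\<^bsub>X\<^esub> e"
  using uu_frob [OF Y.top_in] u_closed Y.meet_top Y.top_in meet_comm [of X a] by simp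

text \<open>The unit map is a section of d: from u^* d^* = 1 one gets u_! y \<le> d^* y, and
  applying u^* to this gives the inequality that adjunction alone does not.\<close>

lemma u_uu: "y \<in> carrier Y \<Longrightarrow> u (uu y) = y"
proof (rule Y.le_antisym)
  assume y: "y \<in> carrier Y"
  then show "y \<sqsubseteq>\<^bsub>Y\<^esub> u (uu y)" using left_adjoint_unit(1) [OF uu_adjoint gunit_map] by simp
  have "uu y \<sqsubseteq>\<^bsub>X\<^esub> d y" using y uu_le_iff d_closed structure_apply by simp
  then show "u (uu y) \<sqsubseteq>\<^bsub>Y\<^esub> y" using y u_mono [of "uu y" "d y"] uu_closed d_closed structure_apply by simp
qed (use u_closed uu_closed in auto)

lemma dd_uu: "y \<in> carrier Y \<Longrightarrow> dd (uu y) = y"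
  by (rule Y.eq_by_upper)
    (use uu_closed dd_closed d_closed structure_apply in \<open>auto simp: dd_le_iff uu_le_iff\<close>)

lemma uu_le_e: "y \<in> carrier Y \<Longrightarrow> uu y \<sqsubseteq>\<^bsub>X\<^esub> e"
  using left_adjoint_unit(3) [OF uu_adjoint gunit_map] Y.top_in Y.le_top by simp

lemma le_e_eq: "\<lbrakk>b \<in> carrier X; b \<sqsubseteq>\<^bsub>X\<^esub> e\<rbrakk> \<Longrightarrow> uu (u b) = b"
  using uu_u X.le_iff_meet_eq e_closed by simp

text \<open>The law u(d g) g = g says that w is the least upper bound of the d^*(u^* x) \<and> y
  with x y \<le> w. The two statements are the two halves of this.\<close>

lemma unit_law_left:
  "\<lbrakk>x \<in> carrier X; y \<in> carrier X\<rbrakk> \<Longrightarrow> d (u x) \<sqinter>\<^bsub>X\<^esub> y \<sqsubseteq>\<^bsub>X\<^esub> qm x y"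
  "\<lbrakk>w \<in> carrier X; v \<in> carrier X;
    \<And>x y. \<lbrakk>x \<in> carrier X; y \<in> carrier X; qm x y \<sqsubseteq>\<^bsub>X\<^esub> w\<rbrakk> \<Longrightarrow> d (u x) \<sqinter>\<^bsub>X\<^esub> y \<sqsubseteq>\<^bsub>X\<^esub> v\<rbrakk> \<Longrightarrow> w \<sqsubseteq>\<^bsub>X\<^esub> v"
proof -
  have eq: "gpair G X (loc_comp X u d) (loc_id X) (m w) = w" if "w \<in> carrier X" for w
    using that fun_cong [OF unit_mul, of w] by simp
  show "d (u x) \<sqinter>\<^bsub>X\<^esub> y \<sqsubseteq>\<^bsub>X\<^esub> qm x y" if "x \<in> carrier X" "y \<in> carrier X"
    using Q.gpair_upper [OF X.frame_axioms ud_map id_map _ that, of "qm x y"] that Q.mul_closed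
    by (simp add: eq)
  show "w \<sqsubseteq>\<^bsub>X\<^esub> v" if "w \<in> carrier X" "v \<in> carrier X"
    "\<And>x y. \<lbrakk>x \<in> carrier X; y \<in> carrier X; qm x y \<sqsubseteq>\<^bsub>X\<^esub> w\<rbrakk> \<Longrightarrow> d (u x) \<sqinter>\<^bsub>X\<^esub> y \<sqsubseteq>\<^bsub>X\<^esub> v"
    using Q.gpair_le_iff [OF X.frame_axioms ud_map id_map that(1,2)] that by (simp add: eq)
qed

lemma unit_law_right:
  "\<lbrakk>x \<in> carrier X; y \<in> carrier X\<rbrakk> \<Longrightarrow> x \<sqinter>\<^bsub>X\<^esub> r (u y) \<sqsubseteq>\<^bsub>X\<^esub> qm x y"
  "\<lbrakk>w \<in> carrier X; v \<in> carrier X;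
    \<And>x y. \<lbrakk>x \<in> carrier X; y \<in> carrier X; qm x y \<sqsubseteq>\<^bsub>X\<^esub> w\<rbrakk> \<Longrightarrow> x \<sqinter>\<^bsub>X\<^esub> r (u y) \<sqsubseteq>\<^bsub>X\<^esub> v\<rbrakk> \<Longrightarrow> w \<sqsubseteq>\<^bsub>X\<^esub> v"
proof -
  have eq: "gpair G X (loc_id X) (loc_comp X u r) (m w) = w" if "w \<in> carrier X" for w
    using that fun_cong [OF mul_unit, of w] by simp
  show "x \<sqinter>\<^bsub>X\<^esub> r (u y) \<sqsubseteq>\<^bsub>X\<^esub> qm x y" if "x \<in> carrier X" "y \<in> carrier X"
    using Q.gpair_upper [OF X.frame_axioms id_map ur_map _ that, of "qm x y"] that Q.mul_closed
    by (simp add: eq)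
  show "w \<sqsubseteq>\<^bsub>X\<^esub> v" if "w \<in> carrier X" "v \<in> carrier X"
    "\<And>x y. \<lbrakk>x \<in> carrier X; y \<in> carrier X; qm x y \<sqsubseteq>\<^bsub>X\<^esub> w\<rbrakk> \<Longrightarrow> x \<sqinter>\<^bsub>X\<^esub> r (u y) \<sqsubseteq>\<^bsub>X\<^esub> v"
    using Q.gpair_le_iff [OF X.frame_axioms id_map ur_map that(1,2)] that by (simp add: eq)
qed

text \<open>Of g g^-1 = u(d g) this is the upper bound half, which yields the support axiom. Of g^-1
  g = u(r g) the next lemma keeps the least upper bound half, which yields s^* s \<le> e.\<close>

lemma inverse_law_right:
  "\<lbrakk>x \<in> carrier X; y \<in> carrier X\<rbrakk> \<Longrightarrow> x \<sqinter>\<^bsub>X\<^esub> i y \<sqsubseteq>\<^bsub>X\<^esub> d (u (qm x y))"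
proof -
  have eq: "gpair G X (loc_id X) i (m w) = d (u w)" if "w \<in> carrier X" for w
    using that fun_cong [OF mul_inv, of w] by simp
  show "x \<sqinter>\<^bsub>X\<^esub> i y \<sqsubseteq>\<^bsub>X\<^esub> d (u (qm x y))" if "x \<in> carrier X" "y \<in> carrier X"
    using Q.gpair_upper [OF X.frame_axioms id_map ginv_map _ that, of "qm x y"] that Q.mul_closed
      d_closed u_closed
    by (simp add: eq)
qed

lemma inverse_law_left:
  "\<lbrakk>w \<in> carrier X; v \<in> carrier X;
    \<And>x y. \<lbrakk>x \<in> carrier X; y \<in> carrier X; qm x y \<sqsubseteq>\<^bsub>X\<^esub> w\<rbrakk> \<Longrightarrow> i x \<sqinter>\<^bsub>X\<^esub> y \<sqsubseteq>\<^bsub>X\<^esub> v\<rbrakk> \<Longrightarrow>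
    r (u w) \<sqsubseteq>\<^bsub>X\<^esub> v"
proof -
  have eq: "gpair G X i (loc_id X) (m w) = r (u w)" if "w \<in> carrier X" for w
    using that fun_cong [OF inv_mul, of w] by simp
  show "r (u w) \<sqsubseteq>\<^bsub>X\<^esub> v" if "w \<in> carrier X" "v \<in> carrier X"
    "\<And>x y. \<lbrakk>x \<in> carrier X; y \<in> carrier X; qm x y \<sqsubseteq>\<^bsub>X\<^esub> w\<rbrakk> \<Longrightarrow> i x \<sqinter>\<^bsub>X\<^esub> y \<sqsubseteq>\<^bsub>X\<^esub> v"
    using Q.gpair_le_iff [OF X.frame_axioms ginv_map id_map that(1,2)] that by (simp add: eq)
qed

lemma e_meet_d: "w \<in> carrier Y \<Longrightarrow> e \<sqinter>\<^bsub>X\<^esub> d w = uu w"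
  and e_meet_r: "w \<in> carrier Y \<Longrightarrow> e \<sqinter>\<^bsub>X\<^esub> r w = uu w"
  using uu_u [of "d w"] uu_u [of "r w"] d_closed r_closed structure_apply meet_comm [of X e] by auto

lemma uu_u_le: "a \<in> carrier X \<Longrightarrow> uu (u a) \<sqsubseteq>\<^bsub>X\<^esub> a"
  by (rule left_adjoint_unit(2) [OF uu_adjoint gunit_map])

lemma u_e: "u e = \<top>\<^bsub>Y\<^esub>"
  using u_uu [OF Y.top_in] .

lemma qm_e_left:
  assumes y: "y \<in> carrier X" shows "qm e y = y"
proof (rule X.le_antisym)
  show "qm e y \<in> carrier X" "y \<in> carrier X" using y e_closed Q.mul_closed by auto
  show "y \<sqsubseteq>\<^bsub>X\<^esub> qm e y"
    using unit_law_left(1) [OF e_closed y] y X.meet_top by (simp add: u_e loc_mapD(4) [OF gdom_map])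
  \<comment> \<open>\<open>?v\<close> is the largest x with e x \<le> y, so y \<le>
    \<open>?v\<close> is enough. The unit law reduces this to d^*(u^* p) \<and> q with p q \<le> y,
    where balancing gives e (d^*(u^* p) \<and> q) = (e \<and> r^*(u^* p)) q = u_!(u^* p) q \<le> p
    q.\<close>
  let ?v = "\<Squnion>\<^bsub>X\<^esub>{x \<in> carrier X. qm e x \<sqsubseteq>\<^bsub>X\<^esub> y}"
  have v: "?v \<in> carrier X" by (rule X.sup_closed) auto
  have "y \<sqsubseteq>\<^bsub>X\<^esub> ?v"
  proof (rule unit_law_left(2) [OF y v])
    fix p q assume pq: "p \<in> carrier X" "q \<in> carrier X" "qm p q \<sqsubseteq>\<^bsub>X\<^esub> y"
    have dp: "u p \<in> carrier Y" "d (u p) \<in> carrier X" using pq u_closed d_closed by auto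
    have "qm e (d (u p) \<sqinter>\<^bsub>X\<^esub> q) = qm (e \<sqinter>\<^bsub>X\<^esub> r (u p)) q"
      by (rule Q.mul_balance [symmetric]) (fact e_closed pq(2) dp(1))+
    also have "e \<sqinter>\<^bsub>X\<^esub> r (u p) = uu (u p)" by (rule e_meet_r [OF dp(1)])
    also have "qm (uu (u p)) q \<sqsubseteq>\<^bsub>X\<^esub> qm p q"
      using pq uu_u_le uu_closed dp by (intro Q.mul_mono) auto
    finally have "qm e (d (u p) \<sqinter>\<^bsub>X\<^esub> q) \<sqsubseteq>\<^bsub>X\<^esub> y"
      using pq dp e_closed y Q.mul_closed X.le_trans [of _ "qm p q" y] by simp
    then show "d (u p) \<sqinter>\<^bsub>X\<^esub> q \<sqsubseteq>\<^bsub>X\<^esub> ?v"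
      using pq dp by (intro X.sup_upper) auto
  qed
  then have "qm e y \<sqsubseteq>\<^bsub>X\<^esub> qm e ?v" using y v e_closed by (intro Q.mul_mono) auto
  also have "qm e ?v \<sqsubseteq>\<^bsub>X\<^esub> y"
    using y e_closed Q.mul_closed by (auto simp: Q.mul_sup_right intro!: X.sup_least)
  finally show "qm e y \<sqsubseteq>\<^bsub>X\<^esub> y" using y v e_closed Q.mul_closed by simp
qed

lemma qm_e_right:
  assumes x: "x \<in> carrier X" shows "qm x e = x"
proof (rule X.le_antisym)
  show "qm x e \<in> carrier X" "x \<in> carrier X" using x e_closed Q.mul_closed by auto
  show "x \<sqsubseteq>\<^bsub>X\<^esub> qm x e"
    using unit_law_right(1) [OF x e_closed] x X.meet_top by (simp add: u_e loc_mapD(4) [OF gran_map])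
  let ?v = "\<Squnion>\<^bsub>X\<^esub>{y \<in> carrier X. qm y e \<sqsubseteq>\<^bsub>X\<^esub> x}"
  have v: "?v \<in> carrier X" by (rule X.sup_closed) auto
  have "x \<sqsubseteq>\<^bsub>X\<^esub> ?v"
  proof (rule unit_law_right(2) [OF x v])
    fix p q assume pq: "p \<in> carrier X" "q \<in> carrier X" "qm p q \<sqsubseteq>\<^bsub>X\<^esub> x"
    have dp: "u q \<in> carrier Y" "r (u q) \<in> carrier X" using pq u_closed r_closed by auto
    have "qm (p \<sqinter>\<^bsub>X\<^esub> r (u q)) e = qm p (d (u q) \<sqinter>\<^bsub>X\<^esub> e)"
      by (rule Q.mul_balance) (fact pq(1) e_closed dp(1))+
    also have "d (u q) \<sqinter>\<^bsub>X\<^esub> e = uu (u q)"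
      using e_meet_d [OF dp(1)] by (subst meet_comm)
    also have "qm p (uu (u q)) \<sqsubseteq>\<^bsub>X\<^esub> qm p q"
      using pq uu_u_le uu_closed dp by (intro Q.mul_mono) auto
    finally have "qm (p \<sqinter>\<^bsub>X\<^esub> r (u q)) e \<sqsubseteq>\<^bsub>X\<^esub> x"
      using pq dp e_closed x Q.mul_closed X.le_trans [of _ "qm p q" x] by simp
    then show "p \<sqinter>\<^bsub>X\<^esub> r (u q) \<sqsubseteq>\<^bsub>X\<^esub> ?v"
      using pq dp by (intro X.sup_upper) auto
  qed
  then have "qm x e \<sqsubseteq>\<^bsub>X\<^esub> qm ?v e" using x v e_closed by (intro Q.mul_mono) auto
  also have "qm ?v e \<sqsubseteq>\<^bsub>X\<^esub> x"
    using x e_closed Q.mul_closed by (auto simp: Q.mul_sup_left intro!: X.sup_least)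
  finally show "qm x e \<sqsubseteq>\<^bsub>X\<^esub> x" using x v e_closed Q.mul_closed by simp
qed

lemma support_uu: "a \<in> carrier X \<Longrightarrow> qm a \<top>\<^bsub>X\<^esub> \<sqinter>\<^bsub>X\<^esub> e = uu (dd a)"
  using uu_u [of "d (dd a)"] dd_closed d_closed structure_apply by (simp add: qm_top)

text \<open>The inverse law gives a \<le> d^*(u^* c) for c the product of a and its inverse.
  Transposing across d and then across u turns this into u_!(d_! a) \<le> c, and the left side is
  the support.\<close>

lemma support_eq:
  assumes a: "a \<in> carrier X" shows "qm a \<top>\<^bsub>X\<^esub> \<sqinter>\<^bsub>X\<^esub> e = qm a (i a) \<sqinter>\<^bsub>X\<^esub> e"
proof (rule X.le_antisym)
  have c: "i a \<in> carrier X" "qm a (i a) \<in> carrier X" "qm a \<top>\<^bsub>X\<^esub> \<in> carrier X"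
    using a i_closed Q.mul_closed X.top_in by auto
  show "qm a (i a) \<sqinter>\<^bsub>X\<^esub> e \<sqsubseteq>\<^bsub>X\<^esub> qm a \<top>\<^bsub>X\<^esub> \<sqinter>\<^bsub>X\<^esub> e"
    using a c e_closed X.top_in X.le_top by (intro X.meet_mono Q.mul_mono) auto
  have "a \<sqsubseteq>\<^bsub>X\<^esub> d (u (qm a (i a)))"
    using inverse_law_right [OF a c(1)] a by (simp add: i_i X.meet_idem)
  then have "uu (dd a) \<sqsubseteq>\<^bsub>X\<^esub> qm a (i a)"
    using a c u_closed dd_closed by (simp add: uu_le_iff dd_le_iff)
  then show "qm a \<top>\<^bsub>X\<^esub> \<sqinter>\<^bsub>X\<^esub> e \<sqsubseteq>\<^bsub>X\<^esub> qm a (i a) \<sqinter>\<^bsub>X\<^esub> e"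
    using a c uu_closed dd_closed e_closed uu_le_e by (simp add: support_uu X.le_meet_iff)
qed (use a i_closed Q.mul_closed X.top_in e_closed in auto)

text \<open>In terms of arrows, g = u(d g) g. The support is u_!(d_! a), whose restriction along u
  is d_! a, so the unit law bounds the product from below by d^*(d_! a) \<and> a = a.\<close>

lemma support_mul:
  assumes a: "a \<in> carrier X" shows "qm (qm a \<top>\<^bsub>X\<^esub> \<sqinter>\<^bsub>X\<^esub> e) a = a"
  unfolding support_uu [OF a]
proof (rule X.le_antisym)
  have c: "dd a \<in> carrier Y" "uu (dd a) \<in> carrier X" using a dd_closed uu_closed by auto
  show "qm (uu (dd a)) a \<in> carrier X" using a c Q.mul_closed by simp
  show "qm (uu (dd a)) a \<sqsubseteq>\<^bsub>X\<^esub> a"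
    using Q.mul_mono [OF uu_le_e [OF c(1)] X.le_refl [OF a] c(2) a e_closed a] qm_e_left [OF a]
    by simp
  have "d (u (uu (dd a))) \<sqinter>\<^bsub>X\<^esub> a = a"
    using a c d_closed dd_unit by (simp add: u_uu meet_comm [of X _ a] flip: X.le_iff_meet_eq)
  then show "a \<sqsubseteq>\<^bsub>X\<^esub> qm (uu (dd a)) a"
    using unit_law_left(1) [OF c(2) a] by simp
qed (rule a)

text \<open>
  \<open>s\<^sup>* s\<close> consists of the arrows \<open>g\<inverse> h\<close> with \<open>g, h \<in> s\<close> and \<open>d g = d h\<close>, which forces \<open>g = h\<close>.
\<close>

lemma dom_injective_inverse_mul:
  assumes s: "dom_injective s" shows "qm (i s) s \<sqsubseteq>\<^bsub>X\<^esub> e"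
proof -
  note sX = dom_injectiveD(1) [OF s]
  have isX: "i s \<in> carrier X" using sX i_closed by simp
  \<comment> \<open>It suffices that the elements t with i(s) (s \<and> t) \<le> e cover G_1. The
    inverse law at e supplies such elements: the i(x) \<and> y with x y \<le> e.\<close>
  let ?V = "{t \<in> carrier X. qm (i s) (s \<sqinter>\<^bsub>X\<^esub> t) \<sqsubseteq>\<^bsub>X\<^esub> e}"
  let ?v = "\<Squnion>\<^bsub>X\<^esub>?V"
  have V: "?V \<subseteq> carrier X" by auto
  then have v: "?v \<in> carrier X" by (rule X.sup_closed)
  have "r (u e) \<sqsubseteq>\<^bsub>X\<^esub> ?v"
  proof (rule inverse_law_left [OF e_closed v])
    fix x y assume xy: "x \<in> carrier X" "y \<in> carrier X" "qm x y \<sqsubseteq>\<^bsub>X\<^esub> e"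
    let ?t = "s \<sqinter>\<^bsub>X\<^esub> (i x \<sqinter>\<^bsub>X\<^esub> y)"
    have c: "i x \<in> carrier X" "?t \<in> carrier X" "dd ?t \<in> carrier Y" "i ?t \<in> carrier X"
      "d (dd ?t) \<in> carrier X" "r (dd ?t) \<in> carrier X"
      using sX xy i_closed dd_closed d_closed r_closed by auto
    have t: "s \<sqinter>\<^bsub>X\<^esub> d (dd ?t) = ?t"
      using dom_injectiveD(2) [OF s c(2)] sX xy c by (simp add: X.meet_left)
    have it: "i ?t = i s \<sqinter>\<^bsub>X\<^esub> r (dd ?t)"
      using arg_cong [OF t, of i] sX c by (simp add: loc_mapD(2) [OF ginv_map] structure_apply)
    \<comment> \<open>Below s, passing to \<open>?t\<close> is restriction to its domain. Balancing
      moves that restriction to the left factor, where it turns i(s) into i(\<open>?t\<close>), and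
      then back, so both factors shrink and lie below x and y.\<close>
    have "qm (i s) ?t = qm (i s) (d (dd ?t) \<sqinter>\<^bsub>X\<^esub> s)"
      using t by (simp add: meet_comm [of X s])
    also have "\<dots> = qm (i ?t) s"
      using isX c sX it by (simp add: Q.mul_balance)
    also have "i ?t = i ?t \<sqinter>\<^bsub>X\<^esub> r (dd ?t)"
      unfolding it using isX c by (simp add: X.meet_assoc X.meet_idem)
    also have "qm \<dots> s = qm (i ?t) ?t"
      using c sX t by (simp add: Q.mul_balance meet_comm [of X _ s])
    also have "\<dots> \<sqsubseteq>\<^bsub>X\<^esub> qm x y"
    proof (rule Q.mul_mono)
      show "i ?t \<sqsubseteq>\<^bsub>X\<^esub> x" using c xy sX by (simp add: i_le_iff X.meet_leI1 X.meet_leI2)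
      show "?t \<sqsubseteq>\<^bsub>X\<^esub> y" using c xy sX by (simp add: X.meet_leI1 X.meet_leI2)
    qed (use c xy in auto)
    finally have "qm (i s) ?t \<sqsubseteq>\<^bsub>X\<^esub> qm x y" .
    then have "qm (i s) ?t \<sqsubseteq>\<^bsub>X\<^esub> e"
      by (rule X.le_trans [OF _ xy(3)]) (fact isX c xy e_closed | rule Q.mul_closed)+
    then have "i x \<sqinter>\<^bsub>X\<^esub> y \<in> ?V" using c xy by simp
    then show "i x \<sqinter>\<^bsub>X\<^esub> y \<sqsubseteq>\<^bsub>X\<^esub> ?v" by (rule X.sup_upper [OF V])
  qed
  then have "\<top>\<^bsub>X\<^esub> \<sqsubseteq>\<^bsub>X\<^esub> ?v" by (simp add: u_e loc_mapD(4) [OF gran_map])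
  then have "s \<sqsubseteq>\<^bsub>X\<^esub> ?v" using X.le_trans [OF X.le_top [OF sX]] sX v X.top_in by simp
  then have "s \<sqinter>\<^bsub>X\<^esub> ?v = s" using X.le_iff_meet_eq sX v by simp
  then have "qm (i s) s = qm (i s) (\<Squnion>\<^bsub>X\<^esub>((\<lambda>t. s \<sqinter>\<^bsub>X\<^esub> t) ` ?V))"
    using X.meet_sup_distrib [OF sX V] by simp
  also have "\<dots> \<sqsubseteq>\<^bsub>X\<^esub> e"
    using isX sX e_closed Q.mul_closed
    by (subst Q.mul_sup_right) (auto intro!: X.sup_least)
  finally show ?thesis .
qed

text \<open>An element on which d is injective satisfies only s^* s \<le> e. Meeting s with the
  inverse of another such element t makes d injective on the inverse of the meet as well, which
  gives the other condition; these meets still cover.\<close>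

lemma partial_unit_cover:
  "\<Squnion>\<^bsub>X\<^esub>{s \<in> carrier X. qm s (i s) \<squnion>\<^bsub>X\<^esub> qm (i s) s \<sqsubseteq>\<^bsub>X\<^esub> e} = \<top>\<^bsub>X\<^esub>" (is "\<Squnion>\<^bsub>X\<^esub>?P = _")
proof (rule X.le_antisym)
  obtain \<Gamma> where \<Gamma>: "\<Gamma> \<subseteq> carrier X" "\<Squnion>\<^bsub>X\<^esub>\<Gamma> = \<top>\<^bsub>X\<^esub>" "\<And>s. s \<in> \<Gamma> \<Longrightarrow> dom_injective s"
    using dom_injective_cover by blast
  have i\<Gamma>: "i ` \<Gamma> \<subseteq> carrier X" "\<Squnion>\<^bsub>X\<^esub>(i ` \<Gamma>) = \<top>\<^bsub>X\<^esub>"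
    using \<Gamma> i_closed loc_mapD(3) [OF ginv_map \<Gamma>(1), symmetric] loc_mapD(4) [OF ginv_map]
    by auto
  have P: "?P \<subseteq> carrier X" by auto
  show c: "\<Squnion>\<^bsub>X\<^esub>?P \<in> carrier X" "\<top>\<^bsub>X\<^esub> \<in> carrier X" using X.sup_closed [OF P] X.top_in by auto
  have mem: "s \<sqinter>\<^bsub>X\<^esub> i t \<sqsubseteq>\<^bsub>X\<^esub> \<Squnion>\<^bsub>X\<^esub>?P" if st: "s \<in> \<Gamma>" "t \<in> \<Gamma>" for s t
  proof -
    have k: "s \<in> carrier X" "t \<in> carrier X" "i t \<in> carrier X" using st \<Gamma>(1) i_closed by auto
    let ?x = "s \<sqinter>\<^bsub>X\<^esub> i t"
    have x: "?x \<in> carrier X" "i ?x \<in> carrier X" using k i_closed by auto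
    have "dom_injective ?x" using dom_injective_le [OF \<Gamma>(3) [OF st(1)]] k by (simp add: X.meet_left)
    then have 1: "qm (i ?x) ?x \<sqsubseteq>\<^bsub>X\<^esub> e" by (rule dom_injective_inverse_mul)
    have "dom_injective (i ?x)"
      using dom_injective_le [OF \<Gamma>(3) [OF st(2)] x(2)] k x by (simp add: i_le_iff X.meet_right)
    then have "qm (i (i ?x)) (i ?x) \<sqsubseteq>\<^bsub>X\<^esub> e" by (rule dom_injective_inverse_mul)
    then have 2: "qm ?x (i ?x) \<sqsubseteq>\<^bsub>X\<^esub> e" using x by (simp add: i_i)
    have "?x \<in> ?P" using 1 2 x Q.mul_closed e_closed by (auto intro: X.join_le)
    then show ?thesis by (rule X.sup_upper [OF P])
  qed
  have "s \<sqsubseteq>\<^bsub>X\<^esub> \<Squnion>\<^bsub>X\<^esub>?P" if s: "s \<in> \<Gamma>" for s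
  proof -
    have sX: "s \<in> carrier X" using s \<Gamma> by auto
    have "s = \<Squnion>\<^bsub>X\<^esub>((\<lambda>t. s \<sqinter>\<^bsub>X\<^esub> t) ` i ` \<Gamma>)"
      by (rule X.cover_meet [OF sX i\<Gamma>])
    also have "\<dots> \<sqsubseteq>\<^bsub>X\<^esub> \<Squnion>\<^bsub>X\<^esub>?P"
      using mem [OF s] sX i\<Gamma>(1) by (intro X.sup_least c) auto
    finally show ?thesis .
  qed
  then show "\<top>\<^bsub>X\<^esub> \<sqsubseteq>\<^bsub>X\<^esub> \<Squnion>\<^bsub>X\<^esub>?P" using X.sup_least [OF \<Gamma>(1) c(1)] \<Gamma>(2) by simp
  show "\<Squnion>\<^bsub>X\<^esub>?P \<sqsubseteq>\<^bsub>X\<^esub> \<top>\<^bsub>X\<^esub>" using c X.le_top by simp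
qed

abbreviation "OG \<equiv> groupoid_quantale G"

lemma O_simps:
  "carrier OG = carrier X" "eq OG = eq X" "le OG = le X" "qmul OG = qm" "qunit OG = e"
  by (auto simp: groupoid_quantale_def qm_def fun_eq_iff)

lemma O_inv: "x \<in> carrier X \<Longrightarrow> qinv OG x = i x"
  by (simp add: groupoid_quantale_def i_direct_image)

lemma O_lattice: "\<Squnion>\<^bsub>OG\<^esub>A = \<Squnion>\<^bsub>X\<^esub>A" "x \<sqinter>\<^bsub>OG\<^esub> y = x \<sqinter>\<^bsub>X\<^esub> y" "x \<squnion>\<^bsub>OG\<^esub> y = x \<squnion>\<^bsub>X\<^esub> y" "\<top>\<^bsub>OG\<^esub> = \<top>\<^bsub>X\<^esub>"
  by (rule gorder_cong; simp add: O_simps)+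

lemma O_frame: "frame OG"
  by (rule frame_cong [OF X.frame_axioms]) (simp_all add: O_simps)

theorem groupoid_quantale_inverse_quantal_frame: "inverse_quantal_frame OG"
proof -
  interpret F: frame OG by (rule O_frame)
  interpret U: unital_involutive_quantale OG
  proof unfold_locales
    fix A b assume "A \<subseteq> carrier OG" "b \<in> carrier OG"
    then show "\<Squnion>\<^bsub>OG\<^esub>A \<cdot>\<^bsub>OG\<^esub> b = \<Squnion>\<^bsub>OG\<^esub>((\<lambda>a. a \<cdot>\<^bsub>OG\<^esub> b) ` A)"
      by (simp add: O_simps O_lattice Q.mul_sup_left)
  next
    fix a B assume "a \<in> carrier OG" "B \<subseteq> carrier OG"
    then show "a \<cdot>\<^bsub>OG\<^esub> \<Squnion>\<^bsub>OG\<^esub>B = \<Squnion>\<^bsub>OG\<^esub>((\<lambda>b. a \<cdot>\<^bsub>OG\<^esub> b) ` B)"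
      by (simp add: O_simps O_lattice Q.mul_sup_right)
  next
    fix A assume A: "A \<subseteq> carrier OG"
    then have "(\<lambda>a. qinv OG a) ` A = i ` A" by (intro image_cong) (auto simp: O_simps O_inv)
    with A show "\<iota>\<^bsub>OG\<^esub> (\<Squnion>\<^bsub>OG\<^esub>A) = \<Squnion>\<^bsub>OG\<^esub>((\<lambda>a. \<iota>\<^bsub>OG\<^esub> a) ` A)"
      by (simp add: O_simps O_lattice O_inv loc_mapD(3) [OF ginv_map])
  qed (simp_all add: O_simps O_inv Q.mul_closed e_closed i_closed qm_assoc qm_e_left qm_e_right i_i i_qm)
  show ?thesis
  proof unfold_locales
    fix a assume "a \<in> carrier OG"
    then have a: "a \<in> carrier X" by (simp add: O_simps)
    show "(a \<cdot>\<^bsub>OG\<^esub> \<top>\<^bsub>OG\<^esub>) \<sqinter>\<^bsub>OG\<^esub> \<epsilon>\<^bsub>OG\<^esub> = (a \<cdot>\<^bsub>OG\<^esub> \<iota>\<^bsub>OG\<^esub> a) \<sqinter>\<^bsub>OG\<^esub> \<epsilon>\<^bsub>OG\<^esub>"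
      using support_eq [OF a] a by (simp add: O_simps O_lattice O_inv)
    show "((a \<cdot>\<^bsub>OG\<^esub> \<top>\<^bsub>OG\<^esub>) \<sqinter>\<^bsub>OG\<^esub> \<epsilon>\<^bsub>OG\<^esub>) \<cdot>\<^bsub>OG\<^esub> a = a"
      using support_mul [OF a] by (simp add: O_simps O_lattice)
  next
    have "partial_units OG = {s \<in> carrier X. qm s (i s) \<squnion>\<^bsub>X\<^esub> qm (i s) s \<sqsubseteq>\<^bsub>X\<^esub> e}"
      by (auto simp: partial_units_def O_simps O_lattice O_inv)
    then show "\<Squnion>\<^bsub>OG\<^esub>(partial_units OG) = \<top>\<^bsub>OG\<^esub>"
      using partial_unit_cover by (simp add: O_lattice)
  qed
qed

end

section \<open>The groupoid of an inverse quantal frame\<close>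

context frame
begin

abbreviation down_order :: "'a \<Rightarrow> 'a gorder" where
  "down_order b \<equiv> \<lparr>carrier = {x \<in> carrier L. x \<sqsubseteq> b}, eq = eq L, le = le L\<rparr>"

context
  fixes b assumes b: "b \<in> carrier L"
begin

lemma down_partial_order: "partial_order (down_order b)"
  by unfold_locales (auto simp: eq_is_equal intro: le_trans le_antisym)

lemma down_sup_least:
  assumes "A \<subseteq> carrier (down_order b)"
  shows "least (down_order b) (\<Squnion>A) (Upper (down_order b) A)"
proof -
  have A: "A \<subseteq> carrier L" using assms by auto
  then have "\<Squnion>A \<sqsubseteq> b" "\<Squnion>A \<in> carrier L" using assms b by (auto intro: sup_least)
  then show ?thesis
    using assms A sup_upper [OF A] sup_least [OF A] by (auto simp: least_def Upper_def subset_eq)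
qed

lemma down_complete: "complete_lattice (down_order b)"
proof -
  interpret D: partial_order "down_order b" by (rule down_partial_order)
  show ?thesis
  proof
    fix A assume A: "A \<subseteq> carrier (down_order b)"
    then show "\<exists>s. least (down_order b) s (Upper (down_order b) A)" using down_sup_least by blast
    have A': "A \<subseteq> carrier L" using A by auto
    \<comment> \<open>The meet with b matters when A is empty, since the infimum in L is then the
      top.\<close>
    have "greatest (down_order b) (\<Sqinter>A \<sqinter> b) (Lower (down_order b) A)"
    proof -
      have 1: "\<Sqinter>A \<in> carrier L" using A' by simp
      have "\<Sqinter>A \<sqinter> b \<sqsubseteq> x" if "x \<in> A" for x
        using inf_lower [OF A' that] 1 A' b that by (auto intro: meet_leI1)
      moreover have "y \<sqsubseteq> \<Sqinter>A \<sqinter> b" if "y \<in> Lower (down_order b) A" for y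
      proof -
        have "y \<sqsubseteq> \<Sqinter>A" using that A by (intro inf_greatest [OF A']) (auto simp: Lower_def)
        then show ?thesis using that 1 b by (auto simp: Lower_def le_meet_iff)
      qed
      ultimately show ?thesis using 1 b A' by (auto simp: greatest_def Lower_def meet_right)
    qed
    then show "\<exists>i. greatest (down_order b) i (Lower (down_order b) A)" by blast
  qed
qed

lemma down_sup: "A \<subseteq> carrier (down_order b) \<Longrightarrow> \<Squnion>\<^bsub>down_order b\<^esub>A = \<Squnion>A"
proof -
  assume A: "A \<subseteq> carrier (down_order b)"
  interpret D: complete_lattice "down_order b" by (rule down_complete)
  have A': "A \<subseteq> carrier L" using A by auto
  show ?thesis
    by (rule D.sup_eqI [OF A])
      (use A A' b in \<open>auto simp: sup_le_iff intro!: sup_least\<close>)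
qed

lemma down_meet:
  assumes "x \<in> carrier (down_order b)" "y \<in> carrier (down_order b)"
  shows "x \<sqinter>\<^bsub>down_order b\<^esub> y = x \<sqinter> y"
proof -
  interpret D: complete_lattice "down_order b" by (rule down_complete)
  have c: "x \<sqinter> y \<in> carrier (down_order b)" using assms b by (auto intro: meet_leI1)
  have d: "x \<sqinter>\<^bsub>down_order b\<^esub> y \<in> carrier (down_order b)" using assms by (rule D.meet_closed)
  show ?thesis
  proof (rule D.le_antisym [OF _ _ d c])
    have "x \<sqinter>\<^bsub>down_order b\<^esub> y \<sqsubseteq> x" "x \<sqinter>\<^bsub>down_order b\<^esub> y \<sqsubseteq> y"
      using D.meet_left [OF assms] D.meet_right [OF assms] by auto
    then show "x \<sqinter>\<^bsub>down_order b\<^esub> y \<sqsubseteq>\<^bsub>down_order b\<^esub> x \<sqinter> y"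
      using assms d by (simp add: le_meet_iff)
    show "x \<sqinter> y \<sqsubseteq>\<^bsub>down_order b\<^esub> x \<sqinter>\<^bsub>down_order b\<^esub> y"
      using D.meet_le [OF _ _ assms c] assms by (auto simp: meet_left meet_right)
  qed
qed

lemma down_top: "\<top>\<^bsub>down_order b\<^esub> = b"
proof -
  interpret D: complete_lattice "down_order b" by (rule down_complete)
  show ?thesis using D.top_in D.le_top [of b] b by (auto intro: le_antisym)
qed

lemma down_frame: "frame (down_order b)"
proof -
  interpret D: complete_lattice "down_order b" by (rule down_complete)
  show ?thesis
  proof
    fix x A assume x: "x \<in> carrier (down_order b)" and A: "A \<subseteq> carrier (down_order b)"
    have "(\<lambda>a. x \<sqinter>\<^bsub>down_order b\<^esub> a) ` A = (\<lambda>a. x \<sqinter> a) ` A"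
      using x A by (intro image_cong down_meet) auto
    moreover have "(\<lambda>a. x \<sqinter> a) ` A \<subseteq> carrier (down_order b)"
      using x A b by (auto simp: subset_eq intro: meet_leI1)
    moreover have "\<Squnion>\<^bsub>down_order b\<^esub>A \<in> carrier (down_order b)" by (rule D.sup_closed [OF A])
    ultimately show "x \<sqinter>\<^bsub>down_order b\<^esub> \<Squnion>\<^bsub>down_order b\<^esub>A =
        \<Squnion>\<^bsub>down_order b\<^esub>((\<lambda>a. x \<sqinter>\<^bsub>down_order b\<^esub> a) ` A)"
      using x A down_meet [OF x] by (simp add: down_sup meet_sup_distrib subset_eq)
  qed
qed

end

end

lemma (in complete_lattice) meet_meet_distrib:
  assumes "x \<in> carrier L" "y \<in> carrier L" "z \<in> carrier L"
  shows "x \<sqinter> y \<sqinter> z = (x \<sqinter> z) \<sqinter> (y \<sqinter> z)"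
  by (rule le_antisym) (use assms in \<open>simp_all add: le_meet_iff meet_leI1 meet_leI2\<close>)

lemma (in complete_lattice) sup_pair:
  "\<lbrakk>a \<sqsubseteq> b; a \<in> carrier L; b \<in> carrier L\<rbrakk> \<Longrightarrow> \<Squnion>{a, b} = b"
  by (rule sup_eqI) (use le_trans [of a b] in auto)

section \<open>Order and involution in involutive quantales\<close>

context unital_involutive_quantale
begin

lemma mul_mono:
  assumes "a \<sqsubseteq> a'" "b \<sqsubseteq> b'"
    and c: "a \<in> carrier Q" "a' \<in> carrier Q" "b \<in> carrier Q" "b' \<in> carrier Q"
  shows "a \<cdot> b \<sqsubseteq> a' \<cdot> b'"
proof -
  have "\<Squnion>{a, a'} = a'" "\<Squnion>{b, b'} = b'"
    using assms sup_pair by auto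
  then have "a' \<cdot> b = \<Squnion>{a \<cdot> b, a' \<cdot> b}" "a' \<cdot> b' = \<Squnion>{a' \<cdot> b, a' \<cdot> b'}"
    using sup_mul [of "{a, a'}" b] mul_sup [of a' "{b, b'}"] c by auto
  then have "a \<cdot> b \<sqsubseteq> a' \<cdot> b" "a' \<cdot> b \<sqsubseteq> a' \<cdot> b'"
    using c mul_closed sup_upper [of "{a \<cdot> b, a' \<cdot> b}" "a \<cdot> b"]
      sup_upper [of "{a' \<cdot> b, a' \<cdot> b'}" "a' \<cdot> b"] by auto
  then show ?thesis by (rule le_trans) (use c mul_closed in auto)
qed

lemma inv_mono:
  assumes "a \<sqsubseteq> b" and c: "a \<in> carrier Q" "b \<in> carrier Q"
  shows "\<iota> a \<sqsubseteq> \<iota> b"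
proof -
  have "\<Squnion>{a, b} = b" using assms by (rule sup_pair)
  then have "\<iota> b = \<Squnion>{\<iota> a, \<iota> b}" using inv_sup [of "{a, b}"] c by simp
  then show ?thesis using sup_upper [of "{\<iota> a, \<iota> b}" "\<iota> a"] c inv_closed by auto
qed

lemma inv_le_iff: "\<lbrakk>a \<in> carrier Q; b \<in> carrier Q\<rbrakk> \<Longrightarrow> \<iota> a \<sqsubseteq> b \<longleftrightarrow> a \<sqsubseteq> \<iota> b"
  using inv_mono [of "\<iota> a" b] inv_mono [of a "\<iota> b"] inv_closed inv_inv by auto

lemma inv_top: "\<iota> \<top> = \<top>"
  using inv_le_iff [of \<top> \<top>] top_in le_top inv_closed by (intro le_antisym) auto

lemma inv_unit: "\<iota> \<epsilon> = \<epsilon>"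
  by (metis inv_closed inv_inv inv_mul mul_unit unit_closed)

lemma inv_meet:
  assumes "a \<in> carrier Q" "b \<in> carrier Q" shows "\<iota> (a \<sqinter> b) = \<iota> a \<sqinter> \<iota> b"
proof (rule le_antisym)
  have c: "\<iota> a \<in> carrier Q" "\<iota> b \<in> carrier Q" using assms inv_closed by auto
  show "\<iota> (a \<sqinter> b) \<sqsubseteq> \<iota> a \<sqinter> \<iota> b"
    using assms c inv_closed inv_mono by (simp add: le_meet_iff meet_left meet_right)
  have "\<iota> (\<iota> a \<sqinter> \<iota> b) \<sqsubseteq> a \<sqinter> b"
    using assms c inv_closed by (simp add: le_meet_iff inv_le_iff meet_left meet_right)
  then show "\<iota> a \<sqinter> \<iota> b \<sqsubseteq> \<iota> (a \<sqinter> b)"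
    using assms c by (simp add: inv_le_iff)
qed (use assms inv_closed in auto)

end

section \<open>Supports, restriction and partial units\<close>

context inverse_quantal_frame
begin

text \<open>The first two axioms of an inverse quantal frame become \<open>supp_le\<close> and
  \<open>supp_mul\<close>, the form in which they are used. The support will be the direct image of
  the domain map.\<close>

definition supp :: "'a \<Rightarrow> 'a" where
  "supp a = (a \<cdot> \<top>) \<sqinter> \<epsilon>"

lemma supp_closed: "a \<in> carrier Q \<Longrightarrow> supp a \<in> carrier Q"
  by (simp add: supp_def mul_closed top_in unit_closed)

lemma supp_le_unit: "a \<in> carrier Q \<Longrightarrow> supp a \<sqsubseteq> \<epsilon>"
  by (simp add: supp_def mul_closed top_in unit_closed meet_right)

lemma supp_le: "a \<in> carrier Q \<Longrightarrow> supp a \<sqsubseteq> a \<cdot> \<iota> a"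
  by (simp add: supp_def support_eq mul_closed inv_closed unit_closed meet_left)

lemma supp_mul: "a \<in> carrier Q \<Longrightarrow> supp a \<cdot> a = a"
  by (simp add: supp_def support_mul)

lemma supp_mono: "\<lbrakk>a \<sqsubseteq> b; a \<in> carrier Q; b \<in> carrier Q\<rbrakk> \<Longrightarrow> supp a \<sqsubseteq> supp b"
  unfolding supp_def by (intro meet_mono mul_mono) (simp_all add: mul_closed top_in unit_closed)

lemma mul_le_left: "\<lbrakk>b \<sqsubseteq> \<epsilon>; a \<in> carrier Q; b \<in> carrier Q\<rbrakk> \<Longrightarrow> b \<cdot> a \<sqsubseteq> a"
  using mul_mono [of b \<epsilon> a a] unit_mul unit_closed by simp

lemma mul_le_right: "\<lbrakk>b \<sqsubseteq> \<epsilon>; a \<in> carrier Q; b \<in> carrier Q\<rbrakk> \<Longrightarrow> a \<cdot> b \<sqsubseteq> a"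
  using mul_mono [of a a b \<epsilon>] mul_unit unit_closed by simp

lemma inv_le_unit: "\<lbrakk>b \<sqsubseteq> \<epsilon>; b \<in> carrier Q\<rbrakk> \<Longrightarrow> \<iota> b \<sqsubseteq> \<epsilon>"
  using inv_mono [of b \<epsilon>] inv_unit unit_closed by simp

context
  fixes b assumes b: "b \<sqsubseteq> \<epsilon>" "b \<in> carrier Q"
begin

lemma supp_unit: "supp b = b"
proof (rule le_antisym)
  have c: "\<iota> b \<in> carrier Q" "b \<cdot> \<iota> b \<in> carrier Q" using b inv_closed mul_closed by auto
  show "supp b \<sqsubseteq> b"
    using le_trans [OF supp_le [OF b(2)] mul_le_right [OF inv_le_unit [OF b] b(2) c(1)]]
      supp_closed b c by simp
  show "b \<sqsubseteq> supp b"
    using mul_le_right [OF b(1) supp_closed [OF b(2)] b(2)] supp_mul [OF b(2)] by simp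
qed (use b supp_closed in auto)

text \<open>Since b is its own support, b \<le> b b^* \<le> b^* for b \<le> e; transposing the
  involution gives the reverse inequality.\<close>

lemma inv_of_unit: "\<iota> b = b"
proof -
  have *: "x \<sqsubseteq> \<iota> x" if x: "x \<sqsubseteq> \<epsilon>" "x \<in> carrier Q" and s: "supp x = x" for x
    using le_trans [OF supp_le [OF x(2)] mul_le_left [OF x(1) inv_closed [OF x(2)] x(2)]]
      s x inv_closed mul_closed by simp
  have "b \<sqsubseteq> \<iota> b" using * [OF b supp_unit] .
  moreover have "\<iota> b \<sqsubseteq> b" using inv_le_iff [OF b(2) b(2)] calculation by simp
  ultimately show ?thesis using b inv_closed by (simp add: le_antisym)
qed

text \<open>Restricting a to domain b is multiplication by b. With t = b 1 \<and> a, the support of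
  t lies below the support of b, which is b; hence t, as its support times t, lies below b
  a.\<close>

lemma restrict_left:
  assumes a: "a \<in> carrier Q" shows "b \<cdot> \<top> \<sqinter> a = b \<cdot> a"
proof (rule le_antisym)
  let ?t = "b \<cdot> \<top> \<sqinter> a"
  have c: "b \<cdot> \<top> \<in> carrier Q" "?t \<in> carrier Q" "b \<cdot> a \<in> carrier Q" "\<top> \<cdot> \<top> \<in> carrier Q"
    "b \<cdot> \<top> \<cdot> \<top> \<in> carrier Q"
    using a b top_in mul_closed by auto
  have "supp ?t \<sqsubseteq> b \<cdot> \<top> \<cdot> \<top> \<sqinter> \<epsilon>"
    unfolding supp_def using c a top_in unit_closed mul_closed
    by (intro meet_mono mul_mono) (auto simp: meet_left)
  moreover have "b \<cdot> \<top> \<cdot> \<top> \<sqsubseteq> b \<cdot> \<top>"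
    using b top_in c le_top mul_mono [of b b "\<top> \<cdot> \<top>" \<top>] by (simp add: mul_assoc)
  then have "b \<cdot> \<top> \<cdot> \<top> \<sqinter> \<epsilon> \<sqsubseteq> supp b"
    unfolding supp_def using c unit_closed by (intro meet_mono) auto
  ultimately have "supp ?t \<sqsubseteq> supp b"
    using c b unit_closed supp_closed le_trans [of "supp ?t" "b \<cdot> \<top> \<cdot> \<top> \<sqinter> \<epsilon>" "supp b"]
    by simp
  then have "supp ?t \<sqsubseteq> b" by (simp add: supp_unit)
  then have "supp ?t \<cdot> ?t \<sqsubseteq> b \<cdot> a"
    using c a b supp_closed by (intro mul_mono) (auto simp: meet_right)
  then show "?t \<sqsubseteq> b \<cdot> a" using supp_mul c by simp
  show "b \<cdot> a \<sqsubseteq> ?t"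
    using a b c top_in le_top mul_mono [of b b a \<top>] mul_le_left by (simp add: le_meet_iff)
qed (use a b top_in mul_closed in auto)

lemma restrict_right:
  assumes a: "a \<in> carrier Q" shows "\<top> \<cdot> b \<sqinter> a = a \<cdot> b"
proof -
  have "\<iota> (b \<cdot> \<top> \<sqinter> \<iota> a) = \<iota> (b \<cdot> \<iota> a)" using restrict_left a inv_closed by simp
  then show ?thesis
    using a b top_in mul_closed inv_closed
    by (simp add: inv_meet inv_mul inv_inv inv_top inv_of_unit)
qed

lemma unit_mul_meet:
  assumes c: "c \<sqsubseteq> \<epsilon>" "c \<in> carrier Q" shows "b \<cdot> c = b \<sqinter> c"
proof -
  have "b \<cdot> c = b \<cdot> \<top> \<sqinter> (\<epsilon> \<sqinter> c)"
    using restrict_left [OF c(2)] c unit_closed by (simp add: le_iff_meet_eq meet_comm [of Q \<epsilon>])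
  also have "\<dots> = supp b \<sqinter> c"
    unfolding supp_def using b c top_in mul_closed unit_closed by (simp add: meet_assoc)
  finally show ?thesis by (simp add: supp_unit)
qed

text \<open>This exhibits \<open>supp\<close> as left adjoint to the inverse image b \<mapsto> b 1
  of the domain map; \<open>supp_mul_unit\<close> below is its Frobenius law.\<close>

lemma supp_adjoint:
  assumes a: "a \<in> carrier Q" shows "supp a \<sqsubseteq> b \<longleftrightarrow> a \<sqsubseteq> b \<cdot> \<top>"
proof
  assume "supp a \<sqsubseteq> b"
  then have "supp a \<cdot> a \<sqsubseteq> b \<cdot> \<top>" using a b supp_closed top_in le_top by (intro mul_mono) auto
  then show "a \<sqsubseteq> b \<cdot> \<top>" using supp_mul a by simp
next
  assume *: "a \<sqsubseteq> b \<cdot> \<top>"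
  have "supp a \<sqsubseteq> supp (b \<cdot> \<top>)" using a b top_in mul_closed by (intro supp_mono *) auto
  also have "supp (b \<cdot> \<top>) = b \<cdot> (\<top> \<cdot> \<top>) \<sqinter> \<epsilon>"
    using b top_in by (simp add: supp_def mul_assoc)
  also have "\<dots> \<sqsubseteq> supp b"
    unfolding supp_def using b top_in mul_closed unit_closed le_top
    by (intro meet_mono mul_mono) auto
  finally show "supp a \<sqsubseteq> b"
    using supp_unit a b supp_closed top_in mul_closed unit_closed by simp
qed

lemma supp_mul_unit:
  assumes a: "a \<in> carrier Q" shows "supp (b \<cdot> a) = b \<sqinter> supp a"
proof -
  have c: "a \<cdot> \<top> \<in> carrier Q" "b \<cdot> \<top> \<in> carrier Q" using a b top_in mul_closed by auto
  have "supp (b \<cdot> a) = b \<cdot> \<top> \<sqinter> (a \<cdot> \<top>) \<sqinter> \<epsilon>"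
    using a b top_in c restrict_left [OF c(1)] by (simp add: supp_def mul_assoc)
  also have "\<dots> = supp b \<sqinter> supp a"
    unfolding supp_def by (rule meet_meet_distrib [OF c(2,1) unit_closed])
  finally show ?thesis by (simp add: supp_unit)
qed

end

lemma partial_units_iff:
  "s \<in> partial_units Q \<longleftrightarrow> s \<in> carrier Q \<and> s \<cdot> \<iota> s \<sqsubseteq> \<epsilon> \<and> \<iota> s \<cdot> s \<sqsubseteq> \<epsilon>"
proof -
  have "x \<squnion> y \<sqsubseteq> \<epsilon> \<longleftrightarrow> x \<sqsubseteq> \<epsilon> \<and> y \<sqsubseteq> \<epsilon>" if "x \<in> carrier Q" "y \<in> carrier Q" for x y
    using that unit_closed join_left [of x y] join_right [of x y] le_trans [of _ "x \<squnion> y" \<epsilon>]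
    by (auto intro: join_le)
  then show ?thesis unfolding partial_units_def using mul_closed inv_closed by auto
qed

lemma partial_units_sub: "partial_units Q \<subseteq> carrier Q"
  by (auto simp: partial_units_def)

lemma partial_units_down:
  assumes s: "s \<in> partial_units Q" and t: "t \<in> carrier Q" "t \<sqsubseteq> s" shows "t \<in> partial_units Q"
proof -
  have sQ: "s \<in> carrier Q" using s partial_units_sub by auto
  have it: "\<iota> t \<sqsubseteq> \<iota> s" using t sQ by (intro inv_mono)
  have "t \<cdot> \<iota> t \<sqsubseteq> s \<cdot> \<iota> s" "\<iota> t \<cdot> t \<sqsubseteq> \<iota> s \<cdot> s"
    using t it sQ inv_closed by (auto intro: mul_mono)
  then show ?thesis
    using s t sQ inv_closed mul_closed unit_closed
      le_trans [of "t \<cdot> \<iota> t" "s \<cdot> \<iota> s" \<epsilon>] le_trans [of "\<iota> t \<cdot> t" "\<iota> s \<cdot> s" \<epsilon>]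
    unfolding partial_units_iff by simp
qed

text \<open>Meeting x with both covers and using that partial units are closed downwards refines x
  simultaneously. The second cover A is free so that it can later consist of images of partial units
  under a homomorphism.\<close>

lemma sup_partial_units_below:
  assumes x: "x \<in> carrier Q" and s: "\<Squnion>A = \<top>" "A \<subseteq> carrier Q"
  obtains T where "T \<subseteq> partial_units Q" "x = \<Squnion>T" "\<And>t. t \<in> T \<Longrightarrow> t \<sqsubseteq> x" "\<And>t. t \<in> T \<Longrightarrow> \<exists>a\<in>A. t \<sqsubseteq> a"
proof -
  let ?T = "(\<lambda>(p, a). x \<sqinter> p \<sqinter> a) ` (partial_units Q \<times> A)"
  have PU: "p \<in> carrier Q" if "p \<in> partial_units Q" for p using that partial_units_sub by auto
  have A: "a \<in> carrier Q" if "a \<in> A" for a using that s by auto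
  have sub: "?T \<subseteq> carrier Q" using PU A x by auto
  have "x \<sqsubseteq> \<Squnion>?T"
  proof -
    have "x \<sqinter> p \<sqsubseteq> \<Squnion>?T" if p: "p \<in> partial_units Q" for p
    proof -
      have "x \<sqinter> p = \<Squnion>((\<lambda>a. x \<sqinter> p \<sqinter> a) ` A)"
        using x PU [OF p] s by (intro cover_meet) auto
      also have "\<dots> \<sqsubseteq> \<Squnion>?T"
        using sub p x PU A by (intro sup_least) (auto intro!: sup_upper)
      finally show ?thesis .
    qed
    moreover have "(\<lambda>p. x \<sqinter> p) ` partial_units Q \<subseteq> carrier Q" using x PU by auto
    ultimately have "\<Squnion>((\<lambda>p. x \<sqinter> p) ` partial_units Q) \<sqsubseteq> \<Squnion>?T"
      using sub by (intro sup_least) auto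
    moreover have "x = \<Squnion>((\<lambda>p. x \<sqinter> p) ` partial_units Q)"
      by (rule cover_meet [OF x partial_units_sub sup_partial_units])
    ultimately show ?thesis by (rule ssubst [where P = "\<lambda>z. z \<sqsubseteq> \<Squnion>?T", rotated])
  qed
  moreover have "\<Squnion>?T \<sqsubseteq> x" using sub x PU A by (intro sup_least) (auto simp: meet_leI1 meet_left)
  ultimately have eq: "x = \<Squnion>?T" using x sub by (intro le_antisym) auto
  have sub': "?T \<subseteq> partial_units Q"
  proof clarify
    fix p a assume "p \<in> partial_units Q" "a \<in> A"
    then show "x \<sqinter> p \<sqinter> a \<in> partial_units Q"
      using x PU A partial_units_down [of p "x \<sqinter> p \<sqinter> a"] by (simp add: meet_leI1 meet_right)
  qed
  show ?thesis
  proof (rule that [OF sub' eq])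
    show "t \<sqsubseteq> x" if "t \<in> ?T" for t using that x PU A by (auto simp: meet_leI1 meet_left)
    show "\<exists>a\<in>A. t \<sqsubseteq> a" if "t \<in> ?T" for t
    proof -
      from that obtain p a where "p \<in> partial_units Q" "a \<in> A" "t = x \<sqinter> p \<sqinter> a" by auto
      then show ?thesis using x PU A by (intro bexI [of _ a]) (simp_all add: meet_right)
    qed
  qed
qed

end

section \<open>The structure maps of the groupoid of a quantale\<close>

definition quantale_groupoid :: "('a, 'b) inv_quantale_scheme \<Rightarrow> 'a loc_groupoid" where
  "quantale_groupoid Q =
     (let E = {b \<in> carrier Q. b \<sqsubseteq>\<^bsub>Q\<^esub> \<epsilon>\<^bsub>Q\<^esub>} in
      \<lparr>G0 = \<lparr>carrier = E, eq = eq Q, le = le Q\<rparr>,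
       G1 = \<lparr>carrier = carrier Q, eq = eq Q, le = le Q\<rparr>,
       gdom = (\<lambda>b\<in>E. b \<cdot>\<^bsub>Q\<^esub> \<top>\<^bsub>Q\<^esub>),
       gran = (\<lambda>b\<in>E. \<top>\<^bsub>Q\<^esub> \<cdot>\<^bsub>Q\<^esub> b),
       gunit = (\<lambda>a\<in>carrier Q. a \<sqinter>\<^bsub>Q\<^esub> \<epsilon>\<^bsub>Q\<^esub>),
       ginv = (\<lambda>a\<in>carrier Q. \<iota>\<^bsub>Q\<^esub> a),
       gmul = (\<lambda>a\<in>carrier Q. {(x, y). x \<in> carrier Q \<and> y \<in> carrier Q \<and> x \<cdot>\<^bsub>Q\<^esub> y \<sqsubseteq>\<^bsub>Q\<^esub> a})\<rparr>)"

context inverse_quantal_frame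
begin

abbreviation "GQ \<equiv> quantale_groupoid Q"

lemma G1_simps [simp]: "carrier (G1 GQ) = carrier Q" "le (G1 GQ) = le Q"
  by (simp_all add: quantale_groupoid_def Let_def)

lemma G1_lattice [simp]:
  "\<Squnion>\<^bsub>G1 GQ\<^esub>A = \<Squnion>A" "x \<sqinter>\<^bsub>G1 GQ\<^esub> y = x \<sqinter> y" "x \<squnion>\<^bsub>G1 GQ\<^esub> y = x \<squnion> y" "\<top>\<^bsub>G1 GQ\<^esub> = \<top>"
  by (rule gorder_cong; simp)+

lemma G0_eq: "G0 GQ = down_order \<epsilon>"
  by (simp add: quantale_groupoid_def Let_def)

lemma G0_simps [simp]: "carrier (G0 GQ) = {b \<in> carrier Q. b \<sqsubseteq> \<epsilon>}" "le (G0 GQ) = le Q"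
  by (simp_all add: G0_eq)

lemma G0_lattice [simp]:
  shows "A \<subseteq> {b \<in> carrier Q. b \<sqsubseteq> \<epsilon>} \<Longrightarrow> \<Squnion>\<^bsub>G0 GQ\<^esub>A = \<Squnion>A"
    and "\<lbrakk>x \<in> carrier Q; x \<sqsubseteq> \<epsilon>; y \<in> carrier Q; y \<sqsubseteq> \<epsilon>\<rbrakk> \<Longrightarrow> x \<sqinter>\<^bsub>G0 GQ\<^esub> y = x \<sqinter> y"
    and "\<top>\<^bsub>G0 GQ\<^esub> = \<epsilon>"
  using down_sup [OF unit_closed] down_meet [OF unit_closed] down_top [OF unit_closed]
  by (simp_all add: G0_eq)

lemma GQ_simps [simp]:
  "\<lbrakk>b \<in> carrier Q; b \<sqsubseteq> \<epsilon>\<rbrakk> \<Longrightarrow> gdom GQ b = b \<cdot> \<top>"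
  "\<lbrakk>b \<in> carrier Q; b \<sqsubseteq> \<epsilon>\<rbrakk> \<Longrightarrow> gran GQ b = \<top> \<cdot> b"
  "a \<in> carrier Q \<Longrightarrow> gunit GQ a = a \<sqinter> \<epsilon>"
  "a \<in> carrier Q \<Longrightarrow> ginv GQ a = \<iota> a"
  "a \<in> carrier Q \<Longrightarrow> gmul GQ a = {(x, y). x \<in> carrier Q \<and> y \<in> carrier Q \<and> x \<cdot> y \<sqsubseteq> a}"
  by (simp_all add: quantale_groupoid_def Let_def)

lemma GQ_extensional:
  "gdom GQ \<in> extensional {b \<in> carrier Q. b \<sqsubseteq> \<epsilon>}" "gran GQ \<in> extensional {b \<in> carrier Q. b \<sqsubseteq> \<epsilon>}"
  "gunit GQ \<in> extensional (carrier Q)" "ginv GQ \<in> extensional (carrier Q)"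
  "gmul GQ \<in> extensional (carrier Q)"
  by (simp_all add: quantale_groupoid_def Let_def)

lemma GQ_G0_frame: "frame (G0 GQ)"
  unfolding G0_eq by (rule down_frame [OF unit_closed])

lemma GQ_G1_frame: "frame (G1 GQ)"
  by (rule frame_cong [OF frame_axioms]) (simp_all add: quantale_groupoid_def Let_def)

lemma GQ_complete: "complete_lattice (G0 GQ)" "complete_lattice (G1 GQ)"
  using GQ_G0_frame GQ_G1_frame by (simp_all add: frame_def)

text \<open>Joins come from distributivity. Meets survive because products below e are meets: (x
  \<and> y) 1 = x y 1, which is x 1 \<and> y 1 by \<open>restrict_left\<close>.\<close>

lemma GQ_gdom_map: "gdom GQ \<in> loc_map (G1 GQ) (G0 GQ)"
proof (rule loc_mapI)
  show "gdom GQ (x \<sqinter>\<^bsub>G0 GQ\<^esub> y) = gdom GQ x \<sqinter>\<^bsub>G1 GQ\<^esub> gdom GQ y"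
    if "x \<in> carrier (G0 GQ)" "y \<in> carrier (G0 GQ)" for x y
    using that unit_closed restrict_left [of x "y \<cdot> \<top>"] unit_mul_meet [of x y]
      mul_assoc [of x y \<top>] top_in mul_closed
    by (simp add: meet_leI1)
  show "gdom GQ (\<Squnion>\<^bsub>G0 GQ\<^esub>A) = \<Squnion>\<^bsub>G1 GQ\<^esub>(gdom GQ ` A)" if "A \<subseteq> carrier (G0 GQ)" for A
  proof -
    have A: "A \<subseteq> carrier Q" using that by auto
    have "gdom GQ ` A = (\<lambda>b. b \<cdot> \<top>) ` A" using that by (intro image_cong) auto
    moreover have "\<Squnion>A \<sqsubseteq> \<epsilon>" using that unit_closed by (intro sup_least) auto
    ultimately show ?thesis using that A top_in by (simp add: sup_mul)
  qed
qed (use GQ_complete GQ_extensional in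
    \<open>auto simp: PiE_def mul_closed top_in unit_mul unit_closed\<close>)

lemma GQ_ginv_map: "ginv GQ \<in> loc_map (G1 GQ) (G1 GQ)"
proof (rule loc_mapI)
  show "ginv GQ (\<Squnion>\<^bsub>G1 GQ\<^esub>A) = \<Squnion>\<^bsub>G1 GQ\<^esub>(ginv GQ ` A)" if "A \<subseteq> carrier (G1 GQ)" for A
  proof -
    have "ginv GQ ` A = (\<lambda>b. \<iota> b) ` A" using that by (intro image_cong) auto
    then show ?thesis using that by (simp add: inv_sup)
  qed
qed (use GQ_complete GQ_extensional in
    \<open>auto simp: PiE_def inv_closed top_in inv_top inv_meet\<close>)

text \<open>Elements below e are self-adjoint, so the involution carries b 1 to 1 b. Proving this
  groupoid law first gives \<open>gran\<close> as a composite of maps of locales.\<close>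

lemma GQ_dom_inv: "loc_comp (G0 GQ) (gdom GQ) (ginv GQ) = gran GQ"
proof (rule extensionalityI [of _ "carrier (G0 GQ)"])
  show "gran GQ \<in> extensional (carrier (G0 GQ))" using GQ_extensional by simp
  show "loc_comp (G0 GQ) (gdom GQ) (ginv GQ) \<in> extensional (carrier (G0 GQ))"
    by (rule loc_comp_extensional)
qed (auto simp: inv_mul inv_top inv_of_unit mul_closed top_in)

lemma GQ_gran_map: "gran GQ \<in> loc_map (G1 GQ) (G0 GQ)"
  using loc_comp_map [OF GQ_ginv_map GQ_gdom_map] by (simp add: GQ_dom_inv)

lemma GQ_gunit_map: "gunit GQ \<in> loc_map (G0 GQ) (G1 GQ)"
proof (rule loc_mapI)
  show "gunit GQ (x \<sqinter>\<^bsub>G1 GQ\<^esub> y) = gunit GQ x \<sqinter>\<^bsub>G0 GQ\<^esub> gunit GQ y"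
    if "x \<in> carrier (G1 GQ)" "y \<in> carrier (G1 GQ)" for x y
    using that unit_closed meet_meet_distrib [of x y \<epsilon>] by (simp add: meet_right)
  show "gunit GQ (\<Squnion>\<^bsub>G1 GQ\<^esub>A) = \<Squnion>\<^bsub>G0 GQ\<^esub>(gunit GQ ` A)" if "A \<subseteq> carrier (G1 GQ)" for A
  proof -
    have "gunit GQ ` A = (\<lambda>a. a \<sqinter> \<epsilon>) ` A" using that by (intro image_cong) auto
    moreover have "(\<lambda>a. a \<sqinter> \<epsilon>) ` A \<subseteq> {b \<in> carrier Q. b \<sqsubseteq> \<epsilon>}"
      using that unit_closed by (auto simp: meet_right subset_eq)
    ultimately show ?thesis using that unit_closed by (simp add: sup_meet_distrib)
  qed
qed (use GQ_complete GQ_extensional in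
    \<open>auto simp: PiE_def meet_right unit_closed meet_top\<close>)

sublocale GQ: loc_graph "quantale_groupoid Q"
  by (rule loc_graph.intro) (rule GQ_G0_frame GQ_G1_frame GQ_gdom_map GQ_gran_map)+

text \<open>
  For a partial unit \<open>t\<close> one has \<open>t = t t\<^sup>* t\<close>, so balancing over \<open>G\<^sub>0\<close> moves \<open>t\<^sup>* t \<le> e\<close> across the tensor
  and \<open>t \<otimes> q = t \<otimes> t\<^sup>* t q\<close>.
\<close>

lemma mem_ideal_by_partial_units:
  assumes T: "GQ.pb2.ideal T" and c: "p \<in> carrier Q" "q \<in> carrier Q"
    and A: "\<Squnion>A = \<top>" "A \<subseteq> carrier Q"
    and mem: "\<And>t a. \<lbrakk>t \<in> partial_units Q; t \<sqsubseteq> p; a \<in> A; t \<sqsubseteq> a\<rbrakk> \<Longrightarrow> (t, \<iota> t \<cdot> (t \<cdot> q)) \<in> T"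
  shows "(p, q) \<in> T"
proof -
  obtain S where S: "S \<subseteq> partial_units Q" "p = \<Squnion>S" "\<And>t. t \<in> S \<Longrightarrow> t \<sqsubseteq> p"
    "\<And>t. t \<in> S \<Longrightarrow> \<exists>a\<in>A. t \<sqsubseteq> a"
    using sup_partial_units_below [OF c(1) A] by blast
  have "(t, q) \<in> T" if t: "t \<in> S" for t
  proof -
    have tP: "t \<in> partial_units Q" using t S(1) by auto
    then have tQ: "t \<in> carrier Q" "t \<cdot> \<iota> t \<sqsubseteq> \<epsilon>" "\<iota> t \<cdot> t \<sqsubseteq> \<epsilon>" by (auto simp: partial_units_iff)
    let ?b = "\<iota> t \<cdot> t"
    have b: "?b \<in> carrier Q" "\<iota> t \<in> carrier Q" using tQ mul_closed inv_closed by auto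
    have "t \<sqsubseteq> t \<cdot> \<iota> t \<cdot> t"
      using mul_mono [OF supp_le [OF tQ(1)] le_refl [OF tQ(1)]] supp_mul tQ b supp_closed mul_closed
      by simp
    moreover have "t \<cdot> \<iota> t \<cdot> t \<sqsubseteq> t"
      using mul_le_left [OF tQ(2) tQ(1)] tQ b mul_closed by simp
    ultimately have tb: "t = t \<cdot> ?b"
      using tQ b mul_closed by (simp add: mul_assoc le_antisym)
    have "t \<sqinter> gran GQ ?b = t"
      using restrict_right [OF tQ(3) b(1) tQ(1)] tb tQ b by (simp add: meet_comm [of Q t])
    moreover have "gdom GQ ?b \<sqinter> q = \<iota> t \<cdot> (t \<cdot> q)"
      using restrict_left [OF tQ(3) b(1) c(2)] tQ b c by (simp add: mul_assoc)
    moreover have "(t, \<iota> t \<cdot> (t \<cdot> q)) \<in> T" using mem tP S(3,4) t by blast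
    ultimately show "(t, q) \<in> T"
      using GQ.pb2.idealD(5) [OF T, of t q ?b] tQ b c by simp
  qed
  then have "(\<Squnion>\<^bsub>G1 GQ\<^esub>S, q) \<in> T"
    using S(1) partial_units_sub c by (intro GQ.pb2.idealD(3) [OF T]) auto
  then show ?thesis using S(2) by simp
qed

lemma gmul_ideal:
  assumes w: "w \<in> carrier Q" shows "GQ.pb2.ideal (gmul GQ w)"
proof (rule GQ.pb2.idealI, goal_cases)
  case 1 show ?case using w by auto
next
  case (2 x y a b)
  then show ?case
    using w le_trans [OF mul_mono [of x a y b], of w] mul_closed by auto
next
  case (3 A y)
  then show ?case
    using w mul_closed by (auto simp: sup_mul subset_eq intro!: sup_least)
next
  case (4 x B)
  then show ?case
    using w mul_closed by (auto simp: mul_sup subset_eq intro!: sup_least)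
next
  case (5 x y z)
  then have "x \<sqinter> gran GQ z = x \<cdot> z" "gdom GQ z \<sqinter> y = z \<cdot> y"
    using restrict_right [of z x] restrict_left [of z y] by (simp_all add: meet_comm [of Q x])
  with 5 w show ?case using mul_closed by (simp add: mul_assoc)
qed

text \<open>The content is preservation of joins. Suppose p q \<le> \<Squnion>A and let t \<le> p be
  a partial unit. Each (t, t^* a) lies in m^* a because t t^* a \<le> a; joining over a gives (t,
  t^* \<Squnion>A), and t^* t q lies below its second component.\<close>

lemma GQ_gmul_map: "gmul GQ \<in> loc_map (G2 GQ) (G1 GQ)"
  unfolding GQ.G2_folds
proof (rule loc_mapI)
  show "complete_lattice (G1 GQ)" "complete_lattice GQ.pb2.P"
    by (rule GQ_complete GQ.pb2.P_complete)+
  show "gmul GQ \<in> carrier (G1 GQ) \<rightarrow>\<^sub>E carrier GQ.pb2.P"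
    using GQ_extensional gmul_ideal by (auto simp: PiE_def simp del: GQ_simps)
  show "gmul GQ (x \<sqinter>\<^bsub>G1 GQ\<^esub> y) = gmul GQ x \<sqinter>\<^bsub>GQ.pb2.P\<^esub> gmul GQ y"
    if "x \<in> carrier (G1 GQ)" "y \<in> carrier (G1 GQ)" for x y
  proof -
    have "gmul GQ (x \<sqinter> y) = gmul GQ x \<inter> gmul GQ y"
      using that mul_closed by (auto simp: le_meet_iff)
    then show ?thesis using that gmul_ideal by (simp add: GQ.pb2.P_meet del: GQ_simps)
  qed
  show "gmul GQ \<top>\<^bsub>G1 GQ\<^esub> = \<top>\<^bsub>GQ.pb2.P\<^esub>"
    using mul_closed top_in le_top by (auto simp: GQ.pb2.P_top)
  fix A assume "A \<subseteq> carrier (G1 GQ)"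
  then have A: "A \<subseteq> carrier Q" by simp
  have I: "GQ.pb2.ideal U" if "U \<in> gmul GQ ` A" for U
    using that A gmul_ideal by (auto simp del: GQ_simps)
  have "\<Squnion>\<^bsub>GQ.pb2.P\<^esub>(gmul GQ ` A) = gmul GQ (\<Squnion>A)"
  proof (rule GQ.pb2.P.sup_eqI)
    show "gmul GQ ` A \<subseteq> carrier GQ.pb2.P" "gmul GQ (\<Squnion>A) \<in> carrier GQ.pb2.P"
      using I gmul_ideal [of "\<Squnion>A"] A by (auto simp del: GQ_simps)
    fix T assume "T \<in> carrier GQ.pb2.P"
    then have T: "GQ.pb2.ideal T" by simp
    have "gmul GQ (\<Squnion>A) \<subseteq> T" if le: "\<And>a. a \<in> A \<Longrightarrow> gmul GQ a \<subseteq> T"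
    proof clarify
      fix p q assume "(p, q) \<in> gmul GQ (\<Squnion>A)"
      then have pq: "p \<in> carrier Q" "q \<in> carrier Q" "p \<cdot> q \<sqsubseteq> \<Squnion>A" using A by auto
      show "(p, q) \<in> T"
      proof (rule mem_ideal_by_partial_units [OF T pq(1,2) sup_partial_units partial_units_sub])
        fix t assume t: "t \<in> partial_units Q" "t \<sqsubseteq> p"
        then have tQ: "t \<in> carrier Q" "t \<cdot> \<iota> t \<sqsubseteq> \<epsilon>" "\<iota> t \<in> carrier Q"
          by (auto simp: partial_units_iff inv_closed)
        have "(t, \<iota> t \<cdot> a) \<in> T" if a: "a \<in> A" for a
        proof -
          have aQ: "a \<in> carrier Q" using a A by auto
          have "t \<cdot> (\<iota> t \<cdot> a) \<sqsubseteq> a"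
            using mul_le_left [OF tQ(2) aQ] tQ aQ mul_closed by (simp flip: mul_assoc)
          then have "(t, \<iota> t \<cdot> a) \<in> gmul GQ a" using tQ aQ mul_closed by simp
          then show ?thesis using le [OF a] by auto
        qed
        then have "(t, \<Squnion>\<^bsub>G1 GQ\<^esub>((\<lambda>a. \<iota> t \<cdot> a) ` A)) \<in> T"
          using tQ A mul_closed by (intro GQ.pb2.idealD(4) [OF T]) auto
        then have *: "(t, \<iota> t \<cdot> \<Squnion>A) \<in> T" using tQ A by (simp add: mul_sup)
        have "t \<cdot> q \<sqsubseteq> p \<cdot> q" using t tQ pq by (intro mul_mono) auto
        then have "t \<cdot> q \<sqsubseteq> \<Squnion>A"
          by (rule le_trans) (use pq tQ A mul_closed in auto)
        then have "\<iota> t \<cdot> (t \<cdot> q) \<sqsubseteq> \<iota> t \<cdot> \<Squnion>A"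
          using tQ pq A mul_closed by (intro mul_mono) auto
        then show "(t, \<iota> t \<cdot> (t \<cdot> q)) \<in> T"
          using GQ.pb2.mem_tensor_mono [OF T *] tQ pq mul_closed by simp
      qed
    qed
    moreover have "gmul GQ a \<subseteq> gmul GQ (\<Squnion>A)" if "a \<in> A" for a
    proof -
      have "a \<in> carrier Q" using that A by auto
      then show ?thesis
        using A mul_closed sup_upper [OF A that] le_trans [of _ a "\<Squnion>A"] by auto
    qed
    ultimately have "gmul GQ (\<Squnion>A) \<subseteq> T \<longleftrightarrow> (\<forall>a\<in>A. gmul GQ a \<subseteq> T)" by (meson order_trans)
    then show "gmul GQ (\<Squnion>A) \<sqsubseteq>\<^bsub>GQ.pb2.P\<^esub> T \<longleftrightarrow> (\<forall>a\<in>gmul GQ ` A. a \<sqsubseteq>\<^bsub>GQ.pb2.P\<^esub> T)"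
      by simp
  qed
  then show "gmul GQ (\<Squnion>\<^bsub>G1 GQ\<^esub>A) = \<Squnion>\<^bsub>GQ.pb2.P\<^esub>(gmul GQ ` A)" by simp
qed

sublocale GQ: loc_mult_graph "quantale_groupoid Q" "\<lambda>a b. a \<cdot> b"
proof
  show "gmul GQ \<in> loc_map (G2 GQ) (G1 GQ)" by (rule GQ_gmul_map)
  show "x \<cdot> y \<in> carrier (G1 GQ)" if "x \<in> carrier (G1 GQ)" "y \<in> carrier (G1 GQ)" for x y
    using that mul_closed by simp
  show "x \<cdot> y \<sqsubseteq>\<^bsub>G1 GQ\<^esub> w \<longleftrightarrow> (x, y) \<in> gmul GQ w"
    if "x \<in> carrier (G1 GQ)" "y \<in> carrier (G1 GQ)" "w \<in> carrier (G1 GQ)" for x y w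
    using that by simp
  show "(x \<sqinter>\<^bsub>G1 GQ\<^esub> gdom GQ z) \<cdot> y = x \<cdot> y \<sqinter>\<^bsub>G1 GQ\<^esub> gdom GQ z"
    if "x \<in> carrier (G1 GQ)" "y \<in> carrier (G1 GQ)" "z \<in> carrier (G0 GQ)" for x y z
    using that restrict_left [of z x] restrict_left [of z "x \<cdot> y"] mul_closed
    by (simp add: meet_comm [of Q _ "z \<cdot> \<top>"] mul_assoc)
  show "x \<cdot> (y \<sqinter>\<^bsub>G1 GQ\<^esub> gran GQ z) = x \<cdot> y \<sqinter>\<^bsub>G1 GQ\<^esub> gran GQ z"
    if "x \<in> carrier (G1 GQ)" "y \<in> carrier (G1 GQ)" "z \<in> carrier (G0 GQ)" for x y z
    using that restrict_right [of z y] restrict_right [of z "x \<cdot> y"] mul_closed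
    by (simp add: meet_comm [of Q _ "\<top> \<cdot> z"] mul_assoc)
qed

end

section \<open>The groupoid laws and the local homeomorphism property\<close>

lemma loc_comp_eq_loc_mapI:
  assumes "k \<in> loc_map X Z" "\<And>z. z \<in> carrier Z \<Longrightarrow> f (g z) = k z"
  shows "loc_comp Z g f = k"
  by (rule extensionalityI [of _ "carrier Z"]) (use assms loc_mapD(5) in auto)

context inverse_quantal_frame
begin

lemma GQ_id_map: "loc_id (G1 GQ) \<in> loc_map (G1 GQ) (G1 GQ)"
  by (rule loc_id_map [OF GQ_complete(2)])

lemma GQ_ud_map: "loc_comp (G1 GQ) (gunit GQ) (gdom GQ) \<in> loc_map (G1 GQ) (G1 GQ)"
  and GQ_ur_map: "loc_comp (G1 GQ) (gunit GQ) (gran GQ) \<in> loc_map (G1 GQ) (G1 GQ)"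
  by (rule loc_comp_map [OF _ GQ_gunit_map], rule GQ_gdom_map GQ_gran_map)+

lemma GQ_unit_apply:
  assumes "a \<in> carrier Q"
  shows "loc_comp (G1 GQ) (gunit GQ) (gdom GQ) a = (a \<sqinter> \<epsilon>) \<cdot> \<top>"
    and "loc_comp (G1 GQ) (gunit GQ) (gran GQ) a = \<top> \<cdot> (a \<sqinter> \<epsilon>)"
  using assms unit_closed by (simp_all add: meet_right)

text \<open>An equation between m composed with a pairing and a map k says that k w is the least
  upper bound of the p x \<and> q y with x y \<le> w. The unit and inverse laws are all proved in
  this form.\<close>

lemma GQ_gpair_eqI:
  assumes p: "p \<in> loc_map (G1 GQ) (G1 GQ)" and q: "q \<in> loc_map (G1 GQ) (G1 GQ)"
    and comp: "\<And>z. z \<in> carrier (G0 GQ) \<Longrightarrow> p (gran GQ z) = q (gdom GQ z)"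
    and k: "k \<in> loc_map (G1 GQ) (G1 GQ)"
    and le: "\<And>x y w. \<lbrakk>x \<in> carrier Q; y \<in> carrier Q; w \<in> carrier Q; x \<cdot> y \<sqsubseteq> w\<rbrakk> \<Longrightarrow> p x \<sqinter> q y \<sqsubseteq> k w"
    and ge: "\<And>w v. \<lbrakk>w \<in> carrier Q; v \<in> carrier Q;
        \<And>x y. \<lbrakk>x \<in> carrier Q; y \<in> carrier Q; x \<cdot> y \<sqsubseteq> w\<rbrakk> \<Longrightarrow> p x \<sqinter> q y \<sqsubseteq> v\<rbrakk> \<Longrightarrow> k w \<sqsubseteq> v"
  shows "loc_comp (G1 GQ) (gmul GQ) (gpair GQ (G1 GQ) p q) = k"
proof (rule loc_comp_eq_loc_mapI [OF k])
  fix w assume "w \<in> carrier (G1 GQ)"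
  then have w: "w \<in> carrier Q" by simp
  let ?g = "gpair GQ (G1 GQ) p q (gmul GQ w)"
  have g: "?g \<in> carrier Q"
    using loc_mapD(1) [OF GQ.gpair_map [OF GQ_G1_frame p q comp]] loc_mapD(1) [OF GQ_gmul_map] w
    by simp
  have kw: "k w \<in> carrier Q" using loc_mapD(1) [OF k] w by simp
  note iff = GQ.gpair_le_iff [OF GQ_G1_frame p q, simplified, OF w]
  show "?g = k w"
  proof (rule le_antisym [OF _ _ g kw])
    show "?g \<sqsubseteq> k w" using iff [OF kw] le w by blast
    show "k w \<sqsubseteq> ?g" using iff [OF g] le_refl [OF g] by (intro ge [OF w g]) blast
  qed
qed

theorem quantale_groupoid_localic: "localic_groupoid GQ"
proof (rule localic_groupoid.intro)
  show "frame (G0 GQ)" "frame (G1 GQ)" by (rule GQ_G0_frame GQ_G1_frame)+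
  show "gdom GQ \<in> loc_map (G1 GQ) (G0 GQ)" "gran GQ \<in> loc_map (G1 GQ) (G0 GQ)"
    "gunit GQ \<in> loc_map (G0 GQ) (G1 GQ)" "ginv GQ \<in> loc_map (G1 GQ) (G1 GQ)"
    "gmul GQ \<in> loc_map (G2 GQ) (G1 GQ)"
    by (rule GQ_gdom_map GQ_gran_map GQ_gunit_map GQ_ginv_map GQ_gmul_map)+
  have id0: "loc_id (G0 GQ) \<in> loc_map (G0 GQ) (G0 GQ)"
    by (rule loc_id_map [OF GQ_complete(1)])
  have bt: "b \<cdot> \<top> \<sqinter> \<epsilon> = b" "\<top> \<cdot> b \<sqinter> \<epsilon> = b" if "b \<in> carrier Q" "b \<sqsubseteq> \<epsilon>" for b
    using that restrict_left [of b \<epsilon>] restrict_right [of b \<epsilon>] unit_closed mul_unit unit_mul by auto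
  show "loc_comp (G0 GQ) (gdom GQ) (gunit GQ) = loc_id (G0 GQ)"
    "loc_comp (G0 GQ) (gran GQ) (gunit GQ) = loc_id (G0 GQ)"
    by (rule loc_comp_eq_loc_mapI [OF id0], use bt top_in mul_closed in simp)+
  show "loc_comp (G0 GQ) (gdom GQ) (ginv GQ) = gran GQ" by (rule GQ_dom_inv)
  show "loc_comp (G0 GQ) (gran GQ) (ginv GQ) = gdom GQ"
    by (rule loc_comp_eq_loc_mapI [OF GQ_gdom_map])
      (simp add: inv_mul inv_top inv_of_unit mul_closed top_in)
  show "loc_comp (G0 GQ) (gdom GQ) (gmul GQ) = loc_comp (G0 GQ) (gdom GQ) (gpi1 GQ)"
  proof (rule loc_comp_eqI)
    fix b assume "b \<in> carrier (G0 GQ)"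
    then have b: "b \<in> carrier Q" "b \<sqsubseteq> \<epsilon>" "b \<cdot> \<top> \<in> carrier Q" using top_in mul_closed by auto
    have t: "gpi1 GQ (b \<cdot> \<top>) = GQ.pb2.tensor (b \<cdot> \<top>) \<top>"
      using b GQ.pb2.proj1_apply by (simp add: GQ.G2_folds)
    have T: "GQ.pb2.ideal (GQ.pb2.tensor (b \<cdot> \<top>) \<top>)"
      using b top_in by (intro GQ.pb2.tensor_ideal) auto
    \<comment> \<open>The tensor x \<otimes> y equals x b' \<otimes> y for b' the support of y, by
      balancing. The new left factor lies below x y y^* and hence below b 1, so the pair belongs to
      the inverse image along the first projection.\<close>
    have "gmul GQ (b \<cdot> \<top>) \<subseteq> GQ.pb2.tensor (b \<cdot> \<top>) \<top>"
    proof clarify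
      fix x y assume "(x, y) \<in> gmul GQ (b \<cdot> \<top>)"
      then have xy: "x \<in> carrier Q" "y \<in> carrier Q" "x \<cdot> y \<sqsubseteq> b \<cdot> \<top>" using b by auto
      note y = supp_closed [OF xy(2)] supp_le_unit [OF xy(2)] inv_closed [OF xy(2)]
      have "x \<cdot> supp y \<sqsubseteq> x \<cdot> (y \<cdot> \<iota> y)"
        using xy y supp_le mul_closed by (intro mul_mono) auto
      also have "x \<cdot> (y \<cdot> \<iota> y) = x \<cdot> y \<cdot> \<iota> y" using xy y by (simp add: mul_assoc)
      also have "\<dots> \<sqsubseteq> b \<cdot> \<top> \<cdot> \<top>"
        by (rule mul_mono) (use xy y b mul_closed top_in le_top in auto)
      also have "b \<cdot> \<top> \<cdot> \<top> = b \<cdot> (\<top> \<cdot> \<top>)" using b top_in by (simp add: mul_assoc)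
      also have "\<dots> \<sqsubseteq> b \<cdot> \<top>"
        using b mul_closed top_in le_top by (intro mul_mono) auto
      finally have le: "x \<cdot> supp y \<sqsubseteq> b \<cdot> \<top>"
        using xy y b mul_closed top_in by simp
      have bt: "(b \<cdot> \<top>, \<top>) \<in> GQ.pb2.tensor (b \<cdot> \<top>) \<top>"
        using b top_in by (intro GQ.pb2.tensor_self) auto
      have "(x \<cdot> supp y, y) \<in> GQ.pb2.tensor (b \<cdot> \<top>) \<top>"
        by (rule GQ.pb2.mem_tensor_mono [OF T bt]) (use xy y le le_top mul_closed in auto)
      moreover have "x \<sqinter> gran GQ (supp y) = x \<cdot> supp y"
        using xy y restrict_right [of "supp y" x] by (simp add: meet_comm [of Q x])
      moreover have "gdom GQ (supp y) \<sqinter> y = y"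
        using xy y restrict_left [of "supp y" y] by (simp add: supp_mul)
      ultimately show "(x, y) \<in> GQ.pb2.tensor (b \<cdot> \<top>) \<top>"
        using GQ.pb2.idealD(5) [OF T, of x y "supp y"] xy y by simp
    qed
    moreover have "(b \<cdot> \<top>, \<top>) \<in> gmul GQ (b \<cdot> \<top>)"
      using b mul_closed top_in le_top by (simp add: mul_assoc mul_mono)
    then have "GQ.pb2.tensor (b \<cdot> \<top>) \<top> \<subseteq> gmul GQ (b \<cdot> \<top>)"
      using GQ.pb2.tensor_le [OF _ _ gmul_ideal [OF b(3)]] b top_in by (simp del: GQ_simps)
    ultimately show "gmul GQ (gdom GQ b) = gpi1 GQ (gdom GQ b)" using b t by simp
  qed
  show "loc_comp (G0 GQ) (gran GQ) (gmul GQ) = loc_comp (G0 GQ) (gran GQ) (gpi2 GQ)"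
  proof (rule loc_comp_eqI)
    fix b assume "b \<in> carrier (G0 GQ)"
    then have b: "b \<in> carrier Q" "b \<sqsubseteq> \<epsilon>" "\<top> \<cdot> b \<in> carrier Q" using top_in mul_closed by auto
    have t: "gpi2 GQ (\<top> \<cdot> b) = GQ.pb2.tensor \<top> (\<top> \<cdot> b)"
      using b GQ.pb2.proj2_apply by (simp add: GQ.G2_folds)
    have T: "GQ.pb2.ideal (GQ.pb2.tensor \<top> (\<top> \<cdot> b))"
      using b top_in by (intro GQ.pb2.tensor_ideal) auto
    have "gmul GQ (\<top> \<cdot> b) \<subseteq> GQ.pb2.tensor \<top> (\<top> \<cdot> b)"
    proof clarify
      fix x y assume "(x, y) \<in> gmul GQ (\<top> \<cdot> b)"
      then have xy: "x \<in> carrier Q" "y \<in> carrier Q" "x \<cdot> y \<sqsubseteq> \<top> \<cdot> b" using b by auto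
      \<comment> \<open>The mirror argument needs a right support of x, which is the support of its
        involute: x \<open>?s\<close> = x and \<open>?s\<close> \<le> x^* x.\<close>
      let ?s = "supp (\<iota> x)"
      note x = inv_closed [OF xy(1)]
      note s = supp_closed [OF x] supp_le_unit [OF x]
      have s_le: "?s \<sqsubseteq> \<iota> x \<cdot> x" using supp_le [OF x] xy by (simp add: inv_inv)
      have xs: "x \<cdot> ?s = x"
        using arg_cong [OF supp_mul [OF x], of "qinv Q"] xy x s
        by (simp add: inv_mul inv_inv inv_of_unit)
      have "?s \<cdot> y \<sqsubseteq> \<iota> x \<cdot> x \<cdot> y"
        using xy x s s_le mul_closed by (intro mul_mono) auto
      also have "\<iota> x \<cdot> x \<cdot> y = \<iota> x \<cdot> (x \<cdot> y)" using xy x by (simp add: mul_assoc)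
      also have "\<dots> \<sqsubseteq> \<top> \<cdot> (\<top> \<cdot> b)"
        by (rule mul_mono) (use xy x b mul_closed top_in le_top in auto)
      also have "\<top> \<cdot> (\<top> \<cdot> b) = \<top> \<cdot> \<top> \<cdot> b" using b top_in by (simp add: mul_assoc)
      also have "\<dots> \<sqsubseteq> \<top> \<cdot> b"
        using b mul_closed top_in le_top by (intro mul_mono) auto
      finally have le: "?s \<cdot> y \<sqsubseteq> \<top> \<cdot> b"
        using xy x s b mul_closed top_in by simp
      have bt: "(\<top>, \<top> \<cdot> b) \<in> GQ.pb2.tensor \<top> (\<top> \<cdot> b)"
        using b top_in by (intro GQ.pb2.tensor_self) auto
      have "(x, ?s \<cdot> y) \<in> GQ.pb2.tensor \<top> (\<top> \<cdot> b)"
        by (rule GQ.pb2.mem_tensor_mono [OF T bt]) (use xy s le le_top mul_closed in auto)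
      moreover have "x \<sqinter> gran GQ ?s = x"
        using xy s xs restrict_right [of ?s x] by (simp add: meet_comm [of Q x])
      moreover have "gdom GQ ?s \<sqinter> y = ?s \<cdot> y"
        using xy s restrict_left [of ?s y] by simp
      ultimately show "(x, y) \<in> GQ.pb2.tensor \<top> (\<top> \<cdot> b)"
        using GQ.pb2.idealD(5) [OF T, of x y ?s] xy s by simp
    qed
    moreover have "(\<top>, \<top> \<cdot> b) \<in> gmul GQ (\<top> \<cdot> b)"
      using b mul_closed top_in le_top by (simp add: mul_mono flip: mul_assoc)
    then have "GQ.pb2.tensor \<top> (\<top> \<cdot> b) \<subseteq> gmul GQ (\<top> \<cdot> b)"
      using GQ.pb2.tensor_le [OF _ _ gmul_ideal [OF b(3)]] b top_in by (simp del: GQ_simps)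
    ultimately show "gmul GQ (gran GQ b) = gpi2 GQ (gran GQ b)" using b t by simp
  qed
  show "loc_comp (G1 GQ) (gmul GQ)
         (gpair GQ (G3 GQ) (loc_comp (G1 GQ) (gmul GQ) (gtri12 GQ)) (gtri3 GQ)) =
       loc_comp (G1 GQ) (gmul GQ)
         (gpair GQ (G3 GQ) (gtri1 GQ)
            (loc_comp (G1 GQ) (gmul GQ) (gpair GQ (G3 GQ) (gtri2 GQ) (gtri3 GQ))))"
    using GQ.mult3_left_eq_right_iff mul_assoc by (simp add: GQ.mult3_left_def GQ.mult3_right_def)
  have part: "(w \<sqinter> \<epsilon>) \<in> carrier Q" "(w \<sqinter> \<epsilon>) \<sqsubseteq> \<epsilon>" "(w \<sqinter> \<epsilon>) \<sqsubseteq> w" if "w \<in> carrier Q" for w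
    using that unit_closed by (auto simp: meet_left meet_right)
  show "loc_comp (G1 GQ) (gmul GQ)
         (gpair GQ (G1 GQ) (loc_comp (G1 GQ) (gunit GQ) (gdom GQ)) (loc_id (G1 GQ))) =
        loc_id (G1 GQ)"
  proof (rule GQ_gpair_eqI [OF GQ_ud_map GQ_id_map _ GQ_id_map], goal_cases)
    case (1 z)
    then show ?case using bt top_in mul_closed by simp
  next
    case (2 x y w)
    then have "(x \<sqinter> \<epsilon>) \<cdot> y \<sqsubseteq> x \<cdot> y" using part by (intro mul_mono) auto
    then have "(x \<sqinter> \<epsilon>) \<cdot> y \<sqsubseteq> w" by (rule le_trans) (use 2 part mul_closed in auto)
    then show ?case
      using 2 part restrict_left [of "x \<sqinter> \<epsilon>" y] by (simp only: GQ_unit_apply loc_id_apply G1_simps)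
  next
    \<comment> \<open>One pair already attains w, namely x = e and y = w.\<close>
    case (3 w v)
    have "(\<epsilon> \<sqinter> \<epsilon>) \<cdot> \<top> \<sqinter> w \<sqsubseteq> v"
      using 3(3) [OF unit_closed 3(1)] 3(1) unit_mul unit_closed
      by (simp only: GQ_unit_apply loc_id_apply G1_simps le_refl)
    then show ?case
      using 3 unit_closed top_in by (simp add: meet_idem unit_mul meet_top)
  qed
  show "loc_comp (G1 GQ) (gmul GQ)
         (gpair GQ (G1 GQ) (loc_id (G1 GQ)) (loc_comp (G1 GQ) (gunit GQ) (gran GQ))) =
        loc_id (G1 GQ)"
  proof (rule GQ_gpair_eqI [OF GQ_id_map GQ_ur_map _ GQ_id_map], goal_cases)
    case (1 z)
    then show ?case using bt top_in mul_closed by simp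
  next
    case (2 x y w)
    then have "x \<cdot> (y \<sqinter> \<epsilon>) \<sqsubseteq> x \<cdot> y" using part by (intro mul_mono) auto
    then have "x \<cdot> (y \<sqinter> \<epsilon>) \<sqsubseteq> w" by (rule le_trans) (use 2 part mul_closed in auto)
    then show ?case
      using 2 part restrict_right [of "y \<sqinter> \<epsilon>" x]
      by (simp only: GQ_unit_apply loc_id_apply G1_simps meet_comm [of Q x])
  next
    case (3 w v)
    have "w \<sqinter> \<top> \<cdot> (\<epsilon> \<sqinter> \<epsilon>) \<sqsubseteq> v"
      using 3(3) [OF 3(1) unit_closed] 3(1) mul_unit unit_closed
      by (simp only: GQ_unit_apply loc_id_apply G1_simps le_refl)
    then show ?case
      using 3 unit_closed top_in by (simp add: meet_idem mul_unit meet_top)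
  qed
  show "loc_comp (G1 GQ) (gmul GQ) (gpair GQ (G1 GQ) (loc_id (G1 GQ)) (ginv GQ)) =
       loc_comp (G1 GQ) (gunit GQ) (gdom GQ)"
  proof (rule GQ_gpair_eqI [OF GQ_id_map GQ_ginv_map _ GQ_ud_map], goal_cases)
    case (1 z)
    then show ?case using top_in mul_closed by (simp add: inv_mul inv_top inv_of_unit)
  next
    case (2 x y w)
    \<comment> \<open>An arrow in x whose inverse lies in y is in \<open>?t\<close>. The support of
      \<open>?t\<close> is below \<open>?t\<close> times its involute, hence below x y and w, and
      \<open>supp_adjoint\<close> transposes this to the claim.\<close>
    let ?t = "x \<sqinter> \<iota> y"
    have c: "?t \<in> carrier Q" "\<iota> y \<in> carrier Q" "\<iota> ?t \<in> carrier Q" using 2 inv_closed by auto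
    have "\<iota> ?t \<sqsubseteq> y" using c 2 by (simp add: inv_le_iff meet_right)
    then have "?t \<cdot> \<iota> ?t \<sqsubseteq> x \<cdot> y" using c 2 by (intro mul_mono) (auto simp: meet_left)
    then have "?t \<cdot> \<iota> ?t \<sqsubseteq> w" by (rule le_trans) (use c 2 mul_closed in auto)
    then have "supp ?t \<sqsubseteq> w"
      using le_trans [OF supp_le [OF c(1)]] c 2 mul_closed supp_closed by simp
    then have "supp ?t \<sqsubseteq> w \<sqinter> \<epsilon>"
      using c 2 supp_closed supp_le_unit unit_closed by (simp add: le_meet_iff)
    then have "?t \<sqsubseteq> (w \<sqinter> \<epsilon>) \<cdot> \<top>" using part [OF 2(3)] c by (simp add: supp_adjoint)
    then show ?case using 2 by (simp only: GQ_unit_apply loc_id_apply G1_simps GQ_simps)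
  next
    case (3 w v)
    \<comment> \<open>For a partial unit s, the element (w \<and> e) s and its involute have product
      below w, so their pair is admissible and bounds (w \<and> e) s by v. Since the partial units
      cover, joining over s reaches (w \<and> e) 1.\<close>
    note b = part [OF 3(1)]
    have "(w \<sqinter> \<epsilon>) \<cdot> s \<sqsubseteq> v" if s: "s \<in> partial_units Q" for s
    proof -
      have s': "s \<in> carrier Q" "s \<cdot> \<iota> s \<sqsubseteq> \<epsilon>" "\<iota> s \<in> carrier Q"
        using s by (auto simp: partial_units_iff inv_closed)
      let ?x = "(w \<sqinter> \<epsilon>) \<cdot> s"
      have c: "?x \<in> carrier Q" "\<iota> ?x \<in> carrier Q" using s' b mul_closed inv_closed by auto
      have "?x \<cdot> \<iota> ?x = (w \<sqinter> \<epsilon>) \<cdot> (s \<cdot> \<iota> s) \<cdot> (w \<sqinter> \<epsilon>)"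
        using s' b mul_closed by (simp add: inv_mul inv_of_unit mul_assoc)
      also have "\<dots> \<sqsubseteq> (w \<sqinter> \<epsilon>) \<cdot> (s \<cdot> \<iota> s)"
        using s' b mul_closed by (intro mul_le_right) auto
      also have "\<dots> \<sqsubseteq> w \<sqinter> \<epsilon>"
        using s' b mul_closed by (intro mul_le_right) auto
      also have "\<dots> \<sqsubseteq> w" by (rule b(3))
      finally have "?x \<cdot> \<iota> ?x \<sqsubseteq> w"
        using s' b 3(1) c mul_closed by simp
      then show ?thesis
        using 3(3) [OF c] c by (simp add: inv_inv meet_idem)
    qed
    then have "(w \<sqinter> \<epsilon>) \<cdot> \<Squnion>(partial_units Q) \<sqsubseteq> v"
      using 3 b partial_units_sub mul_closed
      by (subst mul_sup) (auto intro!: sup_least)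
    then show ?case
      using 3 by (simp only: GQ_unit_apply sup_partial_units)
  qed
  show "loc_comp (G1 GQ) (gmul GQ) (gpair GQ (G1 GQ) (ginv GQ) (loc_id (G1 GQ))) =
       loc_comp (G1 GQ) (gunit GQ) (gran GQ)"
  proof (rule GQ_gpair_eqI [OF GQ_ginv_map GQ_id_map _ GQ_ur_map], goal_cases)
    case (1 z)
    then show ?case using top_in mul_closed by (simp add: inv_mul inv_top inv_of_unit)
  next
    case (2 x y w)
    let ?t = "\<iota> x \<sqinter> y"
    have c: "?t \<in> carrier Q" "\<iota> x \<in> carrier Q" "\<iota> ?t \<in> carrier Q" using 2 inv_closed by auto
    have "\<iota> ?t \<sqsubseteq> x" using c 2 by (simp add: inv_le_iff meet_left)
    then have "\<iota> ?t \<cdot> ?t \<sqsubseteq> x \<cdot> y" using c 2 by (intro mul_mono) (auto simp: meet_right)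
    then have "\<iota> ?t \<cdot> ?t \<sqsubseteq> w" by (rule le_trans) (use c 2 mul_closed in auto)
    then have "supp (\<iota> ?t) \<sqsubseteq> w"
      using le_trans [OF supp_le [OF c(3)]] c 2 mul_closed supp_closed inv_closed
      by (simp add: inv_inv)
    then have "supp (\<iota> ?t) \<sqsubseteq> w \<sqinter> \<epsilon>"
      using c 2 supp_closed supp_le_unit unit_closed by (simp add: le_meet_iff)
    then have "\<iota> ?t \<sqsubseteq> (w \<sqinter> \<epsilon>) \<cdot> \<top>" using part [OF 2(3)] c by (simp add: supp_adjoint)
    then have "?t \<sqsubseteq> \<iota> ((w \<sqinter> \<epsilon>) \<cdot> \<top>)"
      using part [OF 2(3)] c top_in mul_closed by (simp add: inv_le_iff)
    also have "\<iota> ((w \<sqinter> \<epsilon>) \<cdot> \<top>) = \<top> \<cdot> (w \<sqinter> \<epsilon>)"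
      using part [OF 2(3)] top_in by (simp add: inv_mul inv_top inv_of_unit)
    finally show ?case using 2 by (simp only: GQ_unit_apply loc_id_apply G1_simps GQ_simps)
  next
    case (3 w v)
    note b = part [OF 3(1)]
    have "s \<cdot> (w \<sqinter> \<epsilon>) \<sqsubseteq> v" if s: "s \<in> partial_units Q" for s
    proof -
      have s': "s \<in> carrier Q" "\<iota> s \<cdot> s \<sqsubseteq> \<epsilon>" "\<iota> s \<in> carrier Q"
        using s by (auto simp: partial_units_iff inv_closed)
      let ?x = "s \<cdot> (w \<sqinter> \<epsilon>)"
      have c: "?x \<in> carrier Q" "\<iota> ?x \<in> carrier Q" using s' b mul_closed inv_closed by auto
      have "\<iota> ?x \<cdot> ?x = (w \<sqinter> \<epsilon>) \<cdot> (\<iota> s \<cdot> s) \<cdot> (w \<sqinter> \<epsilon>)"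
        using s' b mul_closed by (simp add: inv_mul inv_of_unit mul_assoc)
      also have "\<dots> \<sqsubseteq> (w \<sqinter> \<epsilon>) \<cdot> (\<iota> s \<cdot> s)"
        using s' b mul_closed by (intro mul_le_right) auto
      also have "\<dots> \<sqsubseteq> w \<sqinter> \<epsilon>"
        using s' b mul_closed by (intro mul_le_right) auto
      also have "\<dots> \<sqsubseteq> w" by (rule b(3))
      finally have "\<iota> ?x \<cdot> ?x \<sqsubseteq> w"
        using s' b 3(1) c mul_closed by simp
      then show ?thesis
        using 3(3) [OF c(2,1)] c by (simp add: inv_inv meet_idem)
    qed
    then have "\<Squnion>(partial_units Q) \<cdot> (w \<sqinter> \<epsilon>) \<sqsubseteq> v"
      using 3 b partial_units_sub mul_closed
      by (subst sup_mul) (auto intro!: sup_least)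
    then show ?case
      using 3 by (simp only: GQ_unit_apply sup_partial_units)
  qed
qed

theorem quantale_groupoid_etale: "etale_groupoid GQ"
proof -
  interpret L: localic_groupoid GQ by (rule quantale_groupoid_localic)
  have adj: "left_adjoint (G1 GQ) (G0 GQ) (gdom GQ) (\<lambda>x\<in>carrier (G1 GQ). supp x)"
    by (rule left_adjointI) (use supp_closed supp_le_unit supp_adjoint in auto)
  have dd: "direct_image (G1 GQ) (G0 GQ) (gdom GQ) = (\<lambda>x\<in>carrier (G1 GQ). supp x)"
    by (rule direct_image_eq [OF GQ_complete(2,1) adj])
  have "open_loc_map (G1 GQ) (G0 GQ) (gdom GQ)"
    unfolding open_loc_map_def dd
  proof (intro conjI ballI)
    fix x b assume "x \<in> carrier (G1 GQ)" "b \<in> carrier (G0 GQ)"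
    then have c: "x \<in> carrier Q" "b \<in> carrier Q" "b \<sqsubseteq> \<epsilon>" by auto
    show "(\<lambda>x\<in>carrier (G1 GQ). supp x) (gdom GQ b \<sqinter>\<^bsub>G1 GQ\<^esub> x) =
      b \<sqinter>\<^bsub>G0 GQ\<^esub> (\<lambda>x\<in>carrier (G1 GQ). supp x) x"
      using c restrict_left [of b x] supp_mul_unit [of b x] mul_closed top_in supp_closed supp_le_unit
      by simp
  qed (use GQ_gdom_map adj in auto)
  moreover have "bij_betw (\<lambda>x\<in>carrier (G1 GQ). supp x) (down (G1 GQ) s) (down (G0 GQ) (supp s)) \<and>
      (\<forall>x\<in>down (G1 GQ) s. \<forall>x'\<in>down (G1 GQ) s.
         x \<sqsubseteq>\<^bsub>G1 GQ\<^esub> x' \<longleftrightarrow>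
         (\<lambda>x\<in>carrier (G1 GQ). supp x) x \<sqsubseteq>\<^bsub>G0 GQ\<^esub> (\<lambda>x\<in>carrier (G1 GQ). supp x) x')"
    if s: "s \<in> partial_units Q" for s
  proof -
    have s': "s \<in> carrier Q" "\<iota> s \<cdot> s \<sqsubseteq> \<epsilon>" using s by (auto simp: partial_units_iff)
    \<comment> \<open>The cover required of a local homeomorphism consists of the partial units.
      Below such an s, the inverse of \<open>supp\<close> is b \<mapsto> b s, because supp x s \<le>
      x x^* s \<le> x s^* s \<le> x.\<close>
    have x_eq: "supp x \<cdot> s = x" if x: "x \<in> carrier Q" "x \<sqsubseteq> s" for x
    proof (rule le_antisym)
      note c = supp_closed [OF x(1)] inv_closed [OF x(1)]
      show "x \<sqsubseteq> supp x \<cdot> s"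
        using mul_mono [of "supp x" "supp x" x s] x s' c supp_mul by simp
      have "supp x \<cdot> s \<sqsubseteq> x \<cdot> \<iota> x \<cdot> s"
        using x s' c supp_le mul_closed by (intro mul_mono) auto
      also have "x \<cdot> \<iota> x \<cdot> s = x \<cdot> (\<iota> x \<cdot> s)" using x s' c by (simp add: mul_assoc)
      also have "\<dots> \<sqsubseteq> x \<cdot> (\<iota> s \<cdot> s)"
        using x s' c mul_closed inv_closed inv_mono by (intro mul_mono) auto
      also have "\<dots> \<sqsubseteq> x"
        using x s' mul_closed inv_closed by (intro mul_le_right) auto
      finally show "supp x \<cdot> s \<sqsubseteq> x"
        using x s' c mul_closed inv_closed by simp
    qed (use that s' supp_closed mul_closed in auto)
    have "bij_betw supp (down (G1 GQ) s) (down (G0 GQ) (supp s))"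
    proof (rule bij_betwI [where g = "\<lambda>b. b \<cdot> s"])
      show "supp \<in> down (G1 GQ) s \<rightarrow> down (G0 GQ) (supp s)"
        using s' supp_closed supp_le_unit supp_mono by (auto simp: down_def)
      show "(\<lambda>b. b \<cdot> s) \<in> down (G0 GQ) (supp s) \<rightarrow> down (G1 GQ) s"
        using s' mul_closed mul_le_left by (auto simp: down_def)
      show "supp x \<cdot> s = x" if "x \<in> down (G1 GQ) s" for x
        using that x_eq by (auto simp: down_def)
      show "supp (b \<cdot> s) = b" if "b \<in> down (G0 GQ) (supp s)" for b
        using that s' supp_closed by (auto simp: down_def supp_mul_unit le_iff_meet_eq)
    qed
    then have "bij_betw (\<lambda>x\<in>carrier (G1 GQ). supp x) (down (G1 GQ) s) (down (G0 GQ) (supp s))"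
      by (rule bij_betw_cong [THEN iffD1, rotated]) (auto simp: down_def)
    moreover have "x \<sqsubseteq> x' \<longleftrightarrow> supp x \<sqsubseteq> supp x'"
      if x: "x \<in> carrier Q" "x \<sqsubseteq> s" "x' \<in> carrier Q" "x' \<sqsubseteq> s" for x x'
    proof
      show "supp x \<sqsubseteq> supp x'" if "x \<sqsubseteq> x'" using that x by (intro supp_mono)
      assume "supp x \<sqsubseteq> supp x'"
      then have "supp x \<cdot> s \<sqsubseteq> supp x' \<cdot> s" using x s' supp_closed by (intro mul_mono) auto
      then show "x \<sqsubseteq> x'" using x_eq x by simp
    qed
    ultimately show ?thesis by (auto simp: down_def)
  qed
  ultimately have "local_homeomorphism (G1 GQ) (G0 GQ) (gdom GQ)"
    unfolding local_homeomorphism_def dd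
    using partial_units_sub sup_partial_units by (intro conjI exI [of _ "partial_units Q"]) auto
  then show ?thesis by unfold_locales
qed

sublocale GQ: etale_groupoid "quantale_groupoid Q"
  by (rule quantale_groupoid_etale)

text \<open>Product and unit are recovered from their upper bounds, the adjunctions having been
  built into the definition of the groupoid. Agreement of the operations is claimed on the carrier
  only, as the record fields are arbitrary elsewhere.\<close>

lemma quantale_of_GQ:
  shows "carrier (groupoid_quantale GQ) = carrier Q" "le (groupoid_quantale GQ) = le Q"
    and "\<lbrakk>a \<in> carrier Q; b \<in> carrier Q\<rbrakk> \<Longrightarrow> qmul (groupoid_quantale GQ) a b = a \<cdot> b"
    and "qunit (groupoid_quantale GQ) = \<epsilon>"
    and "a \<in> carrier Q \<Longrightarrow> qinv (groupoid_quantale GQ) a = \<iota> a"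
proof -
  show "carrier (groupoid_quantale GQ) = carrier Q" "le (groupoid_quantale GQ) = le Q"
    by (simp_all add: GQ.O_simps)
  show "qmul (groupoid_quantale GQ) a b = a \<cdot> b" if "a \<in> carrier Q" "b \<in> carrier Q"
    unfolding GQ.O_simps
  proof (rule eq_by_upper)
    show "GQ.qm a b \<in> carrier Q" "a \<cdot> b \<in> carrier Q"
      using that mul_closed GQ.Q.mul_closed [of a b] by simp_all
    show "GQ.qm a b \<sqsubseteq> w \<longleftrightarrow> a \<cdot> b \<sqsubseteq> w" if "w \<in> carrier Q" for w
      using that \<open>a \<in> carrier Q\<close> \<open>b \<in> carrier Q\<close> GQ.Q.mul_le_iff [of a b w] by simp
  qed
  show "qunit (groupoid_quantale GQ) = \<epsilon>"
    unfolding GQ.O_simps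
    by (rule GQ.X.eq_by_upper)
      (use GQ.e_closed unit_closed GQ.uu_le_iff [of \<epsilon>] in \<open>simp_all add: le_meet_iff\<close>)
  show "qinv (groupoid_quantale GQ) a = \<iota> a" if "a \<in> carrier Q"
    using that by (simp add: GQ.O_inv)
qed

end

section \<open>The equivalence\<close>

lemma groupoid_functorD:
  assumes "(f0, f1) \<in> groupoid_functor G H"
  shows "f0 \<in> loc_map (G0 G) (G0 H)" and "f1 \<in> loc_map (G1 G) (G1 H)"
    and "z \<in> carrier (G0 H) \<Longrightarrow> f1 (gdom H z) = gdom G (f0 z)"
    and "z \<in> carrier (G0 H) \<Longrightarrow> f1 (gran H z) = gran G (f0 z)"
    and "x \<in> carrier (G1 H) \<Longrightarrow> gunit G (f1 x) = f0 (gunit H x)"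
    and "x \<in> carrier (G1 H) \<Longrightarrow> gmul G (f1 x) =
      gpair H (G2 G) (loc_comp (G1 H) f1 (gpi1 G)) (loc_comp (G1 H) f1 (gpi2 G)) (gmul H x)"
  using assms unfolding groupoid_functor_def by (auto dest: loc_comp_eqD)

lemma groupoid_functorI:
  assumes "f0 \<in> loc_map (G0 G) (G0 H)" and "f1 \<in> loc_map (G1 G) (G1 H)"
    and "\<And>z. z \<in> carrier (G0 H) \<Longrightarrow> f1 (gdom H z) = gdom G (f0 z)"
    and "\<And>z. z \<in> carrier (G0 H) \<Longrightarrow> f1 (gran H z) = gran G (f0 z)"
    and "\<And>x. x \<in> carrier (G1 H) \<Longrightarrow> gunit G (f1 x) = f0 (gunit H x)"
    and "\<And>x. x \<in> carrier (G1 H) \<Longrightarrow> gmul G (f1 x) =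
      gpair H (G2 G) (loc_comp (G1 H) f1 (gpi1 G)) (loc_comp (G1 H) f1 (gpi2 G)) (gmul H x)"
  shows "(f0, f1) \<in> groupoid_functor G H"
  using assms unfolding groupoid_functor_def by (auto intro!: loc_comp_eqI)

text \<open>Since \<open>d \<circ> u = 1\<close>, the object part of a functor is determined by its arrow part.\<close>

lemma groupoid_functor_unique:
  assumes H: "localic_groupoid H"
    and f: "(f0, f1) \<in> groupoid_functor G H" and g: "(g0, f1) \<in> groupoid_functor G H"
  shows "f0 = g0"
proof (rule loc_map_ext [OF groupoid_functorD(1) [OF f] groupoid_functorD(1) [OF g]])
  interpret H: localic_groupoid H by (rule H)
  fix z assume z: "z \<in> carrier (G0 H)"
  then have dz: "gdom H z \<in> carrier (G1 H)" using loc_mapD(1) [OF H.gdom_map] by simp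
  have "f0 (gunit H (gdom H z)) = g0 (gunit H (gdom H z))"
    using groupoid_functorD(5) [OF f dz] groupoid_functorD(5) [OF g dz] by simp
  then show "f0 z = g0 z" using z by (simp add: H.structure_apply)
qed

lemma groupoid_functor_id:
  assumes "localic_groupoid G"
  shows "(loc_id (G0 G), loc_id (G1 G)) \<in> groupoid_functor G G"
proof -
  interpret localic_groupoid G by (rule assms)
  show ?thesis
  proof (rule groupoid_functorI)
    show "loc_id Y \<in> loc_map Y Y" by (rule loc_id_map) unfold_locales
    show "loc_id X \<in> loc_map X X" by (rule id_map)
    fix x assume x: "x \<in> carrier X"
    have "m x \<in> carrier (G2 G)" using loc_mapD(1) [OF gmul_map x] .
    then have "gpair G (G2 G) (gpi1 G) (gpi2 G) (m x) = m x"
      using pb2.pair_self by (simp add: G2_folds)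
    then show "m (loc_id X x) = gpair G (G2 G) (loc_comp X (loc_id X) (gpi1 G))
        (loc_comp X (loc_id X) (gpi2 G)) (m x)"
      using x by (simp add: loc_comp_id [OF gpi1_map] loc_comp_id [OF gpi2_map])
  qed (use loc_mapD(1) [OF gdom_map] loc_mapD(1) [OF gran_map] u_closed in auto)
qed

lemma groupoid_functor_comp:
  assumes G: "localic_groupoid G" and H: "localic_groupoid H" and K: "localic_groupoid K"
    and f: "(f0, f1) \<in> groupoid_functor G H" and g: "(g0, g1) \<in> groupoid_functor H K"
  shows "(loc_comp (G0 K) g0 f0, loc_comp (G1 K) g1 f1) \<in> groupoid_functor G K"
proof -
  interpret G: localic_groupoid G by (rule G)
  interpret H: localic_groupoid H by (rule H)
  interpret K: localic_groupoid K by (rule K)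
  note fD = groupoid_functorD [OF f] and gD = groupoid_functorD [OF g]
  note f0D = loc_mapD(1) [OF fD(1)]
  note g0D = loc_mapD(1) [OF gD(1)] and g1D = loc_mapD(1) [OF gD(2)]
  note Kd = loc_mapD(1) [OF K.gdom_map] loc_mapD(1) [OF K.gran_map]
  let ?p1 = "loc_comp (G1 H) f1 (gpi1 G)" and ?p2 = "loc_comp (G1 H) f1 (gpi2 G)"
  let ?q1 = "loc_comp (G1 K) g1 (gpi1 H)" and ?q2 = "loc_comp (G1 K) g1 (gpi2 H)"
  \<comment> \<open>These are the maps induced on composable pairs. Compatibility of the composite
    with m reduces to their composition law, which holds because precomposing a pairing gives the
    pairing of the precomposed components.\<close>
  let ?f2 = "gpair H (G2 G) ?p1 ?p2" and ?g2 = "gpair K (G2 H) ?q1 ?q2"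
  note p1 = loc_comp_map [OF G.gpi1_map fD(2)] and p2 = loc_comp_map [OF G.gpi2_map fD(2)]
  note q1 = loc_comp_map [OF H.gpi1_map gD(2)] and q2 = loc_comp_map [OF H.gpi2_map gD(2)]
  note Hd = loc_mapD(1) [OF H.gdom_map] loc_mapD(1) [OF H.gran_map]
  have pc: "?p1 (gran H z) = ?p2 (gdom H z)" if "z \<in> carrier (G0 H)" for z
    using that fD(3,4) f0D Hd G.composable_pi by (simp add: G.composable_def)
  have qc: "?q1 (gran K z) = ?q2 (gdom K z)" if "z \<in> carrier (G0 K)" for z
    using that gD(3,4) g0D Kd H.composable_pi by (simp add: H.composable_def)
  have f2: "?f2 \<in> loc_map (G2 G) (G2 H)"
    by (rule H.gpair_map [OF G.G2.frame_axioms p1 p2 pc])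
  have g2: "?g2 \<in> loc_map (G2 H) (G2 K)"
    by (rule K.gpair_map [OF H.G2.frame_axioms q1 q2 qc])
  have f2_pi: "?f2 (gpi1 H x) = gpi1 G (f1 x)" "?f2 (gpi2 H x) = gpi2 G (f1 x)"
    if "x \<in> carrier (G1 H)" for x
    using H.gpair_pi [OF G.G2.frame_axioms p1 p2 pc] that by simp_all
  have e1: "loc_comp (G1 K) ?q1 ?f2 = loc_comp (G1 K) (loc_comp (G1 K) g1 f1) (gpi1 G)"
    and e2: "loc_comp (G1 K) ?q2 ?f2 = loc_comp (G1 K) (loc_comp (G1 K) g1 f1) (gpi2 G)"
    by (rule loc_comp_eqI, use f2_pi g1D in simp)+
  have f2g2: "loc_comp (G2 K) ?g2 ?f2 = gpair K (G2 G) (loc_comp (G1 K) ?q1 ?f2) (loc_comp (G1 K) ?q2 ?f2)"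
    by (rule K.gpair_comp [OF H.G2.frame_axioms q1 q2 qc G.G2.frame_axioms f2])
  show ?thesis
  proof (rule groupoid_functorI)
    show "loc_comp (G0 K) g0 f0 \<in> loc_map (G0 G) (G0 K)" by (rule loc_comp_map [OF fD(1) gD(1)])
    show "loc_comp (G1 K) g1 f1 \<in> loc_map (G1 G) (G1 K)" by (rule loc_comp_map [OF fD(2) gD(2)])
    fix x assume x: "x \<in> carrier (G1 K)"
    have "gmul G (f1 (g1 x)) = ?f2 (gmul H (g1 x))" by (rule fD(6) [OF g1D [OF x]])
    also have "gmul H (g1 x) = ?g2 (gmul K x)" by (rule gD(6) [OF x])
    also have "?f2 (?g2 (gmul K x)) = loc_comp (G2 K) ?g2 ?f2 (gmul K x)"
      using loc_mapD(1) [OF K.gmul_map x] by simp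
    finally show "gmul G (loc_comp (G1 K) g1 f1 x) =
        gpair K (G2 G) (loc_comp (G1 K) (loc_comp (G1 K) g1 f1) (gpi1 G))
          (loc_comp (G1 K) (loc_comp (G1 K) g1 f1) (gpi2 G)) (gmul K x)"
      using x by (simp add: f2g2 e1 e2)
  qed (use fD(3-5) gD(3-5) g0D g1D Kd K.u_closed in auto)
qed

section \<open>Quantale homomorphisms and the category \<open>IQLoc\<close>\<close>

lemma quantale_homD:
  assumes "h \<in> quantale_hom Q R"
  shows "a \<in> carrier Q \<Longrightarrow> h a \<in> carrier R"
    and "h \<in> extensional (carrier Q)"
    and "A \<subseteq> carrier Q \<Longrightarrow> h (\<Squnion>\<^bsub>Q\<^esub>A) = \<Squnion>\<^bsub>R\<^esub>(h ` A)"
    and "\<lbrakk>a \<in> carrier Q; b \<in> carrier Q\<rbrakk> \<Longrightarrow> h (a \<cdot>\<^bsub>Q\<^esub> b) = h a \<cdot>\<^bsub>R\<^esub> h b"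
    and "a \<in> carrier Q \<Longrightarrow> h (\<iota>\<^bsub>Q\<^esub> a) = \<iota>\<^bsub>R\<^esub> (h a)"
    and "h \<epsilon>\<^bsub>Q\<^esub> = \<epsilon>\<^bsub>R\<^esub>"
  using assms by (auto simp: quantale_hom_def sup_pres_def PiE_def)

lemma quantale_homI:
  assumes "complete_lattice Q" "complete_lattice R" "h \<in> carrier Q \<rightarrow>\<^sub>E carrier R"
    and "\<And>A. A \<subseteq> carrier Q \<Longrightarrow> h (\<Squnion>\<^bsub>Q\<^esub>A) = \<Squnion>\<^bsub>R\<^esub>(h ` A)"
    and "\<And>a b. \<lbrakk>a \<in> carrier Q; b \<in> carrier Q\<rbrakk> \<Longrightarrow> h (a \<cdot>\<^bsub>Q\<^esub> b) = h a \<cdot>\<^bsub>R\<^esub> h b"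
    and "\<And>a. a \<in> carrier Q \<Longrightarrow> h (\<iota>\<^bsub>Q\<^esub> a) = \<iota>\<^bsub>R\<^esub> (h a)"
    and "h \<epsilon>\<^bsub>Q\<^esub> = \<epsilon>\<^bsub>R\<^esub>"
  shows "h \<in> quantale_hom Q R"
  using assms by (auto simp: quantale_hom_def sup_pres_def)

lemma quantale_hom_comp:
  assumes Q: "unital_involutive_quantale Q" and R: "unital_involutive_quantale R"
    and S: "unital_involutive_quantale S"
    and h: "h \<in> quantale_hom Q R" and k: "k \<in> quantale_hom R S"
  shows "compose (carrier Q) k h \<in> quantale_hom Q S"
proof -
  interpret Q: unital_involutive_quantale Q by (rule Q)
  interpret R: unital_involutive_quantale R by (rule R)
  interpret S: unital_involutive_quantale S by (rule S)
  note hD = quantale_homD [OF h] and kD = quantale_homD [OF k]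
  show ?thesis
  proof (rule quantale_homI)
    show "complete_lattice Q" "complete_lattice S" by unfold_locales
    fix A assume A: "A \<subseteq> carrier Q"
    then have "h ` A \<subseteq> carrier R" using hD(1) by auto
    with A have "k (h (\<Squnion>\<^bsub>Q\<^esub>A)) = \<Squnion>\<^bsub>S\<^esub>((\<lambda>x. k (h x)) ` A)"
      using hD(3) kD(3) by (simp add: image_image)
    also have "(\<lambda>x. k (h x)) ` A = compose (carrier Q) k h ` A"
      using A by (intro image_cong) (auto simp: compose_def)
    finally show "compose (carrier Q) k h (\<Squnion>\<^bsub>Q\<^esub>A) = \<Squnion>\<^bsub>S\<^esub>(compose (carrier Q) k h ` A)"
      using A by (simp add: compose_def)
  qed (use hD kD Q.mul_closed Q.inv_closed Q.unit_closed in \<open>auto simp: compose_def\<close>)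
qed

text \<open>Equality of records would be too strong, because the operations may differ outside the
  carrier. Agreement in this sense makes the identity on the carrier a homomorphism in both
  directions.\<close>

definition same_quantale :: "('a, 'b) inv_quantale_scheme \<Rightarrow> ('a, 'c) inv_quantale_scheme \<Rightarrow> bool" where
  "same_quantale Q R \<longleftrightarrow> carrier Q = carrier R \<and> le Q = le R \<and> qunit Q = qunit R \<and>
     (\<forall>a\<in>carrier Q. \<forall>b\<in>carrier Q. a \<cdot>\<^bsub>Q\<^esub> b = a \<cdot>\<^bsub>R\<^esub> b) \<and> (\<forall>a\<in>carrier Q. \<iota>\<^bsub>Q\<^esub> a = \<iota>\<^bsub>R\<^esub> a)"

lemma same_quantale_sym: "same_quantale Q R \<Longrightarrow> same_quantale R Q"
  by (simp add: same_quantale_def)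

lemma same_quantale_id:
  assumes Q: "unital_involutive_quantale Q" and R: "unital_involutive_quantale R"
    and s: "same_quantale Q R"
  shows "(\<lambda>x\<in>carrier Q. x) \<in> quantale_hom Q R"
proof -
  interpret Q: unital_involutive_quantale Q by (rule Q)
  interpret R: unital_involutive_quantale R by (rule R)
  have eqs: "carrier Q = carrier R" "le Q = le R" using s by (auto simp: same_quantale_def)
  show ?thesis
  proof (rule quantale_homI)
    show "complete_lattice Q" "complete_lattice R" by unfold_locales
    fix A assume A: "A \<subseteq> carrier Q"
    then have "(\<lambda>x\<in>carrier Q. x) ` A = A" by (auto simp: subset_eq image_iff)
    then show "(\<lambda>x\<in>carrier Q. x) (\<Squnion>\<^bsub>Q\<^esub>A) = \<Squnion>\<^bsub>R\<^esub>((\<lambda>x\<in>carrier Q. x) ` A)"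
      using Q.sup_closed [OF A] gorder_cong(1) [OF eqs] by simp
  qed (use s Q.mul_closed Q.inv_closed Q.unit_closed in \<open>auto simp: same_quantale_def\<close>)
qed

lemma IQFrm_simps:
  "Obj IQFrm = {Q. inverse_quantal_frame Q}"
  "Hom IQFrm Q R = {h \<in> quantale_hom Q R. meet_pres Q R h \<and> h \<top>\<^bsub>Q\<^esub> = \<top>\<^bsub>R\<^esub>}"
  "Ident IQFrm Q = (\<lambda>a\<in>carrier Q. a)"
  "Comp IQFrm Q R S k h = compose (carrier Q) k h"
  by (simp_all add: IQFrm_def)

lemma IQLoc_simps:
  "Obj IQLoc = {Q. inverse_quantal_frame Q}"
  "Hom IQLoc Q R = {h \<in> quantale_hom R Q. meet_pres R Q h \<and> h \<top>\<^bsub>R\<^esub> = \<top>\<^bsub>Q\<^esub>}"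
  "Ident IQLoc Q = (\<lambda>a\<in>carrier Q. a)"
  "Comp IQLoc Q R S k h = compose (carrier S) h k"
  by (simp_all add: IQLoc_def op_category_def IQFrm_simps)

lemma inverse_quantal_frameD:
  assumes "inverse_quantal_frame Q"
  shows "unital_involutive_quantale Q" "frame Q" "complete_lattice Q"
  using assms by (simp_all add: inverse_quantal_frame_def frame_def)

lemma IQLoc_homI:
  assumes Q: "inverse_quantal_frame Q" and R: "inverse_quantal_frame R"
    and "h \<in> quantale_hom R Q"
    and "\<And>x y. \<lbrakk>x \<in> carrier R; y \<in> carrier R\<rbrakk> \<Longrightarrow> h (x \<sqinter>\<^bsub>R\<^esub> y) = h x \<sqinter>\<^bsub>Q\<^esub> h y"
    and "h \<top>\<^bsub>R\<^esub> = \<top>\<^bsub>Q\<^esub>"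
  shows "h \<in> Hom IQLoc Q R"
  using assms inverse_quantal_frameD [OF Q] inverse_quantal_frameD [OF R]
  by (simp add: IQLoc_simps meet_pres_def complete_lattice_lattice)

lemma IQLoc_homD:
  assumes "h \<in> Hom IQLoc Q R"
  shows "h \<in> quantale_hom R Q"
    and "\<lbrakk>x \<in> carrier R; y \<in> carrier R\<rbrakk> \<Longrightarrow> h (x \<sqinter>\<^bsub>R\<^esub> y) = h x \<sqinter>\<^bsub>Q\<^esub> h y"
    and "h \<top>\<^bsub>R\<^esub> = \<top>\<^bsub>Q\<^esub>"
  using assms by (auto simp: IQLoc_simps meet_pres_def)

lemma IQLoc_same:
  assumes Q: "inverse_quantal_frame Q" and R: "inverse_quantal_frame R" and s: "same_quantale Q R"
  shows "(\<lambda>x\<in>carrier Q. x) \<in> Hom IQLoc Q R"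
proof (rule IQLoc_homI [OF Q R])
  interpret R: inverse_quantal_frame R by (rule R)
  have eqs: "carrier R = carrier Q" "le R = le Q" using s by (auto simp: same_quantale_def)
  show "(\<lambda>x\<in>carrier Q. x) \<in> quantale_hom R Q"
    using same_quantale_id [OF inverse_quantal_frameD(1) [OF R] inverse_quantal_frameD(1) [OF Q]
        same_quantale_sym [OF s]] eqs by simp
  show "(\<lambda>x\<in>carrier Q. x) (x \<sqinter>\<^bsub>R\<^esub> y) = (\<lambda>x\<in>carrier Q. x) x \<sqinter>\<^bsub>Q\<^esub> (\<lambda>x\<in>carrier Q. x) y"
    if "x \<in> carrier R" "y \<in> carrier R" for x y
    using that R.meet_closed [OF that] eqs gorder_cong(2) [OF eqs] by simp
  show "(\<lambda>x\<in>carrier Q. x) \<top>\<^bsub>R\<^esub> = \<top>\<^bsub>Q\<^esub>"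
    using R.top_in eqs gorder_cong(4) [OF eqs] by simp
qed

lemma IQLoc_comp:
  assumes P: "inverse_quantal_frame P" and Q: "inverse_quantal_frame Q"
    and R: "inverse_quantal_frame R" and f: "f \<in> Hom IQLoc P Q" and g: "g \<in> Hom IQLoc Q R"
  shows "Comp IQLoc P Q R g f \<in> Hom IQLoc P R"
  unfolding IQLoc_simps(4)
proof (rule IQLoc_homI [OF P R])
  interpret R: inverse_quantal_frame R by (rule R)
  note fD = IQLoc_homD [OF f] and gD = IQLoc_homD [OF g]
  show "compose (carrier R) f g \<in> quantale_hom R P"
    by (rule quantale_hom_comp [OF _ _ _ gD(1) fD(1)]) (rule inverse_quantal_frameD P Q R)+
  show "compose (carrier R) f g (x \<sqinter>\<^bsub>R\<^esub> y) =
      compose (carrier R) f g x \<sqinter>\<^bsub>P\<^esub> compose (carrier R) f g y"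
    if "x \<in> carrier R" "y \<in> carrier R" for x y
    using that fD(2) gD(2) quantale_homD(1) [OF gD(1)] by (simp add: compose_def)
  show "compose (carrier R) f g \<top>\<^bsub>R\<^esub> = \<top>\<^bsub>P\<^esub>"
    using fD(3) gD(3) R.top_in by (simp add: compose_def)
qed

lemma IQLoc_category: "is_category IQLoc"
  unfolding is_category_def
proof (intro conjI ballI)
  fix Q :: "'a inv_quantale" assume "Q \<in> Obj IQLoc"
  then have Q: "inverse_quantal_frame Q" by (simp add: IQLoc_simps)
  show "Ident IQLoc Q \<in> Hom IQLoc Q Q"
    using IQLoc_same [OF Q Q] by (simp add: IQLoc_simps(3) same_quantale_def)
next
  fix P Q R :: "'a inv_quantale" and f g
  assume "P \<in> Obj IQLoc" "Q \<in> Obj IQLoc" "R \<in> Obj IQLoc" "f \<in> Hom IQLoc P Q" "g \<in> Hom IQLoc Q R"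
  then show "Comp IQLoc P Q R g f \<in> Hom IQLoc P R"
    using IQLoc_comp by (simp add: IQLoc_simps(1))
next
  fix Q R :: "'a inv_quantale" and f
  assume f: "f \<in> Hom IQLoc Q R"
  note fD = quantale_homD(1,2) [OF IQLoc_homD(1) [OF f]]
  show "Comp IQLoc Q Q R f (Ident IQLoc Q) = f" "Comp IQLoc Q R R (Ident IQLoc R) f = f"
    unfolding IQLoc_simps
    by (rule extensionalityI [of _ "carrier R"], use fD in \<open>auto simp: compose_def\<close>)+
next
  fix P Q R S :: "'a inv_quantale" and f g h
  assume "f \<in> Hom IQLoc P Q" "g \<in> Hom IQLoc Q R" and h: "h \<in> Hom IQLoc R S"
  note hD = quantale_homD(1) [OF IQLoc_homD(1) [OF h]]
  show "Comp IQLoc P R S h (Comp IQLoc P Q R g f) = Comp IQLoc P Q S (Comp IQLoc Q R S h g) f"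
    unfolding IQLoc_simps
    by (rule extensionalityI [of _ "carrier S"]) (use hD in \<open>auto simp: compose_def\<close>)
qed

section \<open>The category \<open>Gpd_C\<close>\<close>

lemma Gpd_C_simps:
  "Obj Gpd_C = {G. etale_groupoid G}"
  "Hom Gpd_C = covering_functor"
  "Ident Gpd_C G = (loc_id (G0 G), loc_id (G1 G))"
  "Comp Gpd_C G H K (g0, g1) (f0, f1) = (loc_comp (G0 K) g0 f0, loc_comp (G1 K) g1 f1)"
  by (simp_all add: Gpd_C_def Gpd_def)

lemma covering_functorD:
  assumes "f \<in> covering_functor G H"
  obtains f0 f1 where "f = (f0, f1)" "(f0, f1) \<in> groupoid_functor G H"
    "f1 \<in> quantale_hom (groupoid_quantale H) (groupoid_quantale G)"
  using assms by (auto simp: covering_functor_def)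

lemma etale_groupoidD:
  assumes "etale_groupoid G"
  shows "localic_groupoid G" "inverse_quantal_frame (groupoid_quantale G)"
    "unital_involutive_quantale (groupoid_quantale G)"
    "carrier (groupoid_quantale G) = carrier (G1 G)" "le (groupoid_quantale G) = le (G1 G)"
proof -
  interpret etale_groupoid G by (rule assms)
  show "localic_groupoid G" by (rule localic_groupoid_axioms)
  show "inverse_quantal_frame (groupoid_quantale G)"
    by (rule groupoid_quantale_inverse_quantal_frame)
  then show "unital_involutive_quantale (groupoid_quantale G)"
    by (rule inverse_quantal_frameD)
  show "carrier (groupoid_quantale G) = carrier (G1 G)" "le (groupoid_quantale G) = le (G1 G)"
    by (simp_all add: O_simps)
qed

text \<open>By \<open>groupoid_functor_unique\<close> the arrow part is faithful. The category laws,
  the inverse laws of the unit isomorphism and its naturality all become equations between single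
  frame homomorphisms.\<close>

lemma covering_functor_eqI:
  assumes "etale_groupoid H" "f \<in> covering_functor G H" "g \<in> covering_functor G H" "snd f = snd g"
  shows "f = g"
  using assms groupoid_functor_unique [OF etale_groupoidD(1)]
  by (auto elim!: covering_functorD)

lemma covering_functor_id:
  assumes "etale_groupoid G"
  shows "(loc_id (G0 G), loc_id (G1 G)) \<in> covering_functor G G"
proof -
  note D = etale_groupoidD [OF assms]
  have "loc_id (G1 G) \<in> quantale_hom (groupoid_quantale G) (groupoid_quantale G)"
    using same_quantale_id [OF D(3) D(3)] by (simp add: loc_id_def D(4) same_quantale_def)
  then show ?thesis using groupoid_functor_id [OF D(1)] by (simp add: covering_functor_def)
qed

lemma covering_functor_comp:
  assumes G: "etale_groupoid G" and H: "etale_groupoid H" and K: "etale_groupoid K"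
    and f: "f \<in> covering_functor G H" and g: "g \<in> covering_functor H K"
  shows "Comp Gpd_C G H K g f \<in> covering_functor G K"
    and "snd (Comp Gpd_C G H K g f) = loc_comp (G1 K) (snd g) (snd f)"
proof -
  note D = etale_groupoidD [OF G] etale_groupoidD [OF H] etale_groupoidD [OF K]
  obtain f0 f1 where f: "f = (f0, f1)" "(f0, f1) \<in> groupoid_functor G H"
    "f1 \<in> quantale_hom (groupoid_quantale H) (groupoid_quantale G)"
    using covering_functorD [OF f] .
  obtain g0 g1 where g: "g = (g0, g1)" "(g0, g1) \<in> groupoid_functor H K"
    "g1 \<in> quantale_hom (groupoid_quantale K) (groupoid_quantale H)"
    using covering_functorD [OF g] .
  have "loc_comp (G1 K) g1 f1 \<in> quantale_hom (groupoid_quantale K) (groupoid_quantale G)"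
    using quantale_hom_comp [OF D(13,8,3) g(3) f(3)] D(14) by (simp add: loc_comp_def)
  then show "Comp Gpd_C G H K g f \<in> covering_functor G K"
    using groupoid_functor_comp [OF D(1,6,11) f(2) g(2)]
    by (simp add: Gpd_C_simps covering_functor_def f(1) g(1))
  show "snd (Comp Gpd_C G H K g f) = loc_comp (G1 K) (snd g) (snd f)"
    by (simp add: Gpd_C_simps f(1) g(1))
qed

lemma covering_functor_snd:
  assumes "f \<in> covering_functor G H" shows "snd f \<in> loc_map (G1 G) (G1 H)"
  using assms by (auto elim!: covering_functorD dest: groupoid_functorD(2))

lemma Gpd_C_category: "is_category Gpd_C"
  unfolding is_category_def
proof (intro conjI ballI)
  fix G :: "'a loc_groupoid" assume "G \<in> Obj Gpd_C"
  then show "Ident Gpd_C G \<in> Hom Gpd_C G G"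
    using covering_functor_id by (simp add: Gpd_C_simps)
next
  fix G H K :: "'a loc_groupoid" and f g
  assume "G \<in> Obj Gpd_C" "H \<in> Obj Gpd_C" "K \<in> Obj Gpd_C" "f \<in> Hom Gpd_C G H" "g \<in> Hom Gpd_C H K"
  then show "Comp Gpd_C G H K g f \<in> Hom Gpd_C G K"
    using covering_functor_comp(1) by (simp add: Gpd_C_simps)
next
  fix G H :: "'a loc_groupoid" and f
  assume "G \<in> Obj Gpd_C" "H \<in> Obj Gpd_C" "f \<in> Hom Gpd_C G H"
  then have G: "etale_groupoid G" and H: "etale_groupoid H" and f: "f \<in> covering_functor G H"
    by (auto simp: Gpd_C_simps)
  note i = covering_functor_id [OF G] covering_functor_id [OF H]
  note s = loc_comp_id [OF covering_functor_snd [OF f]]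
  show "Comp Gpd_C G G H f (Ident Gpd_C G) = f" "Comp Gpd_C G H H (Ident Gpd_C H) f = f"
    unfolding Gpd_C_simps(3)
    by (rule covering_functor_eqI [OF H _ f];
        simp add: covering_functor_comp [OF G G H i(1) f] covering_functor_comp [OF G H H f i(2)] s)+
next
  fix G H K L :: "'a loc_groupoid" and f g h
  assume "G \<in> Obj Gpd_C" "H \<in> Obj Gpd_C" "K \<in> Obj Gpd_C" "L \<in> Obj Gpd_C"
    "f \<in> Hom Gpd_C G H" "g \<in> Hom Gpd_C H K" "h \<in> Hom Gpd_C K L"
  then have G: "etale_groupoid G" and H: "etale_groupoid H" and K: "etale_groupoid K"
    and L: "etale_groupoid L" and f: "f \<in> covering_functor G H" and g: "g \<in> covering_functor H K"
    and h: "h \<in> covering_functor K L"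
    by (auto simp: Gpd_C_simps)
  note gf = covering_functor_comp [OF G H K f g] and hg = covering_functor_comp [OF H K L g h]
  note l = covering_functor_comp [OF G K L gf(1) h] and r = covering_functor_comp [OF G H L f hg(1)]
  show "Comp Gpd_C G K L h (Comp Gpd_C G H K g f) = Comp Gpd_C G H L (Comp Gpd_C H K L h g) f"
    by (rule covering_functor_eqI [OF L l(1) r(1)])
      (simp add: l(2) r(2) gf(2) hg(2) loc_comp_assoc [OF covering_functor_snd [OF h]])
qed

section \<open>The functor induced by a homomorphism of quantales\<close>

lemma (in inverse_quantal_frame) same_quantale_GQ: "same_quantale (groupoid_quantale GQ) Q"
  by (simp add: same_quantale_def quantale_of_GQ)

lemma same_quantale_hom:
  assumes h: "h \<in> quantale_hom Q R"
    and Q: "unital_involutive_quantale Q" "unital_involutive_quantale Q'"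
    and R: "unital_involutive_quantale R" "unital_involutive_quantale R'"
    and QQ: "same_quantale Q Q'" and RR: "same_quantale R R'"
  shows "h \<in> quantale_hom Q' R'"
proof -
  interpret Q: unital_involutive_quantale Q by (rule Q)
  note hD = quantale_homD [OF h]
  have eqs: "carrier Q' = carrier Q" "carrier R = carrier R'"
    using QQ RR by (auto simp: same_quantale_def)
  let ?i = "\<lambda>x\<in>carrier Q'. x" and ?j = "\<lambda>x\<in>carrier R. x"
  have "compose (carrier Q') ?j (compose (carrier Q') h ?i) \<in> quantale_hom Q' R'"
    using same_quantale_id [OF Q(2,1) same_quantale_sym [OF QQ]] same_quantale_id [OF R RR] h
    by (intro quantale_hom_comp [OF Q(2) R(1) R(2)] quantale_hom_comp [OF Q(2) Q(1) R(1)])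
  also have "compose (carrier Q') ?j (compose (carrier Q') h ?i) = h"
    by (rule extensionalityI [of _ "carrier Q'"]) (use hD(1,2) eqs in \<open>auto simp: compose_def\<close>)
  finally show ?thesis .
qed

text \<open>The object part is forced: objects form the down-set of the unit, and the inverse image
  of u is the meet with the unit, so compatibility with u leaves only the restriction of h.\<close>

definition quantale_functor_arrow ::
  "('a, 'b) inv_quantale_scheme \<Rightarrow> ('a \<Rightarrow> 'a) \<Rightarrow> ('a \<Rightarrow> 'a) \<times> ('a \<Rightarrow> 'a)" where
  "quantale_functor_arrow Q h = (restrict h {b \<in> carrier Q. b \<sqsubseteq>\<^bsub>Q\<^esub> \<epsilon>\<^bsub>Q\<^esub>}, h)"

lemma snd_quantale_functor_arrow [simp]: "snd (quantale_functor_arrow Q h) = h"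
  by (simp add: quantale_functor_arrow_def)

text \<open>Only compatibility with m is not immediate. \<open>?T\<close> is generated by the h x
  \<otimes> h y with x y \<le> a and is contained in m^*(h a) because h preserves products; the
  opposite inclusion needs partial units.\<close>

lemma quantale_functor_arrow_covering:
  fixes Q R :: "'a inv_quantale"
  assumes Q: "inverse_quantal_frame Q" and R: "inverse_quantal_frame R" and h: "h \<in> Hom IQLoc R Q"
  shows "quantale_functor_arrow Q h \<in> covering_functor (quantale_groupoid R) (quantale_groupoid Q)"
proof -
  interpret Q: inverse_quantal_frame Q by (rule Q)
  interpret R: inverse_quantal_frame R by (rule R)
  note hD = quantale_homD [OF IQLoc_homD(1) [OF h]] IQLoc_homD(2,3) [OF h]
  have h_mono: "h x \<sqsubseteq>\<^bsub>R\<^esub> h y" if "x \<sqsubseteq>\<^bsub>Q\<^esub> y" "x \<in> carrier Q" "y \<in> carrier Q" for x y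
    using that hD(1,7) Q.le_iff_meet_eq [of x y] R.le_iff_meet_eq [of "h x" "h y"] by metis
  have h_unit: "h b \<sqsubseteq>\<^bsub>R\<^esub> \<epsilon>\<^bsub>R\<^esub>" if "b \<in> carrier Q" "b \<sqsubseteq>\<^bsub>Q\<^esub> \<epsilon>\<^bsub>Q\<^esub>" for b
    using h_mono [of b "\<epsilon>\<^bsub>Q\<^esub>"] that Q.unit_closed hD(6) by simp
  let ?E = "{b \<in> carrier Q. b \<sqsubseteq>\<^bsub>Q\<^esub> \<epsilon>\<^bsub>Q\<^esub>}"
  have h1: "h \<in> loc_map (G1 R.GQ) (G1 Q.GQ)"
    by (rule loc_mapI) (use Q.GQ_complete R.GQ_complete hD in \<open>auto simp: PiE_def\<close>)
  have "(restrict h ?E, h) \<in> groupoid_functor R.GQ Q.GQ"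
  proof (rule groupoid_functorI)
    show "h \<in> loc_map (G1 R.GQ) (G1 Q.GQ)" by (rule h1)
    show "restrict h ?E \<in> loc_map (G0 R.GQ) (G0 Q.GQ)"
    proof (rule loc_mapI)
      show "complete_lattice (G0 Q.GQ)" "complete_lattice (G0 R.GQ)"
        by (rule Q.GQ_complete R.GQ_complete)+
      show "restrict h ?E \<in> carrier (G0 Q.GQ) \<rightarrow>\<^sub>E carrier (G0 R.GQ)"
        using hD(1) h_unit by auto
      show "restrict h ?E \<top>\<^bsub>G0 Q.GQ\<^esub> = \<top>\<^bsub>G0 R.GQ\<^esub>" using hD(6) Q.unit_closed by simp
      show "restrict h ?E (x \<sqinter>\<^bsub>G0 Q.GQ\<^esub> y) = restrict h ?E x \<sqinter>\<^bsub>G0 R.GQ\<^esub> restrict h ?E y"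
        if "x \<in> carrier (G0 Q.GQ)" "y \<in> carrier (G0 Q.GQ)" for x y
        using that hD(1,7) h_unit Q.unit_closed by (simp add: Q.meet_leI1)
      fix A assume "A \<subseteq> carrier (G0 Q.GQ)"
      then have A: "A \<subseteq> ?E" "A \<subseteq> carrier Q" by auto
      have im: "restrict h ?E ` A = h ` A" using A by (intro image_cong) auto
      have "h ` A \<subseteq> {b \<in> carrier R. b \<sqsubseteq>\<^bsub>R\<^esub> \<epsilon>\<^bsub>R\<^esub>}" using A hD(1) h_unit by auto
      moreover have "\<Squnion>\<^bsub>Q\<^esub>A \<in> ?E" using A Q.unit_closed by (auto intro: Q.sup_least)
      ultimately show "restrict h ?E (\<Squnion>\<^bsub>G0 Q.GQ\<^esub>A) = \<Squnion>\<^bsub>G0 R.GQ\<^esub>(restrict h ?E ` A)"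
        unfolding im using A hD(3) by simp
    qed
    fix b assume "b \<in> carrier (G0 Q.GQ)"
    then show "h (gdom Q.GQ b) = gdom R.GQ (restrict h ?E b)"
      "h (gran Q.GQ b) = gran R.GQ (restrict h ?E b)"
      using hD(1,4,8) h_unit Q.top_in by auto
  next
    fix a assume "a \<in> carrier (G1 Q.GQ)"
    then have a: "a \<in> carrier Q" by simp
    show "gunit R.GQ (h a) = restrict h ?E (gunit Q.GQ a)"
      using a hD(1,6,7) Q.unit_closed by (simp add: Q.meet_right)
    let ?p1 = "loc_comp (G1 Q.GQ) h (gpi1 R.GQ)" and ?p2 = "loc_comp (G1 Q.GQ) h (gpi2 R.GQ)"
    let ?S = "(\<lambda>(x, y). R.GQ.pb2.tensor (h x) (h y)) ` gmul Q.GQ a"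
    let ?T = "\<Squnion>\<^bsub>G2 R.GQ\<^esub>?S"
    have ha: "h a \<in> carrier R" using hD(1) a by simp
    have sub: "?S \<subseteq> carrier (G2 R.GQ)"
      using a hD(1) R.GQ.pb2.tensor_ideal by (auto simp: R.GQ.G2_folds)
    have "gpair Q.GQ (G2 R.GQ) ?p1 ?p2 (gmul Q.GQ a) =
        \<Squnion>\<^bsub>G2 R.GQ\<^esub>((\<lambda>(x, y). ?p1 x \<sqinter>\<^bsub>G2 R.GQ\<^esub> ?p2 y) ` gmul Q.GQ a)"
      unfolding Q.GQ.G2_folds(4) by (rule Q.GQ.pb2.pair_apply [OF Q.gmul_ideal [OF a]])
    also have "(\<lambda>(x, y). ?p1 x \<sqinter>\<^bsub>G2 R.GQ\<^esub> ?p2 y) ` gmul Q.GQ a = ?S"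
      using a hD(1) by (intro image_cong) (auto simp: R.GQ.tensor_G2)
    finally have eq: "gpair Q.GQ (G2 R.GQ) ?p1 ?p2 (gmul Q.GQ a) = ?T" .
    have TI: "R.GQ.pb2.ideal ?T" using R.GQ.G2.sup_closed [OF sub] by (simp add: R.GQ.G2_folds)
    have "?T \<sqsubseteq>\<^bsub>G2 R.GQ\<^esub> gmul R.GQ (h a)"
    proof (rule R.GQ.G2.sup_least [OF sub])
      show "gmul R.GQ (h a) \<in> carrier (G2 R.GQ)"
        using R.gmul_ideal [OF ha] by (simp add: R.GQ.G2_folds del: R.GQ_simps)
      fix V assume "V \<in> ?S"
      then obtain x y where xy: "x \<in> carrier Q" "y \<in> carrier Q" "x \<cdot>\<^bsub>Q\<^esub> y \<sqsubseteq>\<^bsub>Q\<^esub> a"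
        "V = R.GQ.pb2.tensor (h x) (h y)" using a by auto
      have "h x \<cdot>\<^bsub>R\<^esub> h y \<sqsubseteq>\<^bsub>R\<^esub> h a"
        using h_mono [OF xy(3)] xy a Q.mul_closed hD(4) by simp
      then have "(h x, h y) \<in> gmul R.GQ (h a)" using xy hD(1) ha by simp
      then have "V \<subseteq> gmul R.GQ (h a)"
        using xy hD(1) R.GQ.pb2.tensor_le [OF _ _ R.gmul_ideal [OF ha]] by (simp del: R.GQ_simps)
      then show "V \<sqsubseteq>\<^bsub>G2 R.GQ\<^esub> gmul R.GQ (h a)" by (simp add: R.GQ.G2_folds del: R.GQ_simps)
    qed
    then have 1: "?T \<subseteq> gmul R.GQ (h a)" by (simp add: R.GQ.G2_folds del: R.GQ_simps)
    have gen: "(h x, h y) \<in> ?T" if xy: "x \<in> carrier Q" "y \<in> carrier Q" "x \<cdot>\<^bsub>Q\<^esub> y \<sqsubseteq>\<^bsub>Q\<^esub> a" for x y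
    proof -
      have "R.GQ.pb2.tensor (h x) (h y) \<in> ?S" using xy a by force
      then have "R.GQ.pb2.tensor (h x) (h y) \<sqsubseteq>\<^bsub>G2 R.GQ\<^esub> ?T" by (rule R.GQ.G2.sup_upper [OF sub])
      then have "R.GQ.pb2.tensor (h x) (h y) \<subseteq> ?T" by (simp add: R.GQ.G2_folds)
      then show ?thesis using R.GQ.pb2.tensor_le [OF _ _ TI] xy hD(1) by simp
    qed
    \<comment> \<open>As h preserves joins and the top, the images of the partial units of Q cover
      R. Taking them as the second cover places each t below some h v, which brings the problem back
      to Q.\<close>
    have PU: "h ` partial_units Q \<subseteq> carrier R" "\<Squnion>\<^bsub>R\<^esub>(h ` partial_units Q) = \<top>\<^bsub>R\<^esub>"
      using Q.partial_units_sub hD(1) hD(3) [OF Q.partial_units_sub] Q.sup_partial_units hD(8)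
      by auto
    have 2: "gmul R.GQ (h a) \<subseteq> ?T"
    proof (rule subrelI)
      fix p q assume "(p, q) \<in> gmul R.GQ (h a)"
      then have pq: "p \<in> carrier R" "q \<in> carrier R" "p \<cdot>\<^bsub>R\<^esub> q \<sqsubseteq>\<^bsub>R\<^esub> h a" using ha by auto
      show "(p, q) \<in> ?T"
      proof (rule R.mem_ideal_by_partial_units [OF TI pq(1,2) PU(2,1)])
        fix t s assume t: "t \<in> partial_units R" "t \<sqsubseteq>\<^bsub>R\<^esub> p" and "s \<in> h ` partial_units Q"
          and ts: "t \<sqsubseteq>\<^bsub>R\<^esub> s"
        \<comment> \<open>Since v v^* a \<le> a, the pair (h v, h (v^* a)) is a generator of
          \<open>?T\<close>. From t \<le> h v and t q \<le> h a it dominates (t, t^* t q), because h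
          preserves the involution and products.\<close>
        then obtain v where v: "v \<in> partial_units Q" "s = h v" by auto
        have v': "v \<in> carrier Q" "v \<cdot>\<^bsub>Q\<^esub> \<iota>\<^bsub>Q\<^esub> v \<sqsubseteq>\<^bsub>Q\<^esub> \<epsilon>\<^bsub>Q\<^esub>" "\<iota>\<^bsub>Q\<^esub> v \<in> carrier Q" "h v \<in> carrier R"
          using v by (auto simp: Q.partial_units_iff Q.inv_closed hD(1))
        have t': "t \<in> carrier R" "\<iota>\<^bsub>R\<^esub> t \<in> carrier R"
          using t R.partial_units_sub R.inv_closed by auto
        have "v \<cdot>\<^bsub>Q\<^esub> (\<iota>\<^bsub>Q\<^esub> v \<cdot>\<^bsub>Q\<^esub> a) \<sqsubseteq>\<^bsub>Q\<^esub> a"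
          using Q.mul_le_left [OF v'(2) a] v' a Q.mul_closed by (simp flip: Q.mul_assoc)
        then have *: "(h v, h (\<iota>\<^bsub>Q\<^esub> v \<cdot>\<^bsub>Q\<^esub> a)) \<in> ?T" using gen v' a Q.mul_closed by simp
        have "t \<cdot>\<^bsub>R\<^esub> q \<sqsubseteq>\<^bsub>R\<^esub> p \<cdot>\<^bsub>R\<^esub> q" using t t' pq by (intro R.mul_mono) auto
        then have tq: "t \<cdot>\<^bsub>R\<^esub> q \<sqsubseteq>\<^bsub>R\<^esub> h a"
          by (rule R.le_trans) (use pq t' ha R.mul_closed in auto)
        have "\<iota>\<^bsub>R\<^esub> t \<sqsubseteq>\<^bsub>R\<^esub> h (\<iota>\<^bsub>Q\<^esub> v)"
          using R.inv_mono [of t "h v"] ts v t' v' hD(5) by simp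
        then have "\<iota>\<^bsub>R\<^esub> t \<cdot>\<^bsub>R\<^esub> (t \<cdot>\<^bsub>R\<^esub> q) \<sqsubseteq>\<^bsub>R\<^esub> h (\<iota>\<^bsub>Q\<^esub> v) \<cdot>\<^bsub>R\<^esub> h a"
          by (rule R.mul_mono [OF _ tq]) (use t' v' pq ha R.mul_closed hD(1) in auto)
        then show "(t, \<iota>\<^bsub>R\<^esub> t \<cdot>\<^bsub>R\<^esub> (t \<cdot>\<^bsub>R\<^esub> q)) \<in> ?T"
          using R.GQ.pb2.mem_tensor_mono [OF TI *] ts v t' v' pq a R.mul_closed hD(4) by simp
      qed
    qed
    show "gmul R.GQ (h a) = gpair Q.GQ (G2 R.GQ) ?p1 ?p2 (gmul Q.GQ a)"
      unfolding eq using 1 2 by (rule subset_antisym [rotated])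
  qed
  moreover have "h \<in> quantale_hom (groupoid_quantale Q.GQ) (groupoid_quantale R.GQ)"
    by (rule same_quantale_hom [OF IQLoc_homD(1) [OF h]
          inverse_quantal_frameD(1) [OF Q] etale_groupoidD(3) [OF Q.quantale_groupoid_etale]
          inverse_quantal_frameD(1) [OF R] etale_groupoidD(3) [OF R.quantale_groupoid_etale]
          same_quantale_sym [OF Q.same_quantale_GQ] same_quantale_sym [OF R.same_quantale_GQ]])
  ultimately show ?thesis
    by (simp add: quantale_functor_arrow_def covering_functor_def)
qed

section \<open>Comparison of a groupoid with the groupoid of its quantale\<close>

context etale_groupoid
begin

interpretation QG: inverse_quantal_frame "groupoid_quantale G"
  by (rule groupoid_quantale_inverse_quantal_frame)

abbreviation "GO \<equiv> quantale_groupoid (groupoid_quantale G)"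

text \<open>The frame of arrows is recovered as the same record and m^* on the nose. Only the
  objects change, from G_0 to the down-set of e, with u^* as the identification: for b \<le> e, b 1
  = d^*(d_! b) = d^*(u^* b).\<close>

lemma GO_simps:
  shows "carrier (G0 GO) = {b \<in> carrier X. b \<sqsubseteq>\<^bsub>X\<^esub> e}" "G1 GO = X"
    and "\<lbrakk>b \<in> carrier X; b \<sqsubseteq>\<^bsub>X\<^esub> e\<rbrakk> \<Longrightarrow> gdom GO b = d (u b)"
    and "\<lbrakk>b \<in> carrier X; b \<sqsubseteq>\<^bsub>X\<^esub> e\<rbrakk> \<Longrightarrow> gran GO b = r (u b)"
    and "a \<in> carrier X \<Longrightarrow> gunit GO a = a \<sqinter>\<^bsub>X\<^esub> e"
    and "a \<in> carrier X \<Longrightarrow> gmul GO a = m a"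
proof -
  show "carrier (G0 GO) = {b \<in> carrier X. b \<sqsubseteq>\<^bsub>X\<^esub> e}" by (simp add: O_simps)
  show "G1 GO = X" by (simp add: quantale_groupoid_def Let_def O_simps)
  show d: "gdom GO b = d (u b)" if "b \<in> carrier X" "b \<sqsubseteq>\<^bsub>X\<^esub> e" for b
    using that dd_uu [of "u b"] u_closed by (simp add: O_simps O_lattice qm_top le_e_eq)
  show "gran GO b = r (u b)" if b: "b \<in> carrier X" "b \<sqsubseteq>\<^bsub>X\<^esub> e"
  proof -
    have "gran GO b = ginv GO (gdom GO b)"
      using fun_cong [OF QG.GQ_dom_inv, of b] b by (simp add: O_simps del: QG.GQ_simps)
    also have "gdom GO b = d (u b)" by (rule d [OF b])
    also have "ginv GO (d (u b)) = r (u b)"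
      using b u_closed d_closed by (simp add: O_simps O_inv structure_apply)
    finally show ?thesis .
  qed
  show "gunit GO a = a \<sqinter>\<^bsub>X\<^esub> e" if "a \<in> carrier X"
    using that by (simp add: O_simps O_lattice)
  show "gmul GO a = m a" if a: "a \<in> carrier X"
  proof -
    have "(x, y) \<in> m a \<Longrightarrow> x \<in> carrier X \<and> y \<in> carrier X" for x y
      using pb2.ideal_mem [OF Q.gmul_ideal [OF a]] by blast
    then show ?thesis using a by (auto simp: O_simps Q.mul_le_iff)
  qed
qed

text \<open>The two pullbacks of composable pairs are formed over different locales of objects.
  Pairings into them are nevertheless joins over the same set of pairs of arrows, so each can be
  evaluated in the other groupoid.\<close>

lemma GO_tensor_sup:
  assumes a: "a \<in> carrier X"
  shows "gpair GO (G2 G) (gpi1 G) (gpi2 G) (gmul GO a) = m a"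
    and "gpair G (G2 GO) (gpi1 GO) (gpi2 GO) (m a) = gmul GO a"
proof -
  have a': "a \<in> carrier (groupoid_quantale G)" using a by (simp add: O_simps)
  have "gpair GO (G2 G) (gpi1 G) (gpi2 G) (gmul GO a) =
      \<Squnion>\<^bsub>G2 G\<^esub>((\<lambda>(x, y). gpi1 G x \<sqinter>\<^bsub>G2 G\<^esub> gpi2 G y) ` gmul GO a)"
    unfolding QG.GQ.G2_folds(4) by (rule QG.GQ.pb2.pair_apply [OF QG.gmul_ideal [OF a']])
  also have "\<dots> = gpair G (G2 G) (gpi1 G) (gpi2 G) (m a)"
    unfolding G2_folds(4) pb2.pair_apply [OF Q.gmul_ideal [OF a]] using a by (simp add: GO_simps)
  also have "\<dots> = m a"
    using pb2.pair_self [OF Q.gmul_ideal [OF a]] by (simp add: G2_folds)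
  finally show "gpair GO (G2 G) (gpi1 G) (gpi2 G) (gmul GO a) = m a" .
  have "gpair G (G2 GO) (gpi1 GO) (gpi2 GO) (m a) =
      \<Squnion>\<^bsub>G2 GO\<^esub>((\<lambda>(x, y). gpi1 GO x \<sqinter>\<^bsub>G2 GO\<^esub> gpi2 GO y) ` m a)"
    unfolding G2_folds(4) by (rule pb2.pair_apply [OF Q.gmul_ideal [OF a]])
  also have "\<dots> = gpair GO (G2 GO) (gpi1 GO) (gpi2 GO) (gmul GO a)"
    unfolding QG.GQ.G2_folds(4) QG.GQ.pb2.pair_apply [OF QG.gmul_ideal [OF a']]
    using a by (simp add: GO_simps)
  also have "\<dots> = gmul GO a"
    using QG.GQ.pb2.pair_self [OF QG.gmul_ideal [OF a']] by (simp add: QG.GQ.G2_folds)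
  finally show "gpair G (G2 GO) (gpi1 GO) (gpi2 GO) (m a) = gmul GO a" .
qed

lemma id_quantale_hom:
  "loc_id X \<in> quantale_hom (groupoid_quantale G) (groupoid_quantale GO)"
  "loc_id X \<in> quantale_hom (groupoid_quantale GO) (groupoid_quantale G)"
proof -
  note E = etale_groupoidD(3) [OF QG.quantale_groupoid_etale]
  have U: "unital_involutive_quantale (groupoid_quantale G)" by unfold_locales
  show "loc_id X \<in> quantale_hom (groupoid_quantale G) (groupoid_quantale GO)"
    using same_quantale_id [OF U E same_quantale_sym [OF QG.same_quantale_GQ]]
    by (simp add: loc_id_def O_simps)
  show "loc_id X \<in> quantale_hom (groupoid_quantale GO) (groupoid_quantale G)"
    using same_quantale_id [OF E U QG.same_quantale_GQ] QG.quantale_of_GQ(1)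
    by (simp add: loc_id_def O_simps)
qed

text \<open>The object part is u^* on the down-set of e; the object part u_! of
  \<open>counit_covering\<close> is its inverse, by \<open>u_uu\<close> and \<open>le_e_eq\<close>.
  The arrow parts are identities.\<close>

lemma unit_covering: "(restrict u {b \<in> carrier X. b \<sqsubseteq>\<^bsub>X\<^esub> e}, loc_id X) \<in> covering_functor G GO"
proof -
  let ?E = "{b \<in> carrier X. b \<sqsubseteq>\<^bsub>X\<^esub> e}"
  have "(restrict u ?E, loc_id X) \<in> groupoid_functor G GO"
  proof (rule groupoid_functorI)
    show "loc_id X \<in> loc_map X (G1 GO)" by (simp add: GO_simps id_map)
    show "restrict u ?E \<in> loc_map Y (G0 GO)"
    proof (rule loc_mapI)
      show "complete_lattice (G0 GO)" by (rule QG.GQ_complete)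
      show "complete_lattice Y" by unfold_locales
      show "restrict u ?E \<in> carrier (G0 GO) \<rightarrow>\<^sub>E carrier Y" using u_closed by (simp add: O_simps)
      show "restrict u ?E \<top>\<^bsub>G0 GO\<^esub> = \<top>\<^bsub>Y\<^esub>" using e_closed u_e by (simp add: O_simps)
      show "restrict u ?E (x \<sqinter>\<^bsub>G0 GO\<^esub> y) = restrict u ?E x \<sqinter>\<^bsub>Y\<^esub> restrict u ?E y"
        if "x \<in> carrier (G0 GO)" "y \<in> carrier (G0 GO)" for x y
        using that e_closed
        by (simp add: O_simps O_lattice X.meet_leI1 loc_mapD(2) [OF gunit_map])
      fix A assume A: "A \<subseteq> carrier (G0 GO)"
      then have A': "A \<subseteq> carrier X" "A \<subseteq> ?E" by (auto simp: O_simps)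
      then have "\<Squnion>\<^bsub>X\<^esub>A \<in> ?E" using e_closed by (auto intro: X.sup_least)
      moreover have "restrict u ?E ` A = u ` A" using A' by (intro image_cong) auto
      ultimately show "restrict u ?E (\<Squnion>\<^bsub>G0 GO\<^esub>A) = \<Squnion>\<^bsub>Y\<^esub>(restrict u ?E ` A)"
        using A' by (simp add: O_simps O_lattice loc_mapD(3) [OF gunit_map])
    qed
    fix b assume "b \<in> carrier (G0 GO)"
    then have b: "b \<in> carrier X" "b \<sqsubseteq>\<^bsub>X\<^esub> e" by (auto simp: O_simps)
    then show "loc_id X (gdom GO b) = d (restrict u ?E b)"
      "loc_id X (gran GO b) = r (restrict u ?E b)"
      using u_closed d_closed r_closed by (simp_all add: GO_simps)
  next
    fix a assume "a \<in> carrier (G1 GO)"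
    then have a: "a \<in> carrier X" by (simp add: GO_simps)
    show "u (loc_id X a) = restrict u ?E (gunit GO a)"
      using a e_closed u_e u_closed Y.meet_top
      by (simp add: GO_simps X.meet_right loc_mapD(2) [OF gunit_map])
    show "m (loc_id X a) = gpair GO (G2 G) (loc_comp (G1 GO) (loc_id X) (gpi1 G))
        (loc_comp (G1 GO) (loc_id X) (gpi2 G)) (gmul GO a)"
      using a GO_tensor_sup(1) [OF a]
      by (simp add: GO_simps(2) loc_comp_id [OF gpi1_map] loc_comp_id [OF gpi2_map])
  qed
  then show ?thesis using id_quantale_hom(2) by (simp add: covering_functor_def)
qed

lemma counit_covering: "(uu, loc_id X) \<in> covering_functor GO G"
proof -
  have "(uu, loc_id X) \<in> groupoid_functor GO G"
  proof (rule groupoid_functorI)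
    show "loc_id X \<in> loc_map (G1 GO) X" by (simp add: GO_simps id_map)
    show "uu \<in> loc_map (G0 GO) Y"
    proof (rule loc_mapI)
      show "complete_lattice (G0 GO)" by (rule QG.GQ_complete)
      show "complete_lattice Y" by unfold_locales
      show "uu \<in> carrier Y \<rightarrow>\<^sub>E carrier (G0 GO)"
        using uu_adjoint uu_le_e by (auto simp: left_adjoint_def O_simps)
      show "uu \<top>\<^bsub>Y\<^esub> = \<top>\<^bsub>G0 GO\<^esub>" by (simp add: O_simps)
      show "uu (x \<sqinter>\<^bsub>Y\<^esub> y) = uu x \<sqinter>\<^bsub>G0 GO\<^esub> uu y" if "x \<in> carrier Y" "y \<in> carrier Y" for x y
        using that uu_frob [of x "uu y"] uu_closed uu_le_e by (simp add: O_simps O_lattice u_uu)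
      fix A assume A: "A \<subseteq> carrier Y"
      then have "uu ` A \<subseteq> {b \<in> carrier X. b \<sqsubseteq>\<^bsub>X\<^esub> e}" using uu_closed uu_le_e by auto
      then show "uu (\<Squnion>\<^bsub>Y\<^esub>A) = \<Squnion>\<^bsub>G0 GO\<^esub>(uu ` A)"
        using A left_adjoint_unit(4) [OF uu_adjoint gunit_map A] by (simp add: O_simps O_lattice)
    qed
    fix z assume z: "z \<in> carrier Y"
    then show "loc_id X (d z) = gdom GO (uu z)" "loc_id X (r z) = gran GO (uu z)"
      using d_closed r_closed uu_closed uu_le_e by (simp_all add: GO_simps u_uu)
  next
    fix a assume a: "a \<in> carrier X"
    show "gunit GO (loc_id X a) = uu (u a)" using a by (simp add: GO_simps uu_u)
    show "gmul GO (loc_id X a) = gpair G (G2 GO) (loc_comp X (loc_id X) (gpi1 GO))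
        (loc_comp X (loc_id X) (gpi2 GO)) (m a)"
      using a GO_tensor_sup(2) [OF a] loc_comp_id [OF QG.GQ.gpi1_map] loc_comp_id [OF QG.GQ.gpi2_map]
      by (simp add: GO_simps(2))
  qed
  then show ?thesis using id_quantale_hom(1) by (simp add: covering_functor_def)
qed

end

text \<open>The object part is hidden behind an existential: naturality will need only that the
  arrow part is the identity.\<close>

lemma unit_iso:
  assumes G: "etale_groupoid G"
  obtains t where
    "is_iso Gpd_C G (quantale_groupoid (groupoid_quantale G)) (t, loc_id (G1 G))"
proof -
  interpret etale_groupoid G by (rule G)
  let ?t = "(restrict u {b \<in> carrier X. b \<sqsubseteq>\<^bsub>X\<^esub> e}, loc_id X)" and ?s = "(uu, loc_id X)"
  have H: "etale_groupoid GO"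
    by (rule inverse_quantal_frame.quantale_groupoid_etale [OF groupoid_quantale_inverse_quantal_frame])
  note t = unit_covering and s = counit_covering
  note st = covering_functor_comp [OF G H G t s] and ts = covering_functor_comp [OF H G H s t]
  have ii: "loc_comp X (loc_id X) (loc_id X) = loc_id X" by (rule loc_comp_id [OF id_map])
  have "Comp Gpd_C G GO G ?s ?t = Ident Gpd_C G"
    unfolding Gpd_C_simps(3)
    by (rule covering_functor_eqI [OF G st(1) covering_functor_id [OF G]]) (simp add: st(2) ii)
  moreover have "Comp Gpd_C GO G GO ?t ?s = Ident Gpd_C GO"
    unfolding Gpd_C_simps(3)
    by (rule covering_functor_eqI [OF H ts(1) covering_functor_id [OF H]])
      (simp add: ts(2) ii GO_simps(2))
  ultimately have "is_iso Gpd_C G GO ?t"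
    using t s unfolding is_iso_def Gpd_C_simps(2) by blast
  then show ?thesis by (rule that)
qed

lemma counit_iso:
  fixes Q :: "'a inv_quantale"
  assumes Q: "inverse_quantal_frame Q"
  shows "is_iso IQLoc (groupoid_quantale (quantale_groupoid Q)) Q (\<lambda>x\<in>carrier Q. x)"
proof -
  interpret Q: inverse_quantal_frame Q by (rule Q)
  let ?R = "groupoid_quantale (quantale_groupoid Q)" and ?i = "\<lambda>x\<in>carrier Q. x"
  have R: "inverse_quantal_frame ?R" by (rule etale_groupoidD(2) [OF Q.quantale_groupoid_etale])
  have c: "carrier ?R = carrier Q" by (rule Q.quantale_of_GQ)
  have "?i \<in> Hom IQLoc ?R Q" "?i \<in> Hom IQLoc Q ?R"
    using IQLoc_same [OF R Q Q.same_quantale_GQ]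
      IQLoc_same [OF Q R same_quantale_sym [OF Q.same_quantale_GQ]] c by simp_all
  moreover have "compose (carrier Q) ?i ?i = ?i" by (auto simp: compose_def fun_eq_iff)
  ultimately show ?thesis unfolding is_iso_def by (auto simp: IQLoc_simps c)
qed

section \<open>The two functors and the natural isomorphisms\<close>

definition quantale_functor ::
  "('a loc_groupoid, ('a \<Rightarrow> 'a) \<times> ('a \<Rightarrow> 'a), 'a inv_quantale, 'a \<Rightarrow> 'a) cat_functor" where
  "quantale_functor = \<lparr>fobj = groupoid_quantale, farr = (\<lambda>G H f. snd f)\<rparr>"

definition groupoid_of_quantale_functor ::
  "('a inv_quantale, 'a \<Rightarrow> 'a, 'a loc_groupoid, ('a \<Rightarrow> 'a) \<times> ('a \<Rightarrow> 'a)) cat_functor" where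
  "groupoid_of_quantale_functor =
     \<lparr>fobj = quantale_groupoid, farr = (\<lambda>Q R h. quantale_functor_arrow R h)\<rparr>"

lemma covering_functor_IQLoc_hom:
  assumes G: "etale_groupoid G" and H: "etale_groupoid H" and f: "f \<in> covering_functor G H"
  shows "snd f \<in> Hom IQLoc (groupoid_quantale G) (groupoid_quantale H)"
proof -
  note DG = etale_groupoidD [OF G] and DH = etale_groupoidD [OF H]
  obtain f0 f1 where f: "f = (f0, f1)" "(f0, f1) \<in> groupoid_functor G H"
    "f1 \<in> quantale_hom (groupoid_quantale H) (groupoid_quantale G)"
    using covering_functorD [OF f] .
  note f1D = loc_mapD [OF groupoid_functorD(2) [OF f(2)]]
  have "f1 \<in> Hom IQLoc (groupoid_quantale G) (groupoid_quantale H)"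
    by (rule IQLoc_homI [OF DG(2) DH(2) f(3)])
      (use f1D(2,4) DH(4) gorder_cong(2,4) [OF DG(4,5)] gorder_cong(2,4) [OF DH(4,5)] in simp_all)
  then show ?thesis by (simp add: f(1))
qed

lemma quantale_functor_is_functor: "is_functor Gpd_C IQLoc quantale_functor"
  unfolding is_functor_def
proof (intro conjI ballI)
  show "is_category Gpd_C" "is_category IQLoc" by (rule Gpd_C_category IQLoc_category)+
  fix G :: "'a loc_groupoid" assume "G \<in> Obj Gpd_C"
  then have G: "etale_groupoid G" by (simp add: Gpd_C_simps)
  show "fobj quantale_functor G \<in> Obj IQLoc"
    using etale_groupoidD(2) [OF G] by (simp add: quantale_functor_def IQLoc_simps)
  show "farr quantale_functor G G (Ident Gpd_C G) = Ident IQLoc (fobj quantale_functor G)"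
    using etale_groupoidD(4) [OF G]
    by (simp add: quantale_functor_def IQLoc_simps Gpd_C_simps loc_id_def)
  fix H :: "'a loc_groupoid" assume "H \<in> Obj Gpd_C"
  then have H: "etale_groupoid H" by (simp add: Gpd_C_simps)
  show "farr quantale_functor G H f \<in> Hom IQLoc (fobj quantale_functor G) (fobj quantale_functor H)"
    if "f \<in> Hom Gpd_C G H" for f
    using covering_functor_IQLoc_hom [OF G H] that by (simp add: quantale_functor_def Gpd_C_simps)
  fix K :: "'a loc_groupoid" and f g
  assume "K \<in> Obj Gpd_C" and f: "f \<in> Hom Gpd_C G H" and g: "g \<in> Hom Gpd_C H K"
  then have K: "etale_groupoid K" by (simp add: Gpd_C_simps)
  show "farr quantale_functor G K (Comp Gpd_C G H K g f) =
      Comp IQLoc (fobj quantale_functor G) (fobj quantale_functor H) (fobj quantale_functor K)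
        (farr quantale_functor H K g) (farr quantale_functor G H f)"
    using covering_functor_comp(2) [OF G H K] f g etale_groupoidD(4) [OF K]
    by (simp add: quantale_functor_def IQLoc_simps Gpd_C_simps(2) loc_comp_def)
qed

lemma groupoid_of_quantale_functor_is_functor:
  "is_functor IQLoc Gpd_C groupoid_of_quantale_functor"
  unfolding is_functor_def
proof (intro conjI ballI)
  show "is_category Gpd_C" "is_category IQLoc" by (rule Gpd_C_category IQLoc_category)+
  fix P :: "'a inv_quantale" assume "P \<in> Obj IQLoc"
  then have P: "inverse_quantal_frame P" by (simp add: IQLoc_simps)
  interpret P: inverse_quantal_frame P by (rule P)
  show "fobj groupoid_of_quantale_functor P \<in> Obj Gpd_C"
    using P.quantale_groupoid_etale by (simp add: groupoid_of_quantale_functor_def Gpd_C_simps)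
  show "farr groupoid_of_quantale_functor P P (Ident IQLoc P) =
      Ident Gpd_C (fobj groupoid_of_quantale_functor P)"
    by (auto simp: groupoid_of_quantale_functor_def quantale_functor_arrow_def IQLoc_simps
        Gpd_C_simps loc_id_def fun_eq_iff)
  fix Q :: "'a inv_quantale" assume "Q \<in> Obj IQLoc"
  then have Q: "inverse_quantal_frame Q" by (simp add: IQLoc_simps)
  interpret Q: inverse_quantal_frame Q by (rule Q)
  show "farr groupoid_of_quantale_functor P Q h \<in>
      Hom Gpd_C (fobj groupoid_of_quantale_functor P) (fobj groupoid_of_quantale_functor Q)"
    if "h \<in> Hom IQLoc P Q" for h
    using quantale_functor_arrow_covering [OF Q P that]
    by (simp add: groupoid_of_quantale_functor_def Gpd_C_simps)
  fix R :: "'a inv_quantale" and h k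
  assume "R \<in> Obj IQLoc" and h: "h \<in> Hom IQLoc P Q" and k: "k \<in> Hom IQLoc Q R"
  then have R: "inverse_quantal_frame R" by (simp add: IQLoc_simps)
  interpret R: inverse_quantal_frame R by (rule R)
  note EP = P.quantale_groupoid_etale and EQ = Q.quantale_groupoid_etale
    and ER = R.quantale_groupoid_etale
  note kh = IQLoc_comp [OF P Q R h k]
  note c = covering_functor_comp [OF EP EQ ER quantale_functor_arrow_covering [OF Q P h]
      quantale_functor_arrow_covering [OF R Q k]]
  have "quantale_functor_arrow R (Comp IQLoc P Q R k h) =
      Comp Gpd_C P.GQ Q.GQ R.GQ (quantale_functor_arrow R k) (quantale_functor_arrow Q h)"
    by (rule covering_functor_eqI [OF ER quantale_functor_arrow_covering [OF R P kh] c(1)])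
      (simp add: c(2) IQLoc_simps loc_comp_def)
  then show "farr groupoid_of_quantale_functor P R (Comp IQLoc P Q R k h) =
      Comp Gpd_C (fobj groupoid_of_quantale_functor P) (fobj groupoid_of_quantale_functor Q)
        (fobj groupoid_of_quantale_functor R)
        (farr groupoid_of_quantale_functor Q R k) (farr groupoid_of_quantale_functor P Q h)"
    by (simp add: groupoid_of_quantale_functor_def)
qed

lemma naturally_isomorphic_unit:
  "naturally_isomorphic Gpd_C Gpd_C id_functor
     (comp_functor groupoid_of_quantale_functor quantale_functor)"
proof -
  let ?GO = "\<lambda>G::'a loc_groupoid. quantale_groupoid (groupoid_quantale G)"
  \<comment> \<open>The components are chosen together with their arrow parts. Each naturality
    square is then an equation of arrow parts, where both composites are the arrow part of
    f.\<close>
  have "\<exists>\<tau>. \<forall>G. etale_groupoid G \<longrightarrow> is_iso Gpd_C G (?GO G) (\<tau> G) \<and> snd (\<tau> G) = loc_id (G1 G)"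
    by (rule choice) (metis snd_conv unit_iso)
  then obtain \<tau> where \<tau>: "\<And>G::'a loc_groupoid. etale_groupoid G \<Longrightarrow> is_iso Gpd_C G (?GO G) (\<tau> G)"
    "\<And>G. etale_groupoid G \<Longrightarrow> snd (\<tau> G) = loc_id (G1 G)" by blast
  have nat: "Comp Gpd_C G H (?GO H) (\<tau> H) f =
      Comp Gpd_C G (?GO G) (?GO H) (quantale_functor_arrow (groupoid_quantale H) (snd f)) (\<tau> G)"
    if G: "etale_groupoid G" and H: "etale_groupoid H" and f: "f \<in> covering_functor G H" for G H f
  proof -
    note QG = etale_groupoidD(2) [OF G] and QH = etale_groupoidD(2) [OF H]
    note EG = inverse_quantal_frame.quantale_groupoid_etale [OF QG]
      and EH = inverse_quantal_frame.quantale_groupoid_etale [OF QH]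
    have t: "\<tau> G \<in> covering_functor G (?GO G)" "\<tau> H \<in> covering_functor H (?GO H)"
      using \<tau>(1) G H by (auto simp: is_iso_def Gpd_C_simps)
    note a = quantale_functor_arrow_covering [OF QH QG covering_functor_IQLoc_hom [OF G H f]]
    note l = covering_functor_comp [OF G H EH f t(2)] and r = covering_functor_comp [OF G EG EH t(1) a]
    have 1: "G1 (?GO H) = G1 H"
      using etale_groupoidD(4,5) [OF H] by (simp add: quantale_groupoid_def Let_def groupoid_quantale_def)
    note s = covering_functor_snd [OF f]
    show ?thesis
      by (rule covering_functor_eqI [OF EH l(1) r(1)])
        (simp add: l(2) r(2) \<tau>(2) [OF G] \<tau>(2) [OF H] 1 loc_comp_id [OF s])
  qed
  show ?thesis
    unfolding naturally_isomorphic_def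
    by (rule exI [of _ \<tau>])
      (use \<tau>(1) nat in \<open>simp add: id_functor_def comp_functor_def quantale_functor_def
        groupoid_of_quantale_functor_def Gpd_C_simps(1,2)\<close>)
qed

lemma naturally_isomorphic_counit:
  "naturally_isomorphic IQLoc IQLoc
     (comp_functor quantale_functor groupoid_of_quantale_functor) id_functor"
proof -
  have nat: "compose (carrier R) h (\<lambda>x\<in>carrier R. x) = compose (carrier R) (\<lambda>x\<in>carrier Q. x) h"
    if "h \<in> Hom IQLoc Q R" for Q R :: "'a inv_quantale" and h
    using quantale_homD(1) [OF IQLoc_homD(1) [OF that]] by (auto simp: compose_def fun_eq_iff)
  show ?thesis
    unfolding naturally_isomorphic_def
    by (rule exI [of _ "\<lambda>Q. \<lambda>x\<in>carrier Q. x"])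
      (simp add: counit_iso nat id_functor_def comp_functor_def quantale_functor_def
        groupoid_of_quantale_functor_def IQLoc_simps(1,4))
qed

theorem corollary3p8:
  shows "equivalent_categories
           (Gpd_C :: ('a loc_groupoid, ('a \<Rightarrow> 'a) \<times> ('a \<Rightarrow> 'a)) category)
           (IQLoc :: ('a inv_quantale, 'a \<Rightarrow> 'a) category)"
  unfolding equivalent_categories_def
  using quantale_functor_is_functor groupoid_of_quantale_functor_is_functor
    naturally_isomorphic_unit naturally_isomorphic_counit
  by blast

end
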